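(* Let $t_*^1\in\mathbb V^1$ be a non-degenerate zero of $\mathcal A$ (i.e. $\mathcal A(t_*^1)=0$ and $\mathcal A'(t_*^1)$ is invertible). Suppose the following. (i) With $\theta_0=\|\Pi_0(\Theta_\alpha-I)\Pi_0\|_{\mathcal L(\mathbb V^1)}^2$ and $\theta_\angle=\|\Pi_0(\Theta_\alpha-I)\Pi_\angle\|_{\mathcal L(\mathbb V^1)}^2$, there holds $$\eta:=(1-g)\frac{\gamma_\alpha-\frac12M_\delta\|\Theta_\alpha\|_{\mathcal L(\mathbb V^1)}\delta}{\Delta(t_*^1)+M_\delta\delta}-\frac12\max\{\epsilon+2(1+\epsilon^{-1})\theta_0,\ 2(1+\epsilon^{-1})\theta_\angle\}>\frac12$$ for some $\epsilon>0$ and $\delta>0$. Here $$\Delta(t_*^1)=\max_{\substack{u^0\in\mathbb V^0,\ \|u^0\|_{\mathbb V}=1\\ v^\angle\in\mathbb V^\angle,\ \|v^\angle\|_{\mathbb V}=1}}\big|\langle(\mathcal H_K+[(T_*^1)_1^\dagger,\mathcal H_K])U^0\Phi_0,V^\angle\Phi_0\rangle\big|,$$ $\alpha>0$ and $\gamma_\alpha>0$ are such that $\langle(\mathcal A'(t_*^1)+\alpha I)r^1,r^1\rangle\ge\gamma_\alpha\|r^1\|_{\mathbb V}^2$ for all $r^1\in\mathbb V^1$, and $0<g<1$ is such that $|\langle t^0,t^\angle\rangle_{\mathbb V}|\le g\|t^0\|_{\mathbb V}\|t^\angle\|_{\mathbb V}$ for all $t^1\in\mathbb V^1$. (ii) With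 $\kappa=\|t_*^\angle\|_{\mathbb V}$, there holds $$\kappa<\frac{2\sqrt\eta-\sqrt2}{2-\sqrt2+2\sqrt\eta}\,\delta.$$ Let $D=\{t_*^1+r^1\in\mathbb V^1:\ \|r^0\|_{\mathbb V}^2+\|r^\angle\|_{\mathbb V}^2<\frac12(\delta-\kappa)^2\}$. Then, for any $\lambda\in[0,1)$, there exists $t_{**}^1(\lambda)\in D$ such that $\mathcal K_{\mathrm{KP}}(t_{**}^1(\lambda),\lambda)=0$. Furthermore, $\deg(\mathcal K_{\mathrm{KP}}(\cdot,\lambda),D,0)\equiv d\ne0$ for all $\lambda\in[0,1]$. In particular, there exists $t_{**}^1=t_{**}^0+t_{**}^\angle\in D$ such that $t_{**}^0$ solves the truncated CC equation on $\mathbb V^0$, i.e. $\langle\mathcal A(t_{**}^0),s^0\rangle=0$ for all $s^0\in\mathbb V^0$.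
   Context: Setting. Fix $1\le N\le K<\infty$. Let $\mathfrak L^2=\bigwedge^N L^2(\mathbb R^3)$ with inner product $\langle\cdot,\cdot\rangle$, $\mathfrak H^1=\mathfrak L^2\cap H^1(\mathbb R^{3N})$. Let $\phi_1,\dots,\phi_K\in H^1(\mathbb R^3)$ be $L^2$-orthonormal; $\phi_1,\dots,\phi_N$ are called occupied, the others virtual. For a multiindex $\alpha=(\alpha_1<\dots<\alpha_N)$ in $\{1,\dots,K\}$, $\Phi_\alpha=\phi_{\alpha_1}\wedge\dots\wedge\phi_{\alpha_N}$ is the ($\mathfrak L^2$-normalized) Slater determinant; these form an orthonormal basis of $\mathfrak H^1_K:=\mathrm{Span}\{\Phi_\alpha\}$. The index $0$ means $(1,\dots,N)$, and $\Phi_0=\phi_1\wedge\dots\wedge\phi_N$ is the reference. The Hamiltonian is $\mathcal H=\sum_i[-\tfrac12\Delta_{x_i}+V(x_i)]+\sum_{i<j}w(x_i-x_j)$ with real-valued $V,w\in L^{3/2}(\mathbb R^3)+L^\infty_\varepsilon(\mathbb R^3)$ (the $L^\infty$ part can be chosen arbitrarily small), $w$ even; $\mathcal H_K:\mathfrak H^1_K\to(\mathfrak H^1_K)^*$ is defined by $\langle\mathcal H_K\Phi,\Psi\rangle=\langle\mathcal H\Phi,\Psi\rangle$ (in the form sense) and is regarded as an operator on $\mathfrak H_K^1$ via $\langle\cdot,\cdot\rangle$; it is (the compression of) a two-body operator. Everything is over $\mathbb R$ (the matrix elements $\langle\mathcal H_K\Phi_\alpha,\Phi_\beta\rangle$ are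 real). Excitation and cluster operators. The rank of $\alpha$ is its number of virtual indices. For $\alpha\ne0$ with virtual indices $A_1<\dots<A_r$ and with $I_1<\dots<I_r$ the occupied indices missing from $\alpha$, $X_\alpha=a_{A_1}^\dagger a_{I_1}\cdots a_{A_r}^\dagger a_{I_r}$, where $a_p^\dagger,a_p$ are the fermionic creation/annihilation operators of $\phi_p$; the sign of $\Phi_\alpha$ is chosen so that $\Phi_\alpha=X_\alpha\Phi_0$. Amplitude spaces. Let $\Xi^1$ be the set of (nonzero) excitation multiindices retained by a truncation (possibly all), $\mathbb V^1=\{t=(t_\alpha)_{\alpha\in\Xi^1}:t_\alpha\in\mathbb R\}$; the cluster operator of $t$ is $T=\sum t_\alpha X_\alpha$ (capital letters, with the same superscripts, denote cluster operators of lower-case amplitudes); $\langle t,s\rangle_{\mathbb V}=\langle T\Phi_0,S\Phi_0\rangle_{\mathfrak H^1}$ with norm $\|\cdot\|_{\mathbb V}$. Fix $\rho\ge1$. $\mathbb V^0\subset\mathbb V^1$ is the subspace of amplitudes supported on $\{\alpha\in\Xi^1:\mathrm{rk}\,\alpha\le\rho\}$ and $\mathbb V^\angle$ that of amplitudes supported on $\{\alpha\in\Xi^1:\mathrm{rk}\,\alpha>\rho\}$, so $\mathbb V^1=\mathbb V^0\oplus\mathbb V^\angle$ is $\ell^2$-orthogonal (not necessarily $\mathbb V$-orthogonal); write $t^1=t^0+t^\angle$. $\Pi_0,\Pi_\angle$ are the corresponding $\ell^2$-orthogonal projectors of $\mathbb V^1$ onto $\mathbb V^0,\mathbb V^\angle$.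 $(T_*^1)_1=\sum_{\alpha\in\Xi^1,\mathrm{rk}\,\alpha=1}(t_*^1)_\alpha X_\alpha$ is the singles part of the cluster operator of $t_*^1$. Mappings. $\mathcal H_K(t)=e^{-T}\mathcal H_Ke^T$; $\mathcal A:\mathbb V^1\to(\mathbb V^1)^*$, $\langle\mathcal A(t^1),s^1\rangle=\langle\mathcal H_K(t^1)\Phi_0,S^1\Phi_0\rangle$. The Kowalski--Piecuch homotopy $\mathcal K_{\mathrm{KP}}:\mathbb V^1\times[0,1]\to(\mathbb V^1)^*$ is $$\langle\mathcal K_{\mathrm{KP}}(t^1,\lambda),s^1\rangle=\langle\mathcal H_K(t^0)\Phi_0,S^0\Phi_0\rangle+\langle\mathcal H_K(t^1)\Phi_0,S^\angle\Phi_0\rangle+\lambda\langle\mathcal H_K(t^0)(e^{T^\angle}-I)\Phi_0,S^0\Phi_0\rangle .$$ Constants. $M_\delta=\sup_{\|\zeta\|_{\mathbb V}\le\delta}\|\mathcal A''(t_*^1+\zeta)\|_{\mathcal L(\mathbb V^1\times\mathbb V^1,(\mathbb V^1)^* )}$. The operator $I:\mathbb V^1\to(\mathbb V^1)^*$ in $\mathcal A'(t_*^1)+\alpha I$ is the embedding $\langle Iu,v\rangle=\sum_\alpha u_\alpha v_\alpha$. $\Theta_\alpha:\mathbb V^1\to\mathbb V^1$ is the linear operator defined by $\langle\mathcal A'(t_*^1)u^1,\Theta_\alpha v^1\rangle=\langle(\mathcal A'(t_*^1)+\alpha I)u^1,v^1\rangle$ for all $u^1,v^1\in\mathbb V^1$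 (well defined since $t_*^1$ is non-degenerate). $\|\cdot\|_{\mathcal L(\mathbb V^1)}$ is the operator norm induced by $\|\cdot\|_{\mathbb V}$. $\deg$ is the Brouwer degree, with $\mathbb V^1$ and $(\mathbb V^1)^*$ compatibly oriented. *)

theory Defs
  imports "HOL-Analysis.Analysis" "HOL-Homology.Homology"
begin

section \<open>Sobolev functions and the Hamiltonian form\<close>

definition L2 :: "('a::euclidean_space \<Rightarrow> real) \<Rightarrow> bool" where
  "L2 f \<longleftrightarrow> f \<in> borel_measurable lborel \<and> integrable lborel (\<lambda>x. (f x)\<^sup>2)"

text \<open>Test functions of class \<open>C\<^sup>1\<close> with compact support, as in Gilbarg and Trudinger; for square
  integrable functions, smooth test functions give the same weak derivatives.\<close>

definition test_function :: "('a::euclidean_space \<Rightarrow> real) \<Rightarrow> bool" where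
  "test_function \<psi> \<longleftrightarrow> (\<forall>x. \<psi> differentiable (at x)) \<and>
     (\<forall>b\<in>Basis. continuous_on UNIV (\<lambda>x. frechet_derivative \<psi> (at x) b)) \<and>
     compact (closure {x. \<psi> x \<noteq> 0})"

definition weak_deriv :: "'a::euclidean_space \<Rightarrow> ('a \<Rightarrow> real) \<Rightarrow> ('a \<Rightarrow> real) \<Rightarrow> bool" where
  "weak_deriv b f g \<longleftrightarrow> (\<forall>\<psi>. test_function \<psi> \<longrightarrow>
     (\<integral>x. f x * frechet_derivative \<psi> (at x) b \<partial>lborel) = - (\<integral>x. g x * \<psi> x \<partial>lborel))"

definition H1 :: "('a::euclidean_space \<Rightarrow> real) \<Rightarrow> bool" where
  "H1 f \<longleftrightarrow> L2 f \<and> (\<forall>b\<in>Basis. \<exists>g. L2 g \<and> weak_deriv b f g)"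

text \<open>For \<open>f\<close> in \<open>H\<^sup>1\<close> the weak derivative is determined almost everywhere, so the integrals below
  do not depend on the choice.\<close>

definition wderiv :: "'a::euclidean_space \<Rightarrow> ('a \<Rightarrow> real) \<Rightarrow> 'a \<Rightarrow> real" where
  "wderiv b f = (SOME g. L2 g \<and> weak_deriv b f g)"

definition grad_inner :: "('a::euclidean_space \<Rightarrow> real) \<Rightarrow> ('a \<Rightarrow> real) \<Rightarrow> real" where
  "grad_inner f g = (\<Sum>b\<in>Basis. \<integral>x. wderiv b f x * wderiv b g x \<partial>lborel)"

definition H1_inner :: "('a::euclidean_space \<Rightarrow> real) \<Rightarrow> ('a \<Rightarrow> real) \<Rightarrow> real" where
  "H1_inner f g = (\<integral>x. f x * g x \<partial>lborel) + grad_inner f g"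

definition L32_plus_Linf_eps :: "(real^3 \<Rightarrow> real) \<Rightarrow> bool" where
  "L32_plus_Linf_eps V \<longleftrightarrow> (\<forall>\<epsilon>>0. \<exists>V1 V2. V = (\<lambda>x. V1 x + V2 x) \<and>
     V1 \<in> borel_measurable lborel \<and> integrable lborel (\<lambda>x. \<bar>V1 x\<bar> powr (3/2)) \<and>
     V2 \<in> borel_measurable lborel \<and> (AE x in lborel. \<bar>V2 x\<bar> \<le> \<epsilon>))"

text \<open>Configurations of \<open>N = CARD('n)\<close> particles.\<close>

type_synonym 'n conf = "(real^3, 'n) vec"

definition ham_form :: "(real^3 \<Rightarrow> real) \<Rightarrow> (real^3 \<Rightarrow> real) \<Rightarrow>
    ('n::{finite,linorder} conf \<Rightarrow> real) \<Rightarrow> ('n conf \<Rightarrow> real) \<Rightarrow> real" where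
  "ham_form V w f g = 1/2 * grad_inner f g +
     (\<integral>x. ((\<Sum>i\<in>UNIV. V (x $ i)) + (\<Sum>(i, j)\<in>{(i, j). i < j}. w (x $ i - x $ j))) * f x * g x \<partial>lborel)"

section \<open>Slater determinants and the finite-dimensional state space\<close>

text \<open>A multiindex \<open>\<alpha>\<^sub>1 < \<dots> < \<alpha>\<^sub>N\<close> is represented by its set of entries; the reference
  multiindex is \<open>{1..N}\<close>.\<close>

definition configs :: "nat \<Rightarrow> nat \<Rightarrow> nat set set" where
  "configs K N = {\<alpha>. \<alpha> \<subseteq> {1..K} \<and> card \<alpha> = N}"

definition rk :: "nat \<Rightarrow> nat set \<Rightarrow> nat" where
  "rk N \<alpha> = card (\<alpha> - {1..N})"

definition slater :: "(nat \<Rightarrow> real^3 \<Rightarrow> real) \<Rightarrow> nat set \<Rightarrow> 'n::{finite,linorder} conf \<Rightarrow> real" where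
  "slater \<phi> \<alpha> x = 1 / sqrt (fact CARD('n)) *
     det (\<chi> i j. \<phi> (sorted_list_of_set \<alpha> ! card {k. k < i}) (x $ j))"

text \<open>A vector of the fermionic Fock space over the orbitals is given by its coefficients with
  respect to the orthonormal Slater determinants; the \<open>N\<close>-particle vector \<open>c\<close> stands for
  the wave function \<open>wavefunction K \<phi> c\<close>.\<close>

type_synonym fock = "nat set \<Rightarrow> real"

definition wavefunction :: "nat \<Rightarrow> (nat \<Rightarrow> real^3 \<Rightarrow> real) \<Rightarrow> fock \<Rightarrow>
    'n::{finite,linorder} conf \<Rightarrow> real" where
  "wavefunction K \<phi> c x = (\<Sum>\<alpha>\<in>configs K CARD('n). c \<alpha> * slater \<phi> \<alpha> x)"

definition basis_state :: "nat set \<Rightarrow> fock" where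
  "basis_state \<alpha> = (\<lambda>\<beta>. if \<beta> = \<alpha> then 1 else 0)"

definition ref_state :: "nat \<Rightarrow> fock" where
  "ref_state N = basis_state {1..N}"

definition state_inner :: "nat \<Rightarrow> nat \<Rightarrow> fock \<Rightarrow> fock \<Rightarrow> real" where
  "state_inner K N c d = (\<Sum>\<alpha>\<in>configs K N. c \<alpha> * d \<alpha>)"

definition ham_op :: "'n::{finite,linorder} itself \<Rightarrow> nat \<Rightarrow> (nat \<Rightarrow> real^3 \<Rightarrow> real) \<Rightarrow>
    (real^3 \<Rightarrow> real) \<Rightarrow> (real^3 \<Rightarrow> real) \<Rightarrow> fock \<Rightarrow> fock" where
  "ham_op _ K \<phi> V w c = (\<lambda>\<beta>. if \<beta> \<in> configs K CARD('n)
     then ham_form V w (wavefunction K \<phi> c :: 'n conf \<Rightarrow> real) (slater \<phi> \<beta>) else 0)"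

definition state_adjoint :: "nat \<Rightarrow> nat \<Rightarrow> (fock \<Rightarrow> fock) \<Rightarrow> fock \<Rightarrow> fock" where
  "state_adjoint K N F c = (\<lambda>\<alpha>. if \<alpha> \<in> configs K N
     then state_inner K N c (F (basis_state \<alpha>)) else 0)"

section \<open>Excitation and cluster operators\<close>

text \<open>\<open>create p\<close> maps \<open>\<phi>\<^sub>q\<^sub>1 \<and> \<phi>\<^sub>q\<^sub>2 \<and> \<dots>\<close> to \<open>\<phi>\<^sub>p \<and> \<phi>\<^sub>q\<^sub>1 \<and> \<phi>\<^sub>q\<^sub>2 \<and> \<dots>\<close>, hence the sign; \<open>annihilate p\<close> is
  its adjoint.\<close>

definition create :: "nat \<Rightarrow> fock \<Rightarrow> fock" where
  "create p c = (\<lambda>\<alpha>. if p \<in> \<alpha> then (-1) ^ card {q\<in>\<alpha>. q < p} * c (\<alpha> - {p}) else 0)"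

definition annihilate :: "nat \<Rightarrow> fock \<Rightarrow> fock" where
  "annihilate p c = (\<lambda>\<alpha>. if p \<notin> \<alpha> then (-1) ^ card {q\<in>\<alpha>. q < p} * c (insert p \<alpha>) else 0)"

definition excitation :: "nat \<Rightarrow> nat set \<Rightarrow> fock \<Rightarrow> fock" where
  "excitation N \<alpha> = foldr (\<lambda>(A, I) F. create A \<circ> annihilate I \<circ> F)
     (zip (sorted_list_of_set (\<alpha> - {1..N})) (sorted_list_of_set ({1..N} - \<alpha>))) id"

text \<open>Amplitudes are vectors over a finite index type \<open>'x\<close>; the injection \<open>\<xi>\<close> enumerates the
  retained excitations, i.e. its range is the index set of the amplitude space.\<close>

definition cluster :: "nat \<Rightarrow> ('x::finite \<Rightarrow> nat set) \<Rightarrow> real^'x \<Rightarrow> fock \<Rightarrow> fock" where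
  "cluster N \<xi> t c = (\<lambda>\<alpha>. \<Sum>a\<in>UNIV. t $ a * excitation N (\<xi> a) c \<alpha>)"

definition op_exp :: "(fock \<Rightarrow> fock) \<Rightarrow> fock \<Rightarrow> fock" where
  "op_exp F c = (\<lambda>\<alpha>. suminf (\<lambda>k. (F ^^ k) c \<alpha> / fact k))"

definition transformed :: "nat \<Rightarrow> (fock \<Rightarrow> fock) \<Rightarrow> ('x::finite \<Rightarrow> nat set) \<Rightarrow> real^'x \<Rightarrow> fock \<Rightarrow> fock" where
  "transformed N H \<xi> t = op_exp (cluster N \<xi> (- t)) \<circ> H \<circ> op_exp (cluster N \<xi> t)"

definition proj_low :: "nat \<Rightarrow> nat \<Rightarrow> ('x::finite \<Rightarrow> nat set) \<Rightarrow> real^'x \<Rightarrow> real^'x" where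
  "proj_low N \<rho> \<xi> t = (\<chi> a. if rk N (\<xi> a) \<le> \<rho> then t $ a else 0)"

definition proj_high :: "nat \<Rightarrow> nat \<Rightarrow> ('x::finite \<Rightarrow> nat set) \<Rightarrow> real^'x \<Rightarrow> real^'x" where
  "proj_high N \<rho> \<xi> t = (\<chi> a. if rk N (\<xi> a) > \<rho> then t $ a else 0)"

definition singles :: "nat \<Rightarrow> ('x::finite \<Rightarrow> nat set) \<Rightarrow> real^'x \<Rightarrow> real^'x" where
  "singles N \<xi> t = (\<chi> a. if rk N (\<xi> a) = 1 then t $ a else 0)"

section \<open>The coupled-cluster map and the Kowalski--Piecuch homotopy\<close>

text \<open>The dual of \<open>real^'x\<close> is identified with \<open>real^'x\<close> through the dual basis, so that the
  duality pairing is the inner product.\<close>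

definition dual_vec :: "(real^'x::finite \<Rightarrow> real) \<Rightarrow> real^'x" where
  "dual_vec F = (\<chi> a. F (axis a 1))"

lemma dual_vec_inner:
  assumes "linear F"
  shows "dual_vec F \<bullet> s = F s"
proof -
  have "F s = F (\<Sum>a\<in>UNIV. s $ a *\<^sub>R axis a 1)"
    using basis_expansion[of s] by (simp add: scalar_mult_eq_scaleR)
  also have "\<dots> = dual_vec F \<bullet> s"
    using assms by (simp add: linear_sum linear_scale dual_vec_def inner_vec_def mult.commute)
  finally show ?thesis ..
qed

definition cc_map :: "nat \<Rightarrow> nat \<Rightarrow> (fock \<Rightarrow> fock) \<Rightarrow> ('x::finite \<Rightarrow> nat set) \<Rightarrow> real^'x \<Rightarrow> real^'x" where
  "cc_map K N H \<xi> t = dual_vec (\<lambda>s.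
     state_inner K N (transformed N H \<xi> t (ref_state N)) (cluster N \<xi> s (ref_state N)))"

definition kp_map :: "nat \<Rightarrow> nat \<Rightarrow> nat \<Rightarrow> (fock \<Rightarrow> fock) \<Rightarrow> ('x::finite \<Rightarrow> nat set) \<Rightarrow>
    real^'x \<Rightarrow> real \<Rightarrow> real^'x" where
  "kp_map K N \<rho> H \<xi> t lam = dual_vec (\<lambda>s.
     let \<Phi>0 = ref_state N;
         t0 = proj_low N \<rho> \<xi> t; th = proj_high N \<rho> \<xi> t;
         S0\<Phi>0 = cluster N \<xi> (proj_low N \<rho> \<xi> s) \<Phi>0; Sh\<Phi>0 = cluster N \<xi> (proj_high N \<rho> \<xi> s) \<Phi>0
     in state_inner K N (transformed N H \<xi> t0 \<Phi>0) S0\<Phi>0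
      + state_inner K N (transformed N H \<xi> t \<Phi>0) Sh\<Phi>0
      + lam * state_inner K N
          (transformed N H \<xi> t0 (\<lambda>\<alpha>. op_exp (cluster N \<xi> th) \<Phi>0 \<alpha> - \<Phi>0 \<alpha>)) S0\<Phi>0)"

section \<open>Norms and constants on the amplitude space\<close>

definition amp_inner :: "'n::{finite,linorder} itself \<Rightarrow> nat \<Rightarrow> (nat \<Rightarrow> real^3 \<Rightarrow> real) \<Rightarrow>
    ('x::finite \<Rightarrow> nat set) \<Rightarrow> real^'x \<Rightarrow> real^'x \<Rightarrow> real" where
  "amp_inner _ K \<phi> \<xi> t s = H1_inner
     (wavefunction K \<phi> (cluster CARD('n) \<xi> t (ref_state CARD('n))) :: 'n conf \<Rightarrow> real)
     (wavefunction K \<phi> (cluster CARD('n) \<xi> s (ref_state CARD('n))))"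

definition ip_norm :: "('v \<Rightarrow> 'v \<Rightarrow> real) \<Rightarrow> 'v \<Rightarrow> real" where
  "ip_norm ip t = sqrt (ip t t)"

definition ip_opnorm :: "('v \<Rightarrow> 'v \<Rightarrow> real) \<Rightarrow> ('v \<Rightarrow> 'v) \<Rightarrow> real" where
  "ip_opnorm ip L = (SUP u\<in>{u. ip_norm ip u \<le> 1}. ip_norm ip (L u))"

definition second_deriv :: "('v::real_normed_vector \<Rightarrow> 'v) \<Rightarrow> 'v \<Rightarrow> 'v \<Rightarrow> 'v \<Rightarrow> 'v" where
  "second_deriv F t u v = frechet_derivative (\<lambda>z. frechet_derivative F (at z) u) (at t) v"

text \<open>Norm of a bilinear map with values in the dual space.\<close>

definition ip_bilnorm :: "('v::real_inner \<Rightarrow> 'v \<Rightarrow> real) \<Rightarrow> ('v \<Rightarrow> 'v \<Rightarrow> 'v) \<Rightarrow> real" where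
  "ip_bilnorm ip B = (SUP (u, v, s)\<in>{(u, v, s). ip_norm ip u \<le> 1 \<and> ip_norm ip v \<le> 1 \<and> ip_norm ip s \<le> 1}.
     \<bar>B u v \<bullet> s\<bar>)"

definition M_const :: "('v::real_inner \<Rightarrow> 'v \<Rightarrow> real) \<Rightarrow> ('v \<Rightarrow> 'v) \<Rightarrow> 'v \<Rightarrow> real \<Rightarrow> real" where
  "M_const ip F t \<delta> = (SUP \<zeta>\<in>{\<zeta>. ip_norm ip \<zeta> \<le> \<delta>}. ip_bilnorm ip (second_deriv F (t + \<zeta>)))"

text \<open>The element \<open>0\<close> is inserted only to give the value \<open>0\<close> when one of the two subspaces is trivial.\<close>

definition Delta_const :: "nat \<Rightarrow> nat \<Rightarrow> nat \<Rightarrow> (fock \<Rightarrow> fock) \<Rightarrow> (real^'x \<Rightarrow> real^'x \<Rightarrow> real) \<Rightarrow>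
    ('x::finite \<Rightarrow> nat set) \<Rightarrow> real^'x \<Rightarrow> real" where
  "Delta_const K N \<rho> H ip \<xi> t =
     (let T1a = state_adjoint K N (cluster N \<xi> (singles N \<xi> t));
          G = (\<lambda>c \<alpha>. H c \<alpha> + (T1a (H c) \<alpha> - H (T1a c) \<alpha>))
      in Sup (insert 0
           {\<bar>state_inner K N (G (cluster N \<xi> u (ref_state N))) (cluster N \<xi> v (ref_state N))\<bar> | u v.
              u \<in> range (proj_low N \<rho> \<xi>) \<and> ip_norm ip u = 1 \<and>
              v \<in> range (proj_high N \<rho> \<xi>) \<and> ip_norm ip v = 1}))"

section \<open>Brouwer degree\<close>

definition degree_admissible :: "('a::euclidean_space \<Rightarrow> 'a) \<Rightarrow> 'a set \<Rightarrow> 'a \<Rightarrow> bool" where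
  "degree_admissible f D p \<longleftrightarrow>
     open D \<and> bounded D \<and> continuous_on (closure D) f \<and> p \<notin> f ` frontier D"

text \<open>Homological definition (Dold, Lectures on Algebraic Topology). Write \<open>E\<close> for the whole space, \<open>n\<close>
  for its dimension and \<open>Z\<close> for the compact set of solutions of \<open>f x = p\<close> in \<open>D\<close>. A class \<open>u\<close> in
  \<open>H\<^sub>n(E, E - B)\<close>, with \<open>B\<close> a ball containing \<open>Z\<close> and \<open>p\<close>, restricts to classes in \<open>H\<^sub>n(E, E - Z)\<close>, which
  is \<open>H\<^sub>n(D, D - Z)\<close> by excision, and in \<open>H\<^sub>n(E, E - {p})\<close>. The map induced by \<open>f\<close> sends the first to the
  degree times the second. The groups are written multiplicatively.\<close>

definition brouwer_degree :: "('a::euclidean_space \<Rightarrow> 'a) \<Rightarrow> 'a set \<Rightarrow> 'a \<Rightarrow> int" where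
  "brouwer_degree f D p = (THE d. \<forall>R u c.
     let n = int DIM('a); E = (euclidean :: 'a topology);
         Z = {x\<in>D. f x = p}; B = cball 0 R
     in Z \<subseteq> B \<and> p \<in> B \<and>
        u \<in> carrier (relative_homology_group n E (- B)) \<and>
        c \<in> carrier (relative_homology_group n (top_of_set D) (D - Z)) \<and>
        hom_induced n (top_of_set D) (D - Z) E (- Z) id c = hom_induced n E (- B) E (- Z) id u
      \<longrightarrow> hom_induced n (top_of_set D) (D - Z) E (- {p}) f c =
          hom_induced n E (- B) E (- {p}) id u [^]\<^bsub>relative_homology_group n E (- {p})\<^esub> d)"

end

theory Submission imports Defs begin

text \<open>Let \<open>\<Theta> = \<Theta>\<^sub>\<alpha>\<close>. As \<open>\<K>(t, \<lambda>) = \<A>(t) - (1 - \<lambda>) \<Pi>\<^sub>0 (\<A>(t) - \<A>(\<Pi>\<^sub>0 t))\<close>, the pairing of \<open>\<K>(t\<^sub>* + r, \<lambda>)\<close> with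
  \<open>\<Theta> r\<close> is that of \<open>\<A>(t\<^sub>* + r)\<close>, which a second order Taylor expansion and the coercivity of
  \<open>\<A>'(t\<^sub>*) + \<alpha> I\<close> bound below by a multiple of \<open>\<parallel>r\<parallel>\<^sup>2\<close>, minus a term that the mean value theorem along the
  high-rank direction bounds by \<open>\<Delta> + M \<delta>\<close> times \<open>\<parallel>\<Pi>\<^sub>h (t\<^sub>* + r)\<parallel> \<parallel>\<Pi>\<^sub>0 \<Theta> r\<parallel>\<close>. Here the constant \<open>\<Delta>\<close> suffices because \<open>H\<close> changes
  the rank by at most two, so only the singles of \<open>t\<^sub>*\<close> enter the derivative of \<open>\<Pi>\<^sub>0 \<A>\<close> in high-rank
  directions. The hypotheses make the pairing positive on the boundary of \<open>D\<close>, and so is that of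
  \<open>\<A>'(t\<^sub>*) r\<close> with \<open>\<Theta> r\<close>. The segment from one map to the other therefore avoids \<open>0\<close> there, and all
  degrees equal that of a linear isomorphism, which is nonzero since it acts on homology by an automorphism.

  The rank selection rule needs the Slater--Condon rules, hence bilinearity of the form of the
  Hamiltonian. Because the Lebesgue integral of a non-integrable function is \<open>0\<close>, this requires the
  potential terms to be integrable, which follows from \<open>H\<^sup>1(\<real>\<^sup>3) \<subseteq> L\<^sup>6(\<real>\<^sup>3)\<close>, proved by mollification and the
  Loomis--Whitney inequality.\<close>

subsection \<open>Degree of maps homotopic to a linear isomorphism\<close>

text \<open>Let a and b be the norms of the low and high parts of r, and R the radius of
  \<open>D\<close> in the norm sqrt (a^2 + b^2). The factor 1/2 in \<open>D\<close> gives a + b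
  \<le> \<delta> - \<kappa>, which keeps every point of the Taylor estimates within distance
  \<delta> of t_*. The strengthened Cauchy--Schwarz inequality costs the factor 1 - g. The degree is
  a definite description over homology classes, so existence and uniqueness of its value have to be
  shown. General homotopy invariance is bypassed: every admissible map joined to an affine map x ->
  L (x - a) without zeros on the frontier has the same degree, which depends on L alone. Its
  uniqueness rests on a homology class of infinite order. Ranks are at most N, so all exponentials
  terminate and \<A> is polynomial.\<close>

lemma cyclic_automorphism_power:
  assumes "group G" and "G \<cong> integer_group" and h: "h \<in> iso G G"
  shows "\<exists>d g. d \<noteq> (0 :: int) \<and> (\<forall>x\<in>carrier G. h x = x [^]\<^bsub>G\<^esub> d) \<and> g \<in> carrier G \<and>
    (\<forall>i j :: int. g [^]\<^bsub>G\<^esub> i = g [^]\<^bsub>G\<^esub> j \<longrightarrow> i = j)"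
proof -
  interpret G: group G by fact
  obtain f where f: "f \<in> iso G integer_group"
    using assms(2) by (auto simp: is_iso_def)
  then have fhom: "f \<in> hom G integer_group" and bij: "bij_betw f (carrier G) UNIV"
    by (auto simp: iso_def)
  interpret f: group_hom G integer_group f
    using fhom by (intro group_hom.intro group_hom_axioms.intro) auto
  obtain g where g: "g \<in> carrier G" "f g = 1"
    using bij by (metis UNIV_I bij_betw_iff_bijections)
  have fpow: "f (x [^]\<^bsub>G\<^esub> m) = f x * m" if "x \<in> carrier G" for x and m :: int
    using that by (simp add: f.hom_int_pow  mult.commute)
  have finj: "x = y" if "x \<in> carrier G" "y \<in> carrier G" "f x = f y" for x y
    using bij that by (auto simp: bij_betw_def inj_on_def)
  have hhom: "h \<in> hom G G" and hbij: "bij_betw h (carrier G) (carrier G)"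
    using h by (auto simp: iso_def)
  interpret h: group_hom G G h
    using hhom by unfold_locales auto
  have xg: "x = g [^]\<^bsub>G\<^esub> f x" if "x \<in> carrier G" for x
    using that g fpow[OF g(1)] by (intro finj) auto
  have hg: "h g \<in> carrier G" using g by auto
  \<comment> \<open>Since \<open>f g = 1\<close>, each \<open>x\<close> is the power of
    \<open>g\<close> with exponent \<open>f x\<close>, so \<open>h\<close> is determined by the
    integer at which it sends \<open>g\<close>.\<close>
  define d where "d = f (h g)"
  have "h x = x [^]\<^bsub>G\<^esub> d" if x: "x \<in> carrier G" for x
  proof (rule finj)
    have "f (h x) = f (h (g [^]\<^bsub>G\<^esub> f x))" using xg[OF x] by simp
    also have "\<dots> = f (h g [^]\<^bsub>G\<^esub> f x)" using g by (simp add: h.hom_int_pow)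
    also have "\<dots> = d * f x" using hg by (simp add: fpow d_def)
    finally show "f (h x) = f (x [^]\<^bsub>G\<^esub> d)" using x by (simp add: fpow)
  qed (use x in auto)
  moreover have "d \<noteq> 0"
  proof
    assume "d = 0"
    then have "h g = \<one>\<^bsub>G\<^esub>"
      using xg[OF hg] by (simp add: d_def)
    then have "g = \<one>\<^bsub>G\<^esub>"
      using hbij g by (metis G.one_closed bij_betw_def h.hom_one inj_onD)
    then show False using g by auto
  qed
  moreover have "i = j" if "g [^]\<^bsub>G\<^esub> i = g [^]\<^bsub>G\<^esub> j" for i j :: int
    using arg_cong[OF that, of f] g by (simp add: fpow)
  ultimately show ?thesis using g by blast
qed

lemma iso_preimage:
  assumes "h \<in> iso G H" "y \<in> carrier H"
  obtains x where "x \<in> carrier G" "h x = y"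
proof -
  have "y \<in> h ` carrier G" using assms by (simp add: iso_def bij_betw_def)
  then show thesis by (rule imageE) (rule that, simp_all)
qed

text \<open>The straight-line homotopy as a homotopy of maps of pairs (X, S) -> (Y, T). The
  predicate carried along is the form in which the homotopy axiom of relative homology consumes
  it.\<close>

lemma homotopic_with_linear_pair:
  fixes f g :: "'a::topological_space \<Rightarrow> 'b::real_normed_vector"
  assumes "continuous_on X f" "continuous_on X g"
    and "\<And>x. x \<in> X \<Longrightarrow> closed_segment (f x) (g x) \<subseteq> Y"
    and "\<And>x. x \<in> S \<Longrightarrow> closed_segment (f x) (g x) \<subseteq> T"
  shows "homotopic_with (\<lambda>h. h \<in> S \<rightarrow> T) (top_of_set X) (top_of_set Y) f g"
  unfolding homotopic_with_def
proof (intro exI conjI ballI allI)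
  let ?h = "\<lambda>y. (1 - fst y) *\<^sub>R f (snd y) + fst y *\<^sub>R g (snd y)"
  have "continuous_on ({0..1} \<times> X) ?h"
    by (intro continuous_intros continuous_on_compose2[OF assms(1)] continuous_on_compose2[OF assms(2)]) auto
  then show "continuous_map (prod_topology (top_of_set {0..1}) (top_of_set X)) (top_of_set Y) ?h"
    using assms(3) by (fastforce simp: closed_segment_def continuous_map_in_subtopology)
  show "?h (0, x) = f x" "?h (1, x) = g x" for x by auto
  show "(\<lambda>x. ?h (t, x)) \<in> S \<rightarrow> T" if "t \<in> {0..1}" for t
    using assms(4) that by (fastforce simp: closed_segment_def)
qed

lemma contractible_euclidean: "contractible_space (euclidean :: 'a::real_normed_vector topology)"
  using contractible_space_top_of_set[of "UNIV :: 'a set"] convex_imp_contractible[OF convex_UNIV]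
  by (metis subtopology_UNIV)

text \<open>Both complements retract onto a common sphere up to homotopy; pushing a point radially
  outwards by \<open>R' - R\<close> is a homotopy inverse of the inclusion.\<close>

lemma restriction_between_balls_iso:
  fixes R R' :: real
  assumes R: "0 \<le> R" "R \<le> R'"
  shows "hom_induced n (euclidean :: 'a::euclidean_space topology) (- cball 0 R') euclidean (- cball 0 R) id
    \<in> iso (relative_homology_group n euclidean (- cball 0 R')) (relative_homology_group n euclidean (- cball 0 R))"
proof -
  let ?E = "euclidean :: 'a topology" and ?S = "- cball 0 R' :: 'a set" and ?T = "- cball 0 R :: 'a set"
  let ?r = "\<lambda>x::'a. x + ((R' - R) / norm x) *\<^sub>R x"
  have ST: "?S \<subseteq> ?T" using R by auto
  have idST: "id \<in> ?S \<rightarrow> ?T" by (rule Pi_I) (use ST in \<open>metis id_apply subsetD\<close>)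
  have nonempty: "\<exists>x::'a. norm x > r" for r
    by (metis gt_ex norm_ge_zero vector_choose_size less_le_trans less_imp_le linear)
  have ne: "?S \<noteq> {}" "?T \<noteq> {}"
    using nonempty[of R'] nonempty[of R] by (auto simp: set_eq_iff not_le)
  \<comment> \<open>Pushing radially, by any nonnegative fraction \<open>s\<close>, adds exactly s
    (R' - R) to the norm, so no stage of the homotopy enters the ball.\<close>
  have nr: "norm (x + (s * ((R' - R) / norm x)) *\<^sub>R x) = norm x + s * (R' - R)"
    if "x \<in> ?T" "0 \<le> s" for x s
  proof -
    have x: "norm x > 0" using that R by auto
    have "x + (s * ((R' - R) / norm x)) *\<^sub>R x = (1 + s * ((R' - R) / norm x)) *\<^sub>R x"
      by (simp add: algebra_simps)
    also have "norm \<dots> = (1 + s * ((R' - R) / norm x)) * norm x"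
      using R that by simp
    also have "\<dots> = norm x + s * (R' - R)" using x by (simp add: field_simps)
    finally show ?thesis .
  qed
  have seg: "z \<in> closed_segment (?r x) x \<Longrightarrow> \<exists>s. 0 \<le> s \<and> z = x + (s * ((R' - R) / norm x)) *\<^sub>R x" for z x
  proof -
    assume "z \<in> closed_segment (?r x) x"
    then obtain u where "0 \<le> u" "u \<le> 1" "z = (1 - u) *\<^sub>R ?r x + u *\<^sub>R x"
      by (auto simp: closed_segment_def)
    then show ?thesis by (intro exI[of _ "1 - u"]) (auto simp: algebra_simps diff_divide_distrib)
  qed
  have contr: "continuous_on ?T ?r" using R by (auto intro!: continuous_intros)
  have rS: "?r x \<in> ?S" if "x \<in> ?T" for x
    using nr[OF that, of 1] that by auto
  have hT: "homotopic_with (\<lambda>h. True) (top_of_set ?T) (top_of_set ?T) ?r id"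
  proof -
    have "closed_segment (?r x) (id x) \<subseteq> ?T" if x: "x \<in> ?T" for x
    proof
      fix z assume "z \<in> closed_segment (?r x) (id x)"
      then obtain s where s: "0 \<le> s" "z = x + (s * ((R' - R) / norm x)) *\<^sub>R x"
        using seg[of z x] by auto
      have "norm z = norm x + s * (R' - R)" using nr[OF x s(1)] s(2) by simp
      moreover have "s * (R' - R) \<ge> 0" using s R by simp
      moreover have "norm x > R" using x by simp
      ultimately show "z \<in> ?T" by simp
    qed
    with contr have "homotopic_with (\<lambda>h. h \<in> {} \<rightarrow> {}) (top_of_set ?T) (top_of_set ?T) ?r id"
      by (intro homotopic_with_linear_pair) auto
    then show ?thesis by (rule homotopic_with_mono) auto
  qed
  have hS: "homotopic_with (\<lambda>h. True) (top_of_set ?S) (top_of_set ?S) ?r id"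
  proof -
    have "closed_segment (?r x) (id x) \<subseteq> ?S" if x: "x \<in> ?S" for x
    proof
      fix z assume "z \<in> closed_segment (?r x) (id x)"
      then obtain s where s: "0 \<le> s" "z = x + (s * ((R' - R) / norm x)) *\<^sub>R x"
        using seg[of z x] by auto
      have "x \<in> ?T" using x ST by blast
      then have "norm z = norm x + s * (R' - R)" using nr[OF _ s(1)] s(2) by simp
      moreover have "s * (R' - R) \<ge> 0" using s R by simp
      moreover have "norm x > R'" using x by simp
      ultimately show "z \<in> ?S" by simp
    qed
    with continuous_on_subset[OF contr ST]
    have "homotopic_with (\<lambda>h. h \<in> {} \<rightarrow> {}) (top_of_set ?S) (top_of_set ?S) ?r id"
      by (intro homotopic_with_linear_pair) auto
    then show ?thesis by (rule homotopic_with_mono) auto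
  qed
  let ?i = "hom_induced (n - 1) (top_of_set ?S) {} (top_of_set ?T) {} id"
  have i: "?i \<in> iso (reduced_homology_group (n - 1) (top_of_set ?S)) (reduced_homology_group (n - 1) (top_of_set ?T))"
  proof (rule homotopy_equivalence_reduced_homology_group_isomorphism[where g = ?r])
    show "continuous_map (top_of_set ?S) (top_of_set ?T) id"
      using idST by (simp add: continuous_map_in_subtopology continuous_on_id image_subset_iff_funcset)
    show "continuous_map (top_of_set ?T) (top_of_set ?S) ?r"
      using contr rS by (auto simp: continuous_map_in_subtopology)
  qed (use hS hT in \<open>simp_all only: comp_id id_comp\<close>)
  \<comment> \<open>As the whole space is contractible, the boundary maps identify relative homology
    with the reduced homology of the complements one degree lower; naturality carries the
    isomorphism \<open>?i\<close> back to the pairs.\<close>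
  let ?h = "hom_induced n ?E ?S ?E ?T id"
  have bS: "hom_boundary n ?E ?S \<in> iso (relative_homology_group n ?E ?S) (reduced_homology_group (n - 1) (top_of_set ?S))"
    using ne by (intro iso_relative_homology_of_contractible contractible_euclidean) auto
  have bT: "hom_boundary n ?E ?T \<in> iso (relative_homology_group n ?E ?T) (reduced_homology_group (n - 1) (top_of_set ?T))"
    using ne by (intro iso_relative_homology_of_contractible contractible_euclidean) auto
  have nat: "hom_boundary n ?E ?T \<circ> ?h = ?i \<circ> hom_boundary n ?E ?S"
    proof (rule naturality_hom_induced)
    show "id \<in> ?S \<rightarrow> ?T" by (fact idST)
  qed auto
  have "bij_betw (?i \<circ> hom_boundary n ?E ?S) (carrier (relative_homology_group n ?E ?S))
      (carrier (reduced_homology_group (n - 1) (top_of_set ?T)))"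
    using bS i by (auto simp: iso_def intro: bij_betw_trans)
  then have "bij_betw (hom_boundary n ?E ?T \<circ> ?h) (carrier (relative_homology_group n ?E ?S))
      (carrier (reduced_homology_group (n - 1) (top_of_set ?T)))"
    by (simp add: nat)
  moreover have "?h ` carrier (relative_homology_group n ?E ?S) \<subseteq> carrier (relative_homology_group n ?E ?T)"
    by (auto simp: hom_induced_carrier)
  moreover have "bij_betw (hom_boundary n ?E ?T) (carrier (relative_homology_group n ?E ?T))
      (carrier (reduced_homology_group (n - 1) (top_of_set ?T)))"
    using bT unfolding iso_def by blast
  ultimately have "bij_betw ?h (carrier (relative_homology_group n ?E ?S)) (carrier (relative_homology_group n ?E ?T))"
    using bij_betw_comp_iff2 by blast
  then show ?thesis
    by (simp add: iso_def hom_induced_hom)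
qed

text \<open>Contractibility lowers the degree by one, the punctured space is homotopy equivalent to
  the unit sphere, and the reduced homology of a sphere in its own dimension is infinite
  cyclic.\<close>

lemma relative_homology_punctured_euclidean:
  "relative_homology_group (int DIM('a)) (euclidean :: 'a::euclidean_space topology) (- {0::'a}) \<cong> integer_group"
proof -
  let ?E = "euclidean :: 'a topology" and ?n = "DIM('a)"
  have ne: "- {0::'a} \<noteq> ({} :: 'a set)"
    by (metis Compl_iff SOME_Basis empty_iff insert_iff nonzero_Basis)
  have 1: "relative_homology_group (int ?n) ?E (- {0::'a}) \<cong> reduced_homology_group (int ?n - 1) (top_of_set (- {0::'a}))"
  proof -
    have "topspace ?E \<inter> (- {0::'a}) \<noteq> {}" using ne by simp
    from iso_relative_homology_of_contractible[OF contractible_euclidean this, of "int ?n"]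
    show ?thesis unfolding is_iso_def by blast
  qed
  have "sphere (0::'a) 1 homotopy_eqv - {0::'a}"
  proof -
    have "affine hull (cball (0::'a) 1) = UNIV" "0 \<in> rel_interior (cball (0::'a) 1)"
      by (auto simp: affine_hull_nonempty_interior rel_interior_nonempty_interior)
    then show ?thesis
      using homotopy_eqv_rel_frontier_punctured_affine_hull[of "cball (0::'a) 1" 0]
      by (simp add: Compl_eq_Diff_UNIV)
  qed
  then have 2: "reduced_homology_group (int ?n - 1) (top_of_set (- {0::'a})) \<cong> reduced_homology_group (int ?n - 1) (top_of_set (sphere 0 1 :: 'a set))"
    by (rule homotopy_equivalent_space_imp_isomorphic_reduced_homology_groups[OF homotopy_equivalent_space_sym[THEN iffD1]])
  obtain f g where "homeomorphic_maps (nsphere (?n - 1)) (top_of_set (sphere 0 1 \<inter> span (Basis :: 'a set))) f g"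
    using homeomorphic_maps_nsphere_euclidean_sphere[of "Basis :: 'a set" ?n]
      independent_Basis orthogonal_Basis by auto
  then have "nsphere (?n - 1) homeomorphic_space top_of_set (sphere 0 1 :: 'a set)"
    by (auto simp: homeomorphic_space_def)
  then have 3: "reduced_homology_group (int ?n - 1) (nsphere (?n - 1)) \<cong> reduced_homology_group (int ?n - 1) (top_of_set (sphere 0 1 :: 'a set))"
    by (rule homeomorphic_space_imp_isomorphic_reduced_homology_groups)
  have "int (?n - 1) = int ?n - 1" by (simp add: of_nat_diff Suc_leI)
  then have 4: "reduced_homology_group (int ?n - 1) (nsphere (?n - 1)) \<cong> integer_group"
    using reduced_homology_group_nsphere[of "?n - 1"] by metis
  have "reduced_homology_group (int ?n - 1) (top_of_set (sphere 0 1 :: 'a set)) \<cong> integer_group"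
    by (rule iso_trans[OF group.iso_sym[OF group_reduced_homology_group 3] 4])
  from iso_trans[OF 1 iso_trans[OF 2 this]] show ?thesis .
qed

text \<open>The excised set is the complement of \<open>D\<close>, a closed set inside the open
  complement of \<open>Z\<close>.\<close>

lemma excision_euclidean:
  assumes "open D" "closed Z" "Z \<subseteq> D"
  shows "hom_induced n (top_of_set D) (D - Z) euclidean (- Z) id
    \<in> iso (relative_homology_group n (top_of_set D) (D - Z)) (relative_homology_group n euclidean (- Z))"
proof -
  have "euclidean closure_of (- D) \<subseteq> euclidean interior_of (- Z)"
    using assms by (simp add: closure_closed interior_open closed_Compl open_Compl)
  from homology_excision_axiom[OF this subset_UNIV, of n]
  show ?thesis
    using assms(3) by (simp add: Diff_eq Int_commute)
qed

section \<open>Maps joined to an affine isomorphism without zeros on the frontier\<close>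

context
  fixes f L :: "'a::euclidean_space \<Rightarrow> 'a" and D :: "'a set" and a :: 'a
  assumes adm: "degree_admissible f D 0" and a: "a \<in> D" and L: "linear L"
    and Linj: "\<And>x. L x = 0 \<Longrightarrow> x = 0"
    and nz: "\<And>x s. x \<in> frontier D \<Longrightarrow> s \<in> {0..1} \<Longrightarrow> (1 - s) *\<^sub>R f x + s *\<^sub>R L (x - a) \<noteq> 0"
begin

text \<open>The zeros of all stages are the projection of a closed subset of [0, 1] times the
  closure of \<open>D\<close>, and by \<open>nz\<close> none of them lies on the frontier. Their
  compactness permits excision around one set that serves the entire homotopy.\<close>

lemma compact_zeros_homotopy:
  "compact {x\<in>D. \<exists>s\<in>{0..1}. (1 - s) *\<^sub>R f x + s *\<^sub>R L (x - a) = 0}" (is "compact ?Z")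
proof -
  have D: "open D" "bounded D" "continuous_on (closure D) f"
    using adm by (auto simp: degree_admissible_def)
  have Lc: "continuous_on S L" for S
    using L by (simp add: linear_continuous_on linear_conv_bounded_linear)
  let ?P = "{0..1::real} \<times> closure D"
  let ?h = "\<lambda>y. (1 - fst y) *\<^sub>R f (snd y) + fst y *\<^sub>R L (snd y - a)"
  have P: "compact ?P" using D by (auto intro: compact_Times)
  have "continuous_on ?P ?h"
    by (intro continuous_intros continuous_on_compose2[OF D(3)] continuous_on_compose2[OF Lc[of UNIV]]) auto
  then have "closed (?P \<inter> ?h -` {0})"
    using P by (intro continuous_closed_preimage) (auto intro: compact_imp_closed)
  then have "compact (?P \<inter> (?P \<inter> ?h -` {0}))"
    using P compact_Int_closed by blast
  then have "compact (snd ` (?P \<inter> (?P \<inter> ?h -` {0})))"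
    by (intro compact_continuous_image continuous_intros) auto
  moreover have "snd ` (?P \<inter> (?P \<inter> ?h -` {0})) = ?Z"
  proof -
    have "x \<in> D" if "x \<in> closure D" "s \<in> {0..1}" "(1 - s) *\<^sub>R f x + s *\<^sub>R L (x - a) = 0" for x s
      using nz[of x s] that D(1) by (auto simp: frontier_def interior_open)
    note inD = this
    show ?thesis
    proof (intro equalityI subsetI)
      fix x assume "x \<in> snd ` (?P \<inter> (?P \<inter> ?h -` {0}))"
      then obtain s where "s \<in> {0..1}" "x \<in> closure D" "(1 - s) *\<^sub>R f x + s *\<^sub>R L (x - a) = 0"
        by auto
      then show "x \<in> ?Z" using inD by blast
    next
      fix x assume "x \<in> ?Z"
      then obtain s where "s \<in> {0..1}" "x \<in> D" "(1 - s) *\<^sub>R f x + s *\<^sub>R L (x - a) = 0" by blast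
      then have "(s, x) \<in> ?P \<inter> (?P \<inter> ?h -` {0})" using closure_subset[of D] by auto
      then show "x \<in> snd ` (?P \<inter> (?P \<inter> ?h -` {0}))" by force
    qed
  qed
  ultimately show ?thesis by simp
qed

text \<open>The class \<open>c\<close> lives relative to the complement of the zeros of
  \<open>f\<close> alone, where intermediate stages may vanish. It is lifted to a class
  \<open>c'\<close> relative to the complement of the larger set \<open>W\<close>; there the
  straight-line homotopy is one of pairs and \<open>f\<close> may be replaced by x -> L (x - a).
  This map is defined on the whole space, so the local class can be exchanged for a class relative
  to the outside of a ball, where the translation by \<open>a\<close> can be removed.\<close>

lemma induced_map_eq_linear:
  fixes R :: real
  defines "n \<equiv> int DIM('a)"
  defines "E \<equiv> euclidean :: 'a topology"
  defines "Z \<equiv> {x\<in>D. f x = 0}"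
  assumes Z: "Z \<subseteq> cball 0 R" and R: "0 \<le> R"
    and u: "u \<in> carrier (relative_homology_group n E (- cball 0 R))"
    and c: "c \<in> carrier (relative_homology_group n (top_of_set D) (D - Z))"
    and eq: "hom_induced n (top_of_set D) (D - Z) E (- Z) id c = hom_induced n E (- cball 0 R) E (- Z) id u"
  shows "hom_induced n (top_of_set D) (D - Z) E (- {0}) f c
    = hom_induced n E (- {0}) E (- {0}) L (hom_induced n E (- cball 0 R) E (- {0}) id u)"
proof -
  have D: "open D" "bounded D" "continuous_on (closure D) f"
    using adm by (auto simp: degree_admissible_def)
  have fc: "continuous_on D f" by (rule continuous_on_subset[OF D(3) closure_subset])
  have Lc: "continuous_on S L" for S
    using L by (simp add: linear_continuous_on linear_conv_bounded_linear)
  have L0: "L 0 = 0" using L by (simp add: linear_0)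
  define W where "W = {x\<in>D. \<exists>s\<in>{0..1}. (1 - s) *\<^sub>R f x + s *\<^sub>R L (x - a) = 0}"
  have W: "compact W" "W \<subseteq> D" using compact_zeros_homotopy by (auto simp: W_def)
  have ZW: "Z \<subseteq> W" by (force simp: Z_def W_def)
  have aW: "a \<in> W" using a L0 by (force simp: W_def)
  have Zcl: "closed Z"
  proof -
    have "Z = {x \<in> closure D. f x = 0}"
    proof -
      have "x \<in> D" if "x \<in> closure D" "f x = 0" for x
        using nz[of x 0] that D(1) by (auto simp: frontier_def interior_open)
      then show ?thesis using closure_subset[of D] by (auto simp: Z_def)
    qed
    then show ?thesis using continuous_closed_preimage_constant[OF D(3) closed_closure, of 0] by simp
  qed
  obtain R0 where R0: "D \<subseteq> cball 0 R0" using D(2) by (auto simp: bounded_iff subset_iff)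
  \<comment> \<open>The new ball must contain \<open>D\<close>, hence both \<open>W\<close> and
    \<open>a\<close>, whereas the ball of radius \<open>R\<close> is only known to contain the zeros
    of \<open>f\<close>.\<close>
  define R' where "R' = max R R0"
  have R': "R \<le> R'" "D \<subseteq> cball 0 R'" using R0 by (auto simp: R'_def)
  obtain u' where u': "u' \<in> carrier (relative_homology_group n E (- cball 0 R'))"
      "hom_induced n E (- cball 0 R') E (- cball 0 R) id u' = u"
    using iso_preimage[OF restriction_between_balls_iso[OF R R'(1), of n]] u unfolding E_def by blast
  have excW: "hom_induced n (top_of_set D) (D - W) E (- W) id
      \<in> iso (relative_homology_group n (top_of_set D) (D - W)) (relative_homology_group n E (- W))"
    unfolding E_def using D(1) W by (intro excision_euclidean compact_imp_closed)
  obtain c' where c': "c' \<in> carrier (relative_homology_group n (top_of_set D) (D - W))"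
      "hom_induced n (top_of_set D) (D - W) E (- W) id c' = hom_induced n E (- cball 0 R') E (- W) id u'"
  proof -
    have "hom_induced n E (- cball 0 R') E (- W) id u' \<in> carrier (relative_homology_group n E (- W))"
      by (simp add: hom_induced_carrier)
    then show ?thesis using iso_preimage[OF excW] that by blast
  qed
  have sub: "- cball 0 R' \<subseteq> - W" "- cball 0 R' \<subseteq> - cball 0 R" "- W \<subseteq> - Z" "D - W \<subseteq> D - Z" "D - W \<subseteq> - W"
     "D - Z \<subseteq> - Z" "- cball 0 R \<subseteq> - Z" "- cball 0 R \<subseteq> - {0}" "- cball 0 R' \<subseteq> - {0}"
    using W R' ZW Z R by auto
  have idm: "continuous_map E E id" "continuous_map (top_of_set D) E id" "continuous_map (top_of_set D) (top_of_set D) id"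
    by (auto simp: E_def)
  have mapid: "id \<in> S \<rightarrow> T" if "S \<subseteq> T" for S T :: "'a set" using that by auto
  have fm: "continuous_map (top_of_set D) E f" using fc by (simp add: E_def)
  have Lm: "continuous_map E E L" "continuous_map E E (\<lambda>x. L (x - a))"
    using Lc by (auto simp: E_def intro!: continuous_on_compose2[OF Lc[of UNIV]] continuous_intros)
  \<comment> \<open>Excision around \<open>Z\<close> is injective, so it suffices to compare the
    images of the two classes relative to the complement of \<open>Z\<close> in the whole space;
    both come from the ball class \<open>u'\<close>.\<close>
  have "hom_induced n (top_of_set D) (D - W) (top_of_set D) (D - Z) id c' = c"
  proof -
    let ?x = "hom_induced n (top_of_set D) (D - W) (top_of_set D) (D - Z) id c'"
    have "hom_induced n (top_of_set D) (D - Z) E (- Z) id ?x = hom_induced n (top_of_set D) (D - W) E (- Z) id c'"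
      using hom_induced_compose'[OF idm(3) mapid[OF sub(4)] idm(2) mapid[OF sub(6)], of n c'] by simp
    also have "\<dots> = hom_induced n E (- W) E (- Z) id (hom_induced n (top_of_set D) (D - W) E (- W) id c')"
      using hom_induced_compose'[OF idm(2) mapid[OF sub(5)] idm(1) mapid[OF sub(3)], of n c'] by simp
    also have "\<dots> = hom_induced n E (- cball 0 R') E (- Z) id u'"
      unfolding c' using hom_induced_compose'[OF idm(1) mapid[OF sub(1)] idm(1) mapid[OF sub(3)], of n u'] by simp
    also have "\<dots> = hom_induced n E (- cball 0 R) E (- Z) id u"
      using hom_induced_compose'[OF idm(1) mapid[OF sub(2)] idm(1) mapid[OF sub(7)], of n u'] u'(2) by simp
    finally have "hom_induced n (top_of_set D) (D - Z) E (- Z) id ?x = hom_induced n (top_of_set D) (D - Z) E (- Z) id c"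
      using eq by simp
    moreover have "inj_on (hom_induced n (top_of_set D) (D - Z) E (- Z) id)
        (carrier (relative_homology_group n (top_of_set D) (D - Z)))"
      using excision_euclidean[OF D(1) Zcl, of n] unfolding iso_def bij_betw_def E_def by (auto simp: Z_def)
    moreover have "?x \<in> carrier (relative_homology_group n (top_of_set D) (D - Z))"
      by (simp add: hom_induced_carrier)
    ultimately show ?thesis using c by (meson inj_onD)
  qed
  then have "hom_induced n (top_of_set D) (D - Z) E (- {0}) f c = hom_induced n (top_of_set D) (D - W) E (- {0}) f c'"
    using hom_induced_compose'[OF idm(3) mapid[OF sub(4)] fm, of "- {0}" n c'] by (auto simp: Z_def)
  also have "\<dots> = hom_induced n (top_of_set D) (D - W) E (- {0}) (\<lambda>x. L (x - a)) c'"
  proof -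
    have "homotopic_with (\<lambda>h. h \<in> (D - W) \<rightarrow> - {0}) (top_of_set D) (top_of_set UNIV) f (\<lambda>x. L (x - a))"
    proof (rule homotopic_with_linear_pair)
      show "continuous_on D (\<lambda>x. L (x - a))"
        by (intro continuous_on_compose2[OF Lc[of UNIV]] continuous_intros) auto
      show "closed_segment (f x) (L (x - a)) \<subseteq> - {0}" if "x \<in> D - W" for x
        using that by (force simp: W_def closed_segment_def)
    qed (use fc in auto)
    then have "homotopic_with (\<lambda>h. h \<in> (D - W) \<rightarrow> - {0}) (top_of_set D) E f (\<lambda>x. L (x - a))"
      by (simp add: E_def)
    from homology_homotopy_axiom[OF this, of n] show ?thesis by simp
  qed
  also have "\<dots> = hom_induced n E (- W) E (- {0}) (\<lambda>x. L (x - a)) (hom_induced n (top_of_set D) (D - W) E (- W) id c')"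
  proof -
    have "(\<lambda>x. L (x - a)) \<in> - W \<rightarrow> - {0}" using Linj aW by fastforce
    from hom_induced_compose'[OF idm(2) mapid[OF sub(5)] Lm(2) this, of n c'] show ?thesis by (simp add: comp_def)
  qed
  also have "\<dots> = hom_induced n E (- cball 0 R') E (- {0}) (\<lambda>x. L (x - a)) u'"
  proof -
    have "(\<lambda>x. L (x - a)) \<in> - W \<rightarrow> - {0}" using Linj aW by fastforce
    from hom_induced_compose'[OF idm(1) mapid[OF sub(1)] Lm(2) this, of n u'] c'(2) show ?thesis by (simp add: comp_def)
  qed
  also have "\<dots> = hom_induced n E (- cball 0 R') E (- {0}) L u'"
  proof -
    have "homotopic_with (\<lambda>h. h \<in> (- cball 0 R') \<rightarrow> - {0}) (top_of_set UNIV) (top_of_set UNIV) (\<lambda>x. L (x - a)) L"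
    proof (rule homotopic_with_linear_pair)
      show "continuous_on UNIV (\<lambda>x. L (x - a))"
        by (intro continuous_on_compose2[OF Lc[of UNIV]] continuous_intros) auto
      show "closed_segment (L (x - a)) (L x) \<subseteq> - {0}" if x: "x \<in> - cball 0 R'" for x
      proof
        fix z assume "z \<in> closed_segment (L (x - a)) (L x)"
        then obtain s where s: "0 \<le> s" "s \<le> 1" "z = (1 - s) *\<^sub>R L (x - a) + s *\<^sub>R L x"
          by (auto simp: closed_segment_def)
        have "z = L (x - (1 - s) *\<^sub>R a)"
          using L by (simp add: s(3) linear_diff linear_add linear_scale algebra_simps)
        \<comment> \<open>Here it matters that \<open>R'\<close> is at least the norm of
          \<open>a\<close>, while \<open>x\<close> lies outside the ball of that radius.\<close>
        moreover have "x \<noteq> (1 - s) *\<^sub>R a"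
        proof
          assume "x = (1 - s) *\<^sub>R a"
          then have "norm x \<le> norm a" using s by (simp add: mult_left_le_one_le)
          also have "\<dots> \<le> R'" using a R'(2) by auto
          finally show False using x by simp
        qed
        ultimately show "z \<in> - {0}" using Linj[of "x - (1 - s) *\<^sub>R a"] by auto
      qed
    qed (use Lc in auto)
    then have "homotopic_with (\<lambda>h. h \<in> (- cball 0 R') \<rightarrow> - {0}) E E (\<lambda>x. L (x - a)) L"
      by (simp add: E_def)
    from homology_homotopy_axiom[OF this, of n] show ?thesis by simp
  qed
  also have "\<dots> = hom_induced n E (- cball 0 R) E (- {0}) L u"
  proof -
    have "L \<in> - cball 0 R \<rightarrow> - {0}" using Linj R by fastforce
    from hom_induced_compose'[OF idm(1) mapid[OF sub(2)] Lm(1) this, of n u'] u'(2) show ?thesis by (simp add: comp_def)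
  qed
  also have "\<dots> = hom_induced n E (- {0}) E (- {0}) L (hom_induced n E (- cball 0 R) E (- {0}) id u)"
  proof -
    have "L \<in> - {0} \<rightarrow> - {0}" using Linj by fastforce
    from hom_induced_compose'[OF idm(1) mapid[OF sub(8)] Lm(1) this, of n u] show ?thesis by (simp add: comp_def)
  qed
  finally show ?thesis .
qed

end

text \<open>The integer is the exponent by which \<open>L\<close> acts on the homology of the
  punctured space, so it is fixed before \<open>f\<close>, \<open>D\<close> and \<open>a\<close>
  are; this order of quantifiers is what makes the degree constant along a family of maps. The same
  exponent yields a zero, so no separate existence property of the degree is called upon.\<close>

theorem brouwer_degree_linear_homotopy:
  fixes L :: "'a::euclidean_space \<Rightarrow> 'a"
  assumes L: "linear L" "bij L"
  obtains d :: int where "d \<noteq> 0"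
    "\<And>f D a. degree_admissible f D 0 \<Longrightarrow> a \<in> D \<Longrightarrow>
      (\<And>x s. x \<in> frontier D \<Longrightarrow> s \<in> {0..1} \<Longrightarrow> (1 - s) *\<^sub>R f x + s *\<^sub>R L (x - a) \<noteq> 0) \<Longrightarrow>
      brouwer_degree f D 0 = d \<and> (\<exists>x\<in>D. f x = 0)"
proof -
  define n where "n = int DIM('a)"
  define E where "E = (euclidean :: 'a topology)"
  let ?G = "relative_homology_group n E (- {0})"
  have L0: "L 0 = 0" and Linj: "L x = 0 \<Longrightarrow> x = 0" for x
    using linear_0[OF L(1)] linear_injective_0[OF L(1)] bij_is_inj[OF L(2)] by blast+
  obtain L' where L': "linear L'" "L' \<circ> L = id" "L \<circ> L' = id"
    using linear_injective_isomorphism[OF L(1) bij_is_inj[OF L(2)]] by (auto simp: fun_eq_iff)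
  have "homeomorphic_maps E E L L'"
    unfolding homeomorphic_maps_def E_def using L L'
    by (auto simp: linear_continuous_on linear_conv_bounded_linear fun_eq_iff)
  then have "homeomorphic_map E E L" using homeomorphic_maps_imp_map by blast
  moreover have "L ` (- {0}) = - {0}"
    using L L0 by (metis bij_image_Compl_eq image_empty image_insert)
  ultimately have h1: "hom_induced n E (- {0}) E (- {0}) L \<in> iso ?G ?G"
    by (intro homeomorphic_map_relative_homology_iso) (auto simp: E_def)
  have h2: "?G \<cong> integer_group" unfolding E_def n_def by (rule relative_homology_punctured_euclidean)
  from cyclic_automorphism_power[OF group_relative_homology_group h2 h1]
  obtain d g where dg: "d \<noteq> (0::int)" "\<forall>x\<in>carrier ?G. hom_induced n E (- {0}) E (- {0}) L x = x [^]\<^bsub>?G\<^esub> d"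
    "g \<in> carrier ?G" "\<forall>i j :: int. g [^]\<^bsub>?G\<^esub> i = g [^]\<^bsub>?G\<^esub> j \<longrightarrow> i = j"
    by (elim exE conjE) (rule that)
  note d = dg(1) dg(2)[rule_format] and g = dg(3) dg(4)[rule_format]
  show ?thesis
  proof (rule that[OF d(1)])
    fix f D a
    assume adm: "degree_admissible f D 0" and a: "a \<in> D"
      and nz: "\<And>x s. x \<in> frontier D \<Longrightarrow> s \<in> {0..1} \<Longrightarrow> (1 - s) *\<^sub>R f x + s *\<^sub>R L (x - a) \<noteq> 0"
    let ?Z = "{x\<in>D. f x = 0}"
    have D: "open D" "bounded D" using adm by (auto simp: degree_admissible_def)
    have main: "hom_induced n (top_of_set D) (D - ?Z) E (- {0}) f c = hom_induced n E (- cball 0 R) E (- {0}) id u [^]\<^bsub>?G\<^esub> d"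
      if "?Z \<subseteq> cball 0 R" "0 \<le> R" "u \<in> carrier (relative_homology_group n E (- cball 0 R))"
        "c \<in> carrier (relative_homology_group n (top_of_set D) (D - ?Z))"
        "hom_induced n (top_of_set D) (D - ?Z) E (- ?Z) id c = hom_induced n E (- cball 0 R) E (- ?Z) id u" for R u c
      using induced_map_eq_linear[OF adm a L(1) Linj nz, of R u c] that d(2)
      by (simp add: n_def E_def hom_induced_carrier)
    obtain R where R: "0 \<le> R" "D \<subseteq> cball 0 R"
      using D(2) by (metis bounded_pos mem_cball_0 less_imp_le subsetI)
    then have ZR: "?Z \<subseteq> cball 0 R" by auto
    \<comment> \<open>A test class restricting to \<open>g\<close>, whose distinct powers differ,
      forces the exponent in the definition of the degree to be unique.\<close>
    obtain u where u: "u \<in> carrier (relative_homology_group n E (- cball 0 R))" "hom_induced n E (- cball 0 R) E (- {0}) id u = g"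
    proof -
      have "hom_induced n E (- cball 0 R) E (- {0}) id \<in> iso (relative_homology_group n E (- cball 0 R)) ?G"
        using restriction_between_balls_iso[OF order_refl R(1), of n] by (simp add: E_def)
      from iso_preimage[OF this g(1)] show ?thesis using that by blast
    qed
    have Zcl: "closed ?Z"
    proof -
      have "?Z = {x \<in> closure D. f x = 0}"
      proof -
        have "x \<in> D" if "x \<in> closure D" "f x = 0" for x
          using nz[of x 0] that D(1) by (auto simp: frontier_def interior_open)
        then show ?thesis using closure_subset[of D] by auto
      qed
      then show ?thesis
        using continuous_closed_preimage_constant[OF _ closed_closure, of D f 0] adm by (simp add: degree_admissible_def)
    qed
    obtain c where c: "c \<in> carrier (relative_homology_group n (top_of_set D) (D - ?Z))"
        "hom_induced n (top_of_set D) (D - ?Z) E (- ?Z) id c = hom_induced n E (- cball 0 R) E (- ?Z) id u"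
    proof -
      have "hom_induced n E (- cball 0 R) E (- ?Z) id u \<in> carrier (relative_homology_group n E (- ?Z))"
        by (simp add: hom_induced_carrier)
      moreover have "hom_induced n (top_of_set D) (D - ?Z) E (- ?Z) id
        \<in> iso (relative_homology_group n (top_of_set D) (D - ?Z)) (relative_homology_group n E (- ?Z))"
        unfolding E_def using D(1) Zcl by (intro excision_euclidean) auto
      ultimately show ?thesis using iso_preimage that by meson
    qed
    have val: "hom_induced n (top_of_set D) (D - ?Z) E (- {0}) f c = g [^]\<^bsub>?G\<^esub> d"
      using main[OF ZR R(1) u(1) c] u(2) by simp
    have "brouwer_degree f D 0 = d"
      unfolding brouwer_degree_def Let_def
    proof (rule the_equality)
      show "\<forall>R u c. ?Z \<subseteq> cball 0 R \<and> 0 \<in> cball 0 R \<and>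
          u \<in> carrier (relative_homology_group (int DIM('a)) euclidean (- cball 0 R)) \<and>
          c \<in> carrier (relative_homology_group (int DIM('a)) (top_of_set D) (D - ?Z)) \<and>
          hom_induced (int DIM('a)) (top_of_set D) (D - ?Z) euclidean (- ?Z) id c =
          hom_induced (int DIM('a)) euclidean (- cball 0 R) euclidean (- ?Z) id u \<longrightarrow>
          hom_induced (int DIM('a)) (top_of_set D) (D - ?Z) euclidean (- {0}) f c =
          hom_induced (int DIM('a)) euclidean (- cball 0 R) euclidean (- {0}) id u
            [^]\<^bsub>relative_homology_group (int DIM('a)) euclidean (- {0})\<^esub> d"
        using main by (simp add: n_def E_def)
      fix d' :: int
      assume *: "\<forall>R u c. ?Z \<subseteq> cball 0 R \<and> 0 \<in> cball 0 R \<and>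
          u \<in> carrier (relative_homology_group (int DIM('a)) euclidean (- cball 0 R)) \<and>
          c \<in> carrier (relative_homology_group (int DIM('a)) (top_of_set D) (D - ?Z)) \<and>
          hom_induced (int DIM('a)) (top_of_set D) (D - ?Z) euclidean (- ?Z) id c =
          hom_induced (int DIM('a)) euclidean (- cball 0 R) euclidean (- ?Z) id u \<longrightarrow>
          hom_induced (int DIM('a)) (top_of_set D) (D - ?Z) euclidean (- {0}) f c =
          hom_induced (int DIM('a)) euclidean (- cball 0 R) euclidean (- {0}) id u
            [^]\<^bsub>relative_homology_group (int DIM('a)) euclidean (- {0})\<^esub> d'"
      have "g [^]\<^bsub>?G\<^esub> d' = g [^]\<^bsub>?G\<^esub> d"
        using *[rule_format, of R u c] ZR R(1) u c val by (simp add: n_def E_def)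
      then show "d' = d" using g(2) by blast
    qed
    \<comment> \<open>Without zeros, \<open>c\<close> is a class of the pair (D, D), whose homology
      is trivial, so the \<open>d\<close>-th power of \<open>g\<close> would be the identity
      although \<open>d\<close> is nonzero.\<close>
    moreover have "?Z \<noteq> {}"
    proof
      assume e: "?Z = {}"
      have "trivial_group (relative_homology_group n (top_of_set D) (D - ?Z))"
        using trivial_relative_homology_group_topspace[of n "top_of_set D"] unfolding e by simp
      then have "c = \<one>\<^bsub>relative_homology_group n (top_of_set D) (D - ?Z)\<^esub>"
        using c(1) by (simp add: trivial_group_def)
      then have "hom_induced n (top_of_set D) (D - ?Z) E (- {0}) f c = \<one>\<^bsub>?G\<^esub>"
        by (simp only: hom_one[OF hom_induced_hom group_relative_homology_group group_relative_homology_group])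
      then have "g [^]\<^bsub>?G\<^esub> d = g [^]\<^bsub>?G\<^esub> (0::int)"
        using val by simp
      then show False using g(2) d(1) by blast
    qed
    ultimately show "brouwer_degree f D 0 = d \<and> (\<exists>x\<in>D. f x = 0)" by blast
  qed
qed

subsection \<open>Excitation operators and the rank filtration\<close>

text \<open>The Jordan--Wigner sign: the parity of the occupied orbitals that orbital
  \<open>p\<close> has to pass.\<close>

definition below_sign :: "nat set \<Rightarrow> nat \<Rightarrow> real" where
  "below_sign \<alpha> p = (-1) ^ card {q\<in>\<alpha>. q < p}"

lemma below_sign_remove:
  assumes "p \<in> \<alpha>"
  shows "below_sign (\<alpha> - {p}) q = below_sign \<alpha> q * (if p < q then -1 else 1)"
proof (cases "p < q")
  case True
  have "{x\<in>\<alpha>. x < q} = insert p {x\<in>\<alpha> - {p}. x < q}" using True assms by auto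
  moreover have "finite {x\<in>\<alpha> - {p}. x < q}" by simp
  ultimately have "card {x\<in>\<alpha>. x < q} = Suc (card {x\<in>\<alpha> - {p}. x < q})" by simp
  then show ?thesis using True by (simp add: below_sign_def)
next
  case False
  then have "{x\<in>\<alpha> - {p}. x < q} = {x\<in>\<alpha>. x < q}" by auto
  then show ?thesis using False by (simp add: below_sign_def)
qed

lemma below_sign_insert:
  assumes "p \<notin> \<alpha>"
  shows "below_sign (insert p \<alpha>) q = below_sign \<alpha> q * (if p < q then -1 else 1)"
  using below_sign_remove[of p "insert p \<alpha>" q] assms by auto

lemma below_sign_square: "below_sign \<alpha> p * below_sign \<alpha> p = 1"
  by (simp add: below_sign_def flip: power_add)

lemma create_alt: "create p c \<alpha> = (if p \<in> \<alpha> then below_sign \<alpha> p * c (\<alpha> - {p}) else 0)"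
  by (simp add: create_def below_sign_def)

lemma annihilate_alt: "annihilate p c \<alpha> = (if p \<notin> \<alpha> then below_sign \<alpha> p * c (insert p \<alpha>) else 0)"
  by (simp add: annihilate_def below_sign_def)

text \<open>Of two distinct orbitals exactly one lies below the other, so exchanging the operators
  flips exactly one of the two signs. For equal orbitals both sides vanish.\<close>

lemma create_anticommute: "create p (create q c) = (\<lambda>\<alpha>. - create q (create p c) \<alpha>)"
proof
  fix \<alpha> show "create p (create q c) \<alpha> = - create q (create p c) \<alpha>"
    using linorder_less_linear[of p q]
    by (auto simp: create_alt below_sign_remove Diff_insert[symmetric] insert_commute)
qed

lemma annihilate_anticommute: "annihilate p (annihilate q c) = (\<lambda>\<alpha>. - annihilate q (annihilate p c) \<alpha>)"
proof
  fix \<alpha> show "annihilate p (annihilate q c) \<alpha> = - annihilate q (annihilate p c) \<alpha>"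
    using linorder_less_linear[of p q]
    by (auto simp: annihilate_alt below_sign_insert insert_commute)
qed

lemma annihilate_create_anticommute:
  assumes "p \<noteq> q"
  shows "annihilate q (create p c) = (\<lambda>\<alpha>. - create p (annihilate q c) \<alpha>)"
proof
  fix \<alpha> show "annihilate q (create p c) \<alpha> = - create p (annihilate q c) \<alpha>"
    using linorder_less_linear[of p q] assms
    by (auto simp: annihilate_alt create_alt below_sign_insert below_sign_remove insert_Diff_if)
qed

definition fock_linear :: "(fock \<Rightarrow> fock) \<Rightarrow> bool" where
  "fock_linear F \<longleftrightarrow> (\<forall>c d. F (\<lambda>\<alpha>. c \<alpha> + d \<alpha>) = (\<lambda>\<alpha>. F c \<alpha> + F d \<alpha>)) \<and>
     (\<forall>a c. F (\<lambda>\<alpha>. a * c \<alpha>) = (\<lambda>\<alpha>. a * F c \<alpha>))"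

lemma fock_linear_add: "fock_linear F \<Longrightarrow> F (\<lambda>\<alpha>. c \<alpha> + d \<alpha>) = (\<lambda>\<alpha>. F c \<alpha> + F d \<alpha>)"
  and fock_linear_scale: "fock_linear F \<Longrightarrow> F (\<lambda>\<alpha>. a * c \<alpha>) = (\<lambda>\<alpha>. a * F c \<alpha>)"
  by (auto simp: fock_linear_def)

lemma fock_linear_neg: "fock_linear F \<Longrightarrow> F (\<lambda>\<alpha>. - c \<alpha>) = (\<lambda>\<alpha>. - F c \<alpha>)"
  using fock_linear_scale[of F "-1" c] by simp

lemma fock_linear_zero: "fock_linear F \<Longrightarrow> F (\<lambda>_. 0) = (\<lambda>_. 0)"
  using fock_linear_scale[of F 0 "\<lambda>_. 0"] by simp

lemma fock_linear_sum:
  assumes "fock_linear F" "finite J"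
  shows "F (\<lambda>\<alpha>. \<Sum>j\<in>J. b j * c j \<alpha>) = (\<lambda>\<alpha>. \<Sum>j\<in>J. b j * F (c j) \<alpha>)"
  using assms(2)
  by (induction J rule: finite_induct)
    (simp_all add: fock_linear_zero[OF assms(1)] fock_linear_add[OF assms(1)] fock_linear_scale[OF assms(1)])

lemma fock_linear_create: "fock_linear (create p)" and fock_linear_annihilate: "fock_linear (annihilate p)"
  by (auto simp: fock_linear_def create_def annihilate_def fun_eq_iff algebra_simps)

lemma fock_linear_compose: "fock_linear F \<Longrightarrow> fock_linear G \<Longrightarrow> fock_linear (F \<circ> G)"
  by (auto simp: fock_linear_def)

lemma fock_linear_id: "fock_linear id"
  by (auto simp: fock_linear_def)

lemma fock_linear_power: "fock_linear F \<Longrightarrow> fock_linear (F ^^ k)"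
  by (induction k) (auto simp: fock_linear_id fock_linear_compose)

text \<open>Four anticommutations, an even number of signs. The two inequalities exclude the
  contraction terms that a creator and an annihilator of the same orbital would leave.\<close>

lemma pair_commute:
  assumes "A \<noteq> J" "B \<noteq> I"
  shows "create A (annihilate I (create B (annihilate J c))) = create B (annihilate J (create A (annihilate I c)))"
proof -
  have "create A (annihilate I (create B (annihilate J c))) = (\<lambda>\<alpha>. - create A (create B (annihilate I (annihilate J c))) \<alpha>)"
    using assms(2) by (simp add: annihilate_create_anticommute fock_linear_neg[OF fock_linear_create])
  also have "\<dots> = create B (create A (annihilate I (annihilate J c)))"
    by (subst create_anticommute) simp
  also have "\<dots> = (\<lambda>\<alpha>. - create B (create A (annihilate J (annihilate I c))) \<alpha>)"
    by (subst annihilate_anticommute) (simp add: fock_linear_neg[OF fock_linear_create])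
  also have "\<dots> = create B (annihilate J (create A (annihilate I c)))"
    using assms(1) by (simp add: annihilate_create_anticommute fock_linear_neg[OF fock_linear_create])
  finally show ?thesis .
qed

definition pair_op :: "nat \<times> nat \<Rightarrow> fock \<Rightarrow> fock" where
  "pair_op = (\<lambda>(A, I). create A \<circ> annihilate I)"

definition pair_ops :: "(nat \<times> nat) list \<Rightarrow> fock \<Rightarrow> fock" where
  "pair_ops ps = foldr (\<lambda>p F. pair_op p \<circ> F) ps id"

lemma pair_ops_simps [simp]: "pair_ops [] = id" "pair_ops (p # ps) = pair_op p \<circ> pair_ops ps"
  by (auto simp: pair_ops_def)

definition excitation_pairs :: "nat \<Rightarrow> nat set \<Rightarrow> (nat \<times> nat) list" where
  "excitation_pairs N \<alpha> = zip (sorted_list_of_set (\<alpha> - {1..N})) (sorted_list_of_set ({1..N} - \<alpha>))"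

lemma excitation_alt: "excitation N \<alpha> = pair_ops (excitation_pairs N \<alpha>)"
  unfolding excitation_def pair_ops_def excitation_pairs_def pair_op_def
  by (rule arg_cong[where f = "\<lambda>f. foldr f _ id"]) auto

lemma excitation_pairs_subset:
  "set (excitation_pairs N \<alpha>) \<subseteq> (\<alpha> - {1..N}) \<times> {1..N}"
proof (rule subrelI)
  fix A I assume "(A, I) \<in> set (excitation_pairs N \<alpha>)"
  then have *: "(A, I) \<in> set (zip (sorted_list_of_set (\<alpha> - {1..N})) (sorted_list_of_set ({1..N} - \<alpha>)))"
    by (simp only: excitation_pairs_def)
  have "set (sorted_list_of_set (\<alpha> - {1..N})) \<subseteq> \<alpha> - {1..N}"
    by (cases "finite (\<alpha> - {1..N})") simp_all
  then have "A \<in> \<alpha> - {1..N}" using set_zip_leftD[OF *] by (rule subsetD)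
  moreover have "I \<in> {1..N} - \<alpha>" using set_zip_rightD[OF *] by simp
  ultimately show "(A, I) \<in> (\<alpha> - {1..N}) \<times> {1..N}" by (simp only: mem_Sigma_iff Diff_iff simp_thms)
qed

lemma pair_op_commute:
  assumes "p \<in> S \<times> T" "q \<in> S \<times> T" "S \<inter> T = {}"
  shows "pair_op p (pair_op q c) = pair_op q (pair_op p c)"
  using assms by (cases p; cases q) (auto simp: pair_op_def intro!: pair_commute)

lemma pair_ops_commute:
  assumes "set ps \<subseteq> S \<times> T" "set qs \<subseteq> S \<times> T" "S \<inter> T = {}"
  shows "pair_ops ps (pair_ops qs c) = pair_ops qs (pair_ops ps c)"
proof -
  have one: "pair_op p (pair_ops qs c) = pair_ops qs (pair_op p c)" if "p \<in> S \<times> T" for p c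
    using assms(2) by (induction qs arbitrary: c) (auto simp: pair_op_commute[OF that _ assms(3)])
  show ?thesis using assms(1) by (induction ps arbitrary: c) (auto simp: one)
qed

text \<open>Created orbitals are virtual and annihilated ones occupied, so no contraction ever
  occurs. All cluster operators commute for this reason, which \<open>op_exp_add\<close>
  requires.\<close>

lemma excitation_commute:
  "excitation N \<alpha> (excitation N \<beta> c) = excitation N \<beta> (excitation N \<alpha> c)"
  unfolding excitation_alt
proof (rule pair_ops_commute)
  show "set (excitation_pairs N \<alpha>) \<subseteq> (- {1..N}) \<times> {1..N}" "set (excitation_pairs N \<beta>) \<subseteq> (- {1..N}) \<times> {1..N}"
    using excitation_pairs_subset by blast+
qed auto

lemma fock_linear_excitation: "fock_linear (excitation N \<alpha>)"
proof -
  have "fock_linear (pair_op p)" for p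
    by (cases p) (simp add: pair_op_def fock_linear_compose fock_linear_create fock_linear_annihilate)
  then have "fock_linear (pair_ops ps)" for ps
    by (induction ps) (auto simp: fock_linear_id fock_linear_compose)
  then show ?thesis by (simp add: excitation_alt)
qed

text \<open>The decreasing filtration by excitation rank. Membership in \<open>configs K N\<close>
  is part of the condition, so \<open>ranked K N 0\<close> just says that the vector belongs to the
  N-particle space.\<close>

definition ranked :: "nat \<Rightarrow> nat \<Rightarrow> nat \<Rightarrow> fock \<Rightarrow> bool" where
  "ranked K N r c \<longleftrightarrow> (\<forall>\<alpha>. c \<alpha> \<noteq> 0 \<longrightarrow> \<alpha> \<in> configs K N \<and> r \<le> rk N \<alpha>)"

lemma finite_configs [simp]: "finite (configs K N)"
  unfolding configs_def by (rule finite_subset[of _ "Pow {1..K}"]) auto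

lemma rk_le: "\<alpha> \<in> configs K N \<Longrightarrow> rk N \<alpha> \<le> N"
  unfolding rk_def configs_def by (auto intro!: card_mono intro: finite_subset)

lemma ranked_mono: "ranked K N r c \<Longrightarrow> s \<le> r \<Longrightarrow> ranked K N s c"
  by (auto simp: ranked_def)

text \<open>The filtration ends at rank \<open>N\<close>, since a configuration holds only
  \<open>N\<close> orbitals; this makes cluster operators nilpotent.\<close>

lemma ranked_zero_eq: "ranked K N r c \<Longrightarrow> r > N \<Longrightarrow> c = (\<lambda>_. 0)"
  unfolding ranked_def fun_eq_iff using rk_le by (meson leD le_trans)

lemma ranked_add: "ranked K N r c \<Longrightarrow> ranked K N r d \<Longrightarrow> ranked K N r (\<lambda>\<alpha>. c \<alpha> + d \<alpha>)"
  unfolding ranked_def by (metis add_0)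

lemma ranked_scale: "ranked K N r c \<Longrightarrow> ranked K N r (\<lambda>\<alpha>. a * c \<alpha>)"
  by (auto simp: ranked_def)

lemma ranked_sum:
  assumes "\<And>j. j \<in> J \<Longrightarrow> b j \<noteq> 0 \<Longrightarrow> ranked K N r (c j)"
  shows "ranked K N r (\<lambda>\<alpha>. \<Sum>j\<in>J. b j * c j \<alpha>)"
  unfolding ranked_def
proof (intro allI impI)
  fix \<alpha> assume "(\<Sum>j\<in>J. b j * c j \<alpha>) \<noteq> 0"
  then obtain j where "j \<in> J" "b j * c j \<alpha> \<noteq> 0" by (rule sum.not_neutral_contains_not_neutral)
  then show "\<alpha> \<in> configs K N \<and> r \<le> rk N \<alpha>" using assms by (auto simp: ranked_def)
qed

lemma ranked_pair_op:
  assumes "ranked K N r c" "A \<in> {1..K} - {1..N}" "I \<in> {1..N}"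
  shows "ranked K N (Suc r) (pair_op (A, I) c)"
  unfolding ranked_def
proof (intro allI impI)
  fix \<alpha> assume "pair_op (A, I) c \<alpha> \<noteq> 0"
  then have \<alpha>: "A \<in> \<alpha>" "I \<notin> \<alpha> - {A}" and c: "c (insert I (\<alpha> - {A})) \<noteq> 0"
    by (auto simp: pair_op_def create_alt annihilate_alt split: if_splits)
  define \<beta> where "\<beta> = insert I (\<alpha> - {A})"
  have \<beta>: "\<beta> \<subseteq> {1..K}" "card \<beta> = N" "r \<le> rk N \<beta>"
    using c assms(1) unfolding ranked_def \<beta>_def configs_def by blast+
  then have fin: "finite \<beta>" by (meson finite_atLeastAtMost finite_subset)
  have AI: "A \<noteq> I" using assms by auto
  have e: "\<alpha> = insert A (\<beta> - {I})" "A \<notin> \<beta>" "I \<in> \<beta>" using \<alpha> AI by (auto simp: \<beta>_def)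
  then have "card \<alpha> = N" using \<beta> fin card_Suc_Diff1[of \<beta> I] by simp
  moreover have "\<alpha> - {1..N} = insert A (\<beta> - {1..N})" using e assms by auto
  then have "rk N \<alpha> = Suc (rk N \<beta>)" using e fin by (simp add: rk_def)
  moreover have "\<alpha> \<subseteq> {1..K}" using e \<beta> assms by auto
  ultimately show "\<alpha> \<in> configs K N \<and> Suc r \<le> rk N \<alpha>" using \<beta> by (simp add: configs_def)
qed

lemma card_excitation:
  assumes "\<alpha> \<in> configs K N"
  shows "card ({1..N} - \<alpha>) = rk N \<alpha>" "finite \<alpha>"
proof -
  show f: "finite \<alpha>" using assms by (auto simp: configs_def intro: finite_subset)
  have "card ({1..N} - \<alpha>) = card {1..N} - card ({1..N} \<inter> \<alpha>)" by (simp add: card_Diff_subset_Int)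
  also have "\<dots> = card \<alpha> - card (\<alpha> \<inter> {1..N})" using assms by (simp add: configs_def Int_commute)
  also have "\<dots> = rk N \<alpha>" using f by (simp add: rk_def card_Diff_subset_Int)
  finally show "card ({1..N} - \<alpha>) = rk N \<alpha>" .
qed

lemma ranked_excitation:
  assumes "\<alpha> \<in> configs K N" "ranked K N r c"
  shows "ranked K N (r + rk N \<alpha>) (excitation N \<alpha> c)"
proof -
  have "ranked K N (r + length ps) (pair_ops ps c)" if "set ps \<subseteq> ({1..K} - {1..N}) \<times> {1..N}" for ps
    using that assms(2) by (induction ps) (auto intro: ranked_pair_op)
  moreover have "length (excitation_pairs N \<alpha>) = rk N \<alpha>"
    using card_excitation[OF assms(1)] by (simp add: excitation_pairs_def rk_def)
  moreover have "set (excitation_pairs N \<alpha>) \<subseteq> ({1..K} - {1..N}) \<times> {1..N}"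
    using excitation_pairs_subset[of N \<alpha>] assms(1) by (auto simp: configs_def)
  ultimately show ?thesis by (metis excitation_alt)
qed

lemma pair_op_basis:
  assumes "A \<notin> \<gamma>" "I \<in> \<gamma>"
  obtains s where "s * s = 1" "pair_op (A, I) (basis_state \<gamma>) = (\<lambda>\<beta>. s * basis_state (insert A (\<gamma> - {I})) \<beta>)"
proof
  let ?\<delta> = "insert A (\<gamma> - {I})"
  let ?s = "below_sign ?\<delta> A * below_sign (?\<delta> - {A}) I"
  show "?s * ?s = 1" using below_sign_square[of ?\<delta> A] below_sign_square[of "?\<delta> - {A}" I]
    by (simp add: algebra_simps)
  have "insert I (\<delta> - {A}) = \<gamma> \<longleftrightarrow> \<delta> = ?\<delta>" if "A \<in> \<delta>" "I \<notin> \<delta> - {A}" for \<delta>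
    using that assms by auto
  moreover have "I \<notin> ?\<delta> - {A}" using assms by auto
  ultimately show "pair_op (A, I) (basis_state \<gamma>) = (\<lambda>\<beta>. ?s * basis_state ?\<delta> \<beta>)"
    using assms by (auto simp: pair_op_def create_alt annihilate_alt basis_state_def fun_eq_iff)
qed

lemma pair_ops_basis:
  assumes "length As = length Is" "distinct As" "distinct Is" "set As \<inter> \<beta> = {}" "set Is \<subseteq> \<beta>"
  shows "\<exists>s. s * s = 1 \<and> pair_ops (zip As Is) (basis_state \<beta>) = (\<lambda>\<gamma>. s * basis_state ((\<beta> - set Is) \<union> set As) \<gamma>)"
  using assms
proof (induction As Is rule: list_induct2)
  case Nil
  then show ?case by (intro exI[of _ 1]) (simp add: fun_eq_iff)
next
  case (Cons A As I Is)
  then obtain s where s: "s * s = 1" "pair_ops (zip As Is) (basis_state \<beta>) = (\<lambda>\<gamma>. s * basis_state ((\<beta> - set Is) \<union> set As) \<gamma>)"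
    by auto
  let ?\<gamma> = "(\<beta> - set Is) \<union> set As"
  have "A \<notin> ?\<gamma>" "I \<in> ?\<gamma>" using Cons.prems by auto
  then obtain s' where s': "s' * s' = 1" "pair_op (A, I) (basis_state ?\<gamma>) = (\<lambda>\<beta>. s' * basis_state (insert A (?\<gamma> - {I})) \<beta>)"
    by (rule pair_op_basis)
  have lin: "fock_linear (pair_op (A, I))"
    by (simp add: pair_op_def fock_linear_compose fock_linear_create fock_linear_annihilate)
  have "insert A (?\<gamma> - {I}) = (\<beta> - set (I # Is)) \<union> set (A # As)" using Cons.prems by auto
  then have "pair_ops (zip (A # As) (I # Is)) (basis_state \<beta>) = (\<lambda>\<gamma>. (s * s') * basis_state ((\<beta> - set (I # Is)) \<union> set (A # As)) \<gamma>)"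
    using s'(2) by (simp add: s(2) fock_linear_scale[OF lin] mult.assoc)
  moreover have "(s * s') * (s * s') = 1" using s(1) s'(1) by (simp add: algebra_simps)
  ultimately show ?case by blast
qed

text \<open>Basis states are attached to index sets and carry their own sign convention, whence the
  factor \<open>s\<close>. Its square is all that enters later, through inner products.\<close>

lemma excitation_ref_state:
  assumes "\<alpha> \<in> configs K N"
  shows "\<exists>s. s * s = 1 \<and> excitation N \<alpha> (ref_state N) = (\<lambda>\<beta>. s * basis_state \<alpha> \<beta>)"
proof -
  have "({1..N} - ({1..N} - \<alpha>)) \<union> (\<alpha> - {1..N}) = \<alpha>" by auto
  moreover have "set (sorted_list_of_set (\<alpha> - {1..N})) = \<alpha> - {1..N}" using card_excitation(2)[OF assms] by simp
  ultimately show ?thesis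
    using pair_ops_basis[of "sorted_list_of_set (\<alpha> - {1..N})" "sorted_list_of_set ({1..N} - \<alpha>)" "{1..N}"]
      card_excitation[OF assms]
    by (simp add: excitation_alt excitation_pairs_def ref_state_def rk_def) auto
qed

section \<open>Exponentials of operators that raise the rank\<close>

definition raising :: "nat \<Rightarrow> nat \<Rightarrow> nat \<Rightarrow> (fock \<Rightarrow> fock) \<Rightarrow> bool" where
  "raising K N m F \<longleftrightarrow> (\<forall>r c. ranked K N r c \<longrightarrow> ranked K N (r + m) (F c))"

lemma raising_power:
  assumes "raising K N m F" "ranked K N r c"
  shows "ranked K N (r + k * m) ((F ^^ k) c)"
proof (induction k)
  case (Suc k)
  then have "ranked K N (r + k * m + m) (F ((F ^^ k) c))" using assms(1) by (simp add: raising_def)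
  then show ?case by (simp add: algebra_simps)
qed (use assms in simp)

lemma op_exp_truncate:
  assumes "\<And>k. k \<ge> m \<Longrightarrow> (F ^^ k) c \<alpha> = 0"
  shows "op_exp F c \<alpha> = (\<Sum>k<m. (F ^^ k) c \<alpha> / fact k)"
  unfolding op_exp_def by (rule suminf_finite) (use assms in \<open>auto simp: not_less\<close>)

text \<open>Each application raises the rank by at least one, so terms beyond order \<open>N\<close>
  vanish and the exponential is a finite sum.\<close>

lemma op_exp_raising:
  assumes "raising K N m F" "m \<ge> 1" "ranked K N r c"
  shows "op_exp F c = (\<lambda>\<alpha>. \<Sum>k\<le>N. 1 / fact k * (F ^^ k) c \<alpha>)"
proof
  fix \<alpha>
  have "(F ^^ k) c \<alpha> = 0" if "k \<ge> Suc N" for k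
  proof -
    have "k * 1 \<le> k * m" using assms(2) by (intro mult_le_mono) auto
    then have "k \<le> r + k * m" by linarith
    from ranked_mono[OF raising_power[OF assms(1,3)] this] have "ranked K N k ((F ^^ k) c)" .
    from ranked_zero_eq[OF this] show ?thesis using that by (simp add: less_eq_Suc_le)
  qed
  from op_exp_truncate[of "Suc N", OF this] show "op_exp F c \<alpha> = (\<Sum>k\<le>N. 1 / fact k * (F ^^ k) c \<alpha>)"
    by (simp add: lessThan_Suc_atMost)
qed

lemma ranked_op_exp:
  assumes "raising K N m F" "m \<ge> 1" "ranked K N r c"
  shows "ranked K N r (op_exp F c)"
  unfolding op_exp_raising[OF assms]
  by (rule ranked_sum, rule ranked_mono[OF raising_power[OF assms(1,3)]]) simp

text \<open>The term of order \<open>p\<close> starts at rank r + p m, hence a component of smaller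
  rank sees lower orders only. All later selection rules for exponentials are instances with
  \<open>p\<close> equal to 1 or 2.\<close>

lemma op_exp_low_order:
  assumes "raising K N m F" "ranked K N r c" "rk N \<alpha> < r + p * m"
  shows "op_exp F c \<alpha> = (\<Sum>k<p. (F ^^ k) c \<alpha> / fact k)"
proof (rule op_exp_truncate)
  fix k assume "k \<ge> p"
  then have "r + p * m \<le> r + k * m" by simp
  then have "ranked K N (r + p * m) ((F ^^ k) c)"
    using raising_power[OF assms(1,2), of k] ranked_mono by blast
  then show "(F ^^ k) c \<alpha> = 0" using assms(3) by (auto simp: ranked_def)
qed

lemma op_exp_linear:
  assumes F: "fock_linear F" "raising K N m F" "m \<ge> 1" and c: "ranked K N 0 c" "ranked K N 0 d"
  shows "op_exp F (\<lambda>\<alpha>. a * c \<alpha> + b * d \<alpha>) = (\<lambda>\<alpha>. a * op_exp F c \<alpha> + b * op_exp F d \<alpha>)"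
proof -
  have cd: "ranked K N 0 (\<lambda>\<alpha>. a * c \<alpha> + b * d \<alpha>)" by (intro ranked_add ranked_scale c)
  have *: "(F ^^ k) (\<lambda>\<alpha>. a * c \<alpha> + b * d \<alpha>) = (\<lambda>\<alpha>. a * (F ^^ k) c \<alpha> + b * (F ^^ k) d \<alpha>)" for k
    by (simp add: fock_linear_add[OF fock_linear_power[OF F(1)]] fock_linear_scale[OF fock_linear_power[OF F(1)]])
  show ?thesis
    unfolding op_exp_raising[OF F(2,3) c(1)] op_exp_raising[OF F(2,3) c(2)] op_exp_raising[OF F(2,3) cd] *
    by (simp add: sum_distrib_left sum.distrib algebra_simps)
qed

text \<open>The Cauchy product, for the divided powers \<open>F\<^sup>k / k!\<close>.\<close>

lemma op_exp_add:
  assumes F: "fock_linear F" "raising K N m F" "m \<ge> 1" and G: "fock_linear G" "raising K N n G" "n \<ge> 1"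
    and comm: "\<And>c. F (G c) = G (F c)" and c: "ranked K N r c"
  shows "op_exp (\<lambda>c \<alpha>. F c \<alpha> + G c \<alpha>) c = op_exp F (op_exp G c)"
proof -
  let ?S = "\<lambda>c \<alpha>. F c \<alpha> + G c \<alpha>"
  let ?a = "\<lambda>i j. 1 / (fact i * fact j) :: real"
  have commk: "G ((F ^^ i) d) = (F ^^ i) (G d)" for i d
    by (induction i arbitrary: d) (auto simp: comm[symmetric])
  have S: "raising K N 1 ?S"
    using F(2,3) G(2,3) unfolding raising_def by (blast intro: ranked_add ranked_mono add_left_mono)
  \<comment> \<open>The binomial theorem for commuting operators, divided by k!.\<close>
  have div: "1 / fact k * (?S ^^ k) c \<alpha> = (\<Sum>i\<le>k. ?a i (k - i) * (F ^^ i) ((G ^^ (k - i)) c) \<alpha>)" for k \<alpha>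
  proof -
    have "(?S ^^ k) c = (\<lambda>\<alpha>. \<Sum>i\<le>k. real (k choose i) * (F ^^ i) ((G ^^ (k - i)) c) \<alpha>)"
    proof (induction k)
      case (Suc k)
      let ?f = "\<lambda>i j \<alpha>. (F ^^ i) ((G ^^ j) c) \<alpha>"
      have "(?S ^^ Suc k) c = (\<lambda>\<alpha>. (\<Sum>i\<le>k. real (k choose i) * ?f (Suc i) (k - i) \<alpha>)
          + (\<Sum>i\<le>k. real (k choose i) * ?f i (Suc (k - i)) \<alpha>))"
        by (simp add: Suc fock_linear_sum[OF F(1)] fock_linear_sum[OF G(1)] commk)
      also have "\<dots> = (\<lambda>\<alpha>. \<Sum>i\<le>Suc k. real (Suc k choose i) * ?f i (Suc k - i) \<alpha>)"
      proof
        fix \<alpha>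
        have "(\<Sum>i\<le>k. real (k choose i) * ?f i (Suc (k - i)) \<alpha>) = (\<Sum>i\<le>k. real (k choose i) * ?f i (Suc k - i) \<alpha>)"
          by (intro sum.cong) (auto simp: Suc_diff_le)
        also have "\<dots> = (\<Sum>i\<le>Suc k. real (k choose i) * ?f i (Suc k - i) \<alpha>)" by simp
        also have "\<dots> = ?f 0 (Suc k) \<alpha> + (\<Sum>i\<le>k. real (k choose Suc i) * ?f (Suc i) (k - i) \<alpha>)"
          by (subst sum.atMost_Suc_shift) simp
        finally have 1: "(\<Sum>i\<le>k. real (k choose i) * ?f i (Suc (k - i)) \<alpha>)
          = ?f 0 (Suc k) \<alpha> + (\<Sum>i\<le>k. real (k choose Suc i) * ?f (Suc i) (k - i) \<alpha>)" .
        have 2: "(\<Sum>i\<le>Suc k. real (Suc k choose i) * ?f i (Suc k - i) \<alpha>)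
          = ?f 0 (Suc k) \<alpha> + (\<Sum>i\<le>k. real (Suc k choose Suc i) * ?f (Suc i) (k - i) \<alpha>)"
          by (subst sum.atMost_Suc_shift) simp
        show "(\<Sum>i\<le>k. real (k choose i) * ?f (Suc i) (k - i) \<alpha>) + (\<Sum>i\<le>k. real (k choose i) * ?f i (Suc (k - i)) \<alpha>)
          = (\<Sum>i\<le>Suc k. real (Suc k choose i) * ?f i (Suc k - i) \<alpha>)"
          unfolding 1 2 by (simp add: sum.distrib algebra_simps)
      qed
      finally show ?case .
    qed simp
    then show ?thesis
      by (simp add: sum_divide_distrib) (auto intro!: sum.cong simp: binomial_fact field_simps)
  qed
  have zero: "(F ^^ i) ((G ^^ j) c) \<alpha> = 0" if "i + j > N" for i j \<alpha>
  proof -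
    have "ranked K N (r + j * n + i * m) ((F ^^ i) ((G ^^ j) c))"
      by (intro raising_power[OF F(2)] raising_power[OF G(2)] c)
    moreover have "j * 1 \<le> j * n" "i * 1 \<le> i * m" using F(3) G(3) by (intro mult_le_mono; simp)+
    then have "r + j * n + i * m > N" using that by linarith
    ultimately show ?thesis using ranked_zero_eq by metis
  qed
  have G0: "ranked K N r (op_exp G c)" by (rule ranked_op_exp[OF G(2,3) c])
  show ?thesis
  proof
    fix \<alpha>
    have "op_exp ?S c \<alpha> = (\<Sum>k\<le>N. \<Sum>i\<le>k. ?a i (k - i) * (F ^^ i) ((G ^^ (k - i)) c) \<alpha>)"
      unfolding op_exp_raising[OF S order_refl c] by (simp only: div)
    also have "\<dots> = (\<Sum>(i,j)\<in>{(i,j). i + j \<le> N}. ?a i j * (F ^^ i) ((G ^^ j) c) \<alpha>)"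
      by (rule sum.triangle_reindex_eq[symmetric])
    \<comment> \<open>Index pairs of total order above \<open>N\<close> contribute nothing, so the
      triangle may be completed to a square, over which the double sum factorises.\<close>
    also have "\<dots> = (\<Sum>(i,j)\<in>{..N} \<times> {..N}. ?a i j * (F ^^ i) ((G ^^ j) c) \<alpha>)"
      by (rule sum.mono_neutral_left) (auto, use zero not_le in blast)
    also have "\<dots> = (\<Sum>i\<le>N. \<Sum>j\<le>N. ?a i j * (F ^^ i) ((G ^^ j) c) \<alpha>)"
      by (simp add: sum.cartesian_product)
    also have "\<dots> = (\<Sum>i\<le>N. 1 / fact i * (F ^^ i) (op_exp G c) \<alpha>)"
      unfolding op_exp_raising[OF G(2,3) c]
      by (simp add: fock_linear_sum[OF fock_linear_power[OF F(1)], of "{..N}" _ "\<lambda>k. 1 / fact k", simplified]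
          sum_distrib_left sum_divide_distrib field_simps)
    also have "\<dots> = op_exp F (op_exp G c) \<alpha>"
      by (simp only: op_exp_raising[OF F(2,3) G0])
    finally show "op_exp ?S c \<alpha> = op_exp F (op_exp G c) \<alpha>" .
  qed
qed

subsection \<open>The coupled-cluster map\<close>

lemma raising_apply: "raising K N m F \<Longrightarrow> ranked K N r c \<Longrightarrow> ranked K N (r + m) (F c)"
  by (simp add: raising_def)

lemma real_polynomial_function_cmult:
  "real_polynomial_function f \<Longrightarrow> real_polynomial_function (\<lambda>x. a * f x)"
  by (intro real_polynomial_function.intros(4) real_polynomial_function.intros(2))

lemma fock_linear_expansion:
  assumes "fock_linear F" "ranked K N 0 c"
  shows "F c \<beta> = (\<Sum>\<gamma>\<in>configs K N. c \<gamma> * F (basis_state \<gamma>) \<beta>)"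
proof -
  have "c = (\<lambda>\<alpha>. \<Sum>\<gamma>\<in>configs K N. c \<gamma> * basis_state \<gamma> \<alpha>)"
    using assms(2) by (auto simp: fun_eq_iff basis_state_def ranked_def if_distrib cong: if_cong)
  then have "F c \<beta> = F (\<lambda>\<alpha>. \<Sum>\<gamma>\<in>configs K N. c \<gamma> * basis_state \<gamma> \<alpha>) \<beta>" by simp
  also have "\<dots> = (\<Sum>\<gamma>\<in>configs K N. c \<gamma> * F (basis_state \<gamma>) \<beta>)"
    by (subst fock_linear_sum[OF assms(1)]) auto
  finally show ?thesis .
qed

lemma state_inner_commute: "state_inner K N c d = state_inner K N d c"
  by (simp add: state_inner_def mult.commute)

lemma state_inner_add: "state_inner K N (\<lambda>\<alpha>. c \<alpha> + d \<alpha>) e = state_inner K N c e + state_inner K N d e"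
  and state_inner_diff: "state_inner K N (\<lambda>\<alpha>. c \<alpha> - d \<alpha>) e = state_inner K N c e - state_inner K N d e"
  and state_inner_scale: "state_inner K N (\<lambda>\<alpha>. a * c \<alpha>) e = a * state_inner K N c e"
  by (simp_all add: state_inner_def sum.distrib sum_subtractf sum_distrib_left algebra_simps)

lemma state_inner_sum: "state_inner K N (\<lambda>\<alpha>. \<Sum>j\<in>J. b j * c j \<alpha>) e = (\<Sum>j\<in>J. b j * state_inner K N (c j) e)"
  unfolding state_inner_def sum_distrib_left sum_distrib_right
  by (subst sum.swap) (simp add: mult.assoc)

lemma state_adjoint_inner:
  assumes "fock_linear F" "ranked K N 0 c"
  shows "state_inner K N (F c) d = state_inner K N c (state_adjoint K N F d)"
proof -
  have "state_inner K N (F c) d = state_inner K N (\<lambda>\<beta>. \<Sum>\<gamma>\<in>configs K N. c \<gamma> * F (basis_state \<gamma>) \<beta>) d"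
    unfolding state_inner_def by (simp add: fock_linear_expansion[OF assms])
  also have "\<dots> = state_inner K N c (state_adjoint K N F d)"
    by (simp add: state_inner_sum) (simp add: state_inner_def state_adjoint_def mult.commute)
  finally show ?thesis .
qed

text \<open>The Hamiltonian enters the amplitude equations only through linearity, symmetry and the
  fact that it lowers the rank by at most two. Subtraction in \<open>H_ranked\<close> is truncated,
  so for ranks up to 2 the assumption says that the N-particle space is preserved.\<close>

locale coupled_cluster =
  fixes K N \<rho> :: nat and \<xi> :: "'x::finite \<Rightarrow> nat set" and H :: "fock \<Rightarrow> fock"
  assumes NK: "N \<le> K" and \<rho>: "\<rho> \<ge> 1"
    and \<xi>_inj: "inj \<xi>" and \<xi>_range: "range \<xi> \<subseteq> configs K N - {{1..N}}"
    and H_linear: "fock_linear H"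
    and H_ranked: "\<And>r c. ranked K N r c \<Longrightarrow> ranked K N (r - 2) (H c)"
    and H_symmetric: "\<And>c d. state_inner K N (H c) d = state_inner K N c (H d)"
begin

abbreviation "T \<equiv> cluster N \<xi>"
abbreviation "E t \<equiv> op_exp (T t)"
abbreviation "\<Phi> \<equiv> ref_state N"
abbreviation "P0 \<equiv> proj_low N \<rho> \<xi>"
abbreviation "Ph \<equiv> proj_high N \<rho> \<xi>"
abbreviation "A \<equiv> cc_map K N H \<xi>"

lemma \<xi>_configs: "\<xi> a \<in> configs K N" using \<xi>_range by auto

lemma rk_pos: "1 \<le> rk N (\<xi> a)"
proof (rule ccontr)
  assume "\<not> 1 \<le> rk N (\<xi> a)"
  then have "rk N (\<xi> a) = 0" by linarith
  then have "\<xi> a - {1..N} = {}" using card_excitation(2)[OF \<xi>_configs[of a]] by (simp add: rk_def)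
  then have "\<xi> a \<subseteq> {1..N}" by blast
  moreover have "card (\<xi> a) = card {1..N}" using \<xi>_configs[of a] by (simp add: configs_def)
  ultimately have "\<xi> a = {1..N}" by (simp add: card_subset_eq)
  then show False using \<xi>_range by (metis DiffD2 insertI1 range_subsetD)
qed

lemma N_pos: "1 \<le> N" using rk_pos[of undefined] rk_le[OF \<xi>_configs[of undefined]] by linarith

lemma ranked_ref: "ranked K N 0 \<Phi>"
  using NK by (auto simp: ranked_def ref_state_def basis_state_def configs_def split: if_splits)

lemma T_linear: "fock_linear (T t)"
  unfolding fock_linear_def cluster_def
  by (auto simp: fun_eq_iff fock_linear_add[OF fock_linear_excitation] fock_linear_scale[OF fock_linear_excitation]
      sum.distrib sum_distrib_left algebra_simps)

lemma T_add: "T (s + t) = (\<lambda>c \<alpha>. T s c \<alpha> + T t c \<alpha>)"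
  by (simp add: cluster_def fun_eq_iff sum.distrib algebra_simps)

lemma T_scale: "T (a *\<^sub>R t) c = (\<lambda>\<alpha>. a * T t c \<alpha>)"
  by (simp add: cluster_def fun_eq_iff sum_distrib_left algebra_simps)

lemma T_minus: "T (- t) c = (\<lambda>\<alpha>. - T t c \<alpha>)"
  using T_scale[of "-1" t c] by simp

lemma T_commute: "T s (T t c) = T t (T s c)"
proof
  fix \<alpha>
  have "T s (T t c) \<alpha> = (\<Sum>a\<in>UNIV. \<Sum>b\<in>UNIV. s $ a * t $ b * excitation N (\<xi> a) (excitation N (\<xi> b) c) \<alpha>)"
    unfolding cluster_def
    by (simp add: fock_linear_sum[OF fock_linear_excitation] sum_distrib_left mult.assoc)
  also have "\<dots> = (\<Sum>b\<in>UNIV. \<Sum>a\<in>UNIV. t $ b * s $ a * excitation N (\<xi> b) (excitation N (\<xi> a) c) \<alpha>)"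
    by (subst sum.swap) (simp add: excitation_commute mult.commute)
  also have "\<dots> = T t (T s c) \<alpha>"
    unfolding cluster_def
    by (simp add: fock_linear_sum[OF fock_linear_excitation] sum_distrib_left mult.assoc)
  finally show "T s (T t c) \<alpha> = T t (T s c) \<alpha>" .
qed

lemma T_raising:
  assumes "\<And>a. t $ a \<noteq> 0 \<Longrightarrow> m \<le> rk N (\<xi> a)"
  shows "raising K N m (T t)"
  unfolding raising_def cluster_def
  using ranked_excitation[OF \<xi>_configs] assms
  by (intro allI impI ranked_sum) (meson add_left_mono ranked_mono)

lemma T_raising_1: "raising K N 1 (T t)"
  by (rule T_raising) (rule rk_pos)

lemmas E_linear = op_exp_linear[OF T_linear T_raising_1 order_refl]
lemmas E_ranked = ranked_op_exp[OF T_raising_1 order_refl]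

lemma E_add: "ranked K N r c \<Longrightarrow> E (s + t) c = E s (E t c)"
  using op_exp_add[OF T_linear[of s] T_raising_1[of s] order_refl T_linear[of t] T_raising_1[of t] order_refl
      T_commute[of s t], of r c]
  by (simp only: T_add)

lemma T_ref_nonzero:
  assumes "T s \<Phi> \<alpha> \<noteq> 0" obtains a where "\<alpha> = \<xi> a" "s $ a \<noteq> 0"
proof -
  obtain a where a: "s $ a * excitation N (\<xi> a) \<Phi> \<alpha> \<noteq> 0"
    using assms unfolding cluster_def by (rule sum.not_neutral_contains_not_neutral)
  then have "\<alpha> = \<xi> a"
    using excitation_ref_state[OF \<xi>_configs[of a]] by (auto simp: basis_state_def split: if_splits)
  with a that show thesis by auto
qed

text \<open>The retained excitations of the reference are, up to sign, distinct Slater determinants.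
  The Euclidean inner product of amplitudes is therefore the inner product of states, which also
  gives the embedding \<open>I\<close> its form.\<close>

lemma T_ref_inner: "state_inner K N (T s \<Phi>) (T t \<Phi>) = s \<bullet> t"
proof -
  obtain g where g: "\<And>a. g a * g a = 1" "\<And>a. excitation N (\<xi> a) \<Phi> = (\<lambda>\<beta>. g a * basis_state (\<xi> a) \<beta>)"
    using excitation_ref_state[OF \<xi>_configs] by metis
  have ex: "excitation N (\<xi> b) \<Phi> (\<xi> a) = (if a = b then g a else 0)" for a b
    using \<xi>_inj by (auto simp: g(2) basis_state_def inj_def)
  have val: "T s \<Phi> (\<xi> a) = s $ a * g a" for s a
    by (simp add: cluster_def ex if_distrib cong: if_cong)
  have "state_inner K N (T s \<Phi>) (T t \<Phi>) = (\<Sum>\<alpha>\<in>range \<xi>. T s \<Phi> \<alpha> * T t \<Phi> \<alpha>)"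
  proof -
    have "T s \<Phi> \<alpha> = 0" if "\<alpha> \<notin> range \<xi>" for \<alpha>
    proof (rule ccontr)
      assume "T s \<Phi> \<alpha> \<noteq> 0"
      then show False by (rule T_ref_nonzero) (use that in blast)
    qed
    then show ?thesis
      unfolding state_inner_def using \<xi>_configs by (intro sum.mono_neutral_right) auto
  qed
  also have "\<dots> = (\<Sum>a\<in>UNIV. T s \<Phi> (\<xi> a) * T t \<Phi> (\<xi> a))"
    by (subst sum.reindex[OF \<xi>_inj]) simp
  also have "\<dots> = s \<bullet> t"
    unfolding inner_vec_def val
  proof (intro sum.cong)
    fix a show "s $ a * g a * (t $ a * g a) = s $ a \<bullet> t $ a"
      using g(1)[of a] by (simp add: algebra_simps)
  qed simp
  finally show ?thesis .
qed

lemma P0_Ph: "P0 t + Ph t = t"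
  by (simp add: vec_eq_iff proj_low_def proj_high_def)

lemma P0_simps: "P0 (s + t) = P0 s + P0 t" "P0 (a *\<^sub>R t) = a *\<^sub>R P0 t" "P0 (- t) = - P0 t" "P0 (P0 t) = P0 t" "P0 (Ph t) = 0"
  and Ph_simps: "Ph (s + t) = Ph s + Ph t" "Ph (a *\<^sub>R t) = a *\<^sub>R Ph t" "Ph (- t) = - Ph t" "Ph (Ph t) = Ph t" "Ph (P0 t) = 0"
  by (simp_all add: vec_eq_iff proj_low_def proj_high_def)

lemma T_low_rank: "T (P0 s) \<Phi> \<alpha> \<noteq> 0 \<Longrightarrow> rk N \<alpha> \<le> \<rho>"
  by (erule T_ref_nonzero) (auto simp: proj_low_def split: if_splits)

lemma T_high_raising: "raising K N (\<rho> + 1) (T (Ph t))"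
  by (rule T_raising) (auto simp: proj_high_def split: if_splits)

lemma inner_low_cong:
  assumes "\<And>\<alpha>. \<alpha> \<in> configs K N \<Longrightarrow> rk N \<alpha> \<le> \<rho> \<Longrightarrow> c \<alpha> = d \<alpha>"
  shows "state_inner K N c (T (P0 s) \<Phi>) = state_inner K N d (T (P0 s) \<Phi>)"
  unfolding state_inner_def
proof (intro sum.cong refl)
  fix \<alpha> assume "\<alpha> \<in> configs K N"
  then show "c \<alpha> * T (P0 s) \<Phi> \<alpha> = d \<alpha> * T (P0 s) \<Phi> \<alpha>"
    using assms T_low_rank[of s \<alpha>] by (cases "T (P0 s) \<Phi> \<alpha> = 0") auto
qed

text \<open>A high-rank cluster operator raises the rank by at least \<rho> + 1, so its exponential
  alters only components of rank above \<rho>, where the test state vanishes.\<close>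

lemma inner_E_high_low:
  assumes "ranked K N 0 c"
  shows "state_inner K N (E (Ph t) c) (T (P0 s) \<Phi>) = state_inner K N c (T (P0 s) \<Phi>)"
proof (rule inner_low_cong)
  fix \<alpha> assume "rk N \<alpha> \<le> \<rho>"
  then show "E (Ph t) c \<alpha> = c \<alpha>"
    using op_exp_low_order[OF T_high_raising assms, of \<alpha> 1 t] by simp
qed

lemma H_ranked_0: "ranked K N 0 c \<Longrightarrow> ranked K N 0 (H c)"
  using H_ranked[of 0] by simp

text \<open>Against a low-rank test state the high-rank factor to the left of \<open>H\<close>
  disappears, while the one to the right survives and acts before the low-rank similarity
  transformation. This matches the coupling term of the homotopy.\<close>

lemma transformed_low:
  assumes "ranked K N 0 c"
  shows "state_inner K N (transformed N H \<xi> t c) (T (P0 s) \<Phi>)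
    = state_inner K N (transformed N H \<xi> (P0 t) (E (Ph t) c)) (T (P0 s) \<Phi>)"
proof -
  have "E t c = E (P0 t) (E (Ph t) c)"
    using E_add[OF assms, of "P0 t" "Ph t"] by (simp add: P0_Ph)
  moreover have "E (- t) d = E (Ph (- t)) (E (P0 (- t)) d)" if "ranked K N 0 d" for d
    using E_add[OF that, of "Ph (- t)" "P0 (- t)"] by (simp only: P0_Ph add.commute[of "Ph (- t)"])
  moreover have "ranked K N 0 (H (E (P0 t) (E (Ph t) c)))"
    by (intro H_ranked_0 E_ranked assms)
  ultimately show ?thesis
    by (simp add: transformed_def inner_E_high_low[OF E_ranked] P0_simps(3))
qed

lemma A_inner: "A t \<bullet> s = state_inner K N (transformed N H \<xi> t \<Phi>) (T s \<Phi>)"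
  unfolding cc_map_def
  by (rule dual_vec_inner)
    (auto intro!: linearI simp: T_add T_scale state_inner_commute[of K N "transformed N H \<xi> t \<Phi>"] state_inner_add state_inner_scale)

lemma transformed_linear:
  assumes "ranked K N 0 c" "ranked K N 0 d"
  shows "transformed N H \<xi> t (\<lambda>\<alpha>. a * c \<alpha> + b * d \<alpha>) = (\<lambda>\<alpha>. a * transformed N H \<xi> t c \<alpha> + b * transformed N H \<xi> t d \<alpha>)"
  using assms
  by (simp add: transformed_def E_linear E_ranked H_ranked_0 fock_linear_add[OF H_linear] fock_linear_scale[OF H_linear])

text \<open>The factor exp(\<open>T\<^sup>\<angle>\<close>) - I of the coupling term splits it into
  two transformed states whose low-rank components are, by \<open>transformed_low\<close>, those of
  the coupled-cluster map at \<open>t\<close> and at its low part.\<close>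

theorem kp_map_inner:
  "kp_map K N \<rho> H \<xi> t lam \<bullet> s = A (P0 t) \<bullet> P0 s + A t \<bullet> Ph s + lam * (A t \<bullet> P0 s - A (P0 t) \<bullet> P0 s)"
proof -
  let ?tr = "transformed N H \<xi> (P0 t)"
  have lin: "linear (\<lambda>s. state_inner K N c (T (P0 s) \<Phi>))" "linear (\<lambda>s. state_inner K N c (T (Ph s) \<Phi>))" for c
    by (auto intro!: linearI simp: P0_simps Ph_simps T_add T_scale state_inner_commute[of K N c] state_inner_add state_inner_scale)
  have "?tr (\<lambda>\<alpha>. E (Ph t) \<Phi> \<alpha> - \<Phi> \<alpha>) = (\<lambda>\<alpha>. ?tr (E (Ph t) \<Phi>) \<alpha> - ?tr \<Phi> \<alpha>)"
    using transformed_linear[OF E_ranked[OF ranked_ref] ranked_ref, of "P0 t" 1 "Ph t" "-1"] by simp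
  then show ?thesis
    unfolding kp_map_def Let_def
  proof (subst dual_vec_inner)
    show "linear (\<lambda>s. state_inner K N (?tr \<Phi>) (T (P0 s) \<Phi>) + state_inner K N (transformed N H \<xi> t \<Phi>) (T (Ph s) \<Phi>) +
        lam * state_inner K N (?tr (\<lambda>\<alpha>. E (Ph t) \<Phi> \<alpha> - \<Phi> \<alpha>)) (T (P0 s) \<Phi>))"
      by (intro linear_compose_add lin linear_compose[OF lin(1), of "(*) lam", unfolded comp_def] linear_times)
  qed (simp add: A_inner transformed_low[OF ranked_ref, of t] state_inner_diff)
qed

lemma poly_linear:
  assumes F: "fock_linear F" and c: "\<And>t. ranked K N 0 (c t)" "\<And>\<alpha>. real_polynomial_function (\<lambda>t. c t \<alpha>)"
  shows "real_polynomial_function (\<lambda>t. F (c t) \<beta>)"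
  unfolding fock_linear_expansion[OF F c(1)]
  by (intro real_polynomial_function_sum real_polynomial_function.intros(4) c(2) real_polynomial_function.intros(2) finite_configs)

lemma poly_T:
  assumes l: "bounded_linear l" and c: "\<And>t. ranked K N 0 (c t)" "\<And>\<alpha>. real_polynomial_function (\<lambda>t. c t \<alpha>)"
  shows "real_polynomial_function (\<lambda>t. T (l t) (c t) \<beta>)"
proof -
  have "real_polynomial_function (\<lambda>t. l t $ a)" for a
    by (intro real_polynomial_function.intros(1) bounded_linear_compose[OF bounded_linear_vec_nth l])
  then show ?thesis
    unfolding cluster_def
    by (intro real_polynomial_function_sum real_polynomial_function.intros(4) poly_linear[OF fock_linear_excitation] c) auto
qed

lemma poly_E:
  assumes l: "bounded_linear l" and c: "\<And>t. ranked K N 0 (c t)" "\<And>\<alpha>. real_polynomial_function (\<lambda>t. c t \<alpha>)"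
  shows "real_polynomial_function (\<lambda>t. E (l t) (c t) \<beta>)"
proof -
  have rk: "ranked K N 0 ((T (l t) ^^ k) (c t))" for k t
    by (rule ranked_mono[OF raising_power[OF T_raising_1 c(1)]]) simp
  have "real_polynomial_function (\<lambda>t. (T (l t) ^^ k) (c t) \<beta>)" for k \<beta>
    by (induction k arbitrary: \<beta>) (auto intro: c(2) poly_T[OF l rk])
  then show ?thesis
    unfolding op_exp_raising[OF T_raising_1 order_refl c(1)]
    by (intro real_polynomial_function_sum real_polynomial_function_cmult) auto
qed

text \<open>The exponential series terminate, so every component is a polynomial in the amplitudes.
  All smoothness used in the Taylor estimates comes from here.\<close>

lemma poly_A: "real_polynomial_function (\<lambda>t. A t $ a)"
proof -
  have 1: "real_polynomial_function (\<lambda>t. E t \<Phi> \<beta>)" for \<beta>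
    using poly_E[OF bounded_linear_ident, of "\<lambda>_. \<Phi>"] ranked_ref by auto
  have 2: "real_polynomial_function (\<lambda>t. H (E t \<Phi>) \<beta>)" for \<beta>
    by (rule poly_linear[OF H_linear E_ranked[OF ranked_ref] 1])
  have 3: "real_polynomial_function (\<lambda>t. transformed N H \<xi> t \<Phi> \<beta>)" for \<beta>
    unfolding transformed_def comp_def
    by (rule poly_E[OF bounded_linear_minus[OF bounded_linear_ident] H_ranked_0[OF E_ranked[OF ranked_ref]] 2])
  have "A t $ a = state_inner K N (transformed N H \<xi> t \<Phi>) (T (axis a 1) \<Phi>)" for t
    by (simp flip: A_inner add: inner_axis)
  then show ?thesis
    unfolding state_inner_def
    by (simp add: real_polynomial_function_sum real_polynomial_function.intros(4) 3 real_polynomial_function.intros(2))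
qed

text \<open>The operator H + [T1^*, H] from the constant \<Delta>. The adjoint appears because H -
  T1 H + H T1 is moved to the other side of the inner product.\<close>

definition commutator_op :: "real^'x \<Rightarrow> fock \<Rightarrow> fock" where
  "commutator_op t c = (let T1a = state_adjoint K N (T (singles N \<xi> t)) in (\<lambda>\<alpha>. H c \<alpha> + (T1a (H c) \<alpha> - H (T1a c) \<alpha>)))"

text \<open>Since \<open>H\<close> lowers the rank by at most two, only the terms of the expansion of \<open>e\<^sup>-\<^sup>T H e\<^sup>T\<close> that are
  of first order in the singles part of \<open>T\<close> connect a state of rank above \<open>\<rho>\<close> to one of rank at most \<open>\<rho>\<close>.\<close>

lemma inner_transformed_high_low:
  "state_inner K N (transformed N H \<xi> t (T (Ph u) \<Phi>)) (T (P0 v) \<Phi>)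
    = state_inner K N (commutator_op t (T (P0 v) \<Phi>)) (T (Ph u) \<Phi>)"
proof -
  let ?y = "T (Ph u) \<Phi>" and ?v = "T (P0 v) \<Phi>" and ?T1 = "T (singles N \<xi> t)"
  have y: "ranked K N (\<rho> + 1) ?y" using raising_apply[OF T_high_raising ranked_ref, of u] by simp
  have two: "raising K N 2 (T (t - singles N \<xi> t))" for t
  proof (rule T_raising)
    fix a assume "(t - singles N \<xi> t) $ a \<noteq> 0"
    then show "2 \<le> rk N (\<xi> a)" using rk_pos[of a] by (auto simp: singles_def split: if_splits)
  qed
  have split: "T t c = (\<lambda>\<alpha>. T (singles N \<xi> t) c \<alpha> + T (t - singles N \<xi> t) c \<alpha>)" for t c
    using T_add[of "singles N \<xi> t" "t - singles N \<xi> t"] by simp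
  \<comment> \<open>Apart from its singles, \<open>T t\<close> raises the rank by at least two, and
    so does the second order of the exponential; on the two lowest ranks only the identity and the
    singles remain.\<close>
  have first_order: "E t c \<alpha> = c \<alpha> + T (singles N \<xi> t) c \<alpha>" if "ranked K N r c" "rk N \<alpha> < r + 2" for t r c \<alpha>
  proof -
    have "T (t - singles N \<xi> t) c \<alpha> = 0"
      using raising_apply[OF two that(1)] that(2) by (metis leD ranked_def)
    then show ?thesis
      using op_exp_low_order[OF T_raising_1 that(1), of \<alpha> 2 t] that(2) by (simp add: split[of t c] numeral_2_eq_2)
  qed
  \<comment> \<open>The remainder starts at rank \<rho> + 3. After \<open>H\<close> it starts at
    \<rho> + 1, out of reach of the test state even before the second exponential acts.\<close>
  define z where "z = (\<lambda>\<alpha>. E t ?y \<alpha> - (?y \<alpha> + ?T1 ?y \<alpha>))"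
  have T1y: "ranked K N (\<rho> + 2) (?T1 ?y)" using raising_apply[OF T_raising_1 y] by simp
  have z: "ranked K N (\<rho> + 3) z"
    unfolding ranked_def
  proof (intro allI impI conjI)
    fix \<alpha> assume nz: "z \<alpha> \<noteq> 0"
    then have "E t ?y \<alpha> \<noteq> 0 \<or> ?y \<alpha> \<noteq> 0 \<or> ?T1 ?y \<alpha> \<noteq> 0" by (auto simp: z_def)
    then show "\<alpha> \<in> configs K N" using y T1y E_ranked[OF y] by (auto simp: ranked_def)
    show "\<rho> + 3 \<le> rk N \<alpha>"
    proof (rule ccontr)
      assume "\<not> \<rho> + 3 \<le> rk N \<alpha>"
      then have "rk N \<alpha> < \<rho> + 1 + 2" by simp
      from first_order[OF y this, of t] nz show False by (simp add: z_def)
    qed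
  qed
  have Ety: "E t ?y = (\<lambda>\<alpha>. (?y \<alpha> + ?T1 ?y \<alpha>) + z \<alpha>)" by (simp add: z_def)
  have H: "H (E t ?y) = (\<lambda>\<alpha>. 1 * (\<lambda>\<alpha>. 1 * H ?y \<alpha> + 1 * H (?T1 ?y) \<alpha>) \<alpha> + 1 * H z \<alpha>)"
    unfolding Ety fock_linear_add[OF H_linear] by simp
  have r: "ranked K N (\<rho> - 1) (H ?y)" "ranked K N \<rho> (H (?T1 ?y))" "ranked K N (\<rho> + 1) (H z)"
    using H_ranked[OF y] H_ranked[OF T1y] H_ranked[OF z] by auto
  note r0 = r[THEN ranked_mono[OF _ le0]]
  have "transformed N H \<xi> t ?y \<alpha> = H ?y \<alpha> - ?T1 (H ?y) \<alpha> + H (?T1 ?y) \<alpha>" if \<alpha>: "rk N \<alpha> \<le> \<rho>" for \<alpha>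
  proof -
    have r01: "ranked K N 0 (\<lambda>\<alpha>. 1 * H ?y \<alpha> + 1 * H (?T1 ?y) \<alpha>)"
      by (intro ranked_add ranked_scale r0)
    have "transformed N H \<xi> t ?y \<alpha> = E (- t) (H ?y) \<alpha> + E (- t) (H (?T1 ?y)) \<alpha> + E (- t) (H z) \<alpha>"
      unfolding transformed_def comp_def H E_linear[OF r01 r0(3)] E_linear[OF r0(1,2)] by simp
    moreover have "E (- t) (H ?y) \<alpha> = H ?y \<alpha> - ?T1 (H ?y) \<alpha>"
    proof -
      have "singles N \<xi> (- t) = - singles N \<xi> t" by (simp add: vec_eq_iff singles_def)
      then show ?thesis using first_order[OF r(1), of \<alpha> "- t"] \<alpha> \<rho> by (simp add: T_minus)
    qed
    moreover have "E (- t) (H (?T1 ?y)) \<alpha> = H (?T1 ?y) \<alpha>"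
      using op_exp_low_order[OF T_raising_1 r(2), of \<alpha> 1 "- t"] \<alpha> by simp
    moreover have "E (- t) (H z) \<alpha> = 0"
      using E_ranked[OF r(3), of "- t"] \<alpha> by (auto simp: ranked_def)
    ultimately show ?thesis by simp
  qed
  then have "state_inner K N (transformed N H \<xi> t ?y) ?v
      = state_inner K N (\<lambda>\<alpha>. (H ?y \<alpha> - ?T1 (H ?y) \<alpha>) + H (?T1 ?y) \<alpha>) ?v"
    by (intro inner_low_cong)
  also have "\<dots> = state_inner K N (H ?y) ?v - state_inner K N (?T1 (H ?y)) ?v + state_inner K N (H (?T1 ?y)) ?v"
    by (simp only: state_inner_add state_inner_diff)
  \<comment> \<open>The singles operator becomes an adjoint and \<open>H\<close> is symmetric, so
    the order of the two factors is reversed; this turns the commutator of \<open>H\<close> with the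
    singles into that of their adjoint with \<open>H\<close>.\<close>
  also have "state_inner K N (?T1 (H ?y)) ?v = state_inner K N ?y (H (state_adjoint K N ?T1 ?v))"
    by (simp add: state_adjoint_inner[OF T_linear r0(1)] H_symmetric)
  also have "state_inner K N (H (?T1 ?y)) ?v = state_inner K N ?y (state_adjoint K N ?T1 (H ?v))"
    using state_adjoint_inner[OF T_linear ranked_mono[OF y le0]] by (simp add: H_symmetric)
  also have "state_inner K N (H ?y) ?v = state_inner K N ?y (H ?v)" by (rule H_symmetric)
  finally show ?thesis
    unfolding commutator_op_def Let_def state_inner_add state_inner_diff
    by (simp add: state_inner_commute[of K N ?y])
qed

text \<open>Along a high-rank direction the low-rank components form a polynomial in
  \<open>s\<close>: the direction acts through exp(s T_u) on the reference and is followed by the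
  fixed similarity transformation at \<open>t\<close>. The derivative at 0 is the linear
  coefficient, evaluated by \<open>inner_transformed_high_low\<close>.\<close>

theorem A_directional_derivative:
  "((\<lambda>s. A (t + s *\<^sub>R Ph u) \<bullet> P0 v) has_real_derivative
     state_inner K N (commutator_op t (T (P0 v) \<Phi>)) (T (Ph u) \<Phi>)) (at 0)"
proof -
  define Y where "Y c = state_inner K N (transformed N H \<xi> t c) (T (P0 v) \<Phi>)" for c
  let ?c = "\<lambda>k. (T (Ph u) ^^ k) \<Phi>"
  have ck: "ranked K N 0 (?c k)" for k
    by (rule ranked_mono[OF raising_power[OF T_raising_1 ranked_ref]]) simp
  have Ysum: "Y (\<lambda>\<alpha>. \<Sum>k\<in>J. b k * ?c k \<alpha>) = (\<Sum>k\<in>J. b k * Y (?c k))" if "finite J" for J b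
    using that
  proof (induction J rule: finite_induct)
    case empty
    have "transformed N H \<xi> t (\<lambda>\<alpha>. 0) = (\<lambda>\<alpha>. 0)"
      using transformed_linear[OF ranked_ref ranked_ref, of t 0 0] by simp
    then show ?case by (simp add: Y_def state_inner_def)
  next
    case (insert k J)
    have "ranked K N 0 (\<lambda>\<alpha>. \<Sum>k\<in>J. b k * ?c k \<alpha>)" by (intro ranked_sum ck)
    from transformed_linear[OF ck[of k] this, of t "b k" 1] insert show ?case
      by (simp add: Y_def state_inner_add state_inner_scale)
  qed
  have "A (t + s *\<^sub>R Ph u) \<bullet> P0 v = (\<Sum>k\<le>N. s ^ k * (Y (?c k) / fact k))" for s
  proof -
    have pow: "(T (s *\<^sub>R Ph u) ^^ k) \<Phi> = (\<lambda>\<alpha>. s ^ k * ?c k \<alpha>)" for k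
      by (induction k) (auto simp: T_scale fock_linear_scale[OF T_linear] mult.assoc)
    \<comment> \<open>Two uses of \<open>transformed_low\<close> in opposite directions: the
      increment is removed from the exponential to the left of \<open>H\<close> and the high part of
      \<open>t\<close> put back in its place, so that \<open>s\<close> is left only in the innermost
      exponential.\<close>
    have "A (t + s *\<^sub>R Ph u) \<bullet> P0 v = state_inner K N (transformed N H \<xi> (P0 t) (E (Ph t + s *\<^sub>R Ph u) \<Phi>)) (T (P0 v) \<Phi>)"
      using transformed_low[OF ranked_ref, of "t + s *\<^sub>R Ph u" v]
      by (simp add: A_inner P0_simps Ph_simps)
    also have "E (Ph t + s *\<^sub>R Ph u) \<Phi> = E (Ph t) (E (s *\<^sub>R Ph u) \<Phi>)"
      by (rule E_add[OF ranked_ref])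
    also have "state_inner K N (transformed N H \<xi> (P0 t) (E (Ph t) (E (s *\<^sub>R Ph u) \<Phi>))) (T (P0 v) \<Phi>) = Y (E (s *\<^sub>R Ph u) \<Phi>)"
      unfolding Y_def by (rule transformed_low[OF E_ranked[OF ranked_ref], symmetric])
    also have "E (s *\<^sub>R Ph u) \<Phi> = (\<lambda>\<alpha>. \<Sum>k\<le>N. (s ^ k / fact k) * ?c k \<alpha>)"
      unfolding op_exp_raising[OF T_raising_1 order_refl ranked_ref] pow by (simp add: mult.assoc[symmetric])
    also have "Y \<dots> = (\<Sum>k\<le>N. s ^ k * (Y (?c k) / fact k))"
      by (subst Ysum) auto
    finally show ?thesis .
  qed
  moreover have "((\<lambda>s. \<Sum>k\<le>N. s ^ k * (Y (?c k) / fact k)) has_real_derivative Y (?c 1)) (at 0)"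
  proof -
    have "((\<lambda>s. \<Sum>k\<le>N. s ^ k * (Y (?c k) / fact k)) has_real_derivative
        (\<Sum>k\<le>N. (real k * 0 ^ (k - Suc 0)) * (Y (?c k) / fact k))) (at 0)"
      by (auto intro!: derivative_eq_intros)
    \<comment> \<open>The index 1 is in the range by \<open>N_pos\<close>; all other terms have zero
      derivative at 0.\<close>
    also have "(\<Sum>k\<le>N. (real k * 0 ^ (k - Suc 0)) * (Y (?c k) / fact k)) = (\<Sum>k\<in>{1}. (real k * 0 ^ (k - Suc 0)) * (Y (?c k) / fact k))"
      using N_pos by (intro sum.mono_neutral_right) auto
    finally show ?thesis by simp
  qed
  ultimately show ?thesis
    using inner_transformed_high_low[of t u v] by (simp add: Y_def)
qed

end

section \<open>Square integrable functions\<close>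

lemma L2_measurable [measurable_dest]: "L2 f \<Longrightarrow> f \<in> borel_measurable borel"
  by (simp add: L2_def)

lemma L2_integrable_mult:
  assumes "L2 f" "L2 g"
  shows "integrable lborel (\<lambda>x. f x * g x)"
proof (rule Bochner_Integration.integrable_bound)
  show "integrable lborel (\<lambda>x. (f x)\<^sup>2 + (g x)\<^sup>2)"
    using assms by (simp add: L2_def)
  show "(\<lambda>x. f x * g x) \<in> borel_measurable lborel"
    using assms by (auto simp: L2_def)
  have "\<bar>a * b\<bar> \<le> a\<^sup>2 + b\<^sup>2" for a b :: real
  proof -
    have "2 * (\<bar>a\<bar> * \<bar>b\<bar>) \<le> a\<^sup>2 + b\<^sup>2" using sum_squares_bound[of "\<bar>a\<bar>" "\<bar>b\<bar>"] by (simp add: mult.assoc)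
    moreover have "0 \<le> \<bar>a\<bar> * \<bar>b\<bar>" by simp
    ultimately show ?thesis by (simp only: abs_mult)
  qed
  then show "AE x in lborel. norm (f x * g x) \<le> norm ((f x)\<^sup>2 + (g x)\<^sup>2)"
    by (auto intro!: AE_I2)
qed

lemma L2_scale: "L2 f \<Longrightarrow> L2 (\<lambda>x. a * f x)"
  by (auto simp: L2_def power_mult_distrib intro: borel_measurable_times)

lemma L2_add:
  assumes "L2 f" "L2 g" shows "L2 (\<lambda>x. f x + g x)"
  using assms L2_integrable_mult[OF assms]
  by (auto simp: L2_def power2_sum mult.assoc)

lemma L2_bounded_support:
  fixes g :: "'a::euclidean_space \<Rightarrow> real"
  assumes [measurable]: "g \<in> borel_measurable borel" and "\<And>x. \<bar>g x\<bar> \<le> C" and "\<And>x. x \<notin> cball 0 R \<Longrightarrow> g x = 0"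
  shows "L2 g"
  unfolding L2_def
proof
  show "integrable lborel (\<lambda>x. (g x)\<^sup>2)"
  proof (rule Bochner_Integration.integrable_bound)
    show "integrable lborel (\<lambda>x::'a. C\<^sup>2 * indicator (cball 0 R) x)"
      by (intro integrable_mult_right integrable_real_indicator)
        (use emeasure_bounded_finite[OF bounded_cball] in auto)
    show "AE x in lborel. norm ((g x)\<^sup>2) \<le> norm (C\<^sup>2 * indicator (cball 0 R) x)"
    proof (rule AE_I2)
      fix x :: 'a
      have "(g x)\<^sup>2 \<le> C\<^sup>2" using assms(2)[of x] by (simp add: abs_le_square_iff[symmetric])
      then show "norm ((g x)\<^sup>2) \<le> norm (C\<^sup>2 * indicator (cball 0 R) x)"
        using assms(3)[of x] by (auto simp: indicator_def)
    qed
  qed simp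
qed simp

text \<open>Dominated convergence with majorant C |f| on a fixed ball, integrable as a product of
  two square integrable functions. Limits of integrals against \<open>f\<close> are reduced to this
  form.\<close>

lemma L2_integral_limit:
  fixes f :: "'a::euclidean_space \<Rightarrow> real"
  assumes f: "L2 f" and k: "\<And>n. k n \<in> borel_measurable borel" "\<And>n x. \<bar>k n x\<bar> \<le> C"
    "\<And>n x. x \<notin> cball 0 R \<Longrightarrow> k n x = 0" and lim: "AE x in lborel. (\<lambda>n. k n x) \<longlonglongrightarrow> h x"
    and h: "h \<in> borel_measurable borel"
  shows "(\<lambda>n. \<integral>x. f x * k n x \<partial>lborel) \<longlonglongrightarrow> (\<integral>x. f x * h x \<partial>lborel)"
proof (rule integral_dominated_convergence)
  note [measurable] = L2_measurable[OF f] k(1) h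
  show "(\<lambda>x. f x * h x) \<in> borel_measurable lborel" "\<And>n. (\<lambda>x. f x * k n x) \<in> borel_measurable lborel" by simp_all
  have C: "C \<ge> 0" using k(2)[of 0 0] by linarith
  have "L2 (\<lambda>x::'a. C * indicator (cball 0 R) x)"
    by (rule L2_bounded_support[of _ C R]) (auto simp: indicator_def C)
  moreover have "L2 (\<lambda>x. \<bar>f x\<bar>)" using f by (simp add: L2_def)
  ultimately show "integrable lborel (\<lambda>x. \<bar>f x\<bar> * (C * indicator (cball 0 R) x))"
    using L2_integrable_mult by blast
  show "AE x in lborel. (\<lambda>n. f x * k n x) \<longlonglongrightarrow> f x * h x"
    using lim by eventually_elim (intro tendsto_intros)
  show "AE x in lborel. norm (f x * k n x) \<le> \<bar>f x\<bar> * (C * indicator (cball 0 R) x)" for n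
  proof (rule AE_I2)
    fix x show "norm (f x * k n x) \<le> \<bar>f x\<bar> * (C * indicator (cball 0 R) x)"
      using k(2)[of n x] k(3)[of x n] by (cases "x \<in> cball 0 R") (auto simp: abs_mult intro: mult_left_mono)
  qed
qed

lemma lborel_distr_reflect: "distr lborel borel (\<lambda>y. x - y) = (lborel :: 'a::euclidean_space measure)"
  using lborel_affine[of "-1" x] by (simp add: density_1)

subsection \<open>Mollification\<close>

text \<open>A polynomial profile suffices since test functions are of class C^1; the square makes
  the positive part differentiable at the rim.\<close>

definition bump :: "real \<Rightarrow> 'a::euclidean_space \<Rightarrow> real" where
  "bump e x = (max 0 (e\<^sup>2 - x \<bullet> x))\<^sup>2"

definition bump_deriv :: "real \<Rightarrow> 'a::euclidean_space \<Rightarrow> 'a \<Rightarrow> real" where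
  "bump_deriv e x h = - 4 * max 0 (e\<^sup>2 - x \<bullet> x) * (x \<bullet> h)"

lemma has_derivative_max_square:
  "((\<lambda>t::real. (max 0 t)\<^sup>2) has_real_derivative 2 * max 0 t) (at t)"
proof -
  consider "t > 0" | "t < 0" | "t = 0" by linarith
  then show ?thesis
  proof cases
    case 1
    have "((\<lambda>t::real. t\<^sup>2) has_real_derivative 2 * t) (at t)" by (auto intro!: derivative_eq_intros)
    then have "((\<lambda>t::real. (max 0 t)\<^sup>2) has_real_derivative 2 * t) (at t)"
      by (rule has_field_derivative_transform_within_open[of _ _ _ "{0<..}"]) (use 1 in auto)
    then show ?thesis using 1 by simp
  next
    case 2
    have "((\<lambda>t::real. 0) has_real_derivative 0) (at t)" by simp
    then have "((\<lambda>t::real. (max 0 t)\<^sup>2) has_real_derivative 0) (at t)"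
      by (rule has_field_derivative_transform_within_open[of _ _ _ "{..<0}"]) (use 2 in auto)
    then show ?thesis using 2 by simp
  next
    case 3
    have "((\<lambda>h::real. (max 0 h)\<^sup>2 / h) \<longlongrightarrow> 0) (at 0)"
    proof (rule Lim_null_comparison)
      show "\<forall>\<^sub>F h in at 0. norm ((max 0 h)\<^sup>2 / h) \<le> \<bar>h\<bar>"
        by (rule eventually_at_filter[THEN iffD2]) (auto simp: max_def power2_eq_square)
      show "((\<lambda>h::real. \<bar>h\<bar>) \<longlongrightarrow> 0) (at 0)" by (auto intro!: tendsto_eq_intros)
    qed
    then show ?thesis using 3 by (simp add: DERIV_def)
  qed
qed

lemma bump_has_derivative: "(bump e has_derivative bump_deriv e x) (at x)"
proof -
  have "((\<lambda>x. e\<^sup>2 - x \<bullet> x) has_derivative (\<lambda>h. - 2 * (x \<bullet> h))) (at x)"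
    by (auto intro!: derivative_eq_intros simp: inner_commute)
  from has_derivative_compose[OF this, of "\<lambda>t. (max 0 t)\<^sup>2", OF has_derivative_max_square[THEN has_field_derivative_imp_has_derivative]]
  show ?thesis by (simp add: bump_def[abs_def] bump_deriv_def[abs_def] algebra_simps)
qed

lemma bump_zero: "e > 0 \<Longrightarrow> norm x \<ge> e \<Longrightarrow> bump e x = 0" "e > 0 \<Longrightarrow> norm x \<ge> e \<Longrightarrow> bump_deriv e x h = 0"
proof -
  assume "e > 0" "norm x \<ge> e"
  then have "e\<^sup>2 \<le> (norm x)\<^sup>2" by (intro power_mono) auto
  then show "bump e x = 0" "bump_deriv e x h = 0" by (simp_all add: bump_def bump_deriv_def power2_norm_eq_inner)
qed

lemma bump_bounds: "0 \<le> bump e x" "bump e x \<le> e ^ 4"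
proof -
  show "0 \<le> bump e x" by (simp add: bump_def)
  have "(max 0 (e\<^sup>2 - x \<bullet> x))\<^sup>2 \<le> (e\<^sup>2)\<^sup>2" by (intro power_mono) auto
  then show "bump e x \<le> e ^ 4" by (simp add: bump_def)
qed

lemma continuous_bump: "continuous_on S (bump e)" and continuous_bump_deriv: "continuous_on S (\<lambda>x. bump_deriv e x h)"
  unfolding bump_def[abs_def] bump_deriv_def by (intro continuous_intros)+

lemma bump_measurable [measurable]: "bump e \<in> borel_measurable borel"
  by (rule borel_measurable_continuous_onI[OF continuous_bump])

lemma integrable_bump: "e > 0 \<Longrightarrow> integrable lborel (bump e :: 'a::euclidean_space \<Rightarrow> real)"
proof -
  assume e: "e > 0"
  have "set_integrable lborel (cball (0::'a) e) (bump e)"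
    unfolding set_integrable_def by (rule borel_integrable_compact) (auto intro: continuous_bump)
  moreover have "(\<lambda>x. indicator (cball 0 e) x *\<^sub>R bump e x) = (bump e :: 'a \<Rightarrow> real)"
    using bump_zero(1)[OF e] by (force simp: indicator_def)
  ultimately show ?thesis by (simp only: set_integrable_def)
qed

lemma integral_bump_pos: "e > 0 \<Longrightarrow> 0 < (\<integral>x. bump e (x::'a::euclidean_space) \<partial>lborel)"
proof -
  assume e: "e > 0"
  have "(\<integral>x. bump e (x::'a) \<partial>lborel) \<noteq> 0"
  proof
    assume "(\<integral>x. bump e (x::'a) \<partial>lborel) = 0"
    then have ae: "AE x::'a in lborel. bump e x = 0"
      using integral_nonneg_eq_0_iff_AE[OF integrable_bump[OF e]] bump_bounds by auto
    have nz: "bump e x \<noteq> 0" if "x \<in> ball 0 e" for x :: 'a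
    proof -
      have "(norm x)\<^sup>2 < e\<^sup>2" using that e by (intro power_strict_mono) auto
      then show ?thesis by (simp add: bump_def power2_norm_eq_inner)
    qed
    have "AE x::'a in lborel. x \<notin> ball 0 e" using ae by eventually_elim (use nz in auto)
    then have "ball (0::'a) e \<in> null_sets lborel" by (subst (asm) AE_iff_null_sets[symmetric]) auto
    then show False using e open_not_negligible[of "ball (0::'a) e"]
      by (auto simp: negligible_iff_null_sets null_sets_def completion.null_sets_outer)
  qed
  moreover have "(\<integral>x. bump e (x::'a) \<partial>lborel) \<ge> 0" by (intro Bochner_Integration.integral_nonneg) (auto simp: bump_bounds)
  ultimately show ?thesis by simp
qed

definition mollifier :: "real \<Rightarrow> 'a::euclidean_space \<Rightarrow> real" where
  "mollifier e x = bump e x / (\<integral>x. bump e (x::'a) \<partial>lborel)"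

definition mollifier_deriv :: "real \<Rightarrow> 'a::euclidean_space \<Rightarrow> 'a \<Rightarrow> real" where
  "mollifier_deriv e x h = bump_deriv e x h / (\<integral>x. bump e (x::'a) \<partial>lborel)"

definition mollify :: "real \<Rightarrow> ('a::euclidean_space \<Rightarrow> real) \<Rightarrow> 'a \<Rightarrow> real" where
  "mollify e f x = (\<integral>y. f y * mollifier e (x - y) \<partial>lborel)"

context
  fixes e :: real
  assumes e: "e > 0"
begin

lemma mollifier_nonneg: "0 \<le> mollifier e (x::'a::euclidean_space)"
  using integral_bump_pos[OF e, where 'a = 'a] bump_bounds(1)[of e x] by (simp add: mollifier_def)

lemma mollifier_zero: "norm x \<ge> e \<Longrightarrow> mollifier e x = 0" "norm x \<ge> e \<Longrightarrow> mollifier_deriv e x h = 0"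
  using bump_zero[OF e, of x] by (auto simp: mollifier_def mollifier_deriv_def)

lemma mollifier_continuous: "continuous_on S (mollifier e)" "continuous_on S (\<lambda>x. mollifier_deriv e x h)"
  using integral_bump_pos[OF e, where 'a = 'a] unfolding mollifier_def[abs_def] mollifier_deriv_def
  by (auto intro!: continuous_intros continuous_bump continuous_bump_deriv)

lemma mollifier_measurable [measurable]: "mollifier e \<in> borel_measurable borel"
    "(\<lambda>x. mollifier_deriv e x h) \<in> borel_measurable borel"
  by (intro borel_measurable_continuous_onI mollifier_continuous)+

lemma mollifier_has_derivative: "(mollifier e has_derivative mollifier_deriv e x) (at x)"
  unfolding mollifier_def[abs_def] mollifier_deriv_def[abs_def]
  using integral_bump_pos[OF e, where 'a = 'a] by (auto intro!: derivative_eq_intros bump_has_derivative)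

lemma mollifier_integrable: "integrable lborel (mollifier e)"
  unfolding mollifier_def[abs_def] by (intro integrable_divide integrable_bump e)

lemma mollifier_integral: "(\<integral>x. mollifier e (x::'a::euclidean_space) \<partial>lborel) = 1"
  using integral_bump_pos[OF e, where 'a = 'a] by (simp add: mollifier_def[abs_def])

lemma mollifier_bounded: obtains C where "C > 0" "\<And>x. mollifier e (x::'a::euclidean_space) \<le> C"
proof
  let ?Z = "\<integral>x. bump e (x::'a) \<partial>lborel"
  show "e ^ 4 / ?Z > 0" using integral_bump_pos[OF e, where 'a = 'a] e by simp
  show "mollifier e x \<le> e ^ 4 / ?Z" for x :: 'a
    using integral_bump_pos[OF e, where 'a = 'a] bump_bounds(2)[of e x] by (simp add: mollifier_def divide_right_mono)
qed

text \<open>On its support the bump has derivative at most 4 e^2 |x| |h| with |x| < e, whence 4 e^3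
  over the mass. The uniform bound dominates the difference quotients when differentiating under the
  integral.\<close>

lemma mollifier_lipschitz:
  obtains L where "L \<ge> 0" "\<And>x y. \<bar>mollifier e x - mollifier e (y::'a::euclidean_space)\<bar> \<le> L * norm (x - y)"
proof -
  let ?Z = "\<integral>x. bump e (x::'a) \<partial>lborel"
  let ?L = "4 * e ^ 3 / ?Z"
  have Z: "?Z > 0" by (rule integral_bump_pos[OF e])
  have "onorm (mollifier_deriv e x) \<le> ?L" for x :: 'a
  proof (rule onorm_le)
    fix h
    show "norm (mollifier_deriv e x h) \<le> ?L * norm h"
    proof (cases "norm x \<ge> e")
      case True
      then show ?thesis using mollifier_zero(2)[of x h] Z e by simp
    next
      case False
      have "\<bar>max 0 (e\<^sup>2 - x \<bullet> x)\<bar> \<le> e\<^sup>2" by auto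
      moreover have "\<bar>x \<bullet> h\<bar> \<le> e * norm h"
        using Cauchy_Schwarz_ineq2[of x h] False by (meson le_less_linear mult_right_mono norm_ge_zero order_trans less_imp_le)
      ultimately have "\<bar>max 0 (e\<^sup>2 - x \<bullet> x)\<bar> * \<bar>x \<bullet> h\<bar> \<le> e\<^sup>2 * (e * norm h)" by (intro mult_mono) auto
      then have "\<bar>bump_deriv e x h\<bar> \<le> 4 * e ^ 3 * norm h"
        by (simp add: bump_deriv_def abs_mult power2_eq_square power3_eq_cube)
      then show ?thesis using Z by (simp add: mollifier_deriv_def divide_right_mono)
    qed
  qed
  then have "\<bar>mollifier e x - mollifier e y\<bar> \<le> ?L * norm (x - y)" for x y :: 'a
    using differentiable_bound[OF convex_UNIV, of "mollifier e" "mollifier_deriv e" ?L x y]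
      mollifier_has_derivative[where 'a = 'a] by auto
  then show thesis using that[of ?L] Z e by simp
qed

lemma mollifier_shift_integral: "(\<integral>y. mollifier e (x - y) \<partial>lborel) = 1" "integrable lborel (\<lambda>y. mollifier e (x - y))"
proof -
  have "integrable (distr lborel borel (\<lambda>y. x - y)) (mollifier e)"
    using mollifier_integrable by (simp add: lborel_distr_reflect)
  then show "integrable lborel (\<lambda>y. mollifier e (x - y))" by (subst (asm) integrable_distr_eq) auto
  have "(\<integral>y. mollifier e (x - y) \<partial>lborel) = integral\<^sup>L (distr lborel borel (\<lambda>y. x - y)) (mollifier e)"
    by (subst integral_distr) auto
  then show "(\<integral>y. mollifier e (x - y) \<partial>lborel) = 1" by (simp add: lborel_distr_reflect mollifier_integral)
qed

lemma L2_mollifier_shift: "L2 (\<lambda>y. mollifier e (x - y :: 'a::euclidean_space))"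
proof -
  obtain C where C: "\<And>x. mollifier e (x::'a) \<le> C" using mollifier_bounded by metis
  show ?thesis
  proof (rule L2_bounded_support[of _ C "norm x + e"])
    show "\<bar>mollifier e (x - y)\<bar> \<le> C" for y using C[of "x - y"] mollifier_nonneg[of "x - y"] by simp
    show "mollifier e (x - y) = 0" if "y \<notin> cball 0 (norm x + e)" for y
      using that norm_triangle_ineq2[of y x] by (intro mollifier_zero) (auto simp: norm_minus_commute)
  qed simp
qed

lemma mollify_integrable: "L2 f \<Longrightarrow> integrable lborel (\<lambda>y. f y * mollifier e (x - y))"
  by (rule L2_integrable_mult[OF _ L2_mollifier_shift])

lemma mollify_continuous:
  assumes f: "L2 (f :: 'a::euclidean_space \<Rightarrow> real)"
  shows "continuous_on UNIV (mollify e f)"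
proof (rule continuous_at_imp_continuous_on, rule ballI)
  fix x :: 'a
  obtain C where C: "\<And>x. mollifier e (x::'a) \<le> C" using mollifier_bounded by metis
  show "isCont (mollify e f) x"
    unfolding continuous_at_sequentially comp_def
  proof (intro allI impI)
    fix X assume X: "X \<longlonglongrightarrow> x"
    then obtain B where B: "\<And>n. norm (X n) \<le> B" by (metis BseqE convergentI convergent_imp_Bseq)
    show "(\<lambda>n. mollify e f (X n)) \<longlonglongrightarrow> mollify e f x"
      unfolding mollify_def
    proof (rule L2_integral_limit[OF f, of _ C "B + e"])
      show "\<bar>mollifier e (X n - y)\<bar> \<le> C" for n y using C[of "X n - y"] mollifier_nonneg[of "X n - y"] by simp
      show "mollifier e (X n - y) = 0" if "y \<notin> cball 0 (B + e)" for n y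
        using that norm_triangle_ineq2[of y "X n"] B[of n] by (intro mollifier_zero) (auto simp: norm_minus_commute)
      show "AE y in lborel. (\<lambda>n. mollifier e (X n - y)) \<longlonglongrightarrow> mollifier e (x - y)"
        by (intro AE_I2 continuous_on_tendsto_compose[OF mollifier_continuous(1)[of UNIV]] tendsto_intros X) auto
    qed auto
  qed
qed

lemma mollify_measurable [measurable]: "L2 f \<Longrightarrow> mollify e f \<in> borel_measurable borel"
  by (intro borel_measurable_continuous_onI mollify_continuous)

lemma test_function_mollifier: "test_function (\<lambda>y. mollifier e (x - y :: 'a::euclidean_space))"
    "frechet_derivative (\<lambda>y. mollifier e (x - y)) (at y) b = - mollifier_deriv e (x - y) b"
proof -
  have der: "((\<lambda>y. mollifier e (x - y)) has_derivative (\<lambda>h. - mollifier_deriv e (x - y) h)) (at y)" for y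
  proof -
    have "((\<lambda>y. x - y) has_derivative (\<lambda>h. - h)) (at y)" by (auto intro!: derivative_eq_intros)
    from has_derivative_compose[OF this mollifier_has_derivative]
    show ?thesis by (simp add: mollifier_deriv_def bump_deriv_def)
  qed
  show fd: "frechet_derivative (\<lambda>y. mollifier e (x - y)) (at y) b = - mollifier_deriv e (x - y) b" for y b
    using frechet_derivative_at[OF der, of y] by metis
  have "{y. mollifier e (x - y) \<noteq> 0} \<subseteq> cball x e"
    using mollifier_zero(1)[of "x - _"] by (force simp: dist_norm)
  then have "bounded {y. mollifier e (x - y) \<noteq> 0}" using bounded_cball bounded_subset by blast
  moreover have "continuous_on UNIV (\<lambda>y. - mollifier_deriv e (x - y) b)" for b
    by (intro continuous_intros continuous_on_compose2[OF mollifier_continuous(2)[of UNIV]]) auto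
  ultimately show "test_function (\<lambda>y. mollifier e (x - y))"
    unfolding test_function_def fd using der by (auto simp: differentiable_def)
qed

text \<open>Difference quotients pass under the integral. As a function of y, the mollifier at x - y
  is a test function, so the weak derivative can be transferred to \<open>f\<close>; the sign from
  differentiating in y cancels the one in \<open>weak_deriv\<close>.\<close>

lemma mollify_has_derivative:
  assumes f: "L2 (f :: 'a::euclidean_space \<Rightarrow> real)" and g: "weak_deriv b f g"
  shows "((\<lambda>s. mollify e f (x + s *\<^sub>R b)) has_real_derivative mollify e g (x + s *\<^sub>R b)) (at s)"
proof -
  let ?z = "x + s *\<^sub>R b"
  obtain L where L: "L \<ge> 0" "\<And>x y. \<bar>mollifier e x - mollifier e (y::'a)\<bar> \<le> L * norm (x - y)" using mollifier_lipschitz by metis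
  have "(\<integral>y. f y * mollifier_deriv e (?z - y) b \<partial>lborel) = mollify e g ?z"
    using g test_function_mollifier[of ?z] unfolding weak_deriv_def mollify_def by fastforce
  moreover have "((\<lambda>h. (mollify e f (x + (s + h) *\<^sub>R b) - mollify e f ?z) / h) \<longlongrightarrow> (\<integral>y. f y * mollifier_deriv e (?z - y) b \<partial>lborel)) (at 0)"
    unfolding tendsto_at_iff_sequentially comp_def
  proof (intro allI impI)
    fix X :: "nat \<Rightarrow> real" assume X: "\<forall>i. X i \<in> UNIV - {0}" "X \<longlonglongrightarrow> 0"
    then obtain B where B: "\<And>n. norm (X n) \<le> B" by (metis BseqE convergentI convergent_imp_Bseq)
    let ?k = "\<lambda>n y. (mollifier e (?z + X n *\<^sub>R b - y) - mollifier e (?z - y)) / X n"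
    have "(mollify e f (x + (s + X n) *\<^sub>R b) - mollify e f ?z) / X n = (\<integral>y. f y * ?k n y \<partial>lborel)" for n
      unfolding mollify_def
      by (subst Bochner_Integration.integral_diff[symmetric])
        (auto intro!: mollify_integrable f simp: algebra_simps diff_divide_distrib simp flip: integral_divide_zero)
    moreover have "(\<lambda>n. \<integral>y. f y * ?k n y \<partial>lborel) \<longlonglongrightarrow> (\<integral>y. f y * mollifier_deriv e (?z - y) b \<partial>lborel)"
    proof (rule L2_integral_limit[OF f, of _ "L * norm b" "norm ?z + B * norm b + e"])
      show "\<bar>?k n y\<bar> \<le> L * norm b" for n y
        using L(2)[of "?z + X n *\<^sub>R b - y" "?z - y"] X(1) by (simp add: field_simps abs_mult)
      show "?k n y = 0" if "y \<notin> cball 0 (norm ?z + B * norm b + e)" for n y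
      proof -
        have "norm (X n *\<^sub>R b) \<le> B * norm b" using B[of n] by (simp add: mult_right_mono)
        moreover have "norm (X n *\<^sub>R b) \<ge> 0" by simp
        moreover have "norm y > norm ?z + B * norm b + e" using that by simp
        moreover have "norm y - norm ?z \<le> norm (?z - y)" by (metis norm_minus_commute norm_triangle_ineq2)
        moreover have "norm y - norm (?z + X n *\<^sub>R b) \<le> norm (?z + X n *\<^sub>R b - y)" by (metis norm_minus_commute norm_triangle_ineq2)
        moreover have "norm (?z + X n *\<^sub>R b) \<le> norm ?z + norm (X n *\<^sub>R b)" by (rule norm_triangle_ineq)
        ultimately have "norm (?z - y) \<ge> e" "norm (?z + X n *\<^sub>R b - y) \<ge> e" by linarith+
        then show ?thesis by (simp only: mollifier_zero) simp
      qed
      show "AE y in lborel. (\<lambda>n. ?k n y) \<longlonglongrightarrow> mollifier_deriv e (?z - y) b"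
      proof (rule AE_I2)
        fix y
        have "((\<lambda>s. ?z + s *\<^sub>R b - y) has_derivative (\<lambda>h. h *\<^sub>R b)) (at 0)" by (auto intro!: derivative_eq_intros)
        from has_derivative_compose[OF this, of "mollifier e" "mollifier_deriv e (?z - y)"]
        have "((\<lambda>s. mollifier e (?z + s *\<^sub>R b - y)) has_derivative (\<lambda>h. mollifier_deriv e (?z - y) (h *\<^sub>R b))) (at 0)"
          using mollifier_has_derivative[of "?z - y"] by simp
        moreover have "mollifier_deriv e (?z - y) (h *\<^sub>R b) = mollifier_deriv e (?z - y) b * h" for h
          by (simp add: mollifier_deriv_def bump_deriv_def)
        ultimately have "((\<lambda>s. mollifier e (?z + s *\<^sub>R b - y)) has_real_derivative mollifier_deriv e (?z - y) b) (at 0)"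
          by (simp add: has_field_derivative_def)
        then have "((\<lambda>h. (mollifier e (?z + h *\<^sub>R b - y) - mollifier e (?z - y)) / h) \<longlongrightarrow> mollifier_deriv e (?z - y) b) (at 0)"
          by (simp add: DERIV_def)
        then show "(\<lambda>n. ?k n y) \<longlonglongrightarrow> mollifier_deriv e (?z - y) b"
          using X unfolding tendsto_at_iff_sequentially comp_def by blast
      qed
    qed auto
    ultimately show "(\<lambda>n. (mollify e f (x + (s + X n) *\<^sub>R b) - mollify e f ?z) / X n) \<longlonglongrightarrow> (\<integral>y. f y * mollifier_deriv e (?z - y) b \<partial>lborel)"
      by (simp only:)
  qed
  ultimately show ?thesis by (simp add: DERIV_def)
qed

text \<open>Jensen's inequality for the probability density \<open>mollifier e (x - y)\<close>.\<close>

lemma mollify_square_le: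
  assumes f: "L2 (f :: 'a::euclidean_space \<Rightarrow> real)"
  shows "integrable lborel (\<lambda>y. (f y)\<^sup>2 * mollifier e (x - y))"
    "(mollify e f x)\<^sup>2 \<le> (\<integral>y. (f y)\<^sup>2 * mollifier e (x - y) \<partial>lborel)"
proof -
  obtain C where C: "\<And>x. mollifier e (x::'a) \<le> C" using mollifier_bounded by metis
  show i: "integrable lborel (\<lambda>y. (f y)\<^sup>2 * mollifier e (x - y))"
  proof (rule Bochner_Integration.integrable_bound)
    show "integrable lborel (\<lambda>y. C * (f y)\<^sup>2)" using f by (simp add: L2_def)
    show "(\<lambda>y. (f y)\<^sup>2 * mollifier e (x - y)) \<in> borel_measurable lborel"
      using L2_measurable[OF f] by measurable
    show "AE y in lborel. norm ((f y)\<^sup>2 * mollifier e (x - y)) \<le> norm (C * (f y)\<^sup>2)"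
    proof (rule AE_I2)
      fix y
      have "mollifier e (x - y) \<le> C" "0 \<le> mollifier e (x - y)" by (rule C, rule mollifier_nonneg)
      then have "(f y)\<^sup>2 * mollifier e (x - y) \<le> C * (f y)\<^sup>2" by (simp add: mult.commute[of C] mult_left_mono)
      moreover have "C * (f y)\<^sup>2 \<le> \<bar>C\<bar> * (f y)\<^sup>2" by (intro mult_right_mono) auto
      ultimately show "norm ((f y)\<^sup>2 * mollifier e (x - y)) \<le> norm (C * (f y)\<^sup>2)"
        using \<open>0 \<le> mollifier e (x - y)\<close> by (simp add: abs_mult)
    qed
  qed
  let ?u = "mollify e f x"
  \<comment> \<open>Nonnegativity of the variance of \<open>f\<close> under this density.\<close>
  have "0 \<le> (\<integral>y. (f y - ?u)\<^sup>2 * mollifier e (x - y) \<partial>lborel)"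
    by (intro Bochner_Integration.integral_nonneg mult_nonneg_nonneg mollifier_nonneg) auto
  also have "\<dots> = (\<integral>y. (f y)\<^sup>2 * mollifier e (x - y) - 2 * ?u * (f y * mollifier e (x - y)) + ?u\<^sup>2 * mollifier e (x - y) \<partial>lborel)"
    by (intro Bochner_Integration.integral_cong) (auto simp: power2_diff algebra_simps)
  also have "\<dots> = (\<integral>y. (f y)\<^sup>2 * mollifier e (x - y) \<partial>lborel) - 2 * ?u * ?u + ?u\<^sup>2"
    using i mollify_integrable[OF f, of x] mollifier_shift_integral[of x] by (simp add: mollify_def)
  finally show "?u\<^sup>2 \<le> (\<integral>y. (f y)\<^sup>2 * mollifier e (x - y) \<partial>lborel)" by (simp add: power2_eq_square)
qed

lemma mollify_bounded:
  assumes f: "L2 (f :: 'a::euclidean_space \<Rightarrow> real)"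
  obtains C where "\<And>x. (mollify e f x)\<^sup>2 \<le> C"
proof -
  obtain C where C: "\<And>x. mollifier e (x::'a) \<le> C" using mollifier_bounded by metis
  have "(mollify e f x)\<^sup>2 \<le> (\<integral>y. (f y)\<^sup>2 * C \<partial>lborel)" for x
    by (rule order_trans[OF mollify_square_le(2)[OF f]], rule Bochner_Integration.integral_mono)
      (use f in \<open>auto simp: L2_def intro!: mult_left_mono C mollify_square_le(1)\<close>)
  then show thesis using that by blast
qed

text \<open>For each y the kernel at X n - y eventually vanishes, so the bound of
  \<open>mollify_square_le\<close> tends to 0 by dominated convergence. This decay lets line
  integrals start from the value 0 at infinity.\<close>

lemma mollify_at_infinity:
  assumes f: "L2 (f :: 'a::euclidean_space \<Rightarrow> real)" and X: "filterlim (\<lambda>n. norm (X n)) at_top sequentially"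
  shows "(\<lambda>n. mollify e f (X n)) \<longlonglongrightarrow> 0"
proof -
  obtain C where C: "\<And>x. mollifier e (x::'a) \<le> C" using mollifier_bounded by metis
  have "(\<lambda>n. \<integral>y. (f y)\<^sup>2 * mollifier e (X n - y) \<partial>lborel) \<longlonglongrightarrow> (integral\<^sup>L lborel (\<lambda>y::'a. 0))"
  proof (rule integral_dominated_convergence)
    note [measurable] = L2_measurable[OF f]
    show "(\<lambda>y. (f y)\<^sup>2 * mollifier e (X n - y)) \<in> borel_measurable lborel" for n by measurable
    show "integrable lborel (\<lambda>y. (f y)\<^sup>2 * C)" using f by (simp add: L2_def)
    show "AE y in lborel. norm ((f y)\<^sup>2 * mollifier e (X n - y)) \<le> (f y)\<^sup>2 * C" for n
      by (rule AE_I2) (simp add: abs_mult mollifier_nonneg mult_left_mono C)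
    show "AE y in lborel. (\<lambda>n. (f y)\<^sup>2 * mollifier e (X n - y)) \<longlonglongrightarrow> 0"
    proof (rule AE_I2)
      fix y :: 'a
      have "\<forall>\<^sub>F n in sequentially. norm (X n) \<ge> norm y + e" using X by (simp add: filterlim_at_top)
      then have "\<forall>\<^sub>F n in sequentially. (f y)\<^sup>2 * mollifier e (X n - y) = 0"
      proof eventually_elim
        case (elim n)
        then have "norm (X n - y) \<ge> e" using norm_triangle_ineq2[of "X n" y] by linarith
        then show ?case by (simp add: mollifier_zero)
      qed
      then show "(\<lambda>n. (f y)\<^sup>2 * mollifier e (X n - y)) \<longlonglongrightarrow> 0" by (rule tendsto_eventually)
    qed
  qed auto
  then have lim0: "(\<lambda>n. \<integral>y. (f y)\<^sup>2 * mollifier e (X n - y) \<partial>lborel) \<longlonglongrightarrow> 0" by simp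
  have "(\<lambda>n. (mollify e f (X n))\<^sup>2) \<longlonglongrightarrow> 0"
  proof (rule Lim_null_comparison[OF _ lim0])
    show "\<forall>\<^sub>F n in sequentially. norm ((mollify e f (X n))\<^sup>2) \<le> (\<integral>y. (f y)\<^sup>2 * mollifier e (X n - y) \<partial>lborel)"
      by (rule always_eventually) (simp add: mollify_square_le(2)[OF f])
  qed
  then show ?thesis by (simp add: tendsto_null_power)
qed

text \<open>Pointwise Jensen followed by Tonelli; the total mass of the kernel is 1 in either
  variable.\<close>

lemma nn_integral_mollify_square:
  assumes f: "L2 (f :: 'a::euclidean_space \<Rightarrow> real)"
  shows "(\<integral>\<^sup>+x. ennreal ((mollify e f x)\<^sup>2) \<partial>lborel) \<le> (\<integral>\<^sup>+x. ennreal ((f x)\<^sup>2) \<partial>lborel)"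
proof -
  note [measurable] = L2_measurable[OF f]
  have "(\<integral>\<^sup>+x. ennreal ((mollify e f x)\<^sup>2) \<partial>lborel) \<le> (\<integral>\<^sup>+x. \<integral>\<^sup>+y. ennreal ((f y)\<^sup>2 * mollifier e (x - y)) \<partial>lborel \<partial>lborel)"
  proof (rule nn_integral_mono)
    fix x
    have "ennreal ((mollify e f x)\<^sup>2) \<le> ennreal (\<integral>y. (f y)\<^sup>2 * mollifier e (x - y) \<partial>lborel)"
      by (intro ennreal_leI mollify_square_le f)
    also have "\<dots> = (\<integral>\<^sup>+y. ennreal ((f y)\<^sup>2 * mollifier e (x - y)) \<partial>lborel)"
      by (rule nn_integral_eq_integral[symmetric]) (auto simp: mollifier_nonneg intro: mollify_square_le f)
    finally show "ennreal ((mollify e f x)\<^sup>2) \<le> (\<integral>\<^sup>+y. ennreal ((f y)\<^sup>2 * mollifier e (x - y)) \<partial>lborel)" .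
  qed
  also have "\<dots> = (\<integral>\<^sup>+y. \<integral>\<^sup>+x. ennreal ((f y)\<^sup>2 * mollifier e (x - y)) \<partial>lborel \<partial>lborel)"
    by (rule lborel_pair.Fubini') measurable
  also have "\<dots> = (\<integral>\<^sup>+y. ennreal ((f y)\<^sup>2) * (\<integral>\<^sup>+x. ennreal (mollifier e (x - y)) \<partial>lborel) \<partial>lborel)"
    by (simp add: ennreal_mult mollifier_nonneg nn_integral_cmult)
  also have "\<dots> = (\<integral>\<^sup>+y. ennreal ((f y)\<^sup>2) \<partial>lborel)"
  proof -
    have "(\<integral>\<^sup>+x. ennreal (mollifier e (x - y)) \<partial>lborel) = 1" for y :: 'a
    proof -
      have "(\<integral>\<^sup>+x. ennreal (mollifier e (x - y)) \<partial>lborel) = integral\<^sup>N (distr lborel borel ((+) (- y))) (\<lambda>x. ennreal (mollifier e x))"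
        by (subst nn_integral_distr) (auto simp: add.commute)
      also have "\<dots> = ennreal (\<integral>x. mollifier e (x::'a) \<partial>lborel)"
        by (subst lborel_distr_plus) (auto intro!: nn_integral_eq_integral mollifier_integrable simp: mollifier_nonneg)
      finally show ?thesis by (simp add: mollifier_integral)
    qed
    then show ?thesis by simp
  qed
  finally show ?thesis .
qed

end

lemma L2_mollify:
  assumes "e > 0" "L2 f" shows "L2 (mollify e f)"
  unfolding L2_def
proof
  note [measurable] = mollify_measurable[OF assms]
  show "mollify e f \<in> borel_measurable lborel" by simp
  have "(\<integral>\<^sup>+x. ennreal ((f x)\<^sup>2) \<partial>lborel) < \<infinity>"
    using assms(2) by (simp add: L2_def integrable_iff_bounded)
  then have "(\<integral>\<^sup>+x. ennreal ((mollify e f x)\<^sup>2) \<partial>lborel) < \<infinity>"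
    using nn_integral_mollify_square[OF assms] by (rule order.strict_trans1[rotated])
  then show "integrable lborel (\<lambda>x. (mollify e f x)\<^sup>2)"
    by (simp add: integrable_iff_bounded)
qed

lemma mollifier_even: "mollifier e (- x) = mollifier e x"
  by (simp add: mollifier_def bump_def)

lemma L2_abs: "L2 f \<Longrightarrow> L2 (\<lambda>x. \<bar>f x\<bar>)"
  by (auto simp: L2_def intro: borel_measurable_abs)

text \<open>Fubini and evenness of the kernel. It shifts the mollification onto a continuous factor,
  where pointwise convergence is available.\<close>

lemma mollify_self_adjoint:
  assumes e: "e > 0" and f: "L2 (f :: 'a::euclidean_space \<Rightarrow> real)" and g: "L2 g"
  shows "(\<integral>x. g x * mollify e f x \<partial>lborel) = (\<integral>y. f y * mollify e g y \<partial>lborel)"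
proof -
  note [measurable] = L2_measurable[OF f] L2_measurable[OF g] mollifier_measurable[OF e]
  let ?F = "\<lambda>(x, y). g x * (f y * mollifier e (x - y))"
  have "integrable (lborel \<Otimes>\<^sub>M lborel) ?F"
  proof (rule lborel_pair.Fubini_integrable)
    show "?F \<in> borel_measurable (lborel \<Otimes>\<^sub>M lborel)" by measurable
    have "(\<integral>y. norm (?F (x, y)) \<partial>lborel) = \<bar>g x\<bar> * mollify e (\<lambda>y. \<bar>f y\<bar>) x" for x
      by (simp add: mollify_def abs_mult mollifier_nonneg[OF e])
    moreover have "integrable lborel (\<lambda>x. \<bar>g x\<bar> * mollify e (\<lambda>y. \<bar>f y\<bar>) x)"
      by (intro L2_integrable_mult L2_mollify L2_abs e f g)
    ultimately show "integrable lborel (\<lambda>x. \<integral>y. norm (?F (x, y)) \<partial>lborel)" by simp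
    show "AE x in lborel. integrable lborel (\<lambda>y. ?F (x, y))"
      by (intro AE_I2) (auto intro: mollify_integrable[OF e f])
  qed
  from lborel_pair.Fubini_integral[OF this, symmetric]
  have "(\<integral>x. \<integral>y. g x * (f y * mollifier e (x - y)) \<partial>lborel \<partial>lborel) = (\<integral>y. \<integral>x. g x * (f y * mollifier e (x - y)) \<partial>lborel \<partial>lborel)" .
  also have "\<dots> = (\<integral>y. f y * mollify e g y \<partial>lborel)"
  proof (intro Bochner_Integration.integral_cong refl)
    fix y
    have "mollifier e (x - y) = mollifier e (y - x)" for x :: 'a
      using mollifier_even[of e "y - x"] by simp
    then have "(\<integral>x. g x * (f y * mollifier e (x - y)) \<partial>lborel) = (\<integral>x. f y * (g x * mollifier e (y - x)) \<partial>lborel)"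
      by (simp add: mult.left_commute)
    then show "(\<integral>x. g x * (f y * mollifier e (x - y)) \<partial>lborel) = f y * mollify e g y"
      by (simp add: mollify_def)
  qed
  finally show ?thesis by (simp add: mollify_def)
qed

context
  fixes \<psi> :: "'a::euclidean_space \<Rightarrow> real" and M R :: real
  assumes cont: "continuous_on UNIV \<psi>" and bd: "\<And>x. \<bar>\<psi> x\<bar> \<le> M" and supp: "\<And>x. x \<notin> cball 0 R \<Longrightarrow> \<psi> x = 0"
begin

lemma L2_continuous_compact: "L2 \<psi>"
  by (rule L2_bounded_support[OF borel_measurable_continuous_onI[OF cont] bd supp])

lemma mollify_continuous_limit: "(\<lambda>n. mollify (1 / real (Suc n)) \<psi> y) \<longlonglongrightarrow> \<psi> y"
proof (rule LIMSEQ_I)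
  fix r :: real assume r: "r > 0"
  then obtain d where d: "d > 0" "\<And>x. dist x y < d \<Longrightarrow> dist (\<psi> x) (\<psi> y) < r / 2"
    using cont unfolding continuous_on_iff by (metis UNIV_I half_gt_zero)
  obtain n0 where n0: "1 / real (Suc n0) < d" using d(1) by (metis nat_approx_posE)
  show "\<exists>no. \<forall>n\<ge>no. norm (mollify (1 / real (Suc n)) \<psi> y - \<psi> y) < r"
  proof (intro exI allI impI)
    fix n assume "n \<ge> n0"
    then have "1 / real (Suc n) \<le> 1 / real (Suc n0)" by (intro divide_left_mono) auto
    define e where "e = 1 / real (Suc n)"
    have e: "e > 0" "e < d" using n0 \<open>1 / real (Suc n) \<le> _\<close> by (auto simp: e_def)
    have i: "integrable lborel (\<lambda>x. mollifier e (y - x))" "(\<integral>x. mollifier e (y - x) \<partial>lborel) = 1"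
      by (rule mollifier_shift_integral[OF e(1)])+
    have "mollify e \<psi> y - \<psi> y = (\<integral>x. \<psi> x * mollifier e (y - x) - \<psi> y * mollifier e (y - x) \<partial>lborel)"
      using i mollify_integrable[OF e(1) L2_continuous_compact, of y] by (simp add: mollify_def)
    also have "norm \<dots> \<le> (\<integral>x. r / 2 * mollifier e (y - x) \<partial>lborel)"
    proof (rule Bochner_Integration.integral_norm_bound_integral)
      show "norm (\<psi> x * mollifier e (y - x) - \<psi> y * mollifier e (y - x)) \<le> r / 2 * mollifier e (y - x)" for x
      proof (cases "dist x y < d")
        case True
        have "\<bar>\<psi> x - \<psi> y\<bar> * mollifier e (y - x) \<le> r / 2 * mollifier e (y - x)"
          using d(2)[OF True] by (intro mult_right_mono mollifier_nonneg e) (auto simp: dist_real_def)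
        then show ?thesis using mollifier_nonneg[OF e(1), of "y - x"] by (simp add: left_diff_distrib[symmetric] abs_mult)
      next
        case False
        then have "mollifier e (y - x) = 0" using e by (intro mollifier_zero) (auto simp: dist_norm norm_minus_commute)
        then show ?thesis by simp
      qed
    qed (use i mollify_integrable[OF e(1) L2_continuous_compact, of y] in auto)
    also have "\<dots> = r / 2" using i by simp
    finally show "norm (mollify (1 / real (Suc n)) \<psi> y - \<psi> y) < r" using r by (simp add: e_def)
  qed
qed

text \<open>By self-adjointness \<psi> is mollified instead of \<open>f\<close>. With radii at most
  1 its mollifications stay below \<open>M\<close> and vanish outside the ball of radius R + 1,
  which is the setting of \<open>L2_integral_limit\<close>.\<close>

lemma mollify_weak_limit:
  assumes f: "L2 f"
  shows "(\<lambda>n. \<integral>x. \<psi> x * mollify (1 / real (Suc n)) f x \<partial>lborel) \<longlonglongrightarrow> (\<integral>x. \<psi> x * f x \<partial>lborel)"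
proof -
  let ?e = "\<lambda>n. 1 / real (Suc n)"
  have e: "?e n > 0" "?e n \<le> 1" for n by auto
  have "(\<lambda>n. \<integral>y. f y * mollify (?e n) \<psi> y \<partial>lborel) \<longlonglongrightarrow> (\<integral>y. f y * \<psi> y \<partial>lborel)"
  proof (rule L2_integral_limit[OF f, of _ M "R + 1"])
    show "mollify (?e n) \<psi> \<in> borel_measurable borel" for n by (rule mollify_measurable[OF e(1) L2_continuous_compact])
    show "\<psi> \<in> borel_measurable borel" by (rule borel_measurable_continuous_onI[OF cont])
    show "AE x in lborel. (\<lambda>n. mollify (?e n) \<psi> x) \<longlonglongrightarrow> \<psi> x" by (intro AE_I2 mollify_continuous_limit)
    show "\<bar>mollify (?e n) \<psi> x\<bar> \<le> M" for n x
    proof -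
      have "norm (mollify (?e n) \<psi> x) \<le> (\<integral>y. M * mollifier (?e n) (x - y) \<partial>lborel)"
        unfolding mollify_def
      proof (rule Bochner_Integration.integral_norm_bound_integral)
        show "norm (\<psi> y * mollifier (?e n) (x - y)) \<le> M * mollifier (?e n) (x - y)" for y
        proof -
          have nn: "0 \<le> mollifier (?e n) (x - y)" by (rule mollifier_nonneg[OF e(1)])
          show ?thesis
            using mult_right_mono[OF bd[of y] nn] by (simp only: real_norm_def abs_mult abs_of_nonneg[OF nn])
        qed
      qed (use mollifier_shift_integral[OF e(1)] mollify_integrable[OF e(1) L2_continuous_compact] in auto)
      then show ?thesis using mollifier_shift_integral[OF e(1)[of n], of x] by simp
    qed
    show "mollify (?e n) \<psi> x = 0" if x: "x \<notin> cball 0 (R + 1)" for n x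
    proof -
      have "\<psi> y * mollifier (?e n) (x - y) = 0" for y
      proof (cases "y \<in> cball 0 R")
        case True
        then have "norm (x - y) \<ge> 1" using x norm_triangle_ineq2[of x y] by auto
        then have "mollifier (?e n) (x - y) = 0"
          by (intro mollifier_zero(1)[OF e(1)]) (use e(2)[of n] in linarith)
        then show ?thesis by simp
      qed (use supp in auto)
      then show ?thesis unfolding mollify_def by (simp only: Bochner_Integration.integral_zero)
    qed
  qed
  then show ?thesis
    using mollify_self_adjoint[OF e(1) f L2_continuous_compact] by (simp add: mult.commute)
qed

end

text \<open>Lebesgue measurability supplies continuous functions converging almost everywhere.
  Clipping them at height \<open>M\<close> and multiplying by a cut-off that is 1 on the ball of
  radius \<open>R\<close> and 0 beyond R + 1 keeps the limit and adds the bounds.\<close>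

lemma continuous_approximation:
  fixes \<psi> :: "'a::euclidean_space \<Rightarrow> real"
  assumes meas: "\<psi> \<in> borel_measurable borel" and bd: "\<And>x. \<bar>\<psi> x\<bar> \<le> M" and supp: "\<And>x. x \<notin> cball 0 R \<Longrightarrow> \<psi> x = 0"
  shows "\<exists>g :: nat \<Rightarrow> 'a \<Rightarrow> real. (\<forall>n. continuous_on UNIV (g n)) \<and> (\<forall>n x. \<bar>g n x\<bar> \<le> M) \<and>
    (\<forall>n x. x \<notin> cball 0 (R + 1) \<longrightarrow> g n x = 0) \<and> (AE x in lborel. (\<lambda>n. g n x) \<longlonglongrightarrow> \<psi> x)"
proof -
  have M: "M \<ge> 0" using bd[of 0] by linarith
  have "\<psi> \<in> borel_measurable lebesgue" by (rule measurable_completion) (use meas in simp)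
  then have "\<psi> measurable_on UNIV"
    using measurable_on_iff_borel_measurable[of UNIV \<psi>] by (simp add: lebesgue_on_UNIV_eq)
  then obtain N h where N: "negligible N" and h: "\<And>n. continuous_on UNIV (h n)"
      "\<And>x. x \<notin> N \<Longrightarrow> (\<lambda>n. h n x) \<longlonglongrightarrow> \<psi> x"
    unfolding measurable_on_def by auto
  define cut where "cut = (\<lambda>x::'a. max 0 (min 1 (R + 1 - norm x)))"
  define g where "g = (\<lambda>n x. max (- M) (min M (h n x)) * cut x)"
  have cut: "0 \<le> cut x" "cut x \<le> 1" for x by (auto simp: cut_def)
  show ?thesis
  proof (intro exI[of _ g] conjI allI impI)
    show "continuous_on UNIV (g n)" for n
      unfolding g_def cut_def by (intro continuous_intros h)
    show "\<bar>g n x\<bar> \<le> M" for n x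
    proof -
      have "\<bar>g n x\<bar> \<le> M * 1" unfolding g_def abs_mult using M cut[of x] by (intro mult_mono) auto
      then show ?thesis by simp
    qed
    show "g n x = 0" if "x \<notin> cball 0 (R + 1)" for n x using that by (simp add: g_def cut_def)
    have "AE x in lebesgue. x \<notin> N" using N by (simp add: negligible_iff_null_sets AE_not_in)
    then have "AE x in lborel. x \<notin> N" by (simp add: AE_completion_iff)
    then show "AE x in lborel. (\<lambda>n. g n x) \<longlonglongrightarrow> \<psi> x"
    proof eventually_elim
      case (elim x)
      have "(\<lambda>n. g n x) \<longlonglongrightarrow> max (- M) (min M (\<psi> x)) * cut x"
        unfolding g_def by (intro tendsto_intros h elim)
      moreover have "max (- M) (min M (\<psi> x)) = \<psi> x" using bd[of x] by auto
      moreover have "\<psi> x * cut x = \<psi> x" using supp[of x] by (auto simp: cut_def)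
      ultimately show ?case by simp
    qed
  qed
qed

subsection \<open>Uniqueness of weak derivatives\<close>

text \<open>Mollifiers are test functions, so all mollifications of \<open>h\<close> vanish and
  \<open>h\<close> is orthogonal to continuous functions of compact support. Approximating the sign
  of \<open>h\<close> on a ball by such functions shows that |h| integrates to 0 there.\<close>

lemma test_function_orthogonal_zero:
  fixes h :: "'a::euclidean_space \<Rightarrow> real"
  assumes h: "L2 h" and orth: "\<And>\<psi>. test_function \<psi> \<Longrightarrow> (\<integral>x. h x * \<psi> x \<partial>lborel) = 0"
  shows "AE x in lborel. h x = 0"
proof -
  note [measurable] = L2_measurable[OF h]
  have "mollify e h x = 0" if "e > 0" for e x
    using orth[OF test_function_mollifier(1)[OF that, of x]] by (simp add: mollify_def)
  then have cont0: "(\<integral>x. \<psi> x * h x \<partial>lborel) = 0"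
    if "continuous_on UNIV \<psi>" "\<And>x. \<bar>\<psi> x\<bar> \<le> M" "\<And>x. x \<notin> cball 0 R \<Longrightarrow> \<psi> x = 0" for \<psi> M R
    using mollify_weak_limit[OF that h] by (simp add: LIMSEQ_const_iff)
  have "AE x in lborel. x \<in> cball 0 (real m) \<longrightarrow> h x = 0" for m :: nat
  proof -
    let ?\<psi> = "\<lambda>x. sgn (h x) * indicator (cball 0 (real m)) x"
    have "indicator (cball 0 (real m)) \<in> borel_measurable (borel :: 'a measure)"
      by (rule borel_measurable_indicator) auto
    moreover have "(\<lambda>x. sgn (h x)) \<in> borel_measurable borel" by measurable
    ultimately have meas: "?\<psi> \<in> borel_measurable borel" by (rule borel_measurable_times[rotated])
    have "\<bar>?\<psi> x\<bar> \<le> 1" "x \<notin> cball 0 (real m) \<Longrightarrow> ?\<psi> x = 0" for x by (auto simp: indicator_def sgn_if)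
    from continuous_approximation[OF meas this] obtain g where "\<forall>n. continuous_on UNIV (g n)"
      "\<forall>n x. \<bar>g n x\<bar> \<le> 1" "\<forall>n x. x \<notin> cball 0 (real m + 1) \<longrightarrow> g n x = 0"
      "AE x in lborel. (\<lambda>n. g n x) \<longlonglongrightarrow> ?\<psi> x" by blast
    note g = this(1-3)[rule_format] this(4)
    have "(\<lambda>n. \<integral>x. h x * g n x \<partial>lborel) \<longlonglongrightarrow> (\<integral>x. h x * ?\<psi> x \<partial>lborel)"
      by (rule L2_integral_limit[OF h borel_measurable_continuous_onI[OF g(1)] g(2,3,4) meas])
    moreover have "(\<integral>x. h x * g n x \<partial>lborel) = 0" for n
      by (subst mult.commute) (rule cont0[OF g(1,2,3)])
    ultimately have "(\<integral>x. h x * ?\<psi> x \<partial>lborel) = 0" by (simp add: LIMSEQ_const_iff)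
    moreover have "integrable lborel (\<lambda>x. h x * ?\<psi> x)"
      by (intro L2_integrable_mult h L2_bounded_support[of _ 1 "real m"] meas) (auto simp: indicator_def sgn_if)
    moreover have "(\<lambda>x. h x * ?\<psi> x) = (\<lambda>x. \<bar>h x\<bar> * indicator (cball 0 (real m)) x)"
      by (simp add: abs_sgn mult.assoc)
    ultimately have "AE x in lborel. \<bar>h x\<bar> * indicator (cball 0 (real m)) x = 0"
      using integral_nonneg_eq_0_iff_AE[of lborel "\<lambda>x. \<bar>h x\<bar> * indicator (cball 0 (real m)) x"] by simp
    then show ?thesis by eventually_elim (auto simp: indicator_def)
  qed
  then have "AE x in lborel. \<forall>m. x \<in> cball 0 (real m) \<longrightarrow> h x = 0"
    by (rule AE_all_countable[THEN iffD2, rule_format])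
  then show ?thesis
  proof eventually_elim
    case (elim x)
    obtain m where "norm x \<le> real m" using real_arch_simple by blast
    then show ?case using elim by auto
  qed
qed

lemma test_function_L2:
  fixes \<psi> :: "'a::euclidean_space \<Rightarrow> real"
  assumes "test_function \<psi>"
  shows "L2 \<psi>" and "b \<in> Basis \<Longrightarrow> L2 (\<lambda>x. frechet_derivative \<psi> (at x) b)"
proof -
  let ?S = "closure {x. \<psi> x \<noteq> 0}"
  have \<psi>: "compact ?S" "\<And>x. \<psi> differentiable (at x)" using assms by (auto simp: test_function_def)
  have *: "L2 g" if c: "continuous_on UNIV g" and s: "\<And>x. x \<notin> ?S \<Longrightarrow> g x = 0" for g :: "'a \<Rightarrow> real"
  proof -
    have "compact (g ` ?S)" by (rule compact_continuous_image[OF continuous_on_subset[OF c] \<psi>(1)]) auto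
    then obtain C where C: "\<And>x. x \<in> ?S \<Longrightarrow> \<bar>g x\<bar> \<le> C" by (metis bounded_iff compact_imp_bounded imageI real_norm_def)
    obtain R where R: "?S \<subseteq> cball 0 R" using compact_imp_bounded[OF \<psi>(1)] by (auto simp: bounded_iff subset_iff)
    show ?thesis
    proof (rule L2_bounded_support[of _ "max C 0" R])
      show "g \<in> borel_measurable borel" by (rule borel_measurable_continuous_onI[OF c])
      show "\<bar>g x\<bar> \<le> max C 0" for x using C[of x] s[of x] by (cases "x \<in> ?S") auto
      show "g x = 0" if "x \<notin> cball 0 R" for x using R s that by blast
    qed
  qed
  have z: "\<psi> x = 0" if "x \<notin> ?S" for x using that closure_subset[of "{x. \<psi> x \<noteq> 0}"] by blast
  show "L2 \<psi>"
  proof (rule *[OF _ z])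
    show "continuous_on UNIV \<psi>"
      using \<psi>(2) by (intro differentiable_imp_continuous_on) (simp add: differentiable_on_def)
  qed
  show "L2 (\<lambda>x. frechet_derivative \<psi> (at x) b)" if "b \<in> Basis"
  proof (rule *)
    show "continuous_on UNIV (\<lambda>x. frechet_derivative \<psi> (at x) b)" using assms that by (simp add: test_function_def)
    fix x assume x: "x \<notin> ?S"
    have "((\<lambda>x. 0) has_derivative (\<lambda>h. 0)) (at x)" by simp
    then have "(\<psi> has_derivative (\<lambda>h. 0)) (at x)"
    proof (rule has_derivative_transform_within_open)
      show "open (- ?S)" by (rule open_Compl[OF closed_closure])
      show "x \<in> - ?S" using x by blast
      show "0 = \<psi> y" if "y \<in> - ?S" for y using z that by (metis ComplD)
    qed
    from frechet_derivative_at[OF this, symmetric] show "frechet_derivative \<psi> (at x) b = 0" by simp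
  qed
qed

lemma weak_deriv_unique:
  assumes "L2 g" "L2 g'" "weak_deriv b f g" "weak_deriv b f g'"
  shows "AE x in lborel. g x = g' x"
proof -
  have g': "L2 (\<lambda>x. - 1 * g' x)" by (rule L2_scale[OF assms(2)])
  have "AE x in lborel. g x + - 1 * g' x = 0"
  proof (rule test_function_orthogonal_zero)
    show "L2 (\<lambda>x. g x + - 1 * g' x)" by (rule L2_add[OF assms(1) g'])
    fix \<psi> :: "'a \<Rightarrow> real" assume \<psi>: "test_function \<psi>"
    have "- (\<integral>x. g x * \<psi> x \<partial>lborel) = - (\<integral>x. g' x * \<psi> x \<partial>lborel)"
      by (rule trans[OF assms(3)[unfolded weak_deriv_def, rule_format, OF \<psi>, symmetric] assms(4)[unfolded weak_deriv_def, rule_format, OF \<psi>]])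
    then have "(\<integral>x. g x * \<psi> x \<partial>lborel) = (\<integral>x. g' x * \<psi> x \<partial>lborel)" by simp
    then show "(\<integral>x. (g x + - 1 * g' x) * \<psi> x \<partial>lborel) = 0"
      using L2_integrable_mult[OF assms(1) test_function_L2(1)[OF \<psi>]] L2_integrable_mult[OF assms(2) test_function_L2(1)[OF \<psi>]]
      by (simp add: left_diff_distrib)
  qed
  then show ?thesis by eventually_elim simp
qed

lemma weak_deriv_linear:
  assumes "b \<in> Basis" "L2 f" "L2 f'" "L2 g" "L2 g'" "weak_deriv b f g" "weak_deriv b f' g'"
  shows "weak_deriv b (\<lambda>x. r * f x + s * f' x) (\<lambda>x. r * g x + s * g' x)"
  unfolding weak_deriv_def
proof (intro allI impI)
  fix \<psi> :: "'a \<Rightarrow> real" assume \<psi>: "test_function \<psi>"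
  note L = test_function_L2(1)[OF \<psi>] test_function_L2(2)[OF \<psi> assms(1)]
  have "(\<integral>x. (r * f x + s * f' x) * frechet_derivative \<psi> (at x) b \<partial>lborel)
      = r * (\<integral>x. f x * frechet_derivative \<psi> (at x) b \<partial>lborel) + s * (\<integral>x. f' x * frechet_derivative \<psi> (at x) b \<partial>lborel)"
    using L2_integrable_mult[OF assms(2) L(2)] L2_integrable_mult[OF assms(3) L(2)]
    by (simp add: distrib_right mult.assoc)
  also have "\<dots> = - (\<integral>x. (r * g x + s * g' x) * \<psi> x \<partial>lborel)"
    using L2_integrable_mult[OF assms(4) L(1)] L2_integrable_mult[OF assms(5) L(1)]
    by (simp add: distrib_right mult.assoc assms(6,7)[unfolded weak_deriv_def, rule_format, OF \<psi>])
  finally show "(\<integral>x. (r * f x + s * f' x) * frechet_derivative \<psi> (at x) b \<partial>lborel) = - (\<integral>x. (r * g x + s * g' x) * \<psi> x \<partial>lborel)" .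
qed

subsection \<open>Lebesgue measure on a finite power as a product measure\<close>

lemma prod_Basis_vec:
  fixes f :: "'a::euclidean_space ^ 'n \<Rightarrow> 'b::comm_monoid_mult"
  shows "(\<Prod>b\<in>Basis. f b) = (\<Prod>i\<in>UNIV. \<Prod>c\<in>Basis. f (axis i c))"
proof -
  have inj: "inj_on (\<lambda>(i, c). axis i c :: 'a ^ 'n) (UNIV \<times> Basis)"
    by (auto simp: inj_on_def axis_eq_axis)
  have "(Basis :: ('a ^ 'n) set) = (\<lambda>(i, c). axis i c) ` (UNIV \<times> Basis)"
    by (auto simp: Basis_vec_def)
  then have "prod f Basis = prod f ((\<lambda>(i, c). axis i c) ` (UNIV \<times> Basis))" by (rule arg_cong)
  then show ?thesis
    using prod.reindex[OF inj, of f] by (simp add: prod.cartesian_product case_prod_unfold comp_def)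
qed

lemma vec_lambda_measurable [measurable]:
  "(\<lambda>f. \<chi> i. f i) \<in> (\<Pi>\<^sub>M i\<in>(UNIV :: 'n::finite set). lborel) \<rightarrow>\<^sub>M (borel :: ('a::euclidean_space ^ 'n) measure)"
proof (rule borel_measurable_euclidean_space[THEN iffD2], rule ballI)
  fix b :: "'a ^ 'n" assume "b \<in> Basis"
  then obtain i c where b: "b = axis i c" by (auto simp: Basis_vec_def)
  have "(\<lambda>f. (\<chi> i. f i) \<bullet> b) = (\<lambda>f. f i \<bullet> c)" by (simp add: b inner_axis)
  then show "(\<lambda>f. (\<chi> i. f i) \<bullet> b) \<in> borel_measurable (\<Pi>\<^sub>M i\<in>UNIV. lborel)" by simp
qed

lemma mem_box_vec:
  "(x :: 'a::euclidean_space ^ 'n) \<in> box l u \<longleftrightarrow> (\<forall>i. x $ i \<in> box (l $ i) (u $ i))"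
  unfolding mem_box Basis_vec_def by (auto simp: inner_axis)

text \<open>Lebesgue measure is determined by its values on boxes, and a box in the power is a
  product of boxes. Through this identity Fubini can single out the coordinate of one
  particle.\<close>

lemma lborel_vec:
  "(lborel :: ('a::euclidean_space ^ 'n::finite) measure) = distr (\<Pi>\<^sub>M i\<in>UNIV. lborel) borel (\<lambda>f. \<chi> i. f i)"
proof (rule lborel_eqI)
  fix l u :: "'a ^ 'n" assume lu: "\<And>b. b \<in> Basis \<Longrightarrow> l \<bullet> b \<le> u \<bullet> b"
  interpret product_sigma_finite "\<lambda>_::'n. lborel :: 'a measure" ..
  have lui: "l $ i \<bullet> c \<le> u $ i \<bullet> c" if "c \<in> Basis" for i c
    using lu[of "axis i c"] that by (auto simp: Basis_vec_def inner_axis)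
  have "(\<lambda>f. \<chi> i. f i) -` box l u \<inter> space (\<Pi>\<^sub>M i\<in>UNIV. lborel) = (\<Pi>\<^sub>E i\<in>UNIV. box (l $ i) (u $ i))"
    by (auto simp: mem_box_vec space_PiM PiE_def Pi_def)
  then have "emeasure (distr (\<Pi>\<^sub>M i\<in>UNIV. lborel) borel (\<lambda>f. \<chi> i. f i)) (box l u)
      = emeasure (\<Pi>\<^sub>M i\<in>UNIV. lborel) (\<Pi>\<^sub>E i\<in>UNIV. box (l $ i) (u $ i))"
    by (subst emeasure_distr) auto
  also have "\<dots> = (\<Prod>i\<in>UNIV. emeasure lborel (box (l $ i) (u $ i)))"
    by (rule emeasure_PiM) auto
  also have "\<dots> = (\<Prod>i\<in>UNIV. ennreal (\<Prod>c\<in>Basis. (u $ i - l $ i) \<bullet> c))"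
    by (intro prod.cong refl) (simp add: emeasure_lborel_box lui)
  also have "\<dots> = ennreal (\<Prod>i\<in>UNIV. \<Prod>c\<in>Basis. (u $ i - l $ i) \<bullet> c)"
    by (intro prod_ennreal prod_nonneg) (auto simp: lui inner_diff_left)
  also have "(\<Prod>i\<in>UNIV. \<Prod>c\<in>Basis. (u $ i - l $ i) \<bullet> c) = prod ((\<bullet>) (u - l)) Basis"
    by (simp add: prod_Basis_vec inner_axis)
  finally show "emeasure (distr (\<Pi>\<^sub>M i\<in>UNIV. lborel) borel (\<lambda>f. \<chi> i. f i)) (box l u) = ennreal (prod ((\<bullet>) (u - l)) Basis)" .
qed simp

lemma integral_lborel_vec:
  fixes F :: "'a::euclidean_space ^ 'n::finite \<Rightarrow> real"
  assumes "F \<in> borel_measurable borel"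
  shows "(\<integral>x. F x \<partial>lborel) = (\<integral>f. F (\<chi> i. f i) \<partial>(\<Pi>\<^sub>M i\<in>UNIV. lborel))"
    "integrable lborel F \<longleftrightarrow> integrable (\<Pi>\<^sub>M i\<in>UNIV. lborel) (\<lambda>f. F (\<chi> i. f i))"
  using assms by (auto simp: lborel_vec[where 'a='a and 'n='n] integral_distr integrable_distr_eq)

lemma nn_integral_lborel_vec:
  fixes F :: "'a::euclidean_space ^ 'n::finite \<Rightarrow> ennreal"
  assumes "F \<in> borel_measurable borel"
  shows "(\<integral>\<^sup>+x. F x \<partial>lborel) = (\<integral>\<^sup>+f. F (\<chi> i. f i) \<partial>(\<Pi>\<^sub>M i\<in>UNIV. lborel))"
  using assms by (simp add: lborel_vec[where 'a='a and 'n='n] nn_integral_distr)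

lemma vector_measurable [measurable]:
  assumes [measurable]: "f \<in> borel_measurable M" "g \<in> borel_measurable M" "h \<in> borel_measurable M"
  shows "(\<lambda>x. vector [f x, g x, h x] :: real ^ 3) \<in> borel_measurable M"
proof (rule borel_measurable_euclidean_space[THEN iffD2], rule ballI)
  fix b :: "real ^ 3" assume "b \<in> Basis"
  then obtain i where b: "b = axis i 1" by (auto simp: Basis_vec_def)
  show "(\<lambda>x. (vector [f x, g x, h x] :: real^3) \<bullet> b) \<in> borel_measurable M"
    using exhaust_3[of i] by (auto simp: b inner_axis)
qed

lemma nn_integral_real3:
  fixes F :: "real ^ 3 \<Rightarrow> ennreal"
  assumes [measurable]: "F \<in> borel_measurable borel"
  shows "(\<integral>\<^sup>+v. F v \<partial>lborel) = (\<integral>\<^sup>+z. \<integral>\<^sup>+y. \<integral>\<^sup>+x. F (vector [x, y, z]) \<partial>lborel \<partial>lborel \<partial>lborel)"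
proof -
  interpret product_sigma_finite "\<lambda>_::3. lborel :: real measure" ..
  let ?G = "\<lambda>f. F (vector [f 1, f 2, f 3])"
  have vec: "(\<chi> i. f i) = (vector [f 1, f 2, f 3] :: real^3)" for f :: "3 \<Rightarrow> real"
    by (simp add: vec_eq_iff forall_3)
  have U: "(UNIV :: 3 set) = insert 1 (insert 2 {3})" by (auto simp: UNIV_3)
  have m1: "?G \<in> borel_measurable (\<Pi>\<^sub>M i\<in>insert 1 (insert 2 {3::3}). lborel)" by measurable
  have "(\<integral>\<^sup>+v. F v \<partial>lborel) = (\<integral>\<^sup>+f. ?G f \<partial>(\<Pi>\<^sub>M i\<in>insert 1 (insert 2 {3::3}). lborel))"
    by (simp add: nn_integral_lborel_vec vec U[symmetric])
  also have "\<dots> = (\<integral>\<^sup>+f. \<integral>\<^sup>+x. F (vector [x, f 2, f 3]) \<partial>lborel \<partial>(\<Pi>\<^sub>M i\<in>insert 2 {3::3}. lborel))"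
    by (subst product_nn_integral_insert[OF _ _ m1]) auto
  also have "\<dots> = (\<integral>\<^sup>+f. \<integral>\<^sup>+y. \<integral>\<^sup>+x. F (vector [x, y, f 3]) \<partial>lborel \<partial>lborel \<partial>(\<Pi>\<^sub>M i\<in>{3::3}. lborel))"
  proof (subst product_nn_integral_insert)
    show "(\<lambda>f. \<integral>\<^sup>+x. F (vector [x, f 2, f 3]) \<partial>lborel) \<in> borel_measurable (\<Pi>\<^sub>M i\<in>insert 2 {3::3}. lborel)"
      by measurable
  qed auto
  also have "\<dots> = (\<integral>\<^sup>+z. \<integral>\<^sup>+y. \<integral>\<^sup>+x. F (vector [x, y, z]) \<partial>lborel \<partial>lborel \<partial>lborel)"
    by (rule product_nn_integral_singleton) measurable
  finally show ?thesis .
qed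

subsection \<open>The Sobolev embedding of \<open>H\<^sup>1(\<real>\<^sup>3)\<close> into \<open>L\<^sup>6(\<real>\<^sup>3)\<close>\<close>

text \<open>Two Cauchy--Schwarz inequalities: one over (z, y), separating \<open>p\<close> from the
  inner integral \<open>J\<close>, and one over x inside \<open>J\<close>. The bound for the square
  of \<open>J\<close> is a function of z times a function of y, so it integrates to a
  product.\<close>

lemma loomis_whitney:
  fixes p q r :: "real \<times> real \<Rightarrow> ennreal"
  assumes [measurable]: "p \<in> borel_measurable borel" "q \<in> borel_measurable borel" "r \<in> borel_measurable borel"
  shows "(\<integral>\<^sup>+z. \<integral>\<^sup>+y. \<integral>\<^sup>+x. p (y, z) * q (x, z) * r (x, y) \<partial>lborel \<partial>lborel \<partial>lborel)\<^sup>2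
    \<le> (\<integral>\<^sup>+z. \<integral>\<^sup>+y. (p (y, z))\<^sup>2 \<partial>lborel \<partial>lborel) * ((\<integral>\<^sup>+z. \<integral>\<^sup>+x. (q (x, z))\<^sup>2 \<partial>lborel \<partial>lborel) * (\<integral>\<^sup>+y. \<integral>\<^sup>+x. (r (x, y))\<^sup>2 \<partial>lborel \<partial>lborel))"
proof -
  have [measurable]: "p \<in> borel_measurable (borel \<Otimes>\<^sub>M borel)" "q \<in> borel_measurable (borel \<Otimes>\<^sub>M borel)" "r \<in> borel_measurable (borel \<Otimes>\<^sub>M borel)"
    using assms by (simp_all add: borel_prod)
  define J where "J = (\<lambda>(z, y). \<integral>\<^sup>+x. q (x, z) * r (x, y) \<partial>lborel)"
  have J[measurable]: "J \<in> borel_measurable (lborel \<Otimes>\<^sub>M lborel)" unfolding J_def by measurable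
  let ?p = "\<lambda>(z, y). p (y, z)"
  have "(\<integral>\<^sup>+z. \<integral>\<^sup>+y. \<integral>\<^sup>+x. p (y, z) * q (x, z) * r (x, y) \<partial>lborel \<partial>lborel \<partial>lborel)
      = (\<integral>\<^sup>+z. \<integral>\<^sup>+y. ?p (z, y) * J (z, y) \<partial>lborel \<partial>lborel)"
    by (simp add: J_def mult.assoc nn_integral_cmult)
  also have "\<dots> = (\<integral>\<^sup>+w. ?p w * J w \<partial>(lborel \<Otimes>\<^sub>M lborel))"
    by (rule lborel.nn_integral_fst) measurable
  finally have "(\<integral>\<^sup>+z. \<integral>\<^sup>+y. \<integral>\<^sup>+x. p (y, z) * q (x, z) * r (x, y) \<partial>lborel \<partial>lborel \<partial>lborel)\<^sup>2
      \<le> (\<integral>\<^sup>+w. (?p w)\<^sup>2 \<partial>(lborel \<Otimes>\<^sub>M lborel)) * (\<integral>\<^sup>+w. (J w)\<^sup>2 \<partial>(lborel \<Otimes>\<^sub>M lborel))"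
    using Cauchy_Schwarz_nn_integral[of ?p "lborel \<Otimes>\<^sub>M lborel" J] by simp
  also have "(\<integral>\<^sup>+w. (?p w)\<^sup>2 \<partial>(lborel \<Otimes>\<^sub>M lborel)) = (\<integral>\<^sup>+z. \<integral>\<^sup>+y. (p (y, z))\<^sup>2 \<partial>lborel \<partial>lborel)"
    by (subst lborel.nn_integral_fst[symmetric]) auto
  also have "(\<integral>\<^sup>+w. (J w)\<^sup>2 \<partial>(lborel \<Otimes>\<^sub>M lborel)) = (\<integral>\<^sup>+z. \<integral>\<^sup>+y. (J (z, y))\<^sup>2 \<partial>lborel \<partial>lborel)"
    by (subst lborel.nn_integral_fst[symmetric]) auto
  also have "\<dots> \<le> (\<integral>\<^sup>+z. \<integral>\<^sup>+y. (\<integral>\<^sup>+x. (q (x, z))\<^sup>2 \<partial>lborel) * (\<integral>\<^sup>+x. (r (x, y))\<^sup>2 \<partial>lborel) \<partial>lborel \<partial>lborel)"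
    unfolding J_def prod.case by (intro nn_integral_mono Cauchy_Schwarz_nn_integral) auto
  also have "\<dots> = (\<integral>\<^sup>+z. \<integral>\<^sup>+x. (q (x, z))\<^sup>2 \<partial>lborel \<partial>lborel) * (\<integral>\<^sup>+y. \<integral>\<^sup>+x. (r (x, y))\<^sup>2 \<partial>lborel \<partial>lborel)"
    by (simp add: nn_integral_cmult nn_integral_multc)
  finally show ?thesis by (simp add: mult_left_mono)
qed

text \<open>The factors in \<open>loomis_whitney\<close> will be square roots of line integrals,
  which may be infinite on some lines.\<close>

definition ennsqrt :: "ennreal \<Rightarrow> ennreal" where
  "ennsqrt a = (if a = \<infinity> then \<infinity> else ennreal (sqrt (enn2real a)))"

lemma ennsqrt_measurable [measurable]: "ennsqrt \<in> borel_measurable borel"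
  unfolding ennsqrt_def by measurable

lemma ennsqrt_square: "(ennsqrt a)\<^sup>2 = a"
  by (cases a) (auto simp: ennsqrt_def ennreal_power power2_eq_square ennreal_mult[symmetric])

lemma ennsqrt_ge: "0 \<le> a \<Longrightarrow> ennreal (a\<^sup>2) \<le> b \<Longrightarrow> ennreal a \<le> ennsqrt b"
proof (cases b)
  case (real c)
  assume "0 \<le> a" "ennreal (a\<^sup>2) \<le> b"
  then have "a\<^sup>2 \<le> c" using real by simp
  then have "a \<le> sqrt c" by (simp add: real_le_rsqrt)
  then show ?thesis using real by (simp add: ennsqrt_def ennreal_leI)
qed (simp add: ennsqrt_def)

text \<open>The fundamental theorem of calculus on [x - n, x], with the left end running to minus
  infinity.\<close>

lemma line_bound:
  fixes v v' :: "real \<Rightarrow> real"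
  assumes der: "\<And>t. (v has_real_derivative v' t) (at t)" and cont: "continuous_on UNIV v'"
    and lim: "(\<lambda>n. v (x - real n)) \<longlonglongrightarrow> 0"
  shows "ennreal (v x) \<le> (\<integral>\<^sup>+t. ennreal \<bar>v' t\<bar> \<partial>lborel)"
proof -
  have meas [measurable]: "v' \<in> borel_measurable borel" by (rule borel_measurable_continuous_onI[OF cont])
  have *: "ennreal (v x - v (x - real n)) \<le> (\<integral>\<^sup>+t. ennreal \<bar>v' t\<bar> \<partial>lborel)" for n
  proof -
    have b: "has_bochner_integral lborel (\<lambda>t. v' t * indicator {x - real n..x} t) (v x - v (x - real n))"
      by (rule has_bochner_integral_FTC_Icc_real) (use der cont in \<open>auto simp: continuous_on_eq_continuous_at\<close>)
    have "ennreal (v x - v (x - real n)) \<le> ennreal (norm (v x - v (x - real n)))" by (intro ennreal_leI) simp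
    also have "\<dots> \<le> (\<integral>\<^sup>+t. norm (v' t * indicator {x - real n..x} t) \<partial>lborel)"
      using has_bochner_integral_norm_bound[OF b] .
    also have "\<dots> \<le> (\<integral>\<^sup>+t. ennreal \<bar>v' t\<bar> \<partial>lborel)"
      by (intro nn_integral_mono ennreal_leI) (auto simp: indicator_def)
    finally show ?thesis .
  qed
  have "(\<lambda>n. ennreal (v x - v (x - real n))) \<longlonglongrightarrow> ennreal (v x - 0)"
    by (intro tendsto_intros lim)
  then show ?thesis using * by (intro LIMSEQ_le_const2) auto
qed

lemma prod_3: "prod f (UNIV :: 3 set) = f 1 * f 2 * f 3"
  unfolding UNIV_3 by (simp add: ac_simps)

text \<open>The fourth power of \<open>u\<close> has derivative 4 u^3 d_i u along axis i, so it is
  bounded by the integral I_i over each of the three axis lines through the point. The product of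
  the three square roots bounds u^6, and \<open>loomis_whitney\<close> gives S^2 \<le> I_1 I_2 I_3
  for the total integrals. Cauchy--Schwarz yields I_i^2 \<le> 16 S G_i, hence S^4 \<le> 16^3 S^3 G_1
  G_2 G_3, where 16^3 is the 4096 of the statement.\<close>

lemma gagliardo_nirenberg_R3:
  fixes u :: "real ^ 3 \<Rightarrow> real" and d :: "3 \<Rightarrow> real ^ 3 \<Rightarrow> real"
  assumes cu: "continuous_on UNIV u" and cd: "\<And>i. continuous_on UNIV (d i)"
    and der: "\<And>i x s. ((\<lambda>s. u (x + s *\<^sub>R axis i 1)) has_real_derivative d i (x + s *\<^sub>R axis i 1)) (at s)"
    and decay: "\<And>X. filterlim (\<lambda>n. norm (X n)) at_top sequentially \<Longrightarrow> (\<lambda>n. u (X n)) \<longlonglongrightarrow> 0"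
    and fin: "(\<integral>\<^sup>+x. ennreal ((u x) ^ 6) \<partial>lborel) < \<infinity>"
  shows "(\<integral>\<^sup>+x. ennreal ((u x) ^ 6) \<partial>lborel) \<le> 4096 * (\<Prod>i\<in>UNIV. \<integral>\<^sup>+x. ennreal ((d i x)\<^sup>2) \<partial>lborel)"
proof -
  have mu [measurable]: "u \<in> borel_measurable borel" and md [measurable]: "d i \<in> borel_measurable borel" for i
    using cu cd by (auto intro: borel_measurable_continuous_onI)
  define h where "h i x = ennreal (4 * \<bar>u x\<bar> ^ 3 * \<bar>d i x\<bar>)" for i x
  have mh [measurable]: "h i \<in> borel_measurable borel" for i unfolding h_def by measurable
  have line: "ennreal (u (w + a *\<^sub>R axis i 1) ^ 4) \<le> (\<integral>\<^sup>+t. h i (w + t *\<^sub>R axis i 1) \<partial>lborel)" for w a i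
  proof -
    let ?l = "\<lambda>t. w + t *\<^sub>R axis i 1"
    have "ennreal (u (?l a) ^ 4) \<le> (\<integral>\<^sup>+t. ennreal \<bar>4 * u (?l t) ^ 3 * d i (?l t)\<bar> \<partial>lborel)"
    proof (rule line_bound[where v = "\<lambda>t. u (?l t) ^ 4"])
      show "((\<lambda>t. u (?l t) ^ 4) has_real_derivative 4 * u (?l t) ^ 3 * d i (?l t)) (at t)" for t
        using DERIV_power[OF der[of w i t], of 4] by (simp add: mult_ac)
      show "continuous_on UNIV (\<lambda>t. 4 * u (?l t) ^ 3 * d i (?l t))"
        by (intro continuous_intros continuous_on_compose2[OF cu] continuous_on_compose2[OF cd]) auto
      have "filterlim (\<lambda>n. norm (?l (a - real n))) at_top sequentially"
      proof (rule filterlim_at_top_mono)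
        show "filterlim (\<lambda>n. real n - (\<bar>a\<bar> + norm w)) at_top sequentially"
          using filterlim_tendsto_add_at_top[OF tendsto_const filterlim_real_sequentially, of "- (\<bar>a\<bar> + norm w)"] by (simp add: algebra_simps)
        have "real n - (\<bar>a\<bar> + norm w) \<le> norm (?l (a - real n))" for n
        proof -
          have "norm ((a - real n) *\<^sub>R axis i (1::real)) - norm w \<le> norm (?l (a - real n))"
            using norm_diff_ineq[of "(a - real n) *\<^sub>R axis i (1::real)" w] by (simp add: add.commute)
          then show ?thesis by simp
        qed
        then show "\<forall>\<^sub>F n in sequentially. real n - (\<bar>a\<bar> + norm w) \<le> norm (?l (a - real n))" by simp
      qed
      from tendsto_power[OF decay[OF this], of 4] show "(\<lambda>n. u (?l (a - real n)) ^ 4) \<longlonglongrightarrow> 0" by simp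
    qed
    then show ?thesis by (simp add: h_def abs_mult power_abs)
  qed
  have vec: "vector [x, y, z] = vector [0, y, z] + x *\<^sub>R (axis 1 1 :: real^3)"
      "vector [x, y, z] = vector [x, 0, z] + y *\<^sub>R (axis 2 1 :: real^3)"
      "vector [x, y, z] = vector [x, y, 0] + z *\<^sub>R (axis 3 1 :: real^3)" for x y z :: real
    by (simp_all add: vec_eq_iff forall_3 axis_def)
  define p where "p = (\<lambda>(y, z). ennsqrt (\<integral>\<^sup>+x. h 1 (vector [x, y, z]) \<partial>lborel))"
  define q where "q = (\<lambda>(x, z). ennsqrt (\<integral>\<^sup>+y. h 2 (vector [x, y, z]) \<partial>lborel))"
  define r where "r = (\<lambda>(x, y). ennsqrt (\<integral>\<^sup>+z. h 3 (vector [x, y, z]) \<partial>lborel))"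
  have [measurable]: "p \<in> borel_measurable borel" "q \<in> borel_measurable borel" "r \<in> borel_measurable borel"
    unfolding p_def q_def r_def borel_prod[symmetric] by measurable
  define S where "S = (\<integral>\<^sup>+x. ennreal ((u x) ^ 6) \<partial>lborel)"
  define G where "G i = (\<integral>\<^sup>+x. ennreal ((d i x)\<^sup>2) \<partial>lborel)" for i
  define I where "I i = (\<integral>\<^sup>+x. h i x \<partial>lborel)" for i
  have pt: "ennreal (u (vector [x, y, z]) ^ 6) \<le> p (y, z) * q (x, z) * r (x, y)" for x y z
  proof -
    let ?u = "u (vector [x, y, z])"
    have "((?u)\<^sup>2)\<^sup>2 = ?u ^ 4" by simp
    then have "ennreal (((?u)\<^sup>2)\<^sup>2) \<le> (\<integral>\<^sup>+x. h 1 (vector [x, y, z]) \<partial>lborel)"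
        "ennreal (((?u)\<^sup>2)\<^sup>2) \<le> (\<integral>\<^sup>+y. h 2 (vector [x, y, z]) \<partial>lborel)"
        "ennreal (((?u)\<^sup>2)\<^sup>2) \<le> (\<integral>\<^sup>+z. h 3 (vector [x, y, z]) \<partial>lborel)"
      using line[of "vector [0, y, z]" x 1] line[of "vector [x, 0, z]" y 2] line[of "vector [x, y, 0]" z 3]
      by (simp_all only: vec[symmetric])
    then have "ennreal ((?u)\<^sup>2) \<le> p (y, z)" "ennreal ((?u)\<^sup>2) \<le> q (x, z)" "ennreal ((?u)\<^sup>2) \<le> r (x, y)"
      unfolding p_def q_def r_def prod.case by (auto intro: ennsqrt_ge)
    then have "ennreal ((?u)\<^sup>2) * ennreal ((?u)\<^sup>2) * ennreal ((?u)\<^sup>2) \<le> p (y, z) * q (x, z) * r (x, y)"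
      by (intro mult_mono) auto
    moreover have "ennreal ((?u)\<^sup>2) * ennreal ((?u)\<^sup>2) * ennreal ((?u)\<^sup>2) = ennreal (?u ^ 6)"
      by (simp flip: ennreal_mult power_add)
    ultimately show ?thesis by simp
  qed
  have "S \<le> (\<integral>\<^sup>+z. \<integral>\<^sup>+y. \<integral>\<^sup>+x. p (y, z) * q (x, z) * r (x, y) \<partial>lborel \<partial>lborel \<partial>lborel)"
    unfolding S_def by (subst nn_integral_real3) (auto intro!: nn_integral_mono pt)
  then have "S\<^sup>2 \<le> (\<integral>\<^sup>+z. \<integral>\<^sup>+y. \<integral>\<^sup>+x. p (y, z) * q (x, z) * r (x, y) \<partial>lborel \<partial>lborel \<partial>lborel)\<^sup>2"
    by (rule power_mono) simp
  also have "\<dots> \<le> (\<integral>\<^sup>+z. \<integral>\<^sup>+y. (p (y, z))\<^sup>2 \<partial>lborel \<partial>lborel) * ((\<integral>\<^sup>+z. \<integral>\<^sup>+x. (q (x, z))\<^sup>2 \<partial>lborel \<partial>lborel) * (\<integral>\<^sup>+y. \<integral>\<^sup>+x. (r (x, y))\<^sup>2 \<partial>lborel \<partial>lborel))"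
    by (rule loomis_whitney) measurable
  also have "(\<integral>\<^sup>+z. \<integral>\<^sup>+y. (p (y, z))\<^sup>2 \<partial>lborel \<partial>lborel) = I 1"
    by (simp add: p_def ennsqrt_square I_def nn_integral_real3)
  also have "(\<integral>\<^sup>+z. \<integral>\<^sup>+x. (q (x, z))\<^sup>2 \<partial>lborel \<partial>lborel) = I 2"
  proof -
    have "(\<integral>\<^sup>+x. \<integral>\<^sup>+y. h 2 (vector [x, y, z]) \<partial>lborel \<partial>lborel) = (\<integral>\<^sup>+y. \<integral>\<^sup>+x. h 2 (vector [x, y, z]) \<partial>lborel \<partial>lborel)" for z
      by (rule lborel_pair.Fubini'[symmetric]) measurable
    then show ?thesis by (simp add: q_def ennsqrt_square I_def nn_integral_real3)
  qed
  also have "(\<integral>\<^sup>+y. \<integral>\<^sup>+x. (r (x, y))\<^sup>2 \<partial>lborel \<partial>lborel) = I 3"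
  proof -
    have "(\<integral>\<^sup>+x. \<integral>\<^sup>+z. h 3 (vector [x, y, z]) \<partial>lborel \<partial>lborel) = (\<integral>\<^sup>+z. \<integral>\<^sup>+x. h 3 (vector [x, y, z]) \<partial>lborel \<partial>lborel)" for y
      by (rule lborel_pair.Fubini'[symmetric]) measurable
    moreover have "(\<integral>\<^sup>+y. \<integral>\<^sup>+z. \<integral>\<^sup>+x. h 3 (vector [x, y, z]) \<partial>lborel \<partial>lborel \<partial>lborel) = (\<integral>\<^sup>+z. \<integral>\<^sup>+y. \<integral>\<^sup>+x. h 3 (vector [x, y, z]) \<partial>lborel \<partial>lborel \<partial>lborel)"
      by (rule lborel_pair.Fubini'[symmetric]) measurable
    ultimately show ?thesis by (simp add: r_def ennsqrt_square I_def nn_integral_real3)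
  qed
  finally have S2: "S\<^sup>2 \<le> I 1 * (I 2 * I 3)" .
  have I: "(I i)\<^sup>2 \<le> 16 * S * G i" for i
  proof -
    have "(I i)\<^sup>2 = (\<integral>\<^sup>+x. ennreal (4 * \<bar>u x\<bar> ^ 3) * ennreal \<bar>d i x\<bar> \<partial>lborel)\<^sup>2"
      by (simp add: I_def h_def ennreal_mult)
    also have "\<dots> \<le> (\<integral>\<^sup>+x. (ennreal (4 * \<bar>u x\<bar> ^ 3))\<^sup>2 \<partial>lborel) * (\<integral>\<^sup>+x. (ennreal \<bar>d i x\<bar>)\<^sup>2 \<partial>lborel)"
      by (rule Cauchy_Schwarz_nn_integral) measurable
    also have "(\<integral>\<^sup>+x. (ennreal (4 * \<bar>u x\<bar> ^ 3))\<^sup>2 \<partial>lborel) = (\<integral>\<^sup>+x. 16 * ennreal ((u x) ^ 6) \<partial>lborel)"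
    proof (intro nn_integral_cong)
      fix x
      have "(4 * \<bar>u x\<bar> ^ 3)\<^sup>2 = 16 * u x ^ 6" by (simp add: power_mult_distrib flip: power_mult)
      then show "(ennreal (4 * \<bar>u x\<bar> ^ 3))\<^sup>2 = 16 * ennreal ((u x) ^ 6)"
        by (simp add: ennreal_power ennreal_mult)
    qed
    also have "\<dots> = 16 * S" by (simp add: S_def nn_integral_cmult)
    also have "(\<integral>\<^sup>+x. (ennreal \<bar>d i x\<bar>)\<^sup>2 \<partial>lborel) = G i" by (simp add: G_def ennreal_power)
    finally show ?thesis .
  qed
  have "(S\<^sup>2)\<^sup>2 \<le> (I 1 * (I 2 * I 3))\<^sup>2" by (rule power_mono[OF S2]) simp
  also have "\<dots> \<le> (16 * S * G 1) * ((16 * S * G 2) * (16 * S * G 3))"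
    unfolding power_mult_distrib by (intro mult_mono I) auto
  also have "\<dots> = S ^ 3 * (4096 * (G 1 * G 2 * G 3))"
    by (simp add: power3_eq_cube algebra_simps)
  finally have main: "S ^ 3 * S \<le> S ^ 3 * (4096 * (G 1 * G 2 * G 3))"
    by (simp add: power2_eq_square power3_eq_cube mult.assoc)
  \<comment> \<open>Cancelling S^3 is where the assumption \<open>fin\<close> is spent.\<close>
  have "S \<le> 4096 * (G 1 * G 2 * G 3)"
  proof (cases "S = 0")
    case False
    have "S ^ 3 \<noteq> 0" using False by simp
    moreover have "S ^ 3 \<noteq> \<infinity>" using fin by (simp add: S_def power_eq_top_ennreal_iff)
    ultimately show ?thesis
      by (rule ennreal_mult_le_mult_iff[THEN iffD1, OF _ _ main, unfolded infinity_ennreal_def[symmetric]])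
  qed simp
  then show ?thesis unfolding S_def G_def prod_3 by (simp only: mult.assoc)
qed

text \<open>The graph of a^6 lies above its tangent at \<open>b\<close>, here with an explicit sum
  of squares. The left side is affine in \<open>a\<close>, so integrated bounds survive weak
  limits.\<close>

lemma sixth_power_tangent: "6 * a * b ^ 5 - 5 * b ^ 6 \<le> a ^ 6" for a b :: real
proof -
  have "a ^ 6 - (6 * a * b ^ 5 - 5 * b ^ 6) = (a - b)\<^sup>2 * ((a\<^sup>2 + a * b)\<^sup>2 + 2 * b\<^sup>2 * (a + b)\<^sup>2 + 3 * (b\<^sup>2)\<^sup>2)"
    by (simp add: power2_eq_square eval_nat_numeral algebra_simps)
  moreover have "\<dots> \<ge> 0" by (intro mult_nonneg_nonneg add_nonneg_nonneg) auto
  ultimately show ?thesis by linarith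
qed

text \<open>The gradients of the mollifications are mollified weak derivatives, so
  \<open>gagliardo_nirenberg_R3\<close> bounds their sixth powers uniformly in \<open>e\<close>. The
  limit is only weak, against continuous \<psi>, so the tangent inequality replaces u^6 by 6 u
  \<psi>^5 - 5 \<psi>^6. Letting \<psi> approach truncations of \<open>f\<close> and applying
  Fatou's lemma transfers the bound to \<open>f\<close>.\<close>

theorem H1_imp_L6:
  fixes f :: "real ^ 3 \<Rightarrow> real"
  assumes "H1 f"
  shows "integrable lborel (\<lambda>x. f x ^ 6)"
proof -
  have f: "L2 f" using assms by (simp add: H1_def)
  note [measurable] = L2_measurable[OF f]
  have "\<exists>g. L2 g \<and> weak_deriv (axis i 1) f g" for i
    using assms by (auto simp: H1_def Basis_vec_def)
  then obtain g where g: "\<And>i. L2 (g i)" "\<And>i. weak_deriv (axis i 1) f (g i)" by metis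
  let ?u = "\<lambda>e. mollify e f"
  define B where "B = 4096 * (\<Prod>i\<in>UNIV. \<integral>\<^sup>+x. ennreal ((g i x)\<^sup>2) \<partial>lborel)"
  have G: "(\<integral>\<^sup>+x. ennreal ((g i x)\<^sup>2) \<partial>lborel) < \<infinity>" for i
    using g(1)[of i] by (simp add: L2_def integrable_iff_bounded)
  have "B < \<infinity>"
    unfolding B_def prod_3 using G[of 1] G[of 2] G[of 3] by (auto simp: ennreal_mult_less_top)
  then obtain C where C: "C \<ge> 0" "B = ennreal C" by (cases B) auto
  have bound: "integrable lborel (\<lambda>x. (?u e x) ^ 6)" "(\<integral>x. (?u e x) ^ 6 \<partial>lborel) \<le> C" if e: "e > 0" for e
  proof -
    note [measurable] = mollify_measurable[OF e f]
    \<comment> \<open>A mollification is bounded and square integrable, hence its sixth power is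
      integrable; this is the a priori finiteness demanded by
      \<open>gagliardo_nirenberg_R3\<close>.\<close>
    obtain C1 where C1: "\<And>x. (?u e x)\<^sup>2 \<le> C1" using mollify_bounded[OF e f] by blast
    have "integrable lborel (\<lambda>x. C1\<^sup>2 * (?u e x)\<^sup>2)" using L2_mollify[OF e f] by (simp add: L2_def)
    then show i: "integrable lborel (\<lambda>x. (?u e x) ^ 6)"
    proof (rule Bochner_Integration.integrable_bound)
      show "AE x in lborel. norm ((?u e x) ^ 6) \<le> norm (C1\<^sup>2 * (?u e x)\<^sup>2)"
      proof (rule AE_I2)
        fix x
        have "((?u e x)\<^sup>2)\<^sup>2 \<le> C1\<^sup>2" using C1[of x] by (intro power_mono) auto
        then have "((?u e x)\<^sup>2)\<^sup>2 * (?u e x)\<^sup>2 \<le> C1\<^sup>2 * (?u e x)\<^sup>2" by (intro mult_right_mono) auto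
        then show "norm ((?u e x) ^ 6) \<le> norm (C1\<^sup>2 * (?u e x)\<^sup>2)"
          by (simp flip: power_add power_mult add: abs_mult)
      qed
    qed simp
    have "(\<integral>\<^sup>+x. ennreal ((?u e x) ^ 6) \<partial>lborel) \<le> 4096 * (\<Prod>i\<in>UNIV. \<integral>\<^sup>+x. ennreal ((mollify e (g i) x)\<^sup>2) \<partial>lborel)"
    proof (rule gagliardo_nirenberg_R3)
      show "(\<integral>\<^sup>+x. ennreal ((?u e x) ^ 6) \<partial>lborel) < \<infinity>" using i by (simp add: integrable_iff_bounded)
    qed (use e f g in \<open>auto intro: mollify_continuous mollify_has_derivative mollify_at_infinity\<close>)
    also have "\<dots> \<le> B"
      unfolding B_def prod_3 by (intro mult_left_mono mult_mono nn_integral_mollify_square e g) auto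
    finally have "ennreal (\<integral>x. (?u e x) ^ 6 \<partial>lborel) \<le> ennreal C"
      using i C by (subst (asm) nn_integral_eq_integral) auto
    then show "(\<integral>x. (?u e x) ^ 6 \<partial>lborel) \<le> C" using C by simp
  qed
  have test: "6 * (\<integral>x. f x * \<psi> x ^ 5 \<partial>lborel) - 5 * (\<integral>x. \<psi> x ^ 6 \<partial>lborel) \<le> C"
    if \<psi>: "continuous_on UNIV \<psi>" "\<And>x. \<bar>\<psi> x\<bar> \<le> M" "\<And>x. x \<notin> cball 0 R \<Longrightarrow> \<psi> x = 0" for \<psi> M R
  proof -
    let ?e = "\<lambda>n. 1 / real (Suc n)"
    have p: "continuous_on UNIV (\<lambda>x. \<psi> x ^ k)" "\<bar>\<psi> x ^ k\<bar> \<le> M ^ k" "k > 0 \<Longrightarrow> x \<notin> cball 0 R \<Longrightarrow> \<psi> x ^ k = 0" for k x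
      using \<psi> by (auto intro!: continuous_intros power_mono simp: power_abs)
    have L: "L2 (\<lambda>x. \<psi> x ^ k)" if "k > 0" for k
      by (rule L2_continuous_compact[where R = R, OF p(1) p(2)[of _ k]]) (rule p(3)[OF that])
    have i6: "integrable lborel (\<lambda>x. \<psi> x ^ 6)"
      using L[of 3] by (simp add: L2_def flip: power_mult)
    have "6 * (\<integral>x. \<psi> x ^ 5 * ?u (?e n) x \<partial>lborel) - 5 * (\<integral>x. \<psi> x ^ 6 \<partial>lborel) \<le> C" for n
    proof -
      have e: "?e n > 0" by simp
      have i5: "integrable lborel (\<lambda>x. \<psi> x ^ 5 * ?u (?e n) x)"
        by (intro L2_integrable_mult L L2_mollify f e) auto
      have "6 * (\<integral>x. \<psi> x ^ 5 * ?u (?e n) x \<partial>lborel) - 5 * (\<integral>x. \<psi> x ^ 6 \<partial>lborel)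
          = (\<integral>x. 6 * (\<psi> x ^ 5 * ?u (?e n) x) - 5 * \<psi> x ^ 6 \<partial>lborel)"
        using i5 i6 by simp
      also have "\<dots> \<le> (\<integral>x. ?u (?e n) x ^ 6 \<partial>lborel)"
      proof (rule Bochner_Integration.integral_mono)
        show "6 * (\<psi> x ^ 5 * ?u (?e n) x) - 5 * \<psi> x ^ 6 \<le> ?u (?e n) x ^ 6" for x
          using sixth_power_tangent[of "?u (?e n) x" "\<psi> x"] by (simp add: algebra_simps)
      qed (use i5 i6 bound(1)[OF e] in auto)
      also have "\<dots> \<le> C" by (rule bound(2)[OF e])
      finally show ?thesis .
    qed
    moreover have "(\<lambda>n. 6 * (\<integral>x. \<psi> x ^ 5 * ?u (?e n) x \<partial>lborel) - 5 * (\<integral>x. \<psi> x ^ 6 \<partial>lborel))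
        \<longlonglongrightarrow> 6 * (\<integral>x. \<psi> x ^ 5 * f x \<partial>lborel) - 5 * (\<integral>x. \<psi> x ^ 6 \<partial>lborel)"
      by (intro tendsto_intros mollify_weak_limit[where R = R, OF p(1) p(2)[of _ 5] p(3) f]) auto
    ultimately have "6 * (\<integral>x. \<psi> x ^ 5 * f x \<partial>lborel) - 5 * (\<integral>x. \<psi> x ^ 6 \<partial>lborel) \<le> C"
      by (intro LIMSEQ_le_const2) auto
    then show ?thesis by (simp add: mult.commute)
  qed
  \<comment> \<open>Truncation in height and in space. As f times trunc^5 equals trunc^6, the
    tangent bound collapses to (6 - 5) times the integral of trunc^6.\<close>
  define trunc where "trunc m x = f x * indicator ({x. \<bar>f x\<bar> \<le> real m} \<inter> cball 0 (real m)) x" for m x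
  have tset: "{x. \<bar>f x\<bar> \<le> real m} \<inter> cball 0 (real m) \<in> sets borel" for m
  proof (rule sets.Int)
    show "{x. \<bar>f x\<bar> \<le> real m} \<in> sets borel" by measurable
  qed auto
  have tr: "(\<integral>\<^sup>+x. ennreal (trunc m x ^ 6) \<partial>lborel) \<le> ennreal C" for m
  proof -
    have meas: "trunc m \<in> borel_measurable borel"
    proof -
      show ?thesis unfolding trunc_def[abs_def] by (intro borel_measurable_times borel_measurable_indicator tset) simp
    qed
    have tb: "\<bar>trunc m x\<bar> \<le> real m" "x \<notin> cball 0 (real m) \<Longrightarrow> trunc m x = 0" for x
      by (auto simp: trunc_def indicator_def)
    from continuous_approximation[OF meas tb] obtain \<psi> where "\<forall>n. continuous_on UNIV (\<psi> n)"
      "\<forall>n x. \<bar>\<psi> n x\<bar> \<le> real m" "\<forall>n x. x \<notin> cball 0 (real m + 1) \<longrightarrow> \<psi> n x = 0"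
      "AE x in lborel. (\<lambda>n. \<psi> n x) \<longlonglongrightarrow> trunc m x" by blast
    note \<psi> = this(1-3)[rule_format] this(4)
    have mp [measurable]: "(\<lambda>x. \<psi> n x ^ k) \<in> borel_measurable borel" "(\<lambda>x. trunc m x ^ k) \<in> borel_measurable borel" for n k
      by (intro borel_measurable_power borel_measurable_continuous_onI \<psi>(1) meas)+
    have bd: "\<bar>\<psi> n x ^ k\<bar> \<le> real m ^ k" "k > 0 \<Longrightarrow> x \<notin> cball 0 (real m + 1) \<Longrightarrow> \<psi> n x ^ k = 0"
        "AE x in lborel. (\<lambda>n. \<psi> n x ^ k) \<longlonglongrightarrow> trunc m x ^ k" for n k x
      using \<psi>(2)[of n x] \<psi>(3)[of x n] \<psi>(4) by (auto simp: power_abs intro: power_mono tendsto_power elim: eventually_mono)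
    have l5: "(\<lambda>n. \<integral>x. f x * \<psi> n x ^ 5 \<partial>lborel) \<longlonglongrightarrow> (\<integral>x. f x * trunc m x ^ 5 \<partial>lborel)"
      by (rule L2_integral_limit[OF f mp(1) bd(1) _ bd(3) mp(2)]) (use bd(2) in auto)
    \<comment> \<open>Sixth powers carry no factor \<open>f\<close>; the indicator of the supporting
      ball takes the role of the square integrable function in
      \<open>L2_integral_limit\<close>.\<close>
    let ?i = "indicator (cball 0 (real m + 1)) :: real^3 \<Rightarrow> real"
    have Li: "L2 ?i" by (rule L2_bounded_support[OF borel_measurable_indicator, of _ 1 "real m + 1"]) (auto simp: indicator_def)
    have "(\<lambda>n. \<integral>x. ?i x * \<psi> n x ^ 6 \<partial>lborel) \<longlonglongrightarrow> (\<integral>x. ?i x * trunc m x ^ 6 \<partial>lborel)"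
      by (rule L2_integral_limit[OF Li mp(1) bd(1) _ bd(3) mp(2)]) (use bd(2) in auto)
    moreover have "?i x * \<psi> n x ^ 6 = \<psi> n x ^ 6" "?i x * trunc m x ^ 6 = trunc m x ^ 6" for n x
      using \<psi>(3)[of x n] tb(2)[of x] by (auto simp: indicator_def)
    ultimately have l6: "(\<lambda>n. \<integral>x. \<psi> n x ^ 6 \<partial>lborel) \<longlonglongrightarrow> (\<integral>x. trunc m x ^ 6 \<partial>lborel)" by (simp only:)
    have "6 * (\<integral>x. f x * trunc m x ^ 5 \<partial>lborel) - 5 * (\<integral>x. trunc m x ^ 6 \<partial>lborel) \<le> C"
    proof (rule LIMSEQ_le_const2)
      show "(\<lambda>n. 6 * (\<integral>x. f x * \<psi> n x ^ 5 \<partial>lborel) - 5 * (\<integral>x. \<psi> n x ^ 6 \<partial>lborel))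
        \<longlonglongrightarrow> 6 * (\<integral>x. f x * trunc m x ^ 5 \<partial>lborel) - 5 * (\<integral>x. trunc m x ^ 6 \<partial>lborel)"
        by (intro tendsto_intros l5 l6)
      show "\<exists>N. \<forall>n\<ge>N. 6 * (\<integral>x. f x * \<psi> n x ^ 5 \<partial>lborel) - 5 * (\<integral>x. \<psi> n x ^ 6 \<partial>lborel) \<le> C"
        using test[OF \<psi>(1,2,3)] by blast
    qed
    moreover have "f x * trunc m x ^ 5 = trunc m x ^ 6" for x
      by (simp add: trunc_def indicator_def eval_nat_numeral)
    ultimately have "(\<integral>x. trunc m x ^ 6 \<partial>lborel) \<le> C" by simp
    moreover have "integrable lborel (\<lambda>x. trunc m x ^ 6)"
    proof -
      have "L2 (\<lambda>x. trunc m x ^ 3)"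
        by (rule L2_bounded_support[OF mp(2), of _ "real m ^ 3" "real m"]) (use tb in \<open>auto simp: power_abs intro: power_mono\<close>)
      then show ?thesis by (simp add: L2_def flip: power_mult)
    qed
    ultimately show ?thesis using C by (subst nn_integral_eq_integral) (auto intro: ennreal_leI)
  qed
  have "(\<integral>\<^sup>+x. ennreal (f x ^ 6) \<partial>lborel) = (\<integral>\<^sup>+x. liminf (\<lambda>m. ennreal (trunc m x ^ 6)) \<partial>lborel)"
  proof (intro nn_integral_cong)
    fix x
    obtain m0 where m0: "max \<bar>f x\<bar> (norm x) \<le> real m0" using real_arch_simple by blast
    have "\<forall>\<^sub>F m in sequentially. ennreal (trunc m x ^ 6) = ennreal (f x ^ 6)"
    proof (rule eventually_sequentiallyI)
      fix m assume "m0 \<le> m"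
      then have "real m0 \<le> real m" by simp
      then show "ennreal (trunc m x ^ 6) = ennreal (f x ^ 6)" using m0 by (simp add: trunc_def indicator_def)
    qed
    then have "(\<lambda>m. ennreal (trunc m x ^ 6)) \<longlonglongrightarrow> ennreal (f x ^ 6)" by (rule tendsto_eventually)
    then show "ennreal (f x ^ 6) = liminf (\<lambda>m. ennreal (trunc m x ^ 6))"
      by (intro lim_imp_Liminf[symmetric]) auto
  qed
  also have "\<dots> \<le> liminf (\<lambda>m. \<integral>\<^sup>+x. ennreal (trunc m x ^ 6) \<partial>lborel)"
  proof (rule nn_integral_liminf)
    fix m
    have "trunc m \<in> borel_measurable borel"
      unfolding trunc_def[abs_def] by (intro borel_measurable_times borel_measurable_indicator tset) simp
    then show "(\<lambda>x. ennreal (trunc m x ^ 6)) \<in> borel_measurable lborel" by simp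
  qed
  also have "\<dots> \<le> ennreal C"
    by (rule order_trans[OF Liminf_le_Limsup Limsup_bounded]) (auto simp: tr)
  finally have "(\<integral>\<^sup>+x. ennreal (f x ^ 6) \<partial>lborel) < \<infinity>" by (rule order.strict_trans1) simp
  then show ?thesis by (simp add: integrable_iff_bounded)
qed

subsection \<open>Functions with separated variables\<close>

abbreviation tensor :: "('n::finite \<Rightarrow> 'a \<Rightarrow> real) \<Rightarrow> 'a ^ 'n \<Rightarrow> real" where
  "tensor f x \<equiv> \<Prod>j\<in>UNIV. f j (x $ j)"

lemma vec_nth_borel [measurable]: "(\<lambda>x::'a::euclidean_space ^ 'n. x $ i) \<in> borel_measurable borel"
  by (intro borel_measurable_continuous_onI continuous_intros)

lemma integral_vec_split:
  fixes F :: "'a::euclidean_space ^ 'n::finite \<Rightarrow> real"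
  assumes "integrable lborel F"
  shows "(\<integral>x. F x \<partial>lborel) = (\<integral>v. \<integral>y. F (\<chi> j. (v(i := y)) j) \<partial>lborel \<partial>(\<Pi>\<^sub>M j\<in>UNIV - {i}. lborel))"
proof -
  interpret product_sigma_finite "\<lambda>_::'n. lborel :: 'a measure" ..
  have F: "F \<in> borel_measurable borel" using assms by auto
  have U: "(UNIV :: 'n set) = insert i (UNIV - {i})" by auto
  have "integrable (\<Pi>\<^sub>M i\<in>UNIV. lborel) (\<lambda>f. F (\<chi> j. f j))" using integral_lborel_vec(2)[OF F] assms by simp
  then have "integrable (\<Pi>\<^sub>M i\<in>insert i (UNIV - {i}). lborel) (\<lambda>f. F (\<chi> j. f j))" using U by simp
  from product_integral_insert[OF _ _ this] show ?thesis
    unfolding integral_lborel_vec(1)[OF F] using U by simp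
qed

lemma nn_integral_vec_split:
  fixes F :: "'a::euclidean_space ^ 'n::finite \<Rightarrow> ennreal"
  assumes F: "F \<in> borel_measurable borel"
  shows "(\<integral>\<^sup>+x. F x \<partial>lborel) = (\<integral>\<^sup>+v. \<integral>\<^sup>+y. F (\<chi> j. (v(i := y)) j) \<partial>lborel \<partial>(\<Pi>\<^sub>M j\<in>UNIV - {i}. lborel))"
proof -
  interpret product_sigma_finite "\<lambda>_::'n. lborel :: 'a measure" ..
  have U: "(UNIV :: 'n set) = insert i (UNIV - {i})" by auto
  have "(\<lambda>f. F (\<chi> j. f j)) \<in> borel_measurable (\<Pi>\<^sub>M i\<in>UNIV. lborel)"
    by (rule measurable_compose[OF vec_lambda_measurable F])
  then have "(\<lambda>f. F (\<chi> j. f j)) \<in> borel_measurable (\<Pi>\<^sub>M i\<in>insert i (UNIV - {i}). lborel)" using U by simp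
  from product_nn_integral_insert[OF _ _ this] show ?thesis
    unfolding nn_integral_lborel_vec[OF F] using U by simp
qed

lemma tensor_split: "tensor f (\<chi> j. (v(i := y)) j) = f i y * (\<Prod>j\<in>UNIV - {i}. f j (v j))"
  by (subst prod.remove[of UNIV i]) auto

lemma tensor_update: "tensor (f(i := g)) (\<chi> j. (v(i := y)) j) = g y * (\<Prod>j\<in>UNIV - {i}. f j (v j))"
  by (subst tensor_split) simp

lemma tensor_measurable:
  assumes "\<And>j. f j \<in> borel_measurable borel"
  shows "tensor f \<in> borel_measurable (borel :: ('a::euclidean_space ^ 'n::finite) measure)"
  by (intro borel_measurable_prod measurable_compose[OF vec_nth_borel assms])

lemma integral_tensor:
  fixes f :: "'n::finite \<Rightarrow> 'a::euclidean_space \<Rightarrow> real"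
  assumes "\<And>j. integrable lborel (f j)"
  shows "integrable lborel (tensor f)" "(\<integral>x. tensor f x \<partial>lborel) = (\<Prod>j\<in>UNIV. \<integral>y. f j y \<partial>lborel)"
proof -
  interpret product_sigma_finite "\<lambda>_::'n. lborel :: 'a measure" ..
  have m: "tensor f \<in> borel_measurable borel" using assms by (intro tensor_measurable) auto
  show "integrable lborel (tensor f)"
    using integral_lborel_vec(2)[OF m] product_integrable_prod[of UNIV f] assms by simp
  show "(\<integral>x. tensor f x \<partial>lborel) = (\<Prod>j\<in>UNIV. \<integral>y. f j y \<partial>lborel)"
    using integral_lborel_vec(1)[OF m] product_integral_prod[of UNIV f] assms by simp
qed

lemma L2_tensor:
  fixes f :: "'n::finite \<Rightarrow> 'a::euclidean_space \<Rightarrow> real"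
  assumes "\<And>j. L2 (f j)"
  shows "L2 (tensor f)"
  unfolding L2_def
proof
  show "tensor f \<in> borel_measurable lborel"
    using tensor_measurable[of f] L2_measurable[OF assms] by simp
  have "integrable lborel (tensor (\<lambda>j y. (f j y)\<^sup>2))"
    using assms by (intro integral_tensor) (simp add: L2_def)
  then show "integrable lborel (\<lambda>x. (tensor f x)\<^sup>2)" by (simp add: prod_power_distrib)
qed

lemma integral_tensor_mult:
  fixes f g :: "'n::finite \<Rightarrow> 'a::euclidean_space \<Rightarrow> real"
  assumes "\<And>j. L2 (f j)" "\<And>j. L2 (g j)"
  shows "(\<integral>x. tensor f x * tensor g x \<partial>lborel) = (\<Prod>j\<in>UNIV. \<integral>y. f j y * g j y \<partial>lborel)"
  using integral_tensor(2)[of "\<lambda>j y. f j y * g j y"] L2_integrable_mult[OF assms]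
  by (simp add: prod.distrib)

lemma test_function_slice:
  fixes \<psi> :: "'a::euclidean_space ^ 'n::finite \<Rightarrow> real"
  assumes \<psi>: "test_function \<psi>"
  shows "test_function (\<lambda>y. \<psi> (\<chi> j. (v(i := y)) j))"
    "frechet_derivative (\<lambda>y. \<psi> (\<chi> j. (v(i := y)) j)) (at y) c = frechet_derivative \<psi> (at (\<chi> j. (v(i := y)) j)) (axis i c)"
proof -
  let ?e = "\<lambda>y. (\<chi> j. (v(i := y)) j) :: 'a ^ 'n"
  have e: "?e y = (\<chi> j. (v(i := 0)) j) + axis i y" for y
    by (simp add: vec_eq_iff axis_def)
  have bl: "bounded_linear (axis i :: 'a \<Rightarrow> 'a ^ 'n)"
    by (intro linear_conv_bounded_linear[THEN iffD1] linearI) (auto simp: vec_eq_iff axis_def)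
  have de: "(?e has_derivative axis i) (at y)" for y
  proof -
    have "((\<lambda>y. (\<chi> j. (v(i := 0)) j) + axis i y) has_derivative axis i) (at y)"
      by (auto intro!: derivative_eq_intros bounded_linear.has_derivative[OF bl])
    then show ?thesis by (simp only: e[symmetric])
  qed
  have "(\<psi> has_derivative frechet_derivative \<psi> (at x)) (at x)" for x
    using \<psi> by (simp add: test_function_def frechet_derivative_works)
  from has_derivative_compose[OF de this]
  have d: "((\<lambda>y. \<psi> (?e y)) has_derivative (\<lambda>h. frechet_derivative \<psi> (at (?e y)) (axis i h))) (at y)" for y .
  show fd: "frechet_derivative (\<lambda>y. \<psi> (?e y)) (at y) c = frechet_derivative \<psi> (at (?e y)) (axis i c)" for y c
    by (rule fun_cong[OF frechet_derivative_at[OF d, symmetric]])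
  have ce: "continuous_on UNIV ?e"
    by (rule has_derivative_continuous_on) (rule de)
  have "bounded {y. \<psi> (?e y) \<noteq> 0}"
  proof -
    have "compact (closure {x. \<psi> x \<noteq> 0})" using \<psi> by (simp add: test_function_def)
    then obtain B where B: "\<And>x. x \<in> closure {x. \<psi> x \<noteq> 0} \<Longrightarrow> norm x \<le> B"
      using compact_imp_bounded bounded_iff by metis
    have "norm y \<le> B" if "\<psi> (?e y) \<noteq> 0" for y
    proof -
      have "?e y \<in> closure {x. \<psi> x \<noteq> 0}" using that closure_subset[of "{x. \<psi> x \<noteq> 0}"] by blast
      then have "norm (?e y) \<le> B" by (rule B)
      moreover have "norm (?e y $ i) \<le> norm (?e y)" by (rule Finite_Cartesian_Product.norm_nth_le)
      ultimately show ?thesis by simp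
    qed
    then show ?thesis by (auto simp: bounded_iff)
  qed
  moreover have "continuous_on UNIV (\<lambda>y. frechet_derivative \<psi> (at (?e y)) (axis i b))" if "b \<in> Basis" for b
  proof -
    have "axis i b \<in> (Basis :: ('a ^ 'n) set)" using that by (auto simp: Basis_vec_def)
    then have "continuous_on UNIV (\<lambda>x. frechet_derivative \<psi> (at x) (axis i b))" using \<psi> by (simp add: test_function_def)
    from continuous_on_compose2[OF this ce] show ?thesis by simp
  qed
  ultimately show "test_function (\<lambda>y. \<psi> (?e y))"
    unfolding test_function_def fd compact_closure using differentiableI[OF d] by blast
qed

text \<open>Integrating over the i-th variable with the others frozen reduces the claim to the
  one-particle weak derivative, because a slice of a test function is a test function.\<close>

lemma weak_deriv_tensor:
  fixes f :: "'n::finite \<Rightarrow> 'a::euclidean_space \<Rightarrow> real"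
  assumes f: "\<And>j. L2 (f j)" and g: "L2 g" "weak_deriv c (f i) g" and c: "c \<in> Basis"
  shows "weak_deriv (axis i c) (tensor f) (tensor (f(i := g)))"
  unfolding weak_deriv_def
proof (intro allI impI)
  fix \<psi> :: "'a ^ 'n \<Rightarrow> real" assume \<psi>: "test_function \<psi>"
  let ?e = "\<lambda>v y. (\<chi> j. (v(i := y)) j) :: 'a ^ 'n"
  have b: "axis i c \<in> (Basis :: ('a ^ 'n) set)" using c by (auto simp: Basis_vec_def)
  have L2g: "L2 ((f(i := g)) j)" for j using f g by simp
  have i1: "integrable lborel (\<lambda>x. tensor f x * frechet_derivative \<psi> (at x) (axis i c))"
    by (intro L2_integrable_mult L2_tensor f test_function_L2(2)[OF \<psi> b])
  have i2: "integrable lborel (\<lambda>x. tensor (f(i := g)) x * \<psi> x)"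
    by (intro L2_integrable_mult L2_tensor L2g test_function_L2(1)[OF \<psi>])
  have "(\<integral>y. tensor f (?e v y) * frechet_derivative \<psi> (at (?e v y)) (axis i c) \<partial>lborel)
      = - (\<integral>y. tensor (f(i := g)) (?e v y) * \<psi> (?e v y) \<partial>lborel)" for v
  proof -
    let ?Q = "\<Prod>j\<in>UNIV - {i}. f j (v j)"
    have "(\<integral>y. tensor f (?e v y) * frechet_derivative \<psi> (at (?e v y)) (axis i c) \<partial>lborel)
        = (\<integral>y. ?Q * (f i y * frechet_derivative (\<lambda>y. \<psi> (?e v y)) (at y) c) \<partial>lborel)"
      unfolding tensor_split test_function_slice(2)[OF \<psi>] by (simp only: mult_ac)
    also have "\<dots> = ?Q * - (\<integral>y. g y * \<psi> (?e v y) \<partial>lborel)"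
      using g(2)[unfolded weak_deriv_def, rule_format, OF test_function_slice(1)[OF \<psi>, of v i]] by simp
    also have "\<dots> = - (\<integral>y. ?Q * (g y * \<psi> (?e v y)) \<partial>lborel)" by simp
    also have "\<dots> = - (\<integral>y. tensor (f(i := g)) (?e v y) * \<psi> (?e v y) \<partial>lborel)"
      unfolding tensor_update by (simp only: mult_ac)
    finally show ?thesis .
  qed
  then show "(\<integral>x. tensor f x * frechet_derivative \<psi> (at x) (axis i c) \<partial>lborel) = - (\<integral>x. tensor (f(i := g)) x * \<psi> x \<partial>lborel)"
    unfolding integral_vec_split[OF i1, of i] integral_vec_split[OF i2, of i]
    by (simp only: Bochner_Integration.integral_minus)
qed

subsection \<open>Bilinearity of the gradient form\<close>

lemma wderiv:
  assumes "H1 f" "b \<in> Basis"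
  shows "L2 (wderiv b f)" "weak_deriv b f (wderiv b f)"
  using someI_ex[of "\<lambda>g. L2 g \<and> weak_deriv b f g"] assms by (auto simp: H1_def wderiv_def)

lemma wderiv_eq_AE:
  assumes "H1 f" "b \<in> Basis" "L2 g" "weak_deriv b f g"
  shows "AE x in lborel. wderiv b f x = g x"
  by (rule weak_deriv_unique[OF wderiv(1)[OF assms(1,2)] assms(3) wderiv(2)[OF assms(1,2)] assms(4)])

lemma H1_L2: "H1 f \<Longrightarrow> L2 f" by (simp add: H1_def)

lemma H1_linear:
  assumes "H1 f" "H1 g" shows "H1 (\<lambda>x. r * f x + s * g x)"
  unfolding H1_def
proof (intro conjI ballI exI)
  show "L2 (\<lambda>x. r * f x + s * g x)" by (intro L2_add L2_scale H1_L2 assms)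
  fix b :: 'a assume b: "b \<in> Basis"
  show "L2 (\<lambda>x. r * wderiv b f x + s * wderiv b g x)" by (intro L2_add L2_scale wderiv assms b)
  show "weak_deriv b (\<lambda>x. r * f x + s * g x) (\<lambda>x. r * wderiv b f x + s * wderiv b g x)"
    by (intro weak_deriv_linear wderiv H1_L2 assms b)
qed

lemma grad_inner_commute: "grad_inner f g = grad_inner g f"
  by (simp add: grad_inner_def mult.commute)

text \<open>\<open>wderiv\<close> is an arbitrary choice and is linear only almost everywhere, by
  uniqueness of weak derivatives; the integrals do not see the difference.\<close>

lemma grad_inner_linear:
  assumes "H1 f" "H1 g" "H1 h"
  shows "grad_inner (\<lambda>x. r * f x + s * g x) h = r * grad_inner f h + s * grad_inner g h"
proof -
  have "(\<integral>x. wderiv b (\<lambda>x. r * f x + s * g x) x * wderiv b h x \<partial>lborel)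
      = r * (\<integral>x. wderiv b f x * wderiv b h x \<partial>lborel) + s * (\<integral>x. wderiv b g x * wderiv b h x \<partial>lborel)"
    if b: "b \<in> Basis" for b
  proof -
    note w = wderiv[OF assms(1) b] wderiv[OF assms(2) b] wderiv[OF assms(3) b]
    note H = H1_linear[OF assms(1,2), of r s]
    have "AE x in lborel. wderiv b (\<lambda>x. r * f x + s * g x) x = r * wderiv b f x + s * wderiv b g x"
      by (intro wderiv_eq_AE H b L2_add L2_scale w weak_deriv_linear H1_L2 assms)
    then have "(\<integral>x. wderiv b (\<lambda>x. r * f x + s * g x) x * wderiv b h x \<partial>lborel)
        = (\<integral>x. (r * wderiv b f x + s * wderiv b g x) * wderiv b h x \<partial>lborel)"
      using w wderiv(1)[OF H b]
      by (intro integral_cong_AE) (auto simp: L2_def elim: eventually_mono)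
    also have "\<dots> = r * (\<integral>x. wderiv b f x * wderiv b h x \<partial>lborel) + s * (\<integral>x. wderiv b g x * wderiv b h x \<partial>lborel)"
      using L2_integrable_mult[OF w(1,5)] L2_integrable_mult[OF w(3,5)] by (simp add: distrib_right mult.assoc)
    finally show ?thesis .
  qed
  then show ?thesis by (simp add: grad_inner_def sum.distrib sum_distrib_left)
qed

lemma H1_tensor:
  fixes f :: "'n::finite \<Rightarrow> 'a::euclidean_space \<Rightarrow> real"
  assumes "\<And>j. H1 (f j)" shows "H1 (tensor f)"
  unfolding H1_def
proof (intro conjI ballI)
  show "L2 (tensor f)" by (intro L2_tensor H1_L2 assms)
  fix b :: "'a ^ 'n" assume "b \<in> Basis"
  then obtain i c where b: "b = axis i c" "c \<in> Basis" by (auto simp: Basis_vec_def)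
  have "L2 (tensor (f(i := wderiv c (f i))))"
    by (intro L2_tensor) (auto intro: H1_L2 wderiv assms b)
  moreover have "weak_deriv b (tensor f) (tensor (f(i := wderiv c (f i))))"
    unfolding b by (intro weak_deriv_tensor H1_L2 wderiv assms b)
  ultimately show "\<exists>g. L2 g \<and> weak_deriv b (tensor f) g" by blast
qed

text \<open>Differentiating in one variable changes one factor only, so a vanishing overlap at
  another particle persists. The hypothesis asks for such a particle for every i.\<close>

lemma grad_inner_tensor_zero:
  fixes f g :: "'n::finite \<Rightarrow> 'a::euclidean_space \<Rightarrow> real"
  assumes f: "\<And>j. H1 (f j)" and g: "\<And>j. H1 (g j)"
    and zero: "\<And>i. \<exists>j. j \<noteq> i \<and> (\<integral>y. f j y * g j y \<partial>lborel) = 0"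
  shows "grad_inner (tensor f) (tensor g) = 0"
  unfolding grad_inner_def
proof (rule sum.neutral, rule ballI)
  fix b :: "'a ^ 'n" assume "b \<in> Basis"
  then obtain i c where b: "b = axis i c" "c \<in> Basis" "b \<in> Basis" by (auto simp: Basis_vec_def)
  have D: "AE x in lborel. wderiv b (tensor h) x = tensor (h(i := wderiv c (h i))) x"
      "L2 ((h(i := wderiv c (h i))) j)" if "\<And>j. H1 (h j)" for h :: "'n \<Rightarrow> 'a \<Rightarrow> real" and j
  proof -
    show *: "L2 ((h(i := wderiv c (h i))) j)" for j by (auto intro: H1_L2 wderiv that b)
    show "AE x in lborel. wderiv b (tensor h) x = tensor (h(i := wderiv c (h i))) x"
    proof (rule wderiv_eq_AE[OF H1_tensor[OF that] b(3) L2_tensor[OF *]])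
      show "weak_deriv b (tensor h) (tensor (h(i := wderiv c (h i))))"
        unfolding b by (intro weak_deriv_tensor H1_L2 wderiv that b)
    qed
  qed
  let ?f = "f(i := wderiv c (f i))" and ?g = "g(i := wderiv c (g i))"
  have "(\<integral>x. wderiv b (tensor f) x * wderiv b (tensor g) x \<partial>lborel) = (\<integral>x. tensor ?f x * tensor ?g x \<partial>lborel)"
  proof (rule integral_cong_AE)
    show "AE x in lborel. wderiv b (tensor f) x * wderiv b (tensor g) x = tensor ?f x * tensor ?g x"
      using D(1)[of f, OF f] D(1)[of g, OF g] by eventually_elim simp
    have "L2 (wderiv b (tensor f))" "L2 (wderiv b (tensor g))" "L2 (tensor ?f)" "L2 (tensor ?g)"
      by (intro wderiv H1_tensor f g b L2_tensor D(2))+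
    then show "(\<lambda>x. wderiv b (tensor f) x * wderiv b (tensor g) x) \<in> borel_measurable lborel"
        "(\<lambda>x. tensor ?f x * tensor ?g x) \<in> borel_measurable lborel"
      unfolding L2_def by (auto intro: borel_measurable_times)
  qed
  also have "\<dots> = (\<Prod>j\<in>UNIV. \<integral>y. ?f j y * ?g j y \<partial>lborel)"
    by (rule integral_tensor_mult[OF D(2)[of f, OF f] D(2)[of g, OF g]])
  also have "\<dots> = 0"
  proof -
    obtain j where "j \<noteq> i" "(\<integral>y. f j y * g j y \<partial>lborel) = 0" using zero by blast
    then have "(\<integral>y. ?f j y * ?g j y \<partial>lborel) = 0" by simp
    then show ?thesis by (intro prod_zero bexI[of _ j]) simp_all
  qed
  finally show "(\<integral>x. wderiv b (tensor f) x * wderiv b (tensor g) x \<partial>lborel) = 0" .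
qed

subsection \<open>The potentials\<close>

text \<open>Each factor is bounded by a power of the whole right side, with exponents 2/3, 1/6 and
  1/6 that add up to 1. They match a potential in L^(3/2) and two functions in L^6.\<close>

lemma young_three_halves:
  fixes a b c :: real
  assumes "0 \<le> a" "0 \<le> b" "0 \<le> c"
  shows "a * b * c \<le> a powr (3/2) + b ^ 6 + c ^ 6"
proof -
  let ?s = "a powr (3/2) + b ^ 6 + c ^ 6"
  have s: "?s \<ge> 0" "a powr (3/2) \<le> ?s" "b ^ 6 \<le> ?s" "c ^ 6 \<le> ?s" using assms by auto
  have "a = (a powr (3/2)) powr (2/3)" using assms by (simp add: powr_powr)
  then have a: "a \<le> ?s powr (2/3)" using s by (metis powr_mono2 powr_ge_zero divide_nonneg_nonneg zero_le_numeral)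
  have six: "x \<le> ?s powr (1/6)" if "0 \<le> x" "x ^ 6 \<le> ?s" for x
  proof -
    have "x = (x ^ 6) powr (1/6)" using that(1) by (cases "x = 0") (auto simp: powr_powr simp flip: powr_numeral)
    also have "\<dots> \<le> ?s powr (1/6)" using that by (intro powr_mono2) auto
    finally show ?thesis .
  qed
  have "a * b * c \<le> ?s powr (2/3) * ?s powr (1/6) * ?s powr (1/6)"
    using assms by (intro mult_mono a six s mult_nonneg_nonneg) auto
  also have "\<dots> = ?s powr 1" by (simp flip: powr_add)
  finally show ?thesis using s by simp
qed

lemma nn_integral_translate:
  fixes h :: "'a::euclidean_space \<Rightarrow> ennreal"
  assumes "h \<in> borel_measurable borel"
  shows "(\<integral>\<^sup>+x. h (x - y) \<partial>lborel) = (\<integral>\<^sup>+x. h x \<partial>lborel)"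
proof -
  have "(\<integral>\<^sup>+x. h x \<partial>lborel) = (\<integral>\<^sup>+x. h x \<partial>distr lborel borel ((+) (- y)))" by (simp add: lborel_distr_plus)
  also have "\<dots> = (\<integral>\<^sup>+x. h (- y + x) \<partial>lborel)" by (rule nn_integral_distr) (use assms in auto)
  finally show ?thesis by (simp add: algebra_simps)
qed

lemma L32_measurable: "L32_plus_Linf_eps V \<Longrightarrow> V \<in> borel_measurable borel"
  unfolding L32_plus_Linf_eps_def by (drule spec[of _ 1]) (auto intro!: borel_measurable_add)

lemma potential_bound:
  assumes V: "L32_plus_Linf_eps V" and f: "H1 f" and g: "H1 g"
  shows "\<exists>C::real. \<forall>y. (\<integral>\<^sup>+x. ennreal \<bar>V (x - y) * (f x * g x)\<bar> \<partial>lborel) \<le> ennreal C"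
proof -
  obtain V1 V2 where V12: "V = (\<lambda>x. V1 x + V2 x)" and V1: "V1 \<in> borel_measurable borel" "integrable lborel (\<lambda>x. \<bar>V1 x\<bar> powr (3/2))"
    and V2: "V2 \<in> borel_measurable borel" "AE x in lborel. \<bar>V2 x\<bar> \<le> 1"
    using V[unfolded L32_plus_Linf_eps_def, rule_format, of 1] by auto
  note [measurable] = V1(1) V2(1) L2_measurable[OF H1_L2[OF f]] L2_measurable[OF H1_L2[OF g]]
  let ?S = "\<lambda>x. (f x ^ 6 + g x ^ 6) + ((f x)\<^sup>2 + (g x)\<^sup>2)"
  have S: "integrable lborel ?S"
    using H1_imp_L6[OF f] H1_imp_L6[OF g] H1_L2[OF f] H1_L2[OF g] by (auto simp: L2_def)
  have S0: "?S x \<ge> 0" for x by (intro add_nonneg_nonneg) auto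
  let ?A = "\<integral>x. \<bar>V1 x\<bar> powr (3/2) \<partial>lborel"
  have "(\<integral>\<^sup>+x. ennreal \<bar>V (x - y) * (f x * g x)\<bar> \<partial>lborel) \<le> ennreal (?A + (\<integral>x. ?S x \<partial>lborel))" for y
  proof -
    have "AE x in distr lborel borel ((+) (- y)). \<bar>V2 x\<bar> \<le> 1" using V2(2) by (subst lborel_distr_plus)
    then have ae: "AE x in lborel. \<bar>V2 (x - y)\<bar> \<le> 1" by (subst (asm) AE_distr_iff) auto
    have "(\<integral>\<^sup>+x. ennreal \<bar>V (x - y) * (f x * g x)\<bar> \<partial>lborel) \<le> (\<integral>\<^sup>+x. ennreal (\<bar>V1 (x - y)\<bar> powr (3/2)) + ennreal (?S x) \<partial>lborel)"
    proof (rule nn_integral_mono_AE)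
      show "AE x in lborel. ennreal \<bar>V (x - y) * (f x * g x)\<bar> \<le> ennreal (\<bar>V1 (x - y)\<bar> powr (3/2)) + ennreal (?S x)"
        using ae
      proof eventually_elim
        case (elim x)
        have "\<bar>V (x - y) * (f x * g x)\<bar> \<le> (\<bar>V1 (x - y)\<bar> + \<bar>V2 (x - y)\<bar>) * \<bar>f x * g x\<bar>"
          unfolding V12 abs_mult[of "V1 _ + V2 _"] by (intro mult_right_mono) auto
        also have "\<dots> = \<bar>V1 (x - y)\<bar> * \<bar>f x\<bar> * \<bar>g x\<bar> + \<bar>V2 (x - y)\<bar> * \<bar>f x * g x\<bar>"
          by (simp add: abs_mult algebra_simps)
        also have "\<bar>V1 (x - y)\<bar> * \<bar>f x\<bar> * \<bar>g x\<bar> \<le> \<bar>V1 (x - y)\<bar> powr (3/2) + f x ^ 6 + g x ^ 6"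
          using young_three_halves[of "\<bar>V1 (x - y)\<bar>" "\<bar>f x\<bar>" "\<bar>g x\<bar>"] by simp
        also have "\<bar>V2 (x - y)\<bar> * \<bar>f x * g x\<bar> \<le> (f x)\<^sup>2 + (g x)\<^sup>2"
        proof -
          have "\<bar>V2 (x - y)\<bar> * \<bar>f x * g x\<bar> \<le> 1 * \<bar>f x * g x\<bar>" using elim by (intro mult_right_mono) auto
          also have "1 * \<bar>f x * g x\<bar> \<le> (f x)\<^sup>2 + (g x)\<^sup>2"
          proof -
            have "2 * (\<bar>f x\<bar> * \<bar>g x\<bar>) \<le> (f x)\<^sup>2 + (g x)\<^sup>2" using sum_squares_bound[of "\<bar>f x\<bar>" "\<bar>g x\<bar>"] by (simp add: mult.assoc)
            moreover have "0 \<le> \<bar>f x\<bar> * \<bar>g x\<bar>" by simp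
            ultimately show ?thesis by (simp only: abs_mult)
          qed
          finally show ?thesis .
        qed
        finally have "\<bar>V (x - y) * (f x * g x)\<bar> \<le> \<bar>V1 (x - y)\<bar> powr (3/2) + ?S x" by simp
        then have "ennreal \<bar>V (x - y) * (f x * g x)\<bar> \<le> ennreal (\<bar>V1 (x - y)\<bar> powr (3/2) + ?S x)" by (rule ennreal_leI)
        also have "\<dots> = ennreal (\<bar>V1 (x - y)\<bar> powr (3/2)) + ennreal (?S x)" using S0 by (intro ennreal_plus) auto
        finally show ?case .
      qed
    qed
    also have "\<dots> = (\<integral>\<^sup>+x. ennreal (\<bar>V1 (x - y)\<bar> powr (3/2)) \<partial>lborel) + (\<integral>\<^sup>+x. ennreal (?S x) \<partial>lborel)"
      by (rule nn_integral_add) auto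
    also have "(\<integral>\<^sup>+x. ennreal (\<bar>V1 (x - y)\<bar> powr (3/2)) \<partial>lborel) = (\<integral>\<^sup>+x. ennreal (\<bar>V1 x\<bar> powr (3/2)) \<partial>lborel)"
      by (rule nn_integral_translate[where h = "\<lambda>x. ennreal (\<bar>V1 x\<bar> powr (3/2))"]) measurable
    also have "\<dots> = ennreal ?A" by (rule nn_integral_eq_integral[OF V1(2)]) auto
    also have "(\<integral>\<^sup>+x. ennreal (?S x) \<partial>lborel) = ennreal (\<integral>x. ?S x \<partial>lborel)"
      by (rule nn_integral_eq_integral[OF S]) (use S0 in auto)
    also have "ennreal ?A + ennreal (\<integral>x. ?S x \<partial>lborel) = ennreal (?A + (\<integral>x. ?S x \<partial>lborel))"
      using S0 by (intro ennreal_plus[symmetric] Bochner_Integration.integral_nonneg) auto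
    finally show ?thesis .
  qed
  then show ?thesis by blast
qed

lemma one_body_integrable:
  assumes "L32_plus_Linf_eps V" "H1 f" "H1 g"
  shows "integrable lborel (\<lambda>x. V x * (f x * g x))"
proof (rule integrableI_bounded)
  note [measurable] = L32_measurable[OF assms(1)] L2_measurable[OF H1_L2[OF assms(2)]] L2_measurable[OF H1_L2[OF assms(3)]]
  show "(\<lambda>x. V x * (f x * g x)) \<in> borel_measurable lborel" by simp
  obtain C :: real where C: "\<forall>y. (\<integral>\<^sup>+x. ennreal \<bar>V (x - y) * (f x * g x)\<bar> \<partial>lborel) \<le> ennreal C"
    using potential_bound[OF assms] by blast
  have "(\<integral>\<^sup>+x. ennreal (norm (V x * (f x * g x))) \<partial>lborel) \<le> ennreal C" using C[rule_format, of 0] by simp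
  then show "(\<integral>\<^sup>+x. ennreal (norm (V x * (f x * g x))) \<partial>lborel) < \<infinity>" by (rule order.strict_trans1) simp
qed

text \<open>The potential is absorbed into the i-th factor, so the integrand is again a tensor and
  every overlap at a different particle is a factor of its integral.\<close>

lemma one_body_tensor:
  fixes f g :: "'n::finite \<Rightarrow> real^3 \<Rightarrow> real"
  assumes V: "L32_plus_Linf_eps V" and f: "\<And>j. H1 (f j)" and g: "\<And>j. H1 (g j)"
  shows "integrable lborel (\<lambda>x. V (x $ i) * tensor f x * tensor g x)"
    "j \<noteq> i \<Longrightarrow> (\<integral>y. f j y * g j y \<partial>lborel) = 0 \<Longrightarrow> (\<integral>x. V (x $ i) * tensor f x * tensor g x \<partial>lborel) = 0"
proof -
  let ?h = "\<lambda>j y. if j = i then V y * (f j y * g j y) else f j y * g j y"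
  have e: "V (x $ i) * tensor f x * tensor g x = tensor ?h x" for x
  proof -
    have "tensor ?h x = V (x $ i) * (f i (x $ i) * g i (x $ i)) * (\<Prod>j\<in>UNIV - {i}. f j (x $ j) * g j (x $ j))"
      by (subst prod.remove[of UNIV i]) auto
    moreover have "tensor f x = f i (x $ i) * (\<Prod>j\<in>UNIV - {i}. f j (x $ j))" "tensor g x = g i (x $ i) * (\<Prod>j\<in>UNIV - {i}. g j (x $ j))"
      by (subst prod.remove[of UNIV i]; simp)+
    ultimately show ?thesis by (simp add: prod.distrib mult_ac)
  qed
  have h: "integrable lborel (?h j)" for j
    using one_body_integrable[OF V f g] L2_integrable_mult[OF H1_L2[OF f] H1_L2[OF g]] by (cases "j = i") auto
  show "integrable lborel (\<lambda>x. V (x $ i) * tensor f x * tensor g x)"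
    unfolding e by (rule integral_tensor(1)[OF h])
  assume "j \<noteq> i" "(\<integral>y. f j y * g j y \<partial>lborel) = 0"
  then have "(\<integral>y. ?h j y \<partial>lborel) = 0" by simp
  then show "(\<integral>x. V (x $ i) * tensor f x * tensor g x \<partial>lborel) = 0"
    unfolding e integral_tensor(2)[OF h] by (intro prod_zero bexI[of _ j]) simp_all
qed

text \<open>Integrability follows by integrating over particle \<open>i\<close> with all others
  frozen, the bound of \<open>potential_bound\<close> being independent of where \<open>k\<close>
  sits. For the second claim the integral over \<open>j\<close>, on which the interaction does not
  depend, is carried out innermost and vanishes.\<close>

lemma two_body_tensor:
  fixes f g :: "'n::finite \<Rightarrow> real^3 \<Rightarrow> real"
  assumes w: "L32_plus_Linf_eps w" and f: "\<And>j. H1 (f j)" and g: "\<And>j. H1 (g j)" and ik: "i \<noteq> k"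
  shows "integrable lborel (\<lambda>x. w (x $ i - x $ k) * tensor f x * tensor g x)"
    "j \<noteq> i \<Longrightarrow> j \<noteq> k \<Longrightarrow> (\<integral>y. f j y * g j y \<partial>lborel) = 0 \<Longrightarrow> (\<integral>x. w (x $ i - x $ k) * tensor f x * tensor g x \<partial>lborel) = 0"
proof -
  interpret product_sigma_finite "\<lambda>_::'n. lborel :: (real^3) measure" ..
  note [measurable] = L32_measurable[OF w]
  let ?h = "\<lambda>j y. f j y * g j y" and ?F = "\<lambda>x. w (x $ i - x $ k) * tensor f x * tensor g x"
  have fg: "f j \<in> borel_measurable borel" "g j \<in> borel_measurable borel" for j
    using L2_measurable[OF H1_L2[OF f]] L2_measurable[OF H1_L2[OF g]] by auto
  have h: "integrable lborel (?h j)" for j by (rule L2_integrable_mult[OF H1_L2[OF f] H1_L2[OF g]])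
  have "tensor f \<in> borel_measurable borel" "tensor g \<in> borel_measurable borel" by (intro tensor_measurable fg)+
  then have m [measurable]: "?F \<in> borel_measurable borel" by measurable
  have F: "?F (\<chi> l. (v(j := y)) l) = w ((\<chi> l. (v(j := y)) l) $ i - (\<chi> l. (v(j := y)) l) $ k) * (?h j y * (\<Prod>l\<in>UNIV - {j}. ?h l (v l)))" for v j y
    unfolding tensor_split by (simp add: prod.distrib mult_ac)
  obtain C :: real where C: "\<And>y. (\<integral>\<^sup>+x. ennreal \<bar>w (x - y) * ?h i x\<bar> \<partial>lborel) \<le> ennreal C"
    using potential_bound[OF w f g] by blast
  let ?Q = "\<lambda>v. \<Prod>l\<in>UNIV - {i}. ?h l (v l)"
  have Q: "integrable (\<Pi>\<^sub>M j\<in>UNIV - {i}. lborel) ?Q"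
    by (rule product_integrable_prod) (auto intro: h)
  show i: "integrable lborel ?F"
  proof (rule integrableI_bounded)
    show "?F \<in> borel_measurable lborel" using m by simp
    have "(\<integral>\<^sup>+x. ennreal (norm (?F x)) \<partial>lborel) = (\<integral>\<^sup>+v. \<integral>\<^sup>+y. ennreal (norm (?F (\<chi> l. (v(i := y)) l))) \<partial>lborel \<partial>(\<Pi>\<^sub>M j\<in>UNIV - {i}. lborel))"
      by (rule nn_integral_vec_split) measurable
    also have "\<dots> = (\<integral>\<^sup>+v. \<integral>\<^sup>+y. ennreal \<bar>?Q v\<bar> * ennreal \<bar>w (y - v k) * ?h i y\<bar> \<partial>lborel \<partial>(\<Pi>\<^sub>M j\<in>UNIV - {i}. lborel))"
      unfolding F using ik by (simp add: abs_mult mult_ac flip: ennreal_mult)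
    also have "\<dots> = (\<integral>\<^sup>+v. ennreal \<bar>?Q v\<bar> * (\<integral>\<^sup>+y. ennreal \<bar>w (y - v k) * ?h i y\<bar> \<partial>lborel) \<partial>(\<Pi>\<^sub>M j\<in>UNIV - {i}. lborel))"
    proof (intro nn_integral_cong nn_integral_cmult)
      show "(\<lambda>y. ennreal \<bar>w (y - v k) * ?h i y\<bar>) \<in> borel_measurable lborel" for v
        using fg[of i] by measurable
    qed
    also have "\<dots> \<le> (\<integral>\<^sup>+v. ennreal \<bar>?Q v\<bar> * ennreal C \<partial>(\<Pi>\<^sub>M j\<in>UNIV - {i}. lborel))"
      by (intro nn_integral_mono mult_left_mono C) auto
    also have "\<dots> = (\<integral>\<^sup>+v. ennreal \<bar>?Q v\<bar> \<partial>(\<Pi>\<^sub>M j\<in>UNIV - {i}. lborel)) * ennreal C"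
      by (rule nn_integral_multc) (use Q in auto)
    also have "\<dots> < \<infinity>"
      using Q by (auto simp: integrable_iff_bounded ennreal_mult_less_top)
    finally show "(\<integral>\<^sup>+x. ennreal (norm (?F x)) \<partial>lborel) < \<infinity>" .
  qed
  assume j: "j \<noteq> i" "j \<noteq> k" "(\<integral>y. ?h j y \<partial>lborel) = 0"
  have "(\<integral>y. ?F (\<chi> l. (v(j := y)) l) \<partial>lborel) = 0" for v
  proof -
    have "(\<integral>y. ?F (\<chi> l. (v(j := y)) l) \<partial>lborel) = (\<integral>y. w (v i - v k) * (\<Prod>l\<in>UNIV - {j}. ?h l (v l)) * ?h j y \<partial>lborel)"
      unfolding F using j by (simp add: mult_ac)
    also have "\<dots> = w (v i - v k) * (\<Prod>l\<in>UNIV - {j}. ?h l (v l)) * (\<integral>y. ?h j y \<partial>lborel)"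
      by (rule integral_mult_right_zero)
    finally show ?thesis using j(3) by simp
  qed
  then show "(\<integral>x. ?F x \<partial>lborel) = 0" unfolding integral_vec_split[OF i, of j] by simp
qed

subsection \<open>Slater determinants\<close>

text \<open>The linear span of the orbital products with assignments in \<open>Q\<close>. The
  inductive form lets statements linear in a wave function be checked on products alone.\<close>

inductive orbital_span :: "(nat \<Rightarrow> 'a \<Rightarrow> real) \<Rightarrow> ('n::finite \<Rightarrow> nat) set \<Rightarrow> ('a ^ 'n \<Rightarrow> real) \<Rightarrow> bool"
  for \<phi> Q where
  zero: "orbital_span \<phi> Q (\<lambda>x. 0)"
| gen: "q \<in> Q \<Longrightarrow> orbital_span \<phi> Q (tensor (\<lambda>j. \<phi> (q j)))"
| lin: "orbital_span \<phi> Q F \<Longrightarrow> orbital_span \<phi> Q G \<Longrightarrow> orbital_span \<phi> Q (\<lambda>x. r * F x + s * G x)"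

lemma orbital_span_mono: "orbital_span \<phi> Q F \<Longrightarrow> Q \<subseteq> Q' \<Longrightarrow> orbital_span \<phi> Q' F"
  by (induction rule: orbital_span.induct) (auto intro: orbital_span.intros)

lemma orbital_span_sum:
  assumes "finite J" "\<And>j. j \<in> J \<Longrightarrow> orbital_span \<phi> Q (F j)"
  shows "orbital_span \<phi> Q (\<lambda>x. \<Sum>j\<in>J. b j * F j x)"
  using assms
proof (induction J rule: finite_induct)
  case (insert j J)
  then show ?case using orbital_span.lin[of \<phi> Q "F j" "\<lambda>x. \<Sum>j\<in>J. b j * F j x" "b j" 1] by simp
qed (simp add: orbital_span.zero)

text \<open>Linearity of the integral forms holds only where the integrands are integrable, so it is
  assumed on the span over a common larger set \<open>S\<close>, while the vanishing is tested on
  the possibly different sets \<open>Q\<close> and \<open>Q'\<close>.\<close>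

lemma bilinear_zero_on_span:
  fixes B :: "('a ^ 'n::finite \<Rightarrow> real) \<Rightarrow> ('a ^ 'n \<Rightarrow> real) \<Rightarrow> real"
  assumes sub: "Q \<subseteq> S" "Q' \<subseteq> S"
    and left: "\<And>F G h r s. orbital_span \<phi> S F \<Longrightarrow> orbital_span \<phi> S G \<Longrightarrow> orbital_span \<phi> S h \<Longrightarrow>
      B (\<lambda>x. r * F x + s * G x) h = r * B F h + s * B G h"
    and sym: "\<And>F G. B F G = B G F"
    and gen: "\<And>q q'. q \<in> Q \<Longrightarrow> q' \<in> Q' \<Longrightarrow> B (tensor (\<lambda>j. \<phi> (q j))) (tensor (\<lambda>j. \<phi> (q' j))) = 0"
    and F: "orbital_span \<phi> Q F" and G: "orbital_span \<phi> Q' G"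
  shows "B F G = 0"
proof -
  have right: "B h (\<lambda>x. r * F x + s * G x) = r * B h F + s * B h G"
    if "orbital_span \<phi> S F" "orbital_span \<phi> S G" "orbital_span \<phi> S h" for F G h r s
    using left[OF that] by (simp only: sym[of h])
  have z1: "B (\<lambda>x. 0) h = 0" and z2: "B h (\<lambda>x. 0) = 0" if "orbital_span \<phi> S h" for h
    using left[OF orbital_span.zero orbital_span.zero that, of 0 0] right[OF orbital_span.zero orbital_span.zero that, of 0 0] by simp_all
  have "B (tensor (\<lambda>j. \<phi> (q j))) G = 0" if q: "q \<in> Q" for q
    using G
  proof (induction rule: orbital_span.induct)
    case zero
    then show ?case using q sub by (intro z2 orbital_span.gen) auto
  next
    case (lin F G r s)
    then show ?case using right[of F G "tensor (\<lambda>j. \<phi> (q j))" r s] q sub by (auto intro: orbital_span.gen orbital_span_mono)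
  qed (use gen q in auto)
  note * = this
  from F show ?thesis
  proof (induction rule: orbital_span.induct)
    case zero
    then show ?case using G sub by (intro z1) (auto intro: orbital_span_mono)
  next
    case (lin F F' r s)
    then show ?case using left[of F F' G r s] G sub by (auto intro: orbital_span_mono)
  qed (use * in auto)
qed

lemma H1_zero: "H1 (\<lambda>x. 0)"
proof -
  have "weak_deriv b (\<lambda>x. 0) (\<lambda>x. 0)" for b by (simp add: weak_deriv_def)
  then show ?thesis by (auto simp: H1_def L2_def intro!: exI[of _ "\<lambda>x. 0"])
qed

definition position :: "'n::{finite,linorder} \<Rightarrow> nat" where
  "position i = card {k. k < i}"

lemma position: "inj (position :: 'n::{finite,linorder} \<Rightarrow> nat)" "position (i :: 'n) < CARD('n)"
proof -
  have mono: "position i < position j" if "i < j" for i j :: 'n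
    unfolding position_def using that by (intro psubset_card_mono) auto
  show "inj (position :: 'n \<Rightarrow> nat)"
    using mono by (intro injI) (metis less_irrefl linorder_neqE)
  show "position i < CARD('n)"
    unfolding position_def by (intro psubset_card_mono) auto
qed

definition orbital_of :: "nat set \<Rightarrow> 'n::{finite,linorder} \<Rightarrow> nat" where
  "orbital_of \<alpha> i = sorted_list_of_set \<alpha> ! position i"

lemma orbital_of:
  assumes "\<alpha> \<in> configs K CARD('n)"
  shows "inj (orbital_of \<alpha> :: 'n::{finite,linorder} \<Rightarrow> nat)" "range (orbital_of \<alpha> :: 'n \<Rightarrow> nat) = \<alpha>"
proof -
  have fin: "finite \<alpha>" and card: "card \<alpha> = CARD('n)" using assms by (auto simp: configs_def intro: finite_subset)
  then have len: "length (sorted_list_of_set \<alpha>) = CARD('n)" by simp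
  show inj: "inj (orbital_of \<alpha> :: 'n \<Rightarrow> nat)"
    using position(1)[where 'n = 'n] position(2)[where 'n = 'n] len
    by (auto simp: inj_def orbital_of_def nth_eq_iff_index_eq)
  have "range (orbital_of \<alpha> :: 'n \<Rightarrow> nat) \<subseteq> \<alpha>"
  proof -
    have "orbital_of \<alpha> i \<in> set (sorted_list_of_set \<alpha>)" for i :: 'n
      unfolding orbital_of_def by (rule nth_mem) (use position(2)[of i] len in simp)
    then show ?thesis using fin by auto
  qed
  moreover have "card (range (orbital_of \<alpha> :: 'n \<Rightarrow> nat)) = card \<alpha>" using inj card by (simp add: card_image)
  ultimately show "range (orbital_of \<alpha> :: 'n \<Rightarrow> nat) = \<alpha>" using fin by (simp add: card_subset_eq)
qed

text \<open>The matrix is transposed before expanding, so that the permutation acts on the orbital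
  carried by each particle and every summand is a tensor over the particles.\<close>

lemma slater_expansion:
  "slater \<phi> \<alpha> (x :: 'n::{finite,linorder} conf) =
    (\<Sum>p\<in>{p. p permutes (UNIV :: 'n set)}. (of_int (sign p) / sqrt (fact CARD('n))) * tensor (\<lambda>j. \<phi> (orbital_of \<alpha> (p j))) x)"
proof -
  let ?A = "(\<chi> i j. \<phi> (orbital_of \<alpha> i) (x $ j)) :: ((real, 'n) vec, 'n) vec"
  have "slater \<phi> \<alpha> x = det ?A / sqrt (fact CARD('n))"
    by (simp add: slater_def orbital_of_def position_def)
  also have "det ?A = det (transpose ?A)" by simp
  also have "\<dots> = (\<Sum>p\<in>{p. p permutes (UNIV :: 'n set)}. of_int (sign p) * tensor (\<lambda>j. \<phi> (orbital_of \<alpha> (p j))) x)"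
    by (simp add: det_def transpose_def)
  finally show ?thesis by (simp add: sum_divide_distrib)
qed

text \<open>When \<alpha> has as many elements as there are particles, these are the bijective
  assignments of its orbitals to the particles.\<close>

definition fillings :: "nat set \<Rightarrow> ('n::finite \<Rightarrow> nat) set" where
  "fillings \<alpha> = {q. range q = \<alpha>}"

lemma slater_span:
  assumes "\<alpha> \<in> configs K CARD('n)"
  shows "orbital_span \<phi> (fillings \<alpha>) (slater \<phi> \<alpha> :: 'n::{finite,linorder} conf \<Rightarrow> real)"
proof -
  have "(\<lambda>j. orbital_of \<alpha> (p j)) \<in> fillings \<alpha>" if "p permutes (UNIV :: 'n set)" for p
    using orbital_of(2)[OF assms] permutes_surj[OF that] by (simp add: fillings_def) (metis image_image)
  then have "orbital_span \<phi> (fillings \<alpha>) (\<lambda>x. \<Sum>p\<in>{p. p permutes (UNIV :: 'n set)}.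
      (of_int (sign p) / sqrt (fact CARD('n))) * tensor (\<lambda>j. \<phi> (orbital_of \<alpha> (p j))) x)"
    by (intro orbital_span_sum) (auto intro: orbital_span.gen simp: finite_permutations)
  then show ?thesis unfolding slater_expansion[symmetric] .
qed

section \<open>Bilinearity of the Hamiltonian form and the Slater--Condon rules\<close>

locale orbital_system =
  fixes K :: nat and \<phi> :: "nat \<Rightarrow> real^3 \<Rightarrow> real" and V w :: "real^3 \<Rightarrow> real"
    and ty :: "'n::{finite,linorder} itself"
  assumes NK: "CARD('n) \<le> K"
    and orbitals_H1: "\<And>p. p \<in> {1..K} \<Longrightarrow> H1 (\<phi> p)"
    and orthonormal: "\<And>p q. p \<in> {1..K} \<Longrightarrow> q \<in> {1..K} \<Longrightarrow>
          (\<integral>x. \<phi> p x * \<phi> q x \<partial>lborel) = (if p = q then 1 else 0)"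
    and V: "L32_plus_Linf_eps V" and w: "L32_plus_Linf_eps w"
begin

abbreviation "sl \<equiv> slater \<phi> :: nat set \<Rightarrow> 'n conf \<Rightarrow> real"
abbreviation "wav \<equiv> wavefunction K \<phi> :: fock \<Rightarrow> 'n conf \<Rightarrow> real"
abbreviation "all_fillings \<equiv> {q :: 'n \<Rightarrow> nat. range q \<subseteq> {1..K}}"
abbreviation "wave \<equiv> orbital_span \<phi> all_fillings"

definition l2_form :: "('n conf \<Rightarrow> real) \<Rightarrow> ('n conf \<Rightarrow> real) \<Rightarrow> real" where
  "l2_form f g = (\<integral>x. f x * g x \<partial>lborel)"

definition pot :: "'n conf \<Rightarrow> real" where
  "pot x = (\<Sum>i\<in>UNIV. V (x $ i)) + (\<Sum>(i, j)\<in>{(i, j). i < j}. w (x $ i - x $ j))"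

definition pot_form :: "('n conf \<Rightarrow> real) \<Rightarrow> ('n conf \<Rightarrow> real) \<Rightarrow> real" where
  "pot_form f g = (\<integral>x. pot x * f x * g x \<partial>lborel)"

lemma ham_form_alt: "ham_form V w f g = 1/2 * grad_inner f g + pot_form f g"
  by (simp add: ham_form_def pot_form_def pot_def)

lemma orb: "q \<in> all_fillings \<Longrightarrow> H1 (\<phi> (q j))"
  by (rule orbitals_H1) blast

lemma orb_overlap: "q \<in> all_fillings \<Longrightarrow> q' \<in> all_fillings \<Longrightarrow> (\<integral>x. \<phi> (q j) x * \<phi> (q' j) x \<partial>lborel) = (if q j = q' j then 1 else 0)"
  by (rule orthonormal) blast+

lemma wave_H1: "wave F \<Longrightarrow> H1 F"
proof (induction rule: orbital_span.induct)
  case (gen q)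
  then show ?case by (intro H1_tensor orb)
qed (auto intro: H1_zero H1_linear)

lemma fillings_subset: "\<alpha> \<in> configs K CARD('n) \<Longrightarrow> fillings \<alpha> \<subseteq> all_fillings"
  by (auto simp: configs_def fillings_def)

lemma wave_slater: "\<alpha> \<in> configs K CARD('n) \<Longrightarrow> wave (sl \<alpha>)"
  by (rule orbital_span_mono[OF slater_span fillings_subset])

lemma wf_wave: "wave (wav c)"
proof -
  have "wav c = (\<lambda>x. \<Sum>\<alpha>\<in>configs K CARD('n). c \<alpha> * sl \<alpha> x)" by (simp add: fun_eq_iff wavefunction_def)
  then show ?thesis by (simp only:) (intro orbital_span_sum finite_configs wave_slater)
qed

text \<open>Each term of the potential involves at most two particles. If outside any two particles
  some third one carries different orbitals on the two sides, orthogonality of these orbitals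
  annihilates every term.\<close>

lemma pot_integrable_gen:
  assumes "q \<in> all_fillings" "q' \<in> all_fillings"
  shows "integrable lborel (\<lambda>x. pot x * tensor (\<lambda>j. \<phi> (q j)) x * tensor (\<lambda>j. \<phi> (q' j)) x)"
    "\<lbrakk>\<And>i k. \<exists>j. j \<noteq> i \<and> j \<noteq> k \<and> q j \<noteq> q' j\<rbrakk> \<Longrightarrow> pot_form (tensor (\<lambda>j. \<phi> (q j))) (tensor (\<lambda>j. \<phi> (q' j))) = 0"
proof -
  let ?f = "tensor (\<lambda>j. \<phi> (q j)) :: 'n conf \<Rightarrow> real" and ?g = "tensor (\<lambda>j. \<phi> (q' j)) :: 'n conf \<Rightarrow> real"
  have e: "pot x * ?f x * ?g x = (\<Sum>i\<in>UNIV. V (x $ i) * ?f x * ?g x) + (\<Sum>p\<in>{(i, j). i < j}. w (x $ fst p - x $ snd p) * ?f x * ?g x)" for x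
    unfolding pot_def distrib_right sum_distrib_right by (simp add: case_prod_unfold)
  have i1: "integrable lborel (\<lambda>x. V (x $ i) * ?f x * ?g x)" for i
    by (rule one_body_tensor(1)[OF V orb[OF assms(1)] orb[OF assms(2)]])
  have i2: "integrable lborel (\<lambda>x. w (x $ fst p - x $ snd p) * ?f x * ?g x)" if "p \<in> {(i, j). i < j}" for p :: "'n \<times> 'n"
    by (rule two_body_tensor(1)[OF w orb[OF assms(1)] orb[OF assms(2)]]) (use that in auto)
  show "integrable lborel (\<lambda>x. pot x * ?f x * ?g x)"
    unfolding e by (intro Bochner_Integration.integrable_add Bochner_Integration.integrable_sum i1 i2)
  assume *: "\<And>i k. \<exists>j. j \<noteq> i \<and> j \<noteq> k \<and> q j \<noteq> q' j"
  have "(\<integral>x. V (x $ i) * ?f x * ?g x \<partial>lborel) = 0" for i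
  proof -
    obtain j where "j \<noteq> i" "q j \<noteq> q' j" using * by blast
    then show ?thesis
      by (intro one_body_tensor(2)[OF V orb[OF assms(1)] orb[OF assms(2)], of j]) (simp_all add: orb_overlap[OF assms])
  qed
  moreover have "(\<integral>x. w (x $ fst p - x $ snd p) * ?f x * ?g x \<partial>lborel) = 0" if "p \<in> {(i, j). i < j}" for p :: "'n \<times> 'n"
  proof -
    obtain j where "j \<noteq> fst p" "j \<noteq> snd p" "q j \<noteq> q' j" using * by blast
    then show ?thesis using that
      by (intro two_body_tensor(2)[OF w orb[OF assms(1)] orb[OF assms(2)], of "fst p" "snd p" j])
        (auto simp add: orb_overlap[OF assms])
  qed
  ultimately have z: "(\<Sum>i\<in>UNIV. \<integral>x. V (x $ i) * ?f x * ?g x \<partial>lborel) = 0"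
      "(\<Sum>p\<in>{(i, j). i < j}. \<integral>x. w (x $ fst p - x $ snd p) * ?f x * ?g x \<partial>lborel) = 0"
    by (auto intro!: sum.neutral)
  have "pot_form ?f ?g = (\<integral>x. (\<Sum>i\<in>UNIV. V (x $ i) * ?f x * ?g x) \<partial>lborel)
      + (\<integral>x. (\<Sum>p\<in>{(i, j). i < j}. w (x $ fst p - x $ snd p) * ?f x * ?g x) \<partial>lborel)"
    unfolding pot_form_def e by (intro Bochner_Integration.integral_add Bochner_Integration.integrable_sum i1 i2)
  also have "(\<integral>x. (\<Sum>i\<in>UNIV. V (x $ i) * ?f x * ?g x) \<partial>lborel) = (\<Sum>i\<in>UNIV. \<integral>x. V (x $ i) * ?f x * ?g x \<partial>lborel)"
    by (intro Bochner_Integration.integral_sum i1)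
  also have "(\<integral>x. (\<Sum>p\<in>{(i, j). i < j}. w (x $ fst p - x $ snd p) * ?f x * ?g x) \<partial>lborel)
      = (\<Sum>p\<in>{(i, j). i < j}. \<integral>x. w (x $ fst p - x $ snd p) * ?f x * ?g x \<partial>lborel)"
    by (intro Bochner_Integration.integral_sum i2)
  finally show "pot_form ?f ?g = 0" by (simp only: z add_0)
qed

lemma pot_integrable: "wave F \<Longrightarrow> wave G \<Longrightarrow> integrable lborel (\<lambda>x. pot x * F x * G x)"
proof (induction rule: orbital_span.induct)
  case (gen q)
  from gen(2) show ?case
  proof (induction rule: orbital_span.induct)
    case (gen q')
    then show ?case using pot_integrable_gen(1) \<open>q \<in> all_fillings\<close> by blast
  next
    case (lin F G r s)
    then have "integrable lborel (\<lambda>x. r * (pot x * tensor (\<lambda>j. \<phi> (q j)) x * F x) + s * (pot x * tensor (\<lambda>j. \<phi> (q j)) x * G x))"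
      by (intro Bochner_Integration.integrable_add integrable_mult_right) auto
    then show ?case by (simp add: algebra_simps)
  qed simp
next
  case (lin F F' r s)
  then have "integrable lborel (\<lambda>x. r * (pot x * F x * G x) + s * (pot x * F' x * G x))"
    by (intro Bochner_Integration.integrable_add integrable_mult_right) auto
  then show ?case by (simp add: algebra_simps)
qed simp

lemma pot_form_commute: "pot_form f g = pot_form g f"
  by (simp add: pot_form_def mult_ac)

lemma pot_form_linear:
  assumes "wave F" "wave G" "wave h"
  shows "pot_form (\<lambda>x. r * F x + s * G x) h = r * pot_form F h + s * pot_form G h"
proof -
  have "pot_form (\<lambda>x. r * F x + s * G x) h = (\<integral>x. r * (pot x * F x * h x) + s * (pot x * G x * h x) \<partial>lborel)"
    unfolding pot_form_def by (rule Bochner_Integration.integral_cong) (auto simp: algebra_simps)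
  then show ?thesis using pot_integrable[OF assms(1,3)] pot_integrable[OF assms(2,3)] by (simp add: pot_form_def)
qed

lemma l2_form_commute: "l2_form f g = l2_form g f"
  by (simp add: l2_form_def mult.commute)

lemma l2_form_linear:
  assumes "wave F" "wave G" "wave h"
  shows "l2_form (\<lambda>x. r * F x + s * G x) h = r * l2_form F h + s * l2_form G h"
proof -
  note i = L2_integrable_mult[OF H1_L2[OF wave_H1] H1_L2[OF wave_H1]]
  have "l2_form (\<lambda>x. r * F x + s * G x) h = (\<integral>x. r * (F x * h x) + s * (G x * h x) \<partial>lborel)"
    unfolding l2_form_def by (rule Bochner_Integration.integral_cong) (auto simp: algebra_simps)
  then show ?thesis using i[OF assms(1,3)] i[OF assms(2,3)] by (simp add: l2_form_def)
qed

lemma ham_form_commute: "ham_form V w f g = (ham_form V w g f :: real)" for f g :: "'n conf \<Rightarrow> real"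
  unfolding ham_form_alt by (simp add: grad_inner_commute[of f] pot_form_commute[of f])

lemma ham_form_linear:
  assumes "wave F" "wave G" "wave h"
  shows "ham_form V w (\<lambda>x. r * F x + s * G x) h = r * ham_form V w F h + s * ham_form V w G h"
  unfolding ham_form_alt pot_form_linear[OF assms] grad_inner_linear[OF assms[THEN wave_H1]] by (simp add: algebra_simps)

lemma H1_inner_linear:
  assumes "wave F" "wave G" "wave h"
  shows "H1_inner (\<lambda>x. r * F x + s * G x) h = r * H1_inner F h + s * H1_inner G h"
  unfolding H1_inner_def using l2_form_linear[OF assms, of r s] grad_inner_linear[OF assms[THEN wave_H1], of r s]
  by (simp add: l2_form_def algebra_simps)

lemma H1_inner_commute: "H1_inner f g = (H1_inner g f :: real)" for f g :: "'n conf \<Rightarrow> real"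
  unfolding H1_inner_def by (simp add: grad_inner_commute[of f] mult.commute)

lemma H1_inner_ge: "l2_form f f \<le> H1_inner f f"
  unfolding H1_inner_def grad_inner_def l2_form_def
  by (simp add: sum_nonneg Bochner_Integration.integral_nonneg)

lemma l2_form_gen:
  assumes "q \<in> all_fillings" "q' \<in> all_fillings"
  shows "l2_form (tensor (\<lambda>j. \<phi> (q j))) (tensor (\<lambda>j. \<phi> (q' j))) = (if q = q' then 1 else 0)"
proof -
  have "l2_form (tensor (\<lambda>j. \<phi> (q j))) (tensor (\<lambda>j. \<phi> (q' j))) = (\<Prod>j\<in>UNIV. if q j = q' j then 1 else 0)"
    unfolding l2_form_def
    by (subst integral_tensor_mult) (auto intro: H1_L2 orb[OF assms(1)] orb[OF assms(2)] simp: orb_overlap[OF assms])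
  also have "\<dots> = (if q = q' then 1 else 0)"
    by (auto simp: fun_eq_iff intro!: prod_zero)
  finally show ?thesis .
qed

lemma form_sum_left:
  fixes B :: "('n conf \<Rightarrow> real) \<Rightarrow> ('n conf \<Rightarrow> real) \<Rightarrow> real"
  assumes left: "\<And>F G h r s. wave F \<Longrightarrow> wave G \<Longrightarrow> wave h \<Longrightarrow> B (\<lambda>x. r * F x + s * G x) h = r * B F h + s * B G h"
    and "finite J" "\<And>j. j \<in> J \<Longrightarrow> wave (F j)" "wave h"
  shows "B (\<lambda>x. \<Sum>j\<in>J. b j * F j x) h = (\<Sum>j\<in>J. b j * B (F j) h)"
  using assms(2,3)
proof (induction J rule: finite_induct)
  case empty
  show ?case using left[OF orbital_span.zero orbital_span.zero assms(4), of 0 0] by simp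
next
  case (insert j J)
  then show ?case
    using left[of "F j" "\<lambda>x. \<Sum>j\<in>J. b j * F j x" h "b j" 1] assms(4) by (simp add: orbital_span_sum)
qed

text \<open>Distinct index sets share no assignment of orbitals. On the diagonal only equal
  permutations overlap, leaving N! terms of weight 1/N!.\<close>

lemma slater_orthonormal:
  assumes "\<alpha> \<in> configs K CARD('n)" "\<beta> \<in> configs K CARD('n)"
  shows "l2_form (sl \<alpha>) (sl \<beta>) = (if \<alpha> = \<beta> then 1 else 0)"
proof (cases "\<alpha> = \<beta>")
  case False
  have "l2_form (sl \<alpha>) (sl \<beta>) = 0"
  proof (rule bilinear_zero_on_span[where B = l2_form, OF fillings_subset[OF assms(1)] fillings_subset[OF assms(2)] l2_form_linear l2_form_commute _ slater_span[OF assms(1)] slater_span[OF assms(2)]])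
    fix q q' :: "'n \<Rightarrow> nat" assume q: "q \<in> fillings \<alpha>" "q' \<in> fillings \<beta>"
    then have "q \<noteq> q'" using False by (auto simp: fillings_def)
    moreover have "q \<in> all_fillings" "q' \<in> all_fillings" using q fillings_subset assms by blast+
    ultimately show "l2_form (tensor (\<lambda>j. \<phi> (q j))) (tensor (\<lambda>j. \<phi> (q' j))) = 0" by (simp add: l2_form_gen)
  qed
  then show ?thesis using False by simp
next
  case True
  let ?P = "{p. p permutes (UNIV :: 'n set)}"
  let ?q = "\<lambda>p j. orbital_of \<alpha> (p j :: 'n)"
  let ?T = "\<lambda>p. tensor (\<lambda>j. \<phi> (?q p j))"
  let ?b = "\<lambda>p. of_int (sign p) / sqrt (fact CARD('n)) :: real"
  have q: "?q p \<in> all_fillings" for p using orbital_of(2)[OF assms(1)] assms(1) by (auto simp: configs_def)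
  have T: "wave (?T p)" for p by (rule orbital_span.gen[OF q])
  have sl: "sl \<alpha> = (\<lambda>x. \<Sum>p\<in>?P. ?b p * ?T p x)" by (simp add: fun_eq_iff slater_expansion)
  have fin: "finite ?P" by (simp add: finite_permutations)
  have "l2_form (sl \<alpha>) (sl \<alpha>) = (\<Sum>p\<in>?P. ?b p * l2_form (?T p) (sl \<alpha>))"
    by (subst (1) sl) (rule form_sum_left[where B = l2_form, OF l2_form_linear fin T wave_slater[OF assms(1)]])
  also have "\<dots> = (\<Sum>p\<in>?P. ?b p * ?b p)"
  proof (intro sum.cong refl arg_cong2[where f = "(*)"])
    fix p assume p: "p \<in> ?P"
    have "l2_form (?T p) (sl \<alpha>) = l2_form (sl \<alpha>) (?T p)" by (rule l2_form_commute)
    also have "\<dots> = (\<Sum>p'\<in>?P. ?b p' * l2_form (?T p') (?T p))"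
      by (subst sl) (rule form_sum_left[where B = l2_form, OF l2_form_linear fin T T])
    also have "\<dots> = (\<Sum>p'\<in>?P. if p' = p then ?b p' else 0)"
    proof (intro sum.cong refl)
      fix p'
      have "?q p' = ?q p \<longleftrightarrow> p' = p"
        using orbital_of(1)[OF assms(1)] by (auto simp: fun_eq_iff inj_def)
      then show "?b p' * l2_form (?T p') (?T p) = (if p' = p then ?b p' else 0)"
        by (simp add: l2_form_gen[OF q q])
    qed
    also have "\<dots> = ?b p" using p fin by (simp add: sum.delta)
    finally show "l2_form (?T p) (sl \<alpha>) = ?b p" .
  qed
  also have "\<dots> = (\<Sum>p\<in>?P. 1 / fact CARD('n))"
    by (intro sum.cong refl) (auto simp: sign_def)
  also have "\<dots> = 1" using card_permutations[of "UNIV :: 'n set" "CARD('n)"] by simp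
  finally show ?thesis using True by simp
qed

lemma wf_form_left:
  fixes B :: "('n conf \<Rightarrow> real) \<Rightarrow> ('n conf \<Rightarrow> real) \<Rightarrow> real"
  assumes left: "\<And>F G h r s. wave F \<Longrightarrow> wave G \<Longrightarrow> wave h \<Longrightarrow> B (\<lambda>x. r * F x + s * G x) h = r * B F h + s * B G h"
    and "wave h"
  shows "B (wav c) h = (\<Sum>\<alpha>\<in>configs K CARD('n). c \<alpha> * B (sl \<alpha>) h)"
proof -
  have "wav c = (\<lambda>x. \<Sum>\<alpha>\<in>configs K CARD('n). c \<alpha> * sl \<alpha> x)" by (simp add: fun_eq_iff wavefunction_def)
  then show ?thesis
    using form_sum_left[where B = B, OF left finite_configs wave_slater assms(2)] by simp
qed

lemma l2_form_wf: "l2_form (wav c) (wav d) = state_inner K CARD('n) c d"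
proof -
  have "l2_form (sl \<alpha>) (wav d) = d \<alpha>" if \<alpha>: "\<alpha> \<in> configs K CARD('n)" for \<alpha>
  proof -
    have "l2_form (sl \<alpha>) (wav d) = (\<Sum>\<beta>\<in>configs K CARD('n). d \<beta> * l2_form (sl \<beta>) (sl \<alpha>))"
      by (subst l2_form_commute) (rule wf_form_left[where B = l2_form, OF l2_form_linear wave_slater[OF \<alpha>]])
    also have "\<dots> = (\<Sum>\<beta>\<in>configs K CARD('n). if \<beta> = \<alpha> then d \<beta> else 0)"
      by (intro sum.cong refl) (simp add: slater_orthonormal \<alpha>)
    finally show ?thesis using \<alpha> by simp
  qed
  then show ?thesis
    using wf_form_left[where B = l2_form and c = c, OF l2_form_linear wf_wave[of d]] by (simp add: state_inner_def)
qed

lemma wf_linear: "wav (\<lambda>\<alpha>. r * c \<alpha> + s * d \<alpha>) = (\<lambda>x. r * wav c x + s * wav d x)"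
  by (simp add: fun_eq_iff wavefunction_def sum.distrib sum_distrib_left algebra_simps)

abbreviation "H \<equiv> ham_op ty K \<phi> V w"

lemma ham_linear: "fock_linear H"
proof -
  have *: "H (\<lambda>\<alpha>. r * c \<alpha> + s * d \<alpha>) = (\<lambda>\<alpha>. r * H c \<alpha> + s * H d \<alpha>)" for r s c d
    unfolding ham_op_def wf_linear by (auto simp: fun_eq_iff ham_form_linear[OF wf_wave wf_wave wave_slater])
  show ?thesis
    unfolding fock_linear_def using *[of 1 _ 1] *[of _ _ 0] by simp
qed

lemma ham_symmetric: "state_inner K CARD('n) (H c) d = state_inner K CARD('n) c (H d)"
proof -
  have "state_inner K CARD('n) (H c) d = ham_form V w (wav d) (wav c)" for c d
    using wf_form_left[where B = "ham_form V w", OF ham_form_linear wf_wave, of d c]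
    by (simp add: state_inner_def ham_op_def ham_form_commute[of "wav c"] mult.commute)
  then show ?thesis using state_inner_commute[of K "CARD('n)" c "H d"] ham_form_commute[of "wav d" "wav c"] by simp
qed

text \<open>With three orbitals of \<alpha> absent from \<beta>, any two particles can be set aside
  and a third still carries an orbital that does not occur in \<beta>. The kinetic form needs this
  for one excluded particle, the potential for two.\<close>

lemma ham_form_two_body:
  assumes "\<alpha> \<in> configs K CARD('n)" "\<beta> \<in> configs K CARD('n)" "3 \<le> card (\<alpha> - \<beta>)"
  shows "ham_form V w (sl \<alpha>) (sl \<beta>) = 0"
proof (rule bilinear_zero_on_span[where B = "ham_form V w", OF fillings_subset[OF assms(1)] fillings_subset[OF assms(2)] ham_form_linear ham_form_commute _ slater_span[OF assms(1)] slater_span[OF assms(2)]])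
  fix q q' :: "'n \<Rightarrow> nat" assume q: "q \<in> fillings \<alpha>" "q' \<in> fillings \<beta>"
  have a: "q \<in> all_fillings" "q' \<in> all_fillings" using q fillings_subset assms by blast+
  have *: "\<exists>j. j \<noteq> i \<and> j \<noteq> k \<and> q j \<noteq> q' j" for i k
  proof -
    have "card {q i, q k} < card (\<alpha> - \<beta>)" using assms(3) card_insert_le_m1[of 2 "{q k}" "q i"] by (auto simp: card_insert_if)
    then have "\<not> \<alpha> - \<beta> \<subseteq> {q i, q k}" by (metis card_mono finite.emptyI finite.insertI leD)
    then obtain p where p: "p \<in> \<alpha>" "p \<notin> \<beta>" "p \<noteq> q i" "p \<noteq> q k" by blast
    then obtain j where "p = q j" using q by (auto simp: fillings_def)
    then show ?thesis using p q by (intro exI[of _ j]) (auto simp: fillings_def)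
  qed
  have "grad_inner (tensor (\<lambda>j. \<phi> (q j))) (tensor (\<lambda>j. \<phi> (q' j))) = 0"
  proof (rule grad_inner_tensor_zero[OF orb[OF a(1)] orb[OF a(2)]])
    show "\<exists>j. j \<noteq> i \<and> (\<integral>y. \<phi> (q j) y * \<phi> (q' j) y \<partial>lborel) = 0" for i
      using *[of i i] by (auto simp: orb_overlap[OF a])
  qed
  then show "ham_form V w (tensor (\<lambda>j. \<phi> (q j))) (tensor (\<lambda>j. \<phi> (q' j)) :: 'n conf \<Rightarrow> real) = 0"
    using pot_integrable_gen(2)[OF a *] by (simp add: ham_form_alt)
qed

text \<open>A virtual orbital of \<alpha> is either a virtual orbital of \<beta> or an element of
  \<alpha> - \<beta>, and a nonzero matrix element leaves at most two of the latter.\<close>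

lemma ham_ranked:
  assumes c: "ranked K CARD('n) r c"
  shows "ranked K CARD('n) (r - 2) (H c)"
  unfolding ranked_def
proof (intro allI impI)
  fix \<beta> assume nz: "H c \<beta> \<noteq> 0"
  then have \<beta>: "\<beta> \<in> configs K CARD('n)" by (auto simp: ham_op_def split: if_splits)
  then have "(\<Sum>\<alpha>\<in>configs K CARD('n). c \<alpha> * ham_form V w (sl \<alpha>) (sl \<beta>)) \<noteq> 0"
    using nz wf_form_left[where B = "ham_form V w", OF ham_form_linear wave_slater[OF \<beta>], of c] by (simp add: ham_op_def)
  then obtain \<alpha> where "\<alpha> \<in> configs K CARD('n)" "c \<alpha> * ham_form V w (sl \<alpha>) (sl \<beta>) \<noteq> 0" by (rule sum.not_neutral_contains_not_neutral)
  then have \<alpha>: "\<alpha> \<in> configs K CARD('n)" "r \<le> rk CARD('n) \<alpha>" and "\<not> 3 \<le> card (\<alpha> - \<beta>)"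
    using c ham_form_two_body[OF _ \<beta>, of \<alpha>] by (auto simp: ranked_def)
  moreover have "rk CARD('n) \<alpha> \<le> rk CARD('n) \<beta> + card (\<alpha> - \<beta>)"
  proof -
    have fin: "finite \<alpha>" "finite \<beta>" using \<alpha>(1) \<beta> by (auto simp: configs_def intro: finite_subset)
    have "rk CARD('n) \<alpha> \<le> card ((\<beta> - {1..CARD('n)}) \<union> (\<alpha> - \<beta>))" unfolding rk_def using fin by (intro card_mono) auto
    also have "\<dots> \<le> rk CARD('n) \<beta> + card (\<alpha> - \<beta>)" unfolding rk_def by (rule card_Un_le)
    finally show ?thesis .
  qed
  ultimately show "\<beta> \<in> configs K CARD('n) \<and> r - 2 \<le> rk CARD('n) \<beta>" using \<beta> by simp
qed

end

subsection \<open>Inner products dominating the Euclidean one\<close>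

text \<open>Models the H^1 inner product on amplitudes, which dominates the L^2 one and hence the
  Euclidean one. Domination yields definiteness and lets Euclidean compactness be used on balls of
  the new norm.\<close>

locale dominating_inner =
  fixes ip :: "'v::euclidean_space \<Rightarrow> 'v \<Rightarrow> real"
  assumes ip_linear: "ip (r *\<^sub>R x + s *\<^sub>R y) z = r * ip x z + s * ip y z"
    and ip_commute: "ip x y = ip y x"
    and ip_ge: "x \<bullet> x \<le> ip x x"
begin

abbreviation nrm :: "'v \<Rightarrow> real" where "nrm \<equiv> ip_norm ip"

lemma ip_linear_right: "ip z (r *\<^sub>R x + s *\<^sub>R y) = r * ip z x + s * ip z y"
  by (simp only: ip_commute[of z] ip_linear)

lemma ip_nonneg: "0 \<le> ip x x" using ip_ge[of x] inner_ge_zero[of x] by linarith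

lemma nrm_square: "(nrm x)\<^sup>2 = ip x x" by (simp add: ip_norm_def ip_nonneg)

lemma nrm_nonneg: "0 \<le> nrm x" by (simp add: ip_norm_def ip_nonneg)

lemma nrm_ge: "norm x \<le> nrm x"
  unfolding ip_norm_def norm_eq_sqrt_inner using ip_ge by (rule real_sqrt_le_mono)

lemma nrm_zero: "nrm x = 0 \<longleftrightarrow> x = 0"
proof
  assume "nrm x = 0" then show "x = 0" using nrm_ge[of x] by simp
next
  assume "x = 0"
  then have "ip x x = 0" using ip_linear[of 0 x 0 x x] by simp
  then show "nrm x = 0" by (simp add: ip_norm_def)
qed

lemma nrm_scale: "nrm (a *\<^sub>R x) = \<bar>a\<bar> * nrm x"
proof -
  have "ip (a *\<^sub>R x) (a *\<^sub>R x) = a\<^sup>2 * ip x x"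
    using ip_linear[of a x 0 x "a *\<^sub>R x"] ip_linear_right[of x a x 0 x] by (simp add: power2_eq_square)
  then show ?thesis by (simp add: ip_norm_def real_sqrt_mult)
qed

lemma nrm_square_add: "(nrm (x + y))\<^sup>2 = (nrm x)\<^sup>2 + 2 * ip x y + (nrm y)\<^sup>2"
  using ip_linear[of 1 x 1 y "x + y"] ip_linear_right[of x 1 x 1 y] ip_linear_right[of y 1 x 1 y] ip_commute[of y x]
  by (simp add: nrm_square)

lemma ip_cauchy_schwarz: "ip x y \<le> nrm x * nrm y"
proof (cases "nrm x = 0 \<or> nrm y = 0")
  case True
  then have "x = 0 \<or> y = 0" by (simp add: nrm_zero)
  then have "ip x y = 0" using ip_linear[of 0 x 0 x y] ip_linear_right[of x 0 y 0 y] by auto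
  then show ?thesis by (simp add: nrm_nonneg)
next
  case False
  let ?z = "nrm y *\<^sub>R x + (- nrm x) *\<^sub>R y"
  have "0 \<le> ip ?z ?z" by (rule ip_nonneg)
  also have "ip ?z ?z = 2 * (nrm x * nrm y) * (nrm x * nrm y - ip x y)"
    by (simp only: ip_linear ip_linear_right ip_commute[of y x])
      (simp add: nrm_square[of x, symmetric] nrm_square[of y, symmetric] power2_eq_square algebra_simps)
  finally have "0 \<le> 2 * (nrm x * nrm y) * (nrm x * nrm y - ip x y)" .
  moreover have "0 < 2 * (nrm x * nrm y)" using False nrm_nonneg[of x] nrm_nonneg[of y] by (simp add: less_le)
  ultimately show ?thesis by (simp add: zero_le_mult_iff)
qed

lemma nrm_triangle: "nrm (x + y) \<le> nrm x + nrm y"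
proof (rule power2_le_imp_le)
  show "(nrm (x + y))\<^sup>2 \<le> (nrm x + nrm y)\<^sup>2"
    using ip_cauchy_schwarz[of x y] by (simp add: nrm_square_add power2_sum)
qed (simp add: nrm_nonneg)

lemma nrm_sum: "finite J \<Longrightarrow> nrm (\<Sum>j\<in>J. f j) \<le> (\<Sum>j\<in>J. nrm (f j))"
proof (induction J rule: finite_induct)
  case (insert j J)
  then show ?case using nrm_triangle[of "f j" "\<Sum>j\<in>J. f j"] by simp
qed (simp add: nrm_zero[THEN iffD2])

lemma nrm_le_norm: "\<exists>C\<ge>0. \<forall>x. nrm x \<le> C * norm x"
proof (intro exI[of _ "\<Sum>b\<in>Basis. nrm b"] conjI allI)
  fix x :: 'v
  have "nrm x = nrm (\<Sum>b\<in>Basis. (x \<bullet> b) *\<^sub>R b)" by (simp add: euclidean_representation)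
  also have "\<dots> \<le> (\<Sum>b\<in>Basis. nrm ((x \<bullet> b) *\<^sub>R b))" by (rule nrm_sum) simp
  also have "\<dots> \<le> (\<Sum>b\<in>Basis. nrm b * norm x)"
  proof (intro sum_mono)
    fix b :: 'v assume b: "b \<in> Basis"
    show "nrm ((x \<bullet> b) *\<^sub>R b) \<le> nrm b * norm x"
      using mult_right_mono[OF Basis_le_norm[OF b, of x] nrm_nonneg[of b]] by (simp add: nrm_scale mult.commute)
  qed
  finally show "nrm x \<le> (\<Sum>b\<in>Basis. nrm b) * norm x" by (simp add: sum_distrib_right)
qed (simp add: sum_nonneg nrm_nonneg)

lemma nrm_continuous: "continuous_on S nrm"
proof -
  obtain C where C: "C \<ge> 0" "\<And>x. nrm x \<le> C * norm x" using nrm_le_norm by blast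
  have "\<bar>nrm x - nrm y\<bar> \<le> C * norm (x - y)" for x y
  proof -
    have "nrm x \<le> nrm y + nrm (x - y)" using nrm_triangle[of y "x - y"] by simp
    moreover have "nrm y \<le> nrm x + nrm (y - x)" using nrm_triangle[of x "y - x"] by simp
    moreover have "nrm (y - x) = nrm (x - y)" using nrm_scale[of "-1" "x - y"] by simp
    ultimately show ?thesis using C(2)[of "x - y"] by linarith
  qed
  then have "C-lipschitz_on S nrm" using C(1) by (intro lipschitz_onI) (auto simp: dist_norm)
  then show ?thesis by (rule lipschitz_on_continuous_on)
qed

text \<open>A real supremum is informative only for a set bounded above; equivalence of the two
  norms in finite dimension provides the bound.\<close>

lemma opnorm:
  assumes "linear L"
  shows "nrm (L u) \<le> ip_opnorm ip L * nrm u" "0 \<le> ip_opnorm ip L"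
proof -
  obtain C where C: "C \<ge> 0" "\<And>x. nrm x \<le> C * norm x" using nrm_le_norm by blast
  obtain B where B: "B > 0" "\<And>x. norm (L x) \<le> B * norm x" using linear_bounded_pos[OF assms] by blast
  have bd: "nrm (L u) \<le> C * B" if "nrm u \<le> 1" for u
  proof -
    have "nrm (L u) \<le> C * norm (L u)" by (rule C)
    also have "\<dots> \<le> C * (B * norm u)" by (intro mult_left_mono B C)
    also have "\<dots> \<le> C * (B * 1)" using that nrm_ge[of u] B(1) C(1) by (intro mult_left_mono) auto
    finally show ?thesis by simp
  qed
  have bdd: "bdd_above ((\<lambda>u. nrm (L u)) ` {u. nrm u \<le> 1})"
    by (rule bdd_aboveI[of _ "C * B"]) (auto intro: bd)
  have le: "nrm (L u) \<le> ip_opnorm ip L" if "nrm u \<le> 1" for u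
    unfolding ip_opnorm_def by (rule cSUP_upper[OF _ bdd]) (use that in simp)
  have L0: "L 0 = 0" using assms by (rule linear_0)
  show "0 \<le> ip_opnorm ip L" using le[of 0] nrm_zero[of 0] by (simp add: L0)
  show "nrm (L u) \<le> ip_opnorm ip L * nrm u"
  proof (cases "u = 0")
    case False
    then have n: "nrm u > 0" using nrm_zero[of u] nrm_nonneg[of u] by linarith
    have "nrm (L ((1 / nrm u) *\<^sub>R u)) \<le> ip_opnorm ip L" using n by (intro le) (simp add: nrm_scale)
    then show ?thesis using n by (simp add: linear_scale[OF assms] nrm_scale field_simps)
  qed (use L0 nrm_zero[of 0] in simp)
qed

end

subsection \<open>Polynomial maps\<close>

definition polynomial_map :: "('v::euclidean_space \<Rightarrow> 'v) \<Rightarrow> bool" where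
  "polynomial_map F \<longleftrightarrow> (\<forall>b\<in>Basis. real_polynomial_function (\<lambda>t. F t \<bullet> b))"

text \<open>Polynomiality in the base point for each fixed direction is recorded so that the result
  can be applied again to obtain continuous second derivatives.\<close>

lemma real_polynomial_function_derivative:
  assumes "real_polynomial_function (f :: 'v::real_normed_vector \<Rightarrow> real)"
  shows "\<exists>D. \<forall>z. (f has_derivative D z) (at z) \<and> (\<forall>u. real_polynomial_function (\<lambda>z. D z u))"
  using assms
proof (induction rule: real_polynomial_function.induct)
  case (linear f)
  then show ?case
    by (intro exI[of _ "\<lambda>z. f"]) (auto intro: bounded_linear.has_derivative[OF _ has_derivative_ident] real_polynomial_function.intros)
next
  case (const c)
  show ?case by (intro exI[of _ "\<lambda>z u. 0"]) (auto intro: real_polynomial_function.intros)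
next
  case (add f g)
  then obtain Df Dg where D: "\<And>z. (f has_derivative Df z) (at z)" "\<And>u. real_polynomial_function (\<lambda>z. Df z u)"
    "\<And>z. (g has_derivative Dg z) (at z)" "\<And>u. real_polynomial_function (\<lambda>z. Dg z u)" by blast
  show ?case
    by (intro exI[of _ "\<lambda>z u. Df z u + Dg z u"]) (auto intro!: has_derivative_add D real_polynomial_function.intros(3))
next
  case (mult f g)
  then obtain Df Dg where D: "\<And>z. (f has_derivative Df z) (at z)" "\<And>u. real_polynomial_function (\<lambda>z. Df z u)"
    "\<And>z. (g has_derivative Dg z) (at z)" "\<And>u. real_polynomial_function (\<lambda>z. Dg z u)" by blast
  show ?case
    by (intro exI[of _ "\<lambda>z u. f z * Dg z u + Df z u * g z"])
      (auto intro!: has_derivative_mult D real_polynomial_function.intros(3,4) mult)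
qed

lemma polynomial_map_derivative:
  assumes "polynomial_map F"
  shows "(F has_derivative frechet_derivative F (at z)) (at z)"
    "polynomial_map (\<lambda>z. frechet_derivative F (at z) u)"
proof -
  have "\<forall>b\<in>Basis. \<exists>D. \<forall>z. ((\<lambda>t. F t \<bullet> b) has_derivative D z) (at z) \<and> (\<forall>u. real_polynomial_function (\<lambda>z. D z u))"
    using assms real_polynomial_function_derivative unfolding polynomial_map_def by blast
  then obtain D where D: "\<And>b z. b \<in> Basis \<Longrightarrow> ((\<lambda>t. F t \<bullet> b) has_derivative D b z) (at z)"
     "\<And>b u. b \<in> Basis \<Longrightarrow> real_polynomial_function (\<lambda>z. D b z u)" by metis
  let ?F' = "\<lambda>z u. \<Sum>b\<in>Basis. D b z u *\<^sub>R b"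
  have d: "(F has_derivative ?F' z) (at z)" for z
    by (subst has_derivative_componentwise_within) (auto simp: inner_sum_left inner_Basis if_distrib D cong: if_cong)
  then have e: "frechet_derivative F (at z) = ?F' z" for z by (rule frechet_derivative_at[symmetric])
  show "(F has_derivative frechet_derivative F (at z)) (at z)" unfolding e by (rule d)
  show "polynomial_map (\<lambda>z. frechet_derivative F (at z) u)"
    unfolding e polynomial_map_def
    by (auto simp: inner_sum_left inner_Basis if_distrib D cong: if_cong)
qed

lemma polynomial_map_continuous:
  assumes "polynomial_map F" shows "continuous_on S F"
  by (rule continuous_at_imp_continuous_on, rule ballI, rule has_derivative_continuous)
    (rule polynomial_map_derivative(1)[OF assms])

lemma polynomial_map_line:
  assumes "polynomial_map F"
  shows "((\<lambda>s. F (t + s *\<^sub>R d) \<bullet> v) has_real_derivative frechet_derivative F (at (t + s *\<^sub>R d)) d \<bullet> v) (at s)"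
proof -
  let ?D = "frechet_derivative F (at (t + s *\<^sub>R d))"
  have D: "(F has_derivative ?D) (at (t + s *\<^sub>R d))" by (rule polynomial_map_derivative(1)[OF assms])
  have "((\<lambda>s. t + s *\<^sub>R d) has_derivative (\<lambda>h. h *\<^sub>R d)) (at s)" by (auto intro!: derivative_eq_intros)
  from has_derivative_compose[OF this D]
  have "((\<lambda>s. F (t + s *\<^sub>R d)) has_derivative (\<lambda>h. ?D (h *\<^sub>R d))) (at s)" .
  then have "((\<lambda>s. F (t + s *\<^sub>R d) \<bullet> v) has_derivative (\<lambda>h. ?D (h *\<^sub>R d) \<bullet> v)) (at s)"
    by (rule has_derivative_inner_left)
  moreover have "?D (h *\<^sub>R d) \<bullet> v = (?D d \<bullet> v) * h" for h
    using has_derivative_linear[OF D] by (simp add: linear_scale)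
  ultimately show ?thesis by (simp add: has_field_derivative_def)
qed

section \<open>Taylor estimates with the constant \<open>M_const\<close>\<close>

context dominating_inner
begin

context
  fixes F :: "'v \<Rightarrow> 'v" and t :: 'v and \<delta> :: real
  assumes F: "polynomial_map F" and \<delta>: "\<delta> > 0"
begin

abbreviation (input) "dF z \<equiv> frechet_derivative F (at z)"
abbreviation (input) "M \<equiv> M_const ip F t \<delta>"

lemma dF_linear: "linear (dF z)"
  using has_derivative_linear[OF polynomial_map_derivative(1)[OF F]] .

lemma second_deriv_linear: "linear (second_deriv F z u)" "linear (\<lambda>u. second_deriv F z u v)"
proof -
  show "linear (second_deriv F z u)"
    unfolding second_deriv_def[abs_def]
    using has_derivative_linear[OF polynomial_map_derivative(1)[OF polynomial_map_derivative(2)[OF F]]] .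
  note D = polynomial_map_derivative(1)[OF polynomial_map_derivative(2)[OF F], of _ z]
  have *: "second_deriv F z (r *\<^sub>R x + s *\<^sub>R y) v = r *\<^sub>R second_deriv F z x v + s *\<^sub>R second_deriv F z y v" for r s x y
  proof -
    have "(\<lambda>z. dF z (r *\<^sub>R x + s *\<^sub>R y)) = (\<lambda>z. r *\<^sub>R dF z x + s *\<^sub>R dF z y)"
      using dF_linear by (simp add: linear_add linear_scale)
    then show ?thesis
      unfolding second_deriv_def
      by (simp add: frechet_derivative_at[symmetric, OF has_derivative_add[OF has_derivative_scaleR_right[OF D] has_derivative_scaleR_right[OF D]]])
  qed
  show "linear (\<lambda>u. second_deriv F z u v)"
    using *[of 1 _ 1] *[of _ _ 0] by (intro linearI) auto
qed

text \<open>The ball is Euclidean compact and the finitely many components of the second derivative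
  are continuous on it. This secures boundedness of the two nested suprema in
  \<open>M_const\<close>.\<close>

lemma second_deriv_bound: "\<exists>B. \<forall>\<zeta> u v s. nrm \<zeta> \<le> \<delta> \<longrightarrow> \<bar>second_deriv F (t + \<zeta>) u v \<bullet> s\<bar> \<le> B * (norm u * norm v * norm s)"
proof -
  let ?S = "\<lambda>z. \<Sum>b\<in>Basis. \<Sum>c\<in>Basis. norm (second_deriv F z b c)"
  let ?Z = "{\<zeta>. nrm \<zeta> \<le> \<delta>}"
  have "closed ?Z" by (intro closed_Collect_le nrm_continuous continuous_on_const)
  moreover have "bounded ?Z" by (auto simp: bounded_iff intro!: exI[of _ \<delta>] intro: order_trans[OF nrm_ge])
  ultimately have Z: "compact ?Z" by (simp add: compact_eq_bounded_closed)
  have c: "continuous_on UNIV (\<lambda>z. second_deriv F z b c)" for b c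
    unfolding second_deriv_def
    by (intro polynomial_map_continuous polynomial_map_derivative(2) F)
  have "continuous_on ?Z (\<lambda>\<zeta>. second_deriv F (t + \<zeta>) b c)" for b c
    by (rule continuous_on_compose2[OF c]) (auto intro!: continuous_intros)
  then have "continuous_on ?Z (\<lambda>\<zeta>. ?S (t + \<zeta>))" by (intro continuous_on_sum continuous_on_norm)
  then have "compact ((\<lambda>\<zeta>. ?S (t + \<zeta>)) ` ?Z)" using Z by (rule compact_continuous_image)
  then have "bounded ((\<lambda>\<zeta>. ?S (t + \<zeta>)) ` ?Z)" by (rule compact_imp_bounded)
  then obtain B where "\<forall>y\<in>(\<lambda>\<zeta>. ?S (t + \<zeta>)) ` ?Z. norm y \<le> B" unfolding bounded_iff by (rule exE)
  then have "\<bar>?S (t + \<zeta>)\<bar> \<le> B" if "nrm \<zeta> \<le> \<delta>" for \<zeta> using that by (simp only: real_norm_def ball_simps mem_Collect_eq)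
  note B = abs_le_D1[OF this]
  have "\<bar>second_deriv F z u v \<bullet> s\<bar> \<le> ?S z * (norm u * norm v * norm s)" for z u v s
  proof -
    have "second_deriv F z u v = second_deriv F z (\<Sum>b\<in>Basis. (u \<bullet> b) *\<^sub>R b) (\<Sum>c\<in>Basis. (v \<bullet> c) *\<^sub>R c)"
      by (simp add: euclidean_representation)
    also have "\<dots> = (\<Sum>b\<in>Basis. \<Sum>c\<in>Basis. ((u \<bullet> b) * (v \<bullet> c)) *\<^sub>R second_deriv F z b c)"
      by (simp only: linear_sum[OF second_deriv_linear(1)] linear_scale[OF second_deriv_linear(1)]
          linear_sum[OF second_deriv_linear(2)] linear_scale[OF second_deriv_linear(2)] scaleR_sum_right scaleR_scaleR mult.commute)
        (subst sum.swap, simp)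
    finally have e: "second_deriv F z u v = (\<Sum>b\<in>Basis. \<Sum>c\<in>Basis. ((u \<bullet> b) * (v \<bullet> c)) *\<^sub>R second_deriv F z b c)" .
    have "norm (second_deriv F z u v) \<le> (\<Sum>b\<in>Basis. \<Sum>c\<in>Basis. norm (((u \<bullet> b) * (v \<bullet> c)) *\<^sub>R second_deriv F z b c))"
      unfolding e by (intro order_trans[OF norm_sum] sum_mono norm_sum)
    also have "\<dots> \<le> (\<Sum>b\<in>Basis. \<Sum>c\<in>Basis. (norm u * norm v) * norm (second_deriv F z b c))"
      by (intro sum_mono) (auto simp: abs_mult intro!: mult_right_mono mult_mono Basis_le_norm)
    also have "\<dots> = ?S z * (norm u * norm v)" by (simp add: sum_distrib_left sum_distrib_right mult.commute)
    finally have "norm (second_deriv F z u v) * norm s \<le> ?S z * (norm u * norm v) * norm s"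
      by (intro mult_right_mono) auto
    then show ?thesis using Cauchy_Schwarz_ineq2[of "second_deriv F z u v" s] by (simp add: mult.assoc)
  qed
  then have "\<bar>second_deriv F (t + \<zeta>) u v \<bullet> s\<bar> \<le> B * (norm u * norm v * norm s)" if "nrm \<zeta> \<le> \<delta>" for \<zeta> u v s
    by (rule order_trans[OF _ mult_right_mono[OF B[OF that]]]) simp
  then show ?thesis by blast
qed

lemma M_bound_unit:
  assumes \<zeta>: "nrm \<zeta> \<le> \<delta>" and "nrm u \<le> 1" "nrm v \<le> 1" "nrm s \<le> 1"
  shows "\<bar>second_deriv F (t + \<zeta>) u v \<bullet> s\<bar> \<le> M"
proof -
  obtain B where B: "\<And>\<zeta> u v s. nrm \<zeta> \<le> \<delta> \<Longrightarrow> \<bar>second_deriv F (t + \<zeta>) u v \<bullet> s\<bar> \<le> B * (norm u * norm v * norm s)"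
    using second_deriv_bound by blast
  let ?U = "{(u, v, s). nrm u \<le> 1 \<and> nrm v \<le> 1 \<and> nrm s \<le> 1}"
  have b1: "\<bar>second_deriv F (t + \<zeta>) u v \<bullet> s\<bar> \<le> \<bar>B\<bar>" if "nrm \<zeta> \<le> \<delta>" "(u, v, s) \<in> ?U" for \<zeta> u v s
  proof -
    have n: "norm u \<le> 1" "norm v \<le> 1" "norm s \<le> 1"
      using that(2) nrm_ge[of u] nrm_ge[of v] nrm_ge[of s] by auto
    have "norm u * norm v * norm s \<le> 1 * 1 * 1" by (intro mult_mono n) auto
    then have "\<bar>B\<bar> * (norm u * norm v * norm s) \<le> \<bar>B\<bar> * 1" by (intro mult_left_mono) auto
    moreover have "B * (norm u * norm v * norm s) \<le> \<bar>B\<bar> * (norm u * norm v * norm s)" by (intro mult_right_mono) auto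
    ultimately show ?thesis using B[OF that(1), of u v s] by linarith
  qed
  have bdd: "bdd_above ((\<lambda>(u, v, s). \<bar>second_deriv F (t + \<zeta>) u v \<bullet> s\<bar>) ` ?U)" if "nrm \<zeta> \<le> \<delta>" for \<zeta>
    by (rule bdd_aboveI[of _ "\<bar>B\<bar>"]) (use b1[OF that] in auto)
  have "(0, 0, 0) \<in> ?U" by (simp add: nrm_zero[THEN iffD2])
  then have ne: "?U \<noteq> {}" by blast
  have "ip_bilnorm ip (second_deriv F (t + \<zeta>)) \<le> \<bar>B\<bar>" if "nrm \<zeta> \<le> \<delta>" for \<zeta>
    unfolding ip_bilnorm_def by (rule cSUP_least[OF ne]) (use b1[OF that] in auto)
  then have "bdd_above ((\<lambda>\<zeta>. ip_bilnorm ip (second_deriv F (t + \<zeta>))) ` {\<zeta>. nrm \<zeta> \<le> \<delta>})"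
    by (intro bdd_aboveI[of _ "\<bar>B\<bar>"]) auto
  then have "ip_bilnorm ip (second_deriv F (t + \<zeta>)) \<le> M"
    unfolding M_const_def by (intro cSUP_upper) (use \<zeta> in auto)
  moreover have "\<bar>second_deriv F (t + \<zeta>) u v \<bullet> s\<bar> \<le> ip_bilnorm ip (second_deriv F (t + \<zeta>))"
    unfolding ip_bilnorm_def using cSUP_upper[OF _ bdd[OF \<zeta>], of "(u, v, s)"] assms by simp
  ultimately show ?thesis by linarith
qed

lemma M_nonneg: "0 \<le> M"
  using M_bound_unit[of 0 0 0 0] \<delta> by (simp add: nrm_zero[THEN iffD2])

lemma M_bound:
  assumes "nrm \<zeta> \<le> \<delta>"
  shows "\<bar>second_deriv F (t + \<zeta>) u v \<bullet> s\<bar> \<le> M * (nrm u * nrm v * nrm s)"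
proof (cases "u = 0 \<or> v = 0 \<or> s = 0")
  case True
  then have "second_deriv F (t + \<zeta>) u v \<bullet> s = 0"
    using linear_0[OF second_deriv_linear(1)] linear_0[OF second_deriv_linear(2)] by auto
  then show ?thesis by (simp add: M_nonneg nrm_nonneg)
next
  case False
  then have n: "nrm u > 0" "nrm v > 0" "nrm s > 0"
    using nrm_zero[of u] nrm_zero[of v] nrm_zero[of s] nrm_nonneg[of u] nrm_nonneg[of v] nrm_nonneg[of s] by linarith+
  have "\<bar>second_deriv F (t + \<zeta>) ((1 / nrm u) *\<^sub>R u) ((1 / nrm v) *\<^sub>R v) \<bullet> ((1 / nrm s) *\<^sub>R s)\<bar> \<le> M"
    using n by (intro M_bound_unit assms) (simp_all add: nrm_scale)
  then have "\<bar>(second_deriv F (t + \<zeta>) u v \<bullet> s) / (nrm u * nrm v * nrm s)\<bar> \<le> M"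
    by (simp add: linear_scale[OF second_deriv_linear(1)] linear_scale[OF second_deriv_linear(2)] mult_ac)
  then show ?thesis using n by (simp add: abs_mult field_simps)
qed

lemma dF_lipschitz:
  assumes "nrm d \<le> \<delta>"
  shows "\<bar>(dF (t + d) u - dF t u) \<bullet> v\<bar> \<le> M * (nrm u * nrm d * nrm v)"
proof -
  let ?f = "\<lambda>s. dF (t + s *\<^sub>R d) u \<bullet> v"
  have "(?f has_real_derivative second_deriv F (t + s *\<^sub>R d) u d \<bullet> v) (at s)" for s
    unfolding second_deriv_def by (rule polynomial_map_line[OF polynomial_map_derivative(2)[OF F]])
  then obtain s where s: "0 < s" "s < 1" "?f 1 - ?f 0 = (1 - 0) * (second_deriv F (t + s *\<^sub>R d) u d \<bullet> v)"
    using MVT2[of 0 1 ?f "\<lambda>s. second_deriv F (t + s *\<^sub>R d) u d \<bullet> v"] by auto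
  have "nrm (s *\<^sub>R d) \<le> \<delta>" using s assms nrm_nonneg[of d] mult_left_le_one_le[of "nrm d" s] by (simp add: nrm_scale)
  from M_bound[OF this, of u d v] s(3) show ?thesis by (simp add: inner_diff_left)
qed

lemma F_taylor:
  assumes "nrm d \<le> \<delta>"
  shows "\<bar>(F (t + d) - F t - dF t d) \<bullet> v\<bar> \<le> M * ((nrm d)\<^sup>2 * nrm v) / 2"
proof -
  let ?f = "\<lambda>s. F (t + s *\<^sub>R d) \<bullet> v" and ?f1 = "\<lambda>s. dF (t + s *\<^sub>R d) d \<bullet> v" and ?f2 = "\<lambda>s. second_deriv F (t + s *\<^sub>R d) d d \<bullet> v"
  \<comment> \<open>\<open>Maclaurin\<close> expects an infinite family of derivatives; only the
    orders 0, 1 and 2 are consulted for an expansion of length 2.\<close>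
  define diff where "diff = (\<lambda>m::nat. if m = 0 then ?f else if m = 1 then ?f1 else ?f2)"
  have "(?f has_real_derivative ?f1 s) (at s)" for s by (rule polynomial_map_line[OF F])
  moreover have "(?f1 has_real_derivative ?f2 s) (at s)" for s
    unfolding second_deriv_def by (rule polynomial_map_line[OF polynomial_map_derivative(2)[OF F]])
  ultimately have "\<forall>m s. m < 2 \<and> 0 \<le> s \<and> s \<le> 1 \<longrightarrow> (diff m has_real_derivative diff (Suc m) s) (at s)"
    by (auto simp: diff_def less_2_cases_iff)
  then obtain s where s: "0 < s" "s < 1" "?f 1 = (\<Sum>m<2. diff m 0 / fact m * 1 ^ m) + diff 2 s / fact 2 * 1 ^ 2"
    using Maclaurin[of 1 2 diff ?f] by (auto simp: diff_def)
  have "nrm (s *\<^sub>R d) \<le> \<delta>" using s assms nrm_nonneg[of d] mult_left_le_one_le[of "nrm d" s] by (simp add: nrm_scale)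
  from M_bound[OF this, of d d v] have "\<bar>?f2 s\<bar> \<le> M * ((nrm d)\<^sup>2 * nrm v)" by (simp add: power2_eq_square)
  moreover have "(F (t + d) - F t - dF t d) \<bullet> v = ?f2 s / 2"
    using s(3) by (simp add: diff_def numeral_2_eq_2 inner_diff_left)
  ultimately show ?thesis by simp
qed

end

end

subsection \<open>The homotopy does not vanish on the boundary\<close>

text \<open>The source of the maximum in \<eta>: (a + z)^2 \<le> (1 + e) a^2 + (1 + 1/e) z^2 for
  every z, combined with z^2 \<le> 2 (p^2 a^2 + q^2 b^2) for z = p a + q b.\<close>

lemma square_perturbation_bound:
  fixes a b p q e y :: real
  assumes e: "e > 0" and y: "0 \<le> y" "y \<le> a + (p * a + q * b)"
  shows "y\<^sup>2 \<le> a\<^sup>2 + max (e + 2 * (1 + 1/e) * p\<^sup>2) (2 * (1 + 1/e) * q\<^sup>2) * (a\<^sup>2 + b\<^sup>2)"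
proof -
  let ?k = "2 * (1 + 1/e)" and ?z = "p * a + q * b"
  let ?m = "max (e + ?k * p\<^sup>2) (?k * q\<^sup>2)"
  have "y\<^sup>2 \<le> (a + ?z)\<^sup>2" using y by (intro power_mono) auto
  also have "(a + ?z)\<^sup>2 \<le> (1 + e) * a\<^sup>2 + (1 + 1/e) * ?z\<^sup>2"
  proof -
    have "(a + z)\<^sup>2 \<le> (1 + e) * a\<^sup>2 + (1 + 1/e) * z\<^sup>2" for z
    proof -
      have "0 \<le> (e * a - z)\<^sup>2 / e" using e by simp
      also have "\<dots> = e * a\<^sup>2 - 2 * a * z + z\<^sup>2 / e" using e by (simp add: power2_eq_square field_simps)
      finally show ?thesis by (simp add: power2_sum algebra_simps)
    qed
    then show ?thesis .
  qed
  also have "(1 + 1/e) * ?z\<^sup>2 \<le> (1 + 1/e) * (2 * ((p * a)\<^sup>2 + (q * b)\<^sup>2))"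
    using e sum_squares_bound[of "p * a" "q * b"] by (intro mult_left_mono) (auto simp: power2_sum)
  also have "(1 + e) * a\<^sup>2 + (1 + 1/e) * (2 * ((p * a)\<^sup>2 + (q * b)\<^sup>2)) = a\<^sup>2 + ((e + ?k * p\<^sup>2) * a\<^sup>2 + (?k * q\<^sup>2) * b\<^sup>2)"
    by (simp add: power_mult_distrib algebra_simps)
  also have "\<dots> \<le> a\<^sup>2 + (?m * a\<^sup>2 + ?m * b\<^sup>2)"
    by (intro add_left_mono add_mono mult_right_mono) auto
  finally show ?thesis by (simp add: distrib_left)
qed

text \<open>Cleared of its denominator, the hypothesis reads 2 \<kappa> < (2 sqrt \<eta> - sqrt 2)
  (\<delta> - \<kappa>). For the radius with sqrt 2 R = \<delta> - \<kappa> this is \<kappa> + R <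
  sqrt (2 \<eta>) R, the squared conclusion.\<close>

lemma radius_condition:
  fixes \<kappa> \<delta> \<eta> :: real
  assumes \<delta>: "\<delta> > 0" and \<eta>: "\<eta> > 1/2" and \<kappa>: "\<kappa> < (2 * sqrt \<eta> - sqrt 2) / (2 - sqrt 2 + 2 * sqrt \<eta>) * \<delta>"
  shows "\<kappa> < \<delta>" "0 \<le> \<kappa> \<Longrightarrow> R \<ge> 0 \<Longrightarrow> R\<^sup>2 = 1/2 * (\<delta> - \<kappa>)\<^sup>2 \<Longrightarrow> (\<kappa> + R)\<^sup>2 < 2 * \<eta> * R\<^sup>2"
proof -
  let ?w = "sqrt 2" and ?e = "sqrt \<eta>"
  have w: "?w\<^sup>2 = 2" "?w > 0" "?w < 2" by (auto simp: real_less_lsqrt real_sqrt_less_iff[of 2 4, simplified])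
  have e: "?e\<^sup>2 = \<eta>" "?e > 0" using \<eta> by auto
  have den: "2 - ?w + 2 * ?e > 0" using w e by linarith
  then have k: "\<kappa> * (2 - ?w + 2 * ?e) < (2 * ?e - ?w) * \<delta>" using \<kappa> by (simp add: field_simps)
  show kd: "\<kappa> < \<delta>"
  proof (rule ccontr)
    assume "\<not> \<kappa> < \<delta>"
    then have "\<delta> * (2 - ?w + 2 * ?e) \<le> \<kappa> * (2 - ?w + 2 * ?e)" using den by (intro mult_right_mono) auto
    then have "\<delta> * (2 - ?w + 2 * ?e) < (2 * ?e - ?w) * \<delta>" using k by linarith
    then have "\<delta> * 2 < 0" by (simp add: algebra_simps)
    then show False using \<delta> by simp
  qed
  assume \<kappa>0: "0 \<le> \<kappa>" and R: "R \<ge> 0" "R\<^sup>2 = 1/2 * (\<delta> - \<kappa>)\<^sup>2"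
  have "(?w * R)\<^sup>2 = (\<delta> - \<kappa>)\<^sup>2" using R(2) w by (simp add: power_mult_distrib)
  then have wR: "?w * R = \<delta> - \<kappa>" by (rule power2_eq_imp_eq) (use kd R(1) in simp_all)
  have "2 * \<kappa> < (2 * ?e - ?w) * (\<delta> - \<kappa>)" using k by (simp add: algebra_simps)
  also have "\<dots> = 2 * ?e * ?w * R - ?w\<^sup>2 * R" unfolding wR[symmetric] by (simp add: power2_eq_square algebra_simps)
  finally have "\<kappa> + R < ?e * ?w * R" using w by simp
  then have "(\<kappa> + R)\<^sup>2 < (?e * ?w * R)\<^sup>2" using \<kappa>0 R(1) by (intro power_strict_mono) auto
  then show "(\<kappa> + R)\<^sup>2 < 2 * \<eta> * R\<^sup>2" using e w by (simp add: power_mult_distrib)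
qed

context dominating_inner
begin

context
  fixes P0 Ph \<Theta> \<A> :: "'v \<Rightarrow> 'v" and K :: "'v \<Rightarrow> real \<Rightarrow> 'v" and ts :: 'v
    and \<alpha> \<gamma> g \<epsilon> \<delta> \<Delta> \<eta> :: real
  assumes P0: "linear P0" and Ph: "linear Ph" and P0_Ph: "\<And>x. P0 x + Ph x = x" and P0_P0: "\<And>x. P0 (P0 x) = P0 x"
    and poly: "polynomial_map \<A>" and zero: "\<A> ts = 0"
    and K: "\<And>t lam s. K t lam \<bullet> s = \<A> (P0 t) \<bullet> P0 s + \<A> t \<bullet> Ph s + lam * (\<A> t \<bullet> P0 s - \<A> (P0 t) \<bullet> P0 s)"
    and \<Theta>_linear: "linear \<Theta>"
    and \<Theta>: "\<And>u v. frechet_derivative \<A> (at ts) u \<bullet> \<Theta> v = (frechet_derivative \<A> (at ts) u + \<alpha> *\<^sub>R u) \<bullet> v"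
    and nondegenerate: "bij (frechet_derivative \<A> (at ts))"
    and \<gamma>: "\<gamma> > 0" and coercive: "\<And>r. (frechet_derivative \<A> (at ts) r + \<alpha> *\<^sub>R r) \<bullet> r \<ge> \<gamma> * (nrm r)\<^sup>2"
    and g: "0 < g" "g < 1" and strengthened: "\<And>t. \<bar>ip (P0 t) (Ph t)\<bar> \<le> g * nrm (P0 t) * nrm (Ph t)"
    and \<epsilon>: "\<epsilon> > 0" and \<delta>: "\<delta> > 0"
    and \<Delta>0: "0 \<le> \<Delta>" and \<Delta>: "\<And>u v. \<bar>frechet_derivative \<A> (at ts) (Ph u) \<bullet> P0 v\<bar> \<le> \<Delta> * nrm (Ph u) * nrm (P0 v)"
    and \<eta>: "\<eta> = (1 - g) * ((\<gamma> - 1/2 * M_const ip \<A> ts \<delta> * ip_opnorm ip \<Theta> * \<delta>) / (\<Delta> + M_const ip \<A> ts \<delta> * \<delta>))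
               - 1/2 * max (\<epsilon> + 2 * (1 + 1/\<epsilon>) * (ip_opnorm ip (P0 \<circ> (\<lambda>u. \<Theta> u - u) \<circ> P0))\<^sup>2)
                    (2 * (1 + 1/\<epsilon>) * (ip_opnorm ip (P0 \<circ> (\<lambda>u. \<Theta> u - u) \<circ> Ph))\<^sup>2)"
    and \<eta>_gt: "\<eta> > 1/2"
    and \<kappa>: "nrm (Ph ts) < (2 * sqrt \<eta> - sqrt 2) / (2 - sqrt 2 + 2 * sqrt \<eta>) * \<delta>"
begin

abbreviation (input) "A' \<equiv> frechet_derivative \<A> (at ts)"
abbreviation (input) "kap \<equiv> nrm (Ph ts)"
abbreviation (input) "Mc \<equiv> M_const ip \<A> ts \<delta>"
abbreviation (input) "th \<equiv> ip_opnorm ip \<Theta>"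

lemma kap_less: "kap < \<delta>"
  by (rule radius_condition(1)[OF \<delta> \<eta>_gt \<kappa>])

lemma derivative_coercive: "\<gamma> * (nrm r)\<^sup>2 \<le> A' r \<bullet> \<Theta> r"
  using coercive[of r] by (simp add: \<Theta>)

lemma K_alt: "K t lam \<bullet> s = \<A> t \<bullet> s - (1 - lam) * (\<A> t \<bullet> P0 s - \<A> (P0 t) \<bullet> P0 s)"
proof -
  have "\<A> t \<bullet> s = \<A> t \<bullet> P0 s + \<A> t \<bullet> Ph s" by (simp add: P0_Ph flip: inner_add_right)
  then show ?thesis unfolding K by (simp add: algebra_simps)
qed

text \<open>With \<open>?G\<close> = \<Delta> + M \<delta>, the definition of \<eta> says (\<eta> +
  m/2) \<open>?G\<close> = (1 - g) c. Thus \<open>T1\<close> bounds the pairing of \<A> below by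
  (\<eta> + m/2) \<open>?G\<close> R^2, \<open>T2\<close> bounds the subtracted term by
  \<open>?G\<close> (\<kappa> + b) y, and the common factor \<open>?G\<close> cancels. What remains
  is (\<kappa> + b) y < (\<eta> + m/2) R^2.\<close>

theorem homotopy_positive:
  assumes r: "(nrm (P0 r))\<^sup>2 + (nrm (Ph r))\<^sup>2 = 1/2 * (\<delta> - kap)\<^sup>2" and lam: "0 \<le> lam" "lam \<le> 1"
  shows "0 < K (ts + r) lam \<bullet> \<Theta> r"
proof -
  define a b where "a = nrm (P0 r)" and "b = nrm (Ph r)"
  define R where "R = sqrt (a\<^sup>2 + b\<^sup>2)"
  define o0 oh where "o0 = ip_opnorm ip (P0 \<circ> (\<lambda>u. \<Theta> u - u) \<circ> P0)" and "oh = ip_opnorm ip (P0 \<circ> (\<lambda>u. \<Theta> u - u) \<circ> Ph)"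
  define m where "m = max (\<epsilon> + 2 * (1 + 1/\<epsilon>) * o0\<^sup>2) (2 * (1 + 1/\<epsilon>) * oh\<^sup>2)"
  define c where "c = \<gamma> - 1/2 * Mc * th * \<delta>"
  define q where "q = Ph (ts + r)"
  define y where "y = nrm (P0 (\<Theta> r))"
  let ?n = "nrm r"
  have nn: "a \<ge> 0" "b \<ge> 0" "?n \<ge> 0" "kap \<ge> 0" "y \<ge> 0" by (simp_all add: a_def b_def y_def nrm_nonneg)
  have M0: "Mc \<ge> 0" by (rule M_nonneg[OF poly \<delta>])
  have th: "nrm (\<Theta> u) \<le> th * nrm u" "th \<ge> 0" for u by (rule opnorm[OF \<Theta>_linear])+
  have R2: "R\<^sup>2 = a\<^sup>2 + b\<^sup>2" "R \<ge> 0" by (simp_all add: R_def)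
  have Rr: "R\<^sup>2 = 1/2 * (\<delta> - kap)\<^sup>2" using r R2(1) by (simp add: a_def b_def)
  have Rpos: "R\<^sup>2 > 0" using kap_less by (simp add: Rr)
  \<comment> \<open>The factor 1/2 in the radius compensates for (a + b)^2 \<le> 2 (a^2 +
    b^2).\<close>
  have ab: "a + b \<le> \<delta> - kap"
  proof (rule power2_le_imp_le)
    have "(a + b)\<^sup>2 \<le> 2 * (a\<^sup>2 + b\<^sup>2)" using sum_squares_bound[of a b] by (simp add: power2_sum)
    then show "(a + b)\<^sup>2 \<le> (\<delta> - kap)\<^sup>2" using R2(1) Rr by simp
  qed (use kap_less in simp)
  have n_ab: "?n \<le> a + b" using nrm_triangle[of "P0 r" "Ph r"] by (simp add: P0_Ph a_def b_def)
  \<comment> \<open>The low and high parts need not be orthogonal in this norm; the strengthened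
    Cauchy--Schwarz constant limits the cancellation between them.\<close>
  have n_ge: "(1 - g) * R\<^sup>2 \<le> ?n\<^sup>2"
  proof -
    have "?n\<^sup>2 = a\<^sup>2 + 2 * ip (P0 r) (Ph r) + b\<^sup>2" using nrm_square_add[of "P0 r" "Ph r"] by (simp add: P0_Ph a_def b_def)
    moreover have "- (g * a * b) \<le> ip (P0 r) (Ph r)" using strengthened[of r] by (simp add: a_def b_def)
    moreover have "2 * (g * a * b) \<le> g * (a\<^sup>2 + b\<^sup>2)"
      using mult_left_mono[OF sum_squares_bound[of a b], of g] g by (simp add: algebra_simps)
    ultimately show ?thesis by (simp add: R2(1) algebra_simps)
  qed
  let ?G = "\<Delta> + Mc * \<delta>"
  have G0: "?G \<ge> 0" using \<Delta>0 M0 \<delta> by simp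
  have m0: "m > 0"
  proof -
    have "0 \<le> 2 * (1 + 1/\<epsilon>) * o0\<^sup>2" using \<epsilon> by (intro mult_nonneg_nonneg) auto
    then have "0 < \<epsilon> + 2 * (1 + 1/\<epsilon>) * o0\<^sup>2" using \<epsilon> by linarith
    then show ?thesis by (simp add: m_def less_max_iff_disj)
  qed
  have \<eta>': "\<eta> + m / 2 = (1 - g) * (c / ?G)" unfolding \<eta> m_def c_def o0_def oh_def by simp
  \<comment> \<open>A zero denominator would make the quotient 0, hence \<eta> nonpositive, against
    \<eta> > 1/2.\<close>
  have "?G \<noteq> 0"
  proof
    assume "?G = 0"
    then have "\<eta> + m / 2 = 0" using \<eta>' by simp
    then show False using \<eta>_gt m0 by simp
  qed
  with G0 have G: "?G > 0" by simp
  have cG: "(\<eta> + m / 2) * ?G = (1 - g) * c" using \<eta>' G by simp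
  have c0: "c > 0"
  proof -
    have "0 < (\<eta> + m / 2) * ?G" using \<eta>_gt m0 G by (intro mult_pos_pos) auto
    then show ?thesis using cG g by (simp add: zero_less_mult_iff)
  qed
  have T1: "(\<eta> + m / 2) * ?G * R\<^sup>2 \<le> \<A> (ts + r) \<bullet> \<Theta> r"
  proof -
    have n\<delta>: "?n \<le> \<delta>" using n_ab ab nn by linarith
    have "\<bar>(\<A> (ts + r) - \<A> ts - A' r) \<bullet> \<Theta> r\<bar> \<le> Mc * (?n\<^sup>2 * nrm (\<Theta> r)) / 2"
      by (rule F_taylor[OF poly \<delta> n\<delta>])
    also have "\<dots> \<le> Mc * (?n\<^sup>2 * (th * \<delta>)) / 2"
    proof -
      have "nrm (\<Theta> r) \<le> th * \<delta>" using th(1)[of r] mult_left_mono[OF n\<delta> th(2)] by linarith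
      then have "?n\<^sup>2 * nrm (\<Theta> r) \<le> ?n\<^sup>2 * (th * \<delta>)" by (intro mult_left_mono) auto
      then have "Mc * (?n\<^sup>2 * nrm (\<Theta> r)) \<le> Mc * (?n\<^sup>2 * (th * \<delta>))" by (rule mult_left_mono[OF _ M0])
      then show ?thesis by simp
    qed
    finally have "A' r \<bullet> \<Theta> r - Mc * (?n\<^sup>2 * (th * \<delta>)) / 2 \<le> \<A> (ts + r) \<bullet> \<Theta> r"
      unfolding zero inner_diff_left inner_zero_left by linarith
    moreover have "\<gamma> * ?n\<^sup>2 \<le> A' r \<bullet> \<Theta> r" by (rule derivative_coercive)
    ultimately have "c * ?n\<^sup>2 \<le> \<A> (ts + r) \<bullet> \<Theta> r" by (simp add: c_def algebra_simps)
    moreover have "c * ((1 - g) * R\<^sup>2) \<le> c * ?n\<^sup>2" using n_ge c0 by (intro mult_left_mono) auto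
    moreover have "(\<eta> + m / 2) * ?G * R\<^sup>2 = c * ((1 - g) * R\<^sup>2)" unfolding cG by (simp only: mult_ac)
    ultimately show ?thesis by linarith
  qed
  define X where "X = \<A> (ts + r) \<bullet> P0 (\<Theta> r) - \<A> (P0 (ts + r)) \<bullet> P0 (\<Theta> r)"
  have q: "nrm q \<le> kap + b" using nrm_triangle[of "Ph ts" "Ph r"] by (simp add: q_def b_def linear_add[OF Ph])
  have T2: "\<bar>X\<bar> \<le> ?G * ((kap + b) * y)"
  proof -
    let ?f = "\<lambda>s. \<A> (P0 (ts + r) + s *\<^sub>R q) \<bullet> P0 (\<Theta> r)"
    let ?f' = "\<lambda>s. frechet_derivative \<A> (at (P0 (ts + r) + s *\<^sub>R q)) q \<bullet> P0 (\<Theta> r)"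
    have "(?f has_real_derivative ?f' s) (at s)" for s by (rule polynomial_map_line[OF poly])
    then obtain s where s: "0 < s" "s < 1" "?f 1 - ?f 0 = (1 - 0) * ?f' s"
      using MVT2[of 0 1 ?f ?f'] by auto
    \<comment> \<open>The displacement from \<open>ts\<close> of a point between P0 (ts + r) and ts
      + r. Its low part is that of \<open>r\<close>, and its high part s Ph r - (1 - s) Ph ts has
      norm at most b + \<kappa>, so it stays within \<delta>.\<close>
    define d where "d = P0 (ts + r) + s *\<^sub>R q - ts"
    have "X = ?f' s" using s(3) by (simp add: X_def q_def P0_Ph)
    also have "?f' s = A' q \<bullet> P0 (\<Theta> r) + (frechet_derivative \<A> (at (ts + d)) q - A' q) \<bullet> P0 (\<Theta> r)"
      by (simp add: d_def inner_diff_left)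
    finally have X: "\<bar>X\<bar> \<le> \<bar>A' q \<bullet> P0 (\<Theta> r)\<bar> + \<bar>(frechet_derivative \<A> (at (ts + d)) q - A' q) \<bullet> P0 (\<Theta> r)\<bar>" by linarith
    have "d = P0 r + (s *\<^sub>R Ph r + (- (1 - s)) *\<^sub>R Ph ts)"
    proof -
      have "ts = P0 ts + Ph ts" by (simp add: P0_Ph)
      then have "d = P0 (ts + r) + s *\<^sub>R q - (P0 ts + Ph ts)" by (simp add: d_def)
      then show ?thesis by (simp add: q_def linear_add[OF P0] linear_add[OF Ph] algebra_simps)
    qed
    then have "nrm d \<le> a + (nrm (s *\<^sub>R Ph r) + nrm ((- (1 - s)) *\<^sub>R Ph ts))"
      using nrm_triangle[of "P0 r" "s *\<^sub>R Ph r + (- (1 - s)) *\<^sub>R Ph ts"] nrm_triangle[of "s *\<^sub>R Ph r" "(- (1 - s)) *\<^sub>R Ph ts"]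
      by (simp add: a_def)
    also have "\<dots> = a + (s * b + (1 - s) * kap)" using s by (simp only: nrm_scale b_def)
    also have "\<dots> \<le> a + (b + kap)"
      using s nn mult_left_le_one_le[of b s] mult_left_le_one_le[of kap "1 - s"] by simp
    also have "\<dots> \<le> \<delta>" using ab by simp
    finally have d: "nrm d \<le> \<delta>" .
    have "\<bar>(frechet_derivative \<A> (at (ts + d)) q - A' q) \<bullet> P0 (\<Theta> r)\<bar> \<le> Mc * (nrm q * nrm d * y)"
      unfolding y_def by (rule dF_lipschitz[OF poly \<delta> d])
    also have "\<dots> \<le> Mc * (nrm q * \<delta> * y)"
      using d M0 nn by (intro mult_left_mono mult_right_mono) (auto simp: nrm_nonneg)
    finally have "\<bar>X\<bar> \<le> \<Delta> * nrm q * y + Mc * (nrm q * \<delta> * y)"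
      using X \<Delta>[of "ts + r" "\<Theta> r"] unfolding q_def y_def by linarith
    also have "\<dots> = ?G * (nrm q * y)" by (simp add: algebra_simps)
    also have "\<dots> \<le> ?G * ((kap + b) * y)" using q G nn by (intro mult_left_mono mult_right_mono) auto
    finally show ?thesis .
  qed
  have y2: "y\<^sup>2 \<le> a\<^sup>2 + m * (a\<^sup>2 + b\<^sup>2)"
    unfolding m_def
  proof (rule square_perturbation_bound[OF \<epsilon> nn(5)])
    have lin: "linear (\<lambda>u. \<Theta> u - u)" by (intro linear_compose_sub \<Theta>_linear linear_ident)
    have l0: "linear (P0 \<circ> (\<lambda>u. \<Theta> u - u) \<circ> P0)" "linear (P0 \<circ> (\<lambda>u. \<Theta> u - u) \<circ> Ph)"
      by (intro linear_compose P0 Ph lin)+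
    let ?L = "\<lambda>u. \<Theta> u - u"
    have "P0 (\<Theta> r) = P0 r + P0 (?L (P0 r + Ph r))" by (simp add: P0_Ph linear_diff[OF P0])
    also have "\<dots> = P0 r + (P0 (?L (P0 r)) + P0 (?L (Ph r)))"
      using linear_add[OF lin, of "P0 r" "Ph r"] by (simp only: linear_add[OF P0])
    finally have "y \<le> a + (nrm (P0 (?L (P0 r))) + nrm (P0 (?L (Ph r))))"
      using nrm_triangle[of "P0 r" "P0 (?L (P0 r)) + P0 (?L (Ph r))"] nrm_triangle[of "P0 (?L (P0 r))" "P0 (?L (Ph r))"]
      by (simp add: y_def a_def)
    moreover have "nrm (P0 (?L (P0 r))) \<le> o0 * a"
      using opnorm(1)[OF l0(1), of "P0 r"] by (simp add: o0_def a_def P0_P0)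
    moreover have "nrm (P0 (?L (Ph r))) \<le> oh * b"
    proof -
      have "Ph (Ph r) = Ph r"
      proof -
        have "P0 (P0 r + Ph r) = P0 (P0 r) + P0 (Ph r)" by (rule linear_add[OF P0])
        then have "P0 (Ph r) = 0" by (simp add: P0_Ph P0_P0)
        then show ?thesis using P0_Ph[of "Ph r"] by simp
      qed
      then show ?thesis using opnorm(1)[OF l0(2), of "Ph r"] by (simp add: oh_def b_def)
    qed
    ultimately show "y \<le> a + (o0 * a + oh * b)" by linarith
  qed
  have bR: "b \<le> R" by (rule power2_le_imp_le) (simp_all add: R2)
  \<comment> \<open>The product is split as half the sum of the squares. The a^2 in the bound for
    y^2 joins the b^2 from (\<kappa> + b)^2 to form R^2, and b \<le> R takes care of the mixed term,
    which leads to (\<kappa> + R)^2.\<close>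
  have "(kap + b) * y < (\<eta> + m / 2) * R\<^sup>2"
  proof -
    have chain: "u < z" if "2 * u \<le> p + v" "v \<le> h + n" "p + h \<le> q" "q < k" "z = (k + n) / 2" for u z p v h n q k :: real
      using that by argo
    have s1: "2 * ((kap + b) * y) \<le> (kap + b)\<^sup>2 + y\<^sup>2" using sum_squares_bound[of "kap + b" y] by (simp only: mult.assoc)
    have s2: "y\<^sup>2 \<le> a\<^sup>2 + m * R\<^sup>2" using y2 by (simp add: R2(1))
    have s3: "(kap + b)\<^sup>2 + a\<^sup>2 \<le> (kap + R)\<^sup>2"
    proof -
      have "2 * kap * b \<le> 2 * kap * R" using bR nn by (intro mult_left_mono) auto
      then show ?thesis using R2(1) unfolding power2_sum by linarith
    qed
    have s4: "(kap + R)\<^sup>2 < 2 * \<eta> * R\<^sup>2" by (rule radius_condition(2)[OF \<delta> \<eta>_gt \<kappa> nn(4) R2(2) Rr])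
    have s5: "(\<eta> + m / 2) * R\<^sup>2 = (2 * \<eta> * R\<^sup>2 + m * R\<^sup>2) / 2" by (simp add: field_simps)
    show ?thesis by (rule chain[OF s1 s2 s3 s4 s5])
  qed
  then have "?G * ((kap + b) * y) < ?G * ((\<eta> + m / 2) * R\<^sup>2)" using G by (rule mult_strict_left_mono)
  also have "\<dots> = (\<eta> + m / 2) * ?G * R\<^sup>2" by (simp only: mult_ac)
  finally have "\<bar>X\<bar> < \<A> (ts + r) \<bullet> \<Theta> r" using T1 T2 by linarith
  moreover have "(1 - lam) * X \<le> \<bar>X\<bar>"
  proof -
    have "(1 - lam) * X \<le> (1 - lam) * \<bar>X\<bar>" using lam by (intro mult_left_mono) auto
    also have "\<dots> \<le> 1 * \<bar>X\<bar>" using lam by (intro mult_right_mono) auto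
    finally show ?thesis by simp
  qed
  ultimately show ?thesis unfolding K_alt X_def[symmetric] by linarith
qed

definition region :: "'v set" where
  "region = {ts + r | r. (nrm (P0 r))\<^sup>2 + (nrm (Ph r))\<^sup>2 < 1/2 * (\<delta> - kap)\<^sup>2}"

lemma region_alt: "region = {x. (nrm (P0 (x - ts)))\<^sup>2 + (nrm (Ph (x - ts)))\<^sup>2 < 1/2 * (\<delta> - kap)\<^sup>2}"
  unfolding region_def by (auto intro: exI[of _ "_ - ts"])

lemma region_function_continuous: "continuous_on UNIV (\<lambda>x. (nrm (P0 (x - ts)))\<^sup>2 + (nrm (Ph (x - ts)))\<^sup>2)"
proof -
  have l: "continuous_on UNIV (\<lambda>x. L (x - ts))" if "linear L" for L :: "'v \<Rightarrow> 'v"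
    by (rule linear_continuous_on_compose[OF _ that]) (intro continuous_intros)
  show ?thesis
    by (intro continuous_intros continuous_on_compose2[OF nrm_continuous[of UNIV]] l P0 Ph) auto
qed

lemma region_open: "open region"
  unfolding region_alt by (intro open_Collect_less region_function_continuous continuous_on_const)

lemma region_frontier:
  assumes "x \<in> frontier region"
  shows "(nrm (P0 (x - ts)))\<^sup>2 + (nrm (Ph (x - ts)))\<^sup>2 = 1/2 * (\<delta> - kap)\<^sup>2"
proof -
  let ?f = "\<lambda>x. (nrm (P0 (x - ts)))\<^sup>2 + (nrm (Ph (x - ts)))\<^sup>2" and ?c = "1/2 * (\<delta> - kap)\<^sup>2"
  have "closed {x. ?f x \<le> ?c}" by (intro closed_Collect_le region_function_continuous continuous_on_const)
  moreover have "region \<subseteq> {x. ?f x \<le> ?c}" unfolding region_alt by (auto intro: less_imp_le)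
  ultimately have "closure region \<subseteq> {x. ?f x \<le> ?c}" by (rule closure_minimal[rotated])
  moreover have "x \<in> closure region" "x \<notin> region"
    using assms by (auto simp: frontier_def interior_open[OF region_open])
  ultimately show ?thesis unfolding region_alt by auto
qed

lemma region_bounded: "bounded region"
proof -
  have "norm (x - ts) \<le> 2 * (\<delta> - kap)" if "x \<in> region" for x
  proof -
    let ?r = "x - ts"
    have lt: "(nrm (P0 ?r))\<^sup>2 + (nrm (Ph ?r))\<^sup>2 < 1/2 * (\<delta> - kap)\<^sup>2" using that by (simp add: region_alt)
    have "(nrm (P0 ?r))\<^sup>2 \<le> (\<delta> - kap)\<^sup>2" "(nrm (Ph ?r))\<^sup>2 \<le> (\<delta> - kap)\<^sup>2"
      using lt zero_le_power2[of "nrm (P0 ?r)"] zero_le_power2[of "nrm (Ph ?r)"] zero_le_power2[of "\<delta> - kap"] by linarith+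
    then have "nrm (P0 ?r) \<le> \<delta> - kap" "nrm (Ph ?r) \<le> \<delta> - kap" using kap_less by (auto intro: power2_le_imp_le)
    then show ?thesis using nrm_ge[of ?r] nrm_triangle[of "P0 ?r" "Ph ?r"] by (simp add: P0_Ph)
  qed
  then have "region \<subseteq> cball ts (2 * (\<delta> - kap))" by (auto simp: dist_norm norm_minus_commute)
  then show ?thesis by (rule bounded_subset[OF bounded_cball])
qed

lemma center_in_region: "ts \<in> region"
  using kap_less by (simp add: region_alt linear_0[OF P0] linear_0[OF Ph] nrm_zero[THEN iffD2])

lemma K_continuous: "continuous_on S (\<lambda>t. K t lam)"
proof -
  have e: "K t lam = (\<Sum>b\<in>Basis. (\<A> (P0 t) \<bullet> P0 b + \<A> t \<bullet> Ph b + lam * (\<A> t \<bullet> P0 b - \<A> (P0 t) \<bullet> P0 b)) *\<^sub>R b)" for t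
    by (subst euclidean_representation[symmetric, of "K t lam"]) (simp only: K)
  have A: "continuous_on S \<A>" for S by (rule polynomial_map_continuous[OF poly])
  have "continuous_on S P0" by (intro linear_continuous_on linear_conv_bounded_linear[THEN iffD1] P0)
  then have AP: "continuous_on S (\<lambda>t. \<A> (P0 t))" by (rule continuous_on_compose2[OF A]) auto
  show ?thesis unfolding e by (intro continuous_intros A AP)
qed

theorem homotopy_degree:
  "\<exists>d. d \<noteq> 0 \<and> (\<forall>lam\<in>{0..1}. degree_admissible (\<lambda>t. K t lam) region 0 \<and>
      brouwer_degree (\<lambda>t. K t lam) region 0 = d \<and> (\<exists>t\<in>region. K t lam = 0))"
proof -
  have A'lin: "linear A'" using has_derivative_linear[OF polynomial_map_derivative(1)[OF poly]] .
  obtain d :: int where d: "d \<noteq> 0" "\<And>f D a. degree_admissible f D 0 \<Longrightarrow> a \<in> D \<Longrightarrow>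
      (\<And>x s. x \<in> frontier D \<Longrightarrow> s \<in> {0..1} \<Longrightarrow> (1 - s) *\<^sub>R f x + s *\<^sub>R A' (x - a) \<noteq> 0) \<Longrightarrow>
      brouwer_degree f D 0 = d \<and> (\<exists>x\<in>D. f x = 0)"
    using brouwer_degree_linear_homotopy[OF A'lin nondegenerate] by metis
  have pos: "0 < ((1 - s) *\<^sub>R K x lam + s *\<^sub>R A' (x - ts)) \<bullet> \<Theta> (x - ts)"
    if "x \<in> frontier region" "s \<in> {0..1}" "lam \<in> {0..1}" for x s lam
  proof -
    have r: "(nrm (P0 (x - ts)))\<^sup>2 + (nrm (Ph (x - ts)))\<^sup>2 = 1/2 * (\<delta> - kap)\<^sup>2" by (rule region_frontier[OF that(1)])
    have K: "0 < K x lam \<bullet> \<Theta> (x - ts)" using homotopy_positive[OF r, of lam] that(3) by simp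
    have "x - ts \<noteq> 0"
      using r kap_less by (auto simp: linear_0[OF P0] linear_0[OF Ph] nrm_zero[THEN iffD2])
    then have "0 < \<gamma> * (nrm (x - ts))\<^sup>2" using \<gamma> nrm_zero[of "x - ts"] by (intro mult_pos_pos) auto
    then have A: "0 < A' (x - ts) \<bullet> \<Theta> (x - ts)" using derivative_coercive[of "x - ts"] by linarith
    show ?thesis
    proof (cases "s = 0")
      case False
      then have "0 < s * (A' (x - ts) \<bullet> \<Theta> (x - ts))" using that(2) A by (intro mult_pos_pos) auto
      moreover have "0 \<le> (1 - s) * (K x lam \<bullet> \<Theta> (x - ts))" using that(2) K by (intro mult_nonneg_nonneg) auto
      ultimately show ?thesis by (simp add: inner_add_left)
    qed (use K in simp)
  qed
  have "degree_admissible (\<lambda>t. K t lam) region 0 \<and> brouwer_degree (\<lambda>t. K t lam) region 0 = d \<and> (\<exists>t\<in>region. K t lam = 0)"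
    if lam: "lam \<in> {0..1}" for lam
  proof -
    have "0 \<notin> (\<lambda>t. K t lam) ` frontier region"
    proof
      assume "0 \<in> (\<lambda>t. K t lam) ` frontier region"
      then obtain x where "x \<in> frontier region" "K x lam = 0" by auto
      then show False using pos[of x 0 lam] lam by simp
    qed
    then have adm: "degree_admissible (\<lambda>t. K t lam) region 0"
      by (simp add: degree_admissible_def region_open region_bounded K_continuous)
    moreover have "(1 - s) *\<^sub>R K x lam + s *\<^sub>R A' (x - ts) \<noteq> 0" if "x \<in> frontier region" "s \<in> {0..1}" for x s
      using pos[OF that lam] by (metis inner_zero_left less_irrefl)
    ultimately show ?thesis using d(2)[OF adm center_in_region] by blast
  qed
  with d(1) show ?thesis by blast
qed

end

end

subsection \<open>The Kowalski--Piecuch homotopy\<close>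

lemma (in coupled_cluster) polynomial_map_A: "polynomial_map A"
  unfolding polynomial_map_def
  using poly_A by (auto simp: Basis_vec_def inner_axis)

lemma (in coupled_cluster) linear_P0: "linear P0" and linear_Ph: "linear Ph"
  by (auto intro!: linearI simp: P0_simps Ph_simps)

text \<open>Identifies the block of the derivative from high to low ranks with the expression over
  which \<Delta> is a supremum.\<close>

lemma (in coupled_cluster) derivative_high_low:
  "frechet_derivative A (at t) (Ph u) \<bullet> P0 v = state_inner K N (commutator_op t (T (P0 v) \<Phi>)) (T (Ph u) \<Phi>)"
proof -
  have "((\<lambda>s. A (t + s *\<^sub>R Ph u) \<bullet> P0 v) has_real_derivative frechet_derivative A (at t) (Ph u) \<bullet> P0 v) (at 0)"
    using polynomial_map_line[OF polynomial_map_A, of t "Ph u" "P0 v" 0] by simp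
  from DERIV_unique[OF this A_directional_derivative] show ?thesis .
qed

text \<open>In \<open>Delta_const\<close> the operator acts on the low-rank state, so the roles of
  the two arguments are exchanged relative to the derivative. Boundedness of the linear derivative
  makes the supremum meaningful, the inserted 0 covers a trivial subspace, and scaling extends the
  bound from unit vectors.\<close>

lemma (in coupled_cluster) Delta_bound:
  fixes ip
  assumes "dominating_inner ip"
  shows "0 \<le> Delta_const K N \<rho> H ip \<xi> t"
    "\<bar>frechet_derivative A (at t) (Ph u) \<bullet> P0 v\<bar> \<le> Delta_const K N \<rho> H ip \<xi> t * ip_norm ip (Ph u) * ip_norm ip (P0 v)"
proof -
  interpret dominating_inner ip by fact
  let ?A' = "frechet_derivative A (at t)"
  let ?S = "{\<bar>state_inner K N (commutator_op t (T u \<Phi>)) (T v \<Phi>)\<bar> | u v. u \<in> range P0 \<and> ip_norm ip u = 1 \<and> v \<in> range Ph \<and> ip_norm ip v = 1}"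
  have \<Delta>: "Delta_const K N \<rho> H ip \<xi> t = Sup (insert 0 ?S)"
    unfolding Delta_const_def Let_def commutator_op_def ..
  have lin: "linear ?A'" using has_derivative_linear[OF polynomial_map_derivative(1)[OF polynomial_map_A]] .
  obtain B where B: "B > 0" "\<And>x. norm (?A' x) \<le> B * norm x" using linear_bounded_pos[OF lin] by blast
  have "x \<le> B" if "x \<in> insert 0 ?S" for x
  proof (cases "x = 0")
    case False
    with that obtain u v where x: "x = \<bar>state_inner K N (commutator_op t (T (P0 u) \<Phi>)) (T (Ph v) \<Phi>)\<bar>"
      and n: "nrm (P0 u) = 1" "nrm (Ph v) = 1" by auto
    have "x = \<bar>?A' (Ph v) \<bullet> P0 u\<bar>" by (simp add: x derivative_high_low)
    also have "\<dots> \<le> norm (?A' (Ph v)) * norm (P0 u)" by (rule Cauchy_Schwarz_ineq2)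
    also have "\<dots> \<le> (B * norm (Ph v)) * norm (P0 u)" by (intro mult_right_mono B) auto
    also have "\<dots> \<le> (B * 1) * 1"
      using nrm_ge[of "P0 u"] nrm_ge[of "Ph v"] n B(1) by (intro mult_mono) auto
    finally show ?thesis by simp
  qed (use B in simp)
  then have bdd: "bdd_above (insert 0 ?S)" by (rule bdd_aboveI)
  then show \<Delta>0: "0 \<le> Delta_const K N \<rho> H ip \<xi> t" unfolding \<Delta> by (intro cSup_upper) auto
  have zero: "?A' 0 = 0" by (rule linear_0[OF lin])
  show "\<bar>?A' (Ph u) \<bullet> P0 v\<bar> \<le> Delta_const K N \<rho> H ip \<xi> t * nrm (Ph u) * nrm (P0 v)"
  proof (cases "Ph u = 0 \<or> P0 v = 0")
    case True
    then show ?thesis using \<Delta>0 by (auto simp: zero nrm_nonneg)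
  next
    case False
    then have n: "nrm (Ph u) > 0" "nrm (P0 v) > 0"
      using nrm_zero[of "Ph u"] nrm_zero[of "P0 v"] nrm_nonneg[of "Ph u"] nrm_nonneg[of "P0 v"] by linarith+
    let ?u = "(1 / nrm (Ph u)) *\<^sub>R u" and ?v = "(1 / nrm (P0 v)) *\<^sub>R v"
    have "nrm (P0 ?v) = 1" "nrm (Ph ?u) = 1" using n by (simp_all add: P0_simps Ph_simps nrm_scale)
    then have "\<bar>state_inner K N (commutator_op t (T (P0 ?v) \<Phi>)) (T (Ph ?u) \<Phi>)\<bar> \<in> ?S" by blast
    then have "\<bar>?A' (Ph ?u) \<bullet> P0 ?v\<bar> \<le> Delta_const K N \<rho> H ip \<xi> t"
      unfolding \<Delta> derivative_high_low using bdd by (intro cSup_upper) auto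
    moreover have "?A' (Ph ?u) \<bullet> P0 ?v = (?A' (Ph u) \<bullet> P0 v) / (nrm (Ph u) * nrm (P0 v))"
      by (simp add: P0_simps Ph_simps linear_scale[OF lin] mult_ac)
    ultimately show ?thesis using n by (simp add: abs_mult field_simps)
  qed
qed

theorem theorem4p34:
  fixes K N \<rho> :: nat
    and \<phi> :: "nat \<Rightarrow> real^3 \<Rightarrow> real"
    and V w :: "real^3 \<Rightarrow> real"
    and \<xi> :: "'x::finite \<Rightarrow> nat set"
    and H :: "fock \<Rightarrow> fock"
    and ip :: "real^'x \<Rightarrow> real^'x \<Rightarrow> real"
    and \<A> A' \<Theta> \<Pi>0 \<Pi>h :: "real^'x \<Rightarrow> real^'x"
    and tstar :: "real^'x"
    and \<alpha> \<gamma> g \<epsilon> \<delta> \<kappa> \<eta> \<Delta> M \<theta>0 \<theta>h :: real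
    and D :: "(real^'x) set"
  assumes N: "N = CARD('n::{finite,linorder})"
    and NK: "N \<le> K"
    and orbitals_H1: "\<And>p. p \<in> {1..K} \<Longrightarrow> H1 (\<phi> p)"
    and orbitals_orthonormal: "\<And>p q. p \<in> {1..K} \<Longrightarrow> q \<in> {1..K} \<Longrightarrow>
          (\<integral>x. \<phi> p x * \<phi> q x \<partial>lborel) = (if p = q then 1 else 0)"
    and V: "L32_plus_Linf_eps V"
    and w: "L32_plus_Linf_eps w"
    and w_even: "AE x in lborel. w (- x) = w x"
    and \<rho>: "\<rho> \<ge> 1"
    and \<xi>_inj: "inj \<xi>"
    and \<xi>_range: "range \<xi> \<subseteq> configs K N - {{1..N}}"
    and H: "H = ham_op TYPE('n) K \<phi> V w"
    and ip: "ip = amp_inner TYPE('n) K \<phi> \<xi>"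
    and \<Pi>0: "\<Pi>0 = proj_low N \<rho> \<xi>"
    and \<Pi>h: "\<Pi>h = proj_high N \<rho> \<xi>"
    and \<A>: "\<A> = cc_map K N H \<xi>"
    and A': "A' = frechet_derivative \<A> (at tstar)"
    and tstar_zero: "\<A> tstar = 0"
    and tstar_nondegenerate: "bij A'"
    and \<Theta>_linear: "linear \<Theta>"
    and \<Theta>: "\<And>u v. A' u \<bullet> \<Theta> v = (A' u + \<alpha> *\<^sub>R u) \<bullet> v"
    and \<alpha>: "\<alpha> > 0"
    and \<gamma>: "\<gamma> > 0"
    and coercive: "\<And>r. (A' r + \<alpha> *\<^sub>R r) \<bullet> r \<ge> \<gamma> * (ip_norm ip r)\<^sup>2"
    and g: "0 < g" "g < 1"
    and strengthened_CS: "\<And>t. \<bar>ip (\<Pi>0 t) (\<Pi>h t)\<bar> \<le> g * ip_norm ip (\<Pi>0 t) * ip_norm ip (\<Pi>h t)"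
    and \<epsilon>: "\<epsilon> > 0"
    and \<delta>: "\<delta> > 0"
    and M: "M = M_const ip \<A> tstar \<delta>"
    and \<Delta>: "\<Delta> = Delta_const K N \<rho> H ip \<xi> tstar"
    and \<theta>0: "\<theta>0 = (ip_opnorm ip (\<Pi>0 \<circ> (\<lambda>u. \<Theta> u - u) \<circ> \<Pi>0))\<^sup>2"
    and \<theta>h: "\<theta>h = (ip_opnorm ip (\<Pi>0 \<circ> (\<lambda>u. \<Theta> u - u) \<circ> \<Pi>h))\<^sup>2"
    and \<eta>: "\<eta> = (1 - g) * ((\<gamma> - 1/2 * M * ip_opnorm ip \<Theta> * \<delta>) / (\<Delta> + M * \<delta>))
               - 1/2 * max (\<epsilon> + 2 * (1 + 1/\<epsilon>) * \<theta>0) (2 * (1 + 1/\<epsilon>) * \<theta>h)"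
    and \<eta>_gt: "\<eta> > 1/2"
    and \<kappa>: "\<kappa> = ip_norm ip (\<Pi>h tstar)"
    and \<kappa>_less: "\<kappa> < (2 * sqrt \<eta> - sqrt 2) / (2 - sqrt 2 + 2 * sqrt \<eta>) * \<delta>"
    and D: "D = {tstar + r | r. (ip_norm ip (\<Pi>0 r))\<^sup>2 + (ip_norm ip (\<Pi>h r))\<^sup>2 < 1/2 * (\<delta> - \<kappa>)\<^sup>2}"
  shows "(\<forall>lam\<in>{0..<1}. \<exists>t\<in>D. kp_map K N \<rho> H \<xi> t lam = 0) \<and>
         (\<exists>d. d \<noteq> 0 \<and> (\<forall>lam\<in>{0..1}.
            degree_admissible (\<lambda>t. kp_map K N \<rho> H \<xi> t lam) D 0 \<and>
            brouwer_degree (\<lambda>t. kp_map K N \<rho> H \<xi> t lam) D 0 = d)) \<and>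
         (\<exists>t\<in>D. \<forall>s. \<A> (\<Pi>0 t) \<bullet> \<Pi>0 s = 0)"
proof -
  interpret O: orbital_system K \<phi> V w "TYPE('n)"
    by unfold_locales (use NK N orbitals_H1 orbitals_orthonormal V w in auto)
  interpret C: coupled_cluster K N \<rho> \<xi> H
  proof
    show "fock_linear H" unfolding H by (rule O.ham_linear)
    show "ranked K N (r - 2) (H c)" if "ranked K N r c" for r c
      using O.ham_ranked[of r c] that unfolding H N .
    show "state_inner K N (H c) d = state_inner K N c (H d)" for c d
      unfolding H N by (rule O.ham_symmetric)
  qed (fact NK \<rho> \<xi>_inj \<xi>_range)+
  have ip_alt: "ip t s = H1_inner (wavefunction K \<phi> (cluster N \<xi> t (ref_state N)) :: 'n conf \<Rightarrow> real)
      (wavefunction K \<phi> (cluster N \<xi> s (ref_state N)))" for t s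
    unfolding ip amp_inner_def N ..
  \<comment> \<open>The gradient part of the H^1 form is nonnegative, and its L^2 part is the
    Euclidean inner product of the amplitudes by orthonormality of the Slater determinants.\<close>
  have dom: "dominating_inner ip"
  proof
    show "ip (r *\<^sub>R x + s *\<^sub>R y) z = r * ip x z + s * ip y z" for r s x y z
      unfolding ip_alt C.T_add C.T_scale O.wf_linear
      by (rule O.H1_inner_linear[OF O.wf_wave O.wf_wave O.wf_wave])
    show "ip x y = ip y x" for x y unfolding ip_alt by (rule O.H1_inner_commute)
    show "x \<bullet> x \<le> ip x x" for x
      using O.H1_inner_ge[of "wavefunction K \<phi> (cluster N \<xi> x (ref_state N))"] C.T_ref_inner[of x x]
      unfolding ip_alt O.l2_form_wf N by simp
  qed
  interpret dominating_inner ip by (rule dom)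
  have kp: "kp_map K N \<rho> H \<xi> t lam \<bullet> s = \<A> (\<Pi>0 t) \<bullet> \<Pi>0 s + \<A> t \<bullet> \<Pi>h s + lam * (\<A> t \<bullet> \<Pi>0 s - \<A> (\<Pi>0 t) \<bullet> \<Pi>0 s)" for t lam s
    unfolding \<A> \<Pi>0 \<Pi>h by (rule C.kp_map_inner)
  have lin: "linear \<Pi>0" "linear \<Pi>h" unfolding \<Pi>0 \<Pi>h by (rule C.linear_P0, rule C.linear_Ph)
  have split: "\<Pi>0 x + \<Pi>h x = x" "\<Pi>0 (\<Pi>0 x) = \<Pi>0 x" for x
    unfolding \<Pi>0 \<Pi>h by (rule C.P0_Ph, rule C.P0_simps)
  have poly: "polynomial_map \<A>" unfolding \<A> by (rule C.polynomial_map_A)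
  have \<Delta>0: "0 \<le> \<Delta>" and \<Delta>b: "\<bar>frechet_derivative \<A> (at tstar) (\<Pi>h u) \<bullet> \<Pi>0 v\<bar> \<le> \<Delta> * nrm (\<Pi>h u) * nrm (\<Pi>0 v)" for u v
    unfolding \<Delta> \<A> \<Pi>0 \<Pi>h by (rule C.Delta_bound[OF dom])+
  let ?K = "kp_map K N \<rho> H \<xi>"
  note hyps = lin split poly tstar_zero kp \<Theta>_linear \<Theta>[unfolded A'] tstar_nondegenerate[unfolded A'] \<gamma>
    coercive[unfolded A'] g strengthened_CS \<epsilon> \<delta> \<Delta>0 \<Delta>b
    \<eta>[unfolded M \<theta>0 \<theta>h] \<eta>_gt \<kappa>_less[unfolded \<kappa>]
  have D': "D = region \<Pi>0 \<Pi>h tstar \<delta>"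
    unfolding D \<kappa> by (rule region_def[symmetric, OF hyps])
  obtain d :: int where d: "d \<noteq> 0" "\<And>lam. lam \<in> {0..1} \<Longrightarrow> degree_admissible (\<lambda>t. ?K t lam) D 0 \<and>
      brouwer_degree (\<lambda>t. ?K t lam) D 0 = d \<and> (\<exists>t\<in>D. ?K t lam = 0)"
    using homotopy_degree[OF hyps]
    unfolding D' by blast
  \<comment> \<open>At parameter 0 the low-rank components of the homotopy no longer see the
    high-rank amplitudes: tested with a low-rank vector, only \<A> (\<Pi>0 t) remains.\<close>
  have "\<exists>t\<in>D. \<forall>s. \<A> (\<Pi>0 t) \<bullet> \<Pi>0 s = 0"
  proof -
    obtain t where t: "t \<in> D" "?K t 0 = 0" using d(2)[of 0] by auto
    have "\<A> (\<Pi>0 t) \<bullet> \<Pi>0 s = 0" for s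
    proof -
      have "\<Pi>h (\<Pi>0 s) = 0" unfolding \<Pi>0 \<Pi>h by (rule C.Ph_simps)
      then show ?thesis using kp[of t 0 "\<Pi>0 s"] t(2) by (simp add: split)
    qed
    then show ?thesis using t(1) by blast
  qed
  moreover have "\<exists>t\<in>D. ?K t lam = 0" if "lam \<in> {0..<1}" for lam
    using d(2)[of lam] that by auto
  moreover have "degree_admissible (\<lambda>t. ?K t lam) D 0 \<and> brouwer_degree (\<lambda>t. ?K t lam) D 0 = d" if "lam \<in> {0..1}" for lam
    using d(2)[OF that] by blast
  ultimately show ?thesis using d(1) by blast
qed

end
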